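(* Let $0<\alpha<2$, and let $\sigma, q, M, \pi, \Pi, H, T$ be as in the context. For $n\ge1$ let $b_n:=\inf\{x: P(\|H\|>x)\le n^{-1}\}$. Let $(v_n)$ be a sequence of positive numbers with $v_n\to\infty$ satisfying $\lim_{n\to\infty} v_n^{-1}b_n=\sigma(S^{d-1})^{1/\alpha}$, let $Y_{nj}$ and $S_n(k)$ be defined from $(v_n)$ as in the context, and let $$a_n:=n\int_{\{\|x\|<1\}}x\,P(v_n^{-1}Y_{n1}\in dx).$$ Let $\rho$ be the infinitely divisible law with L\'evy representation $[0,0,M]$, so that $v_n^{-1}S_n(n)-a_n\Rightarrow\rho$, and let $\{X(t)\}_{t\ge0}$ be the L\'evy process generated by $\rho$, i.e. $X(0)=0$ almost surely, $\{X(t)\}$ has stationary independent increments, and $X(1)$ has distribution $\rho$. Then, as $n\to\infty$, $$\{v_n^{-1}S_n([nt])-t\,a_n\}_{t\ge0}\Rightarrow\{X(t)\}_{t\ge0}$$ in the sense of finite dimensional distributions.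
   Context: Setting. $\|\cdot\|$ is the Euclidean norm on $\mathbb{R}^d$, $S^{d-1}=\{x\in\mathbb{R}^d:\|x\|=1\}$, $\Rightarrow$ denotes weak convergence, $u\wedge v=\min(u,v)$, and $[nt]$ is the integer part of $nt$. L\'evy representation. An infinitely divisible law on $\mathbb{R}^d$ has L\'evy representation $[a,Q,M]$ if its characteristic function is $e^{\psi(\lambda)}$ with $$\psi(\lambda)=i\langle a,\lambda\rangle-\tfrac12\langle\lambda,Q\lambda\rangle+\int_{x\ne0}\bigl(e^{i\langle\lambda,x\rangle}-1-i\langle\lambda,x\rangle\mathbf{1}(\|x\|\le1)\bigr)M(dx).$$ Tempering. Let $\alpha\in(0,2)$ and let $\sigma$ be a finite non-zero Borel measure on $S^{d-1}$. Let $q:(0,\infty)\times S^{d-1}\to\mathbb{R}$ be a Borel measurable function such that for every $s\in S^{d-1}$, $q(\cdot,s)$ is non-increasing with $q(0+,s)=\alpha$ and $q(\infty,s)=0$, and such that $q(r,\cdot)$ is continuous for every $r>0$. Let $M$ be the measure on $\mathbb{R}^d\setminus\{0\}$ given in polar coordinates $x=rs$ ($r>0$, $s\in S^{d-1}$) by $M(dr,ds)=r^{-\alpha-1}q(r,s)\,dr\,\sigma(ds)$. Put $\pi(u,s)=u^\alpha\int_u^\infty r^{-\alpha-1}q(r,s)\,dr$ for $u>0$, $s\in S^{d-1}$; for each $s$, $\pi(\cdot,s)$ is non-increasing with $\pi(0+,s)=1$ and $\pi(\infty,s)=0$. Let $\Pi(du,s)=-\frac{\partial}{\partial u}\pi(u,s)\,du$,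 a probability measure on $(0,\infty)$, i.e. $\Pi((u,\infty),s)=\pi(u,s)$. Jumps. $H$ is a random vector in $\mathbb{R}^d$ with $P(H=0)=0$ that lies in the domain of attraction of a (non-Gaussian) $\alpha$-stable random vector $Z$ with L\'evy representation $[a,0,M_0]$ for some $a\in\mathbb{R}^d$, where $M_0(dr,ds)=r^{-\alpha-1}dr\,\sigma(ds)$: that is, there are $c_n>0$ and $d_n\in\mathbb{R}^d$ such that $c_n^{-1}(H_1+\cdots+H_n)-d_n\Rightarrow Z$ for i.i.d. copies $H_j$ of $H$. (Equivalently, $V(r)=P(\|H\|>r)$ is regularly varying at infinity with index $-\alpha$, and $P(H/\|H\|\in D\mid\|H\|>r)\to\sigma(D)/\sigma(S^{d-1})$ as $r\to\infty$ for all Borel $D\subset S^{d-1}$ with $\sigma(\partial D)=0$.) $T>0$ is a random variable whose conditional distribution given $H$ is $\Pi(\cdot,H/\|H\|)$. Let $\{(H_j,T_j):j\ge1\}$ be i.i.d. copies of $(H,T)$. Given positive numbers $v_n\to\infty$, define $Y_{nj}:=(\|H_j\|\wedge v_nT_j)\,H_j/\|H_j\|$ for $n,j\ge1$ and $S_n(k):=Y_{n1}+\cdots+Y_{nk}$ (with $S_n(0)=0$).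
   Formalization: The Lévy process {X(t)} is additionally required to be continuous in probability (part of the usual definition); without it, adding a fixed vector times a discontinuous additive function of t vanishing at t=1 keeps the listed properties but falsifies the claim. *)

theory Defs
  imports "HOL-Probability.Probability"
begin

text \<open>The topology is a parameter: it is \<^term>\<open>euclidean\<close> for laws on \<open>\<real>\<^sup>d\<close> and
  a finite product topology for finite dimensional distributions.\<close>

definition weakly_converges_in :: "'b topology \<Rightarrow> (nat \<Rightarrow> 'b measure) \<Rightarrow> 'b measure \<Rightarrow> bool"
  where "weakly_converges_in X \<mu>s \<mu> \<longleftrightarrow>
    (\<forall>f. continuous_map X euclideanreal f \<and> bounded (f ` topspace X) \<longrightarrow>
      (\<lambda>n. \<integral>x. f x \<partial>\<mu>s n) \<longlonglongrightarrow> (\<integral>x. f x \<partial>\<mu>))"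

definition fin_dim_distr ::
    "'b measure \<Rightarrow> (real \<Rightarrow> 'b \<Rightarrow> 'a::topological_space) \<Rightarrow> real set \<Rightarrow> (real \<Rightarrow> 'a) measure"
  where "fin_dim_distr P X J = distr P (\<Pi>\<^sub>M t\<in>J. borel) (\<lambda>\<omega>. \<lambda>t\<in>J. X t \<omega>)"

definition converges_fin_dim_distr ::
    "'b measure \<Rightarrow> (nat \<Rightarrow> real \<Rightarrow> 'b \<Rightarrow> 'a::topological_space) \<Rightarrow>
     'c measure \<Rightarrow> (real \<Rightarrow> 'c \<Rightarrow> 'a) \<Rightarrow> bool"
  where "converges_fin_dim_distr P Xs N X \<longleftrightarrow>
    (\<forall>J. finite J \<and> J \<subseteq> {0..} \<longrightarrow>
      weakly_converges_in (product_topology (\<lambda>_. euclidean) J)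
        (\<lambda>n. fin_dim_distr P (Xs n) J) (fin_dim_distr N X J))"

definition infinitely_divisible :: "'a::euclidean_space measure \<Rightarrow> bool"
  where "infinitely_divisible \<rho> \<longleftrightarrow>
    prob_space \<rho> \<and> sets \<rho> = sets borel \<and>
    (\<forall>n\<ge>1. \<exists>\<mu>. prob_space \<mu> \<and> sets \<mu> = sets borel \<and>
      \<rho> = distr (\<Pi>\<^sub>M i\<in>{1..n::nat}. \<mu>) borel (\<lambda>x. \<Sum>i=1..n. x i))"

text \<open>A measure on \<open>\<real>\<^sup>d\<close> without the origin is represented by a Borel measure on the whole
  space that does not charge the origin.\<close>

definition levy_measure :: "'a::euclidean_space measure \<Rightarrow> bool"
  where "levy_measure M \<longleftrightarrow> sets M = sets borel \<and> emeasure M {0} = 0 \<and>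
    (\<integral>\<^sup>+ x. ennreal (min 1 ((norm x)\<^sup>2)) \<partial>M) < \<infinity>"

definition levy_exponent ::
    "'a::euclidean_space \<Rightarrow> ('a \<Rightarrow> 'a) \<Rightarrow> 'a measure \<Rightarrow> 'a \<Rightarrow> complex"
  where "levy_exponent a Q M u =
    \<i> * of_real (u \<bullet> a) - of_real (u \<bullet> Q u) / 2 +
    (CLINT x:-{0}|M. iexp (u \<bullet> x) - 1 - \<i> * of_real (u \<bullet> x) * indicator {x. norm x \<le> 1} x)"

definition has_levy_representation ::
    "'a::euclidean_space measure \<Rightarrow> 'a \<Rightarrow> ('a \<Rightarrow> 'a) \<Rightarrow> 'a measure \<Rightarrow> bool"
  where "has_levy_representation \<rho> a Q M \<longleftrightarrow>
    infinitely_divisible \<rho> \<and>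
    linear Q \<and> (\<forall>x y. x \<bullet> Q y = Q x \<bullet> y) \<and> (\<forall>x. 0 \<le> x \<bullet> Q x) \<and> levy_measure M \<and>
    (\<forall>u. (CLINT x|\<rho>. iexp (u \<bullet> x)) = exp (levy_exponent a Q M u))"

text \<open>Continuity in probability has to be part of the definition: adding to the process a
  discontinuous additive function vanishing at 1 preserves all the other clauses and the law
  at time 1.  It follows from right-continuity of the paths, which is not required.\<close>

definition levy_process :: "'b measure \<Rightarrow> (real \<Rightarrow> 'b \<Rightarrow> 'a::euclidean_space) \<Rightarrow> bool"
  where "levy_process N X \<longleftrightarrow>
    prob_space N \<and>
    (\<forall>t\<ge>0. X t \<in> borel_measurable N) \<and>
    (AE \<omega> in N. X 0 \<omega> = 0) \<and>
    (\<forall>(n::nat) t. 0 \<le> t 0 \<and> strict_mono_on {..n} t \<longrightarrow>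
      prob_space.indep_vars N (\<lambda>_. borel) (\<lambda>i \<omega>. X (t (Suc i)) \<omega> - X (t i) \<omega>) {..<n}) \<and>
    (\<forall>s\<ge>0. \<forall>h\<ge>0. distr N borel (\<lambda>\<omega>. X (s + h) \<omega> - X s \<omega>) = distr N borel (\<lambda>\<omega>. X h \<omega> - X 0 \<omega>)) \<and>
    (\<forall>t\<ge>0. \<forall>\<epsilon>>0.
      ((\<lambda>s. measure N {\<omega> \<in> space N. norm (X s \<omega> - X t \<omega>) > \<epsilon>}) \<longlongrightarrow> 0) (at t within {0..}))"

definition levy_process_generated_by ::
    "'b measure \<Rightarrow> (real \<Rightarrow> 'b \<Rightarrow> 'a::euclidean_space) \<Rightarrow> 'a measure \<Rightarrow> bool"
  where "levy_process_generated_by N X \<rho> \<longleftrightarrow> levy_process N X \<and> distr N borel (X 1) = \<rho>"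

text \<open>\<open>\<mu>\<close> is the law of the summands and \<open>\<nu>\<close> the limit law; the coordinates of the
  product space are the i.i.d. copies.\<close>

definition domain_of_attraction ::
    "'a::euclidean_space measure \<Rightarrow> 'a measure \<Rightarrow> bool"
  where "domain_of_attraction \<mu> \<nu> \<longleftrightarrow>
    (\<exists>(c::nat \<Rightarrow> real) (d::nat \<Rightarrow> 'a). (\<forall>n. c n > 0) \<and>
      weakly_converges_in euclidean
        (\<lambda>n. distr (\<Pi>\<^sub>M j\<in>{1..n}. \<mu>) borel (\<lambda>x. (1 / c n) *\<^sub>R (\<Sum>j=1..n. x j) - d n)) \<nu>)"

definition spherical_measure :: "'a::euclidean_space measure \<Rightarrow> bool"
  where "spherical_measure \<sigma> \<longleftrightarrow>
    finite_measure \<sigma> \<and> sets \<sigma> = sets (restrict_space borel (sphere 0 1)) \<and>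
    emeasure \<sigma> (sphere 0 1) \<noteq> 0"

definition tempering_function :: "real \<Rightarrow> (real \<Rightarrow> 'a::euclidean_space \<Rightarrow> real) \<Rightarrow> bool"
  where "tempering_function \<alpha> q \<longleftrightarrow>
    (\<lambda>(r, s). q r s) \<in> borel_measurable (restrict_space borel ({0<..} \<times> sphere 0 1)) \<and>
    (\<forall>s\<in>sphere 0 1. antimono_on {0<..} (\<lambda>r. q r s) \<and>
      ((\<lambda>r. q r s) \<longlongrightarrow> \<alpha>) (at_right 0) \<and> ((\<lambda>r. q r s) \<longlongrightarrow> 0) at_top) \<and>
    (\<forall>r>0. continuous_on (sphere 0 1) (q r))"

text \<open>The image under \<open>(r, s) \<mapsto> r s\<close> of \<open>r\<^sup>-\<^sup>\<alpha>\<^sup>-\<^sup>1 q(r, s) dr \<sigma>(ds)\<close> on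
  \<open>(0, \<infinity>) \<times> S\<close>.  The untempered measure is obtained with \<open>q = 1\<close>.\<close>

definition polar_levy_measure ::
    "real \<Rightarrow> (real \<Rightarrow> 'a::euclidean_space \<Rightarrow> real) \<Rightarrow> 'a measure \<Rightarrow> 'a measure"
  where "polar_levy_measure \<alpha> q \<sigma> =
    distr (density (restrict_space lborel {0<..} \<Otimes>\<^sub>M \<sigma>)
             (\<lambda>(r, s). ennreal (r powr (- \<alpha> - 1) * q r s)))
          borel (\<lambda>(r, s). r *\<^sub>R s)"

definition temper_tail :: "real \<Rightarrow> (real \<Rightarrow> 'a::euclidean_space \<Rightarrow> real) \<Rightarrow> real \<Rightarrow> 'a \<Rightarrow> real"
  where "temper_tail \<alpha> q u s = u powr \<alpha> * (LINT r:{u<..}|lborel. r powr (- \<alpha> - 1) * q r s)"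

definition temper_law :: "real \<Rightarrow> (real \<Rightarrow> 'a::euclidean_space \<Rightarrow> real) \<Rightarrow> 'a \<Rightarrow> real measure"
  where "temper_law \<alpha> q s =
    density lborel (\<lambda>u. ennreal (indicator {0<..} u * (- deriv (\<lambda>u'. temper_tail \<alpha> q u' s) u)))"

text \<open>The conditional distribution of \<open>T\<close> given \<open>H\<close> is \<open>\<kappa>(H)\<close>;
  conditioning is on the \<open>\<sigma>\<close>-algebra generated by \<open>H\<close>.\<close>

definition has_conditional_distr ::
    "'b measure \<Rightarrow> ('b \<Rightarrow> real) \<Rightarrow> ('b \<Rightarrow> 'a::topological_space) \<Rightarrow> ('a \<Rightarrow> real measure) \<Rightarrow> bool"
  where "has_conditional_distr P T H \<kappa> \<longleftrightarrow>
    (\<forall>B\<in>sets borel. AE \<omega> in P.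
      real_cond_exp P (vimage_algebra (space P) H borel) (\<lambda>\<omega>. indicator B (T \<omega>)) \<omega>
        = measure (\<kappa> (H \<omega>)) B)"

text \<open>Note \<^term>\<open>sgn x\<close> = \<open>x / \<parallel>x\<parallel>\<close> for vectors.\<close>

definition tempered_jump ::
    "(nat \<Rightarrow> real) \<Rightarrow> (nat \<Rightarrow> 'b \<Rightarrow> 'a::euclidean_space) \<Rightarrow> (nat \<Rightarrow> 'b \<Rightarrow> real) \<Rightarrow>
     nat \<Rightarrow> nat \<Rightarrow> 'b \<Rightarrow> 'a"
  where "tempered_jump v H T n j \<omega> = min (norm (H j \<omega>)) (v n * T j \<omega>) *\<^sub>R sgn (H j \<omega>)"

definition tempered_walk ::
    "(nat \<Rightarrow> real) \<Rightarrow> (nat \<Rightarrow> 'b \<Rightarrow> 'a::euclidean_space) \<Rightarrow> (nat \<Rightarrow> 'b \<Rightarrow> real) \<Rightarrow>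
     nat \<Rightarrow> nat \<Rightarrow> 'b \<Rightarrow> 'a"
  where "tempered_walk v H T n k \<omega> = (\<Sum>j=1..k. tempered_jump v H T n j \<omega>)"

definition walk_centering ::
    "'b measure \<Rightarrow> (nat \<Rightarrow> real) \<Rightarrow> (nat \<Rightarrow> 'b \<Rightarrow> 'a::euclidean_space) \<Rightarrow> (nat \<Rightarrow> 'b \<Rightarrow> real) \<Rightarrow>
     nat \<Rightarrow> 'a"
  where "walk_centering P v H T n = real n *\<^sub>R
    (LINT x:{x. norm x < 1}|distr P borel (\<lambda>\<omega>. (1 / v n) *\<^sub>R tempered_jump v H T n 1 \<omega>). x)"

text \<open>For \<open>n \<le> 1\<close> the set need not be bounded below or nonempty, so that the value is
  unspecified; this does not affect limits.\<close>

definition norm_quantile :: "'b measure \<Rightarrow> ('b \<Rightarrow> 'a::euclidean_space) \<Rightarrow> nat \<Rightarrow> real"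
  where "norm_quantile P H n = Inf {x. measure P {\<omega> \<in> space P. norm (H \<omega>) > x} \<le> 1 / real n}"

end

theory Submission
  imports Defs
begin

text \<open>All limits are limits of characteristic functions. Comparing \<open>H\<close> with its symmetrization, the
attraction hypothesis forces the truncated second moments of \<open>n P(H / c n \<in> \<cdot>)\<close> to stay bounded and
to vanish uniformly near \<open>0\<close>. Second differences of the logarithm of a characteristic function
ignore the centering, so the measures \<open>n P(H / c n \<in> \<cdot>)\<close>, weighted by a trigonometric factor
vanishing at \<open>0\<close>, converge vaguely to the corresponding weighting of \<open>M0\<close>. The tempered jumps are
handled by integrating out \<open>T\<close> first: averaging a test function over \<open>min r T\<close> and then
over \<open>r powr (-\<alpha>-1) dr\<close> turns \<open>M0\<close> into \<open>M\<close>. This gives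
\<open>n (\<phi> n u - 1) - \<i> \<langle>u, a n\<rangle> \<rightarrow> \<psi> u\<close>, which determines the limit on independent increments.\<close>

section \<open>Truncated second moments and characteristic functions\<close>

text \<open>Two obstacles shape the argument. The constants \<open>c n\<close> and
  \<open>d n\<close> of the attraction hypothesis are unspecified, and what converges is an n-th
  power, whose logarithm is known only modulo 2 pi i. Both disappear in the ratio of characteristic
  functions at u + w, u - w and u, provided that w is so small that all arguments stay below pi.
  This smallness, and the control near 0 of measures with total mass n, must come from bounds that
  are available before any limit is identified; the constants 20, 80 and 320 that they carry are not
  sharp. The condition on \<open>v\<close> reflects q(0+) = \<alpha>: near 0 the measure M resembles
  \<alpha> times M0. The tail of M0 shows that the quantile of \<open>norm H\<close> divided by
  \<open>c n\<close> tends to the power 1/\<alpha> of sigma(S)/\<alpha>. Hence the condition says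
  that \<open>c n / v n\<close> tends to \<open>\<alpha> powr (1 / \<alpha>)\<close>, and dilating
  M0 by this number multiplies it by exactly \<alpha>.\<close>

lemma one_minus_cos_le_two: "1 - cos (x::real) \<le> 2"
  using cos_ge_minus_one[of x] by linarith

lemma one_minus_cos_le: "1 - cos (x::real) \<le> 2 * min 1 (x\<^sup>2)"
proof -
  have "1 - cos x = 2 * (sin (x/2))\<^sup>2"
    using cos_double_sin[of "x/2"] by simp
  moreover have "(sin (x/2))\<^sup>2 \<le> (x/2)\<^sup>2"
    using abs_sin_x_le_abs_x[of "x/2"] by (metis abs_le_square_iff)
  moreover have "(x/2)\<^sup>2 \<le> x\<^sup>2"
    by (simp add: power_divide)
  moreover have "1 - cos x \<le> 2"
    using cos_ge_minus_one[of x] by linarith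
  ultimately show ?thesis by (auto simp: min_def)
qed

text \<open>The mean of 1 - cos over [0, x] is 1 - sin x / x, so this gap is what bounds such means
  from below. From x = 10/9 on, sin x \<le> 1 is enough because 9/10 of x is at least 1; before
  that, the Taylor polynomial of degree 3 with remainder x^5/120 suffices.\<close>

lemma sin_le_cubic_gap:
  assumes "0 < (x::real)"
  shows "sin x \<le> x * (1 - min 1 (x\<^sup>2) / 10)"
proof (cases "10/9 \<le> x")
  case True
  then have "1 \<le> x * (1 - 1/10)" by simp
  moreover have "1 \<le> x\<^sup>2" using True by (simp add: one_le_power)
  ultimately have "x * (1 - min 1 (x\<^sup>2) / 10) \<ge> 1" by (simp add: min_def)
  then show ?thesis using sin_le_one[of x] by linarith
next
  case False
  have "\<bar>sin x - (\<Sum>m<5. sin_coeff m * x ^ m)\<bar> \<le> inverse (fact 5) * \<bar>x\<bar> ^ 5"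
    by (rule Maclaurin_sin_bound)
  also have "(\<Sum>m<5. sin_coeff m * x ^ m) = x - x^3/6"
  proof -
    have "{..<5} = {0, 1, 2, 3, 4::nat}" by auto
    then show ?thesis by (simp add: sin_coeff_def fact_numeral)
  qed
  finally have "\<bar>sin x - (x - x^3/6)\<bar> \<le> x^5/120"
    using assms by (simp add: fact_numeral)
  then have s: "sin x \<le> x - x^3/6 + x^5/120"
    by arith
  have eq: "x - x^3/6 + x^5/120 = x * (1 - (x\<^sup>2/6 - x\<^sup>2 * x\<^sup>2/120))"
    by (simp add: algebra_simps eval_nat_numeral)
  have sq: "x\<^sup>2 \<le> 2" using False assms power_mono[of x "10/9" 2] by (simp add: power2_eq_square)
  then have "x\<^sup>2 * x\<^sup>2 \<le> x\<^sup>2 * 2" by (intro mult_left_mono) auto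
  moreover have "min 1 (x\<^sup>2) \<le> x\<^sup>2" "0 \<le> x\<^sup>2" by auto
  ultimately have "min 1 (x\<^sup>2) / 10 \<le> x\<^sup>2/6 - x\<^sup>2 * x\<^sup>2/120"
    by linarith
  then show ?thesis using s assms unfolding eq
    by (smt (verit) mult_left_mono)
qed

text \<open>The integral equals h - sin (h y) / y. Averaging over frequencies is the classical way
  from characteristic functions to truncated second moments.\<close>

lemma integral_one_minus_cos_ge:
  fixes h y :: real
  assumes h: "0 < h"
  shows "h / 10 * min 1 ((h * y)\<^sup>2) \<le> (LINT w|restrict_space lborel {0..h}. 1 - cos (w * y))"
proof (cases "y = 0")
  case False
  have "((\<lambda>w. w - sin (w * y) / y) has_vector_derivative 1 - cos (w * y)) (at w within {0..h})" for w
    unfolding has_real_derivative_iff_has_vector_derivative[symmetric]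
    using False by (auto intro!: derivative_eq_intros)
  then have "(LINT w|lborel. indicator {0..h} w *\<^sub>R (1 - cos (w * y)))
      = (h - sin (h * y) / y) - (0 - sin (0 * y) / y)"
    using h by (intro integral_FTC_atLeastAtMost) (auto intro!: continuous_intros)
  then have *: "(LINT w|restrict_space lborel {0..h}. 1 - cos (w * y)) = h - sin (h * y) / y"
    by (simp add: integral_restrict_space)
  have "sin (h * y) / y = sin (h * \<bar>y\<bar>) / \<bar>y\<bar>" by (auto simp: abs_if)
  also have "\<dots> \<le> (h * \<bar>y\<bar>) * (1 - min 1 ((h * \<bar>y\<bar>)\<^sup>2) / 10) / \<bar>y\<bar>"
    using h False by (intro divide_right_mono sin_le_cubic_gap) auto
  also have "\<dots> = h * (1 - min 1 ((h * y)\<^sup>2) / 10)"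
    using False by (simp add: power_mult_distrib)
  finally show ?thesis unfolding * by (simp add: algebra_simps)
qed simp

lemma finite_measure_restrict_lborel: "finite_measure (restrict_space lborel {0..h::real})"
  by (rule finite_measureI)
    (simp add: space_restrict_space emeasure_restrict_space emeasure_lborel_Icc_eq)

lemma (in finite_measure) integrable_bounded:
  fixes f :: "'a \<Rightarrow> 'b::{banach,second_countable_topology}"
  assumes "f \<in> borel_measurable M" "\<And>x. norm (f x) \<le> B"
  shows "integrable M f"
  using assms by (intro integrable_const_bound[where B = B]) auto

lemma (in finite_measure) averaged_one_minus_cos_ge:
  fixes Y :: "'a \<Rightarrow> real"
  assumes h: "0 < h" and Y[measurable]: "Y \<in> borel_measurable M"
  shows "h / 10 * (LINT x|M. min 1 ((h * Y x)\<^sup>2))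
    \<le> (LINT w|restrict_space lborel {0..h}. LINT x|M. 1 - cos (w * Y x))"
proof -
  interpret L: finite_measure "restrict_space lborel {0..h}"
    by (rule finite_measure_restrict_lborel)
  interpret pair_sigma_finite "restrict_space lborel {0..h}" M ..
  interpret LM: finite_measure "restrict_space lborel {0..h} \<Otimes>\<^sub>M M"
    by (intro finite_measure_pair_measure L.finite_measure_axioms finite_measure_axioms)
  have [measurable]: "(\<lambda>w. w) \<in> borel_measurable (restrict_space lborel {0..h})"
    by (simp add: measurable_restrict_space1)
  have int: "integrable (restrict_space lborel {0..h} \<Otimes>\<^sub>M M) (\<lambda>(w, x). 1 - cos (w * Y x))"
  proof (rule LM.integrable_bounded[where B = 2])
    show "norm (case z of (w, x) \<Rightarrow> 1 - cos (w * Y x)) \<le> 2" for z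
      using cos_ge_minus_one[of "fst z * Y (snd z)"] cos_le_one[of "fst z * Y (snd z)"]
      by (auto simp: split_beta abs_le_iff)
  qed measurable
  have "h / 10 * (LINT x|M. min 1 ((h * Y x)\<^sup>2)) = (LINT x|M. h / 10 * min 1 ((h * Y x)\<^sup>2))"
    by simp
  also have "\<dots> \<le> (LINT x|M. LINT w|restrict_space lborel {0..h}. 1 - cos (w * Y x))"
  proof (rule integral_mono)
    show "integrable M (\<lambda>x. h / 10 * min 1 ((h * Y x)\<^sup>2))"
      using h by (intro integrable_bounded[where B = "h/10"]) (auto simp: abs_mult mult_left_le)
    show "integrable M (\<lambda>x. LINT w|restrict_space lborel {0..h}. 1 - cos (w * Y x))"
      using integrable_snd[OF int] by simp
  qed (rule integral_one_minus_cos_ge[OF h])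
  also have "\<dots> = (LINT w|restrict_space lborel {0..h}. LINT x|M. 1 - cos (w * Y x))"
    using Fubini_integral[OF int] .
  finally show ?thesis .
qed

text \<open>If the averaged truncated second moment \<open>p\<close> were larger than \<open>20 b\<close>, then the truncations
  at level \<open>40 b\<close> of \<open>w \<mapsto> \<integral> 1 - cos (w Y)\<close>, which is at most \<open>2 p\<close>, would have an integral of
  at least \<open>2 b h\<close>; truncation makes dominated convergence applicable.\<close>

lemma eventually_truncated_moment_le:
  fixes M :: "nat \<Rightarrow> 'w measure" and Y :: "nat \<Rightarrow> 'w \<Rightarrow> real"
  assumes fin: "\<And>n. finite_measure (M n)"
    and Y[measurable]: "\<And>n. Y n \<in> borel_measurable (M n)"
    and h: "0 < h" and b: "0 < b"
    and ev: "\<And>w. 0 \<le> w \<Longrightarrow> w \<le> h \<Longrightarrow> \<forall>\<^sub>F n in sequentially. (LINT x|M n. 1 - cos (w * Y n x)) \<le> b"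
  shows "\<forall>\<^sub>F n in sequentially. (LINT x|M n. min 1 ((h * Y n x)\<^sup>2)) \<le> 20 * b"
proof -
  let ?L = "restrict_space lborel {0..h}"
  interpret L: finite_measure ?L by (rule finite_measure_restrict_lborel)
  have [measurable]: "(\<lambda>w. w) \<in> borel_measurable ?L"
    by (simp add: measurable_restrict_space1)
  define U where "U n w = (LINT x|M n. 1 - cos (w * Y n x))" for n w
  \<comment> \<open>The excess of \<open>U n\<close> over \<open>b\<close> after capping at
    \<open>40 * b\<close>. The hypothesis \<open>ev\<close> holds for each w separately, without
    uniformity, which gives pointwise convergence of \<open>g n\<close> to 0; the cap supplies the
    dominating constant.\<close>
  define g where "g n w = max 0 (min (U n w) (40 * b) - b)" for n w
  have U[measurable]: "U n \<in> borel_measurable ?L" for n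
  proof -
    interpret finite_measure "M n" by (rule fin)
    show ?thesis unfolding U_def by measurable
  qed
  have g[measurable]: "g n \<in> borel_measurable ?L" for n unfolding g_def by measurable
  have U0: "0 \<le> U n w" for n w
    unfolding U_def by (intro integral_nonneg_AE) simp
  have measL: "measure ?L (space ?L) = h"
    using h by (simp add: measure_restrict_space space_restrict_space)
  have "(\<lambda>n. LINT w|?L. g n w) \<longlonglongrightarrow> (LINT w|?L. 0)"
  proof (rule integral_dominated_convergence[where w = "\<lambda>_. 40 * b"])
    show "AE w in ?L. (\<lambda>n. g n w) \<longlonglongrightarrow> 0"
    proof (rule AE_I2)
      fix w assume "w \<in> space ?L"
      then have "0 \<le> w" "w \<le> h" by (auto simp: space_restrict_space)
      from ev[OF this] show "(\<lambda>n. g n w) \<longlonglongrightarrow> 0"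
        by (intro tendsto_eventually, elim eventually_mono) (simp add: g_def U_def)
    qed
    show "AE w in ?L. norm (g n w) \<le> 40 * b" for n
      using b by (simp add: g_def)
  qed auto
  then have "\<forall>\<^sub>F n in sequentially. (LINT w|?L. g n w) < b * h"
    using b h by (intro order_tendstoD) auto
  then show ?thesis
  proof eventually_elim
    case (elim n)
    interpret finite_measure "M n" by (rule fin)
    define p where "p = (LINT x|M n. min 1 ((h * Y n x)\<^sup>2))"
    show ?case
    proof (rule ccontr)
      assume "\<not> ?thesis"
      then have p: "20 * b < p" by (simp add: p_def)
      have Up: "U n w \<le> 2 * p" if "w \<in> space ?L" for w
      proof -
        have w: "0 \<le> w" "w \<le> h" using that by (auto simp: space_restrict_space)
        have "U n w \<le> (LINT x|M n. 2 * min 1 ((h * Y n x)\<^sup>2))"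
          unfolding U_def
        proof (rule integral_mono)
          show "integrable (M n) (\<lambda>x. 1 - cos (w * Y n x))"
            by (rule integrable_bounded[where B=2]) (auto simp: abs_le_iff one_minus_cos_le_two)
          show "integrable (M n) (\<lambda>x. 2 * min 1 ((h * Y n x)\<^sup>2))"
            by (rule integrable_bounded[where B=2]) auto
          show "1 - cos (w * Y n x) \<le> 2 * min 1 ((h * Y n x)\<^sup>2)" for x
          proof -
            have "(w * Y n x)\<^sup>2 \<le> (h * Y n x)\<^sup>2"
              using w by (simp add: power_mult_distrib mult_right_mono power_mono)
            then show ?thesis using one_minus_cos_le[of "w * Y n x"] by (auto simp: min_def split: if_splits)
          qed
        qed
        then show ?thesis by (simp add: p_def)
      qed
      have "h / 10 * p \<le> (LINT w|?L. U n w)"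
        unfolding p_def U_def by (rule averaged_one_minus_cos_ge[OF h]) measurable
      \<comment> \<open>The factor \<open>20 * b / p\<close> is less than 1 and brings the bound
        \<open>2 * p\<close> on \<open>U n\<close> down to the cap \<open>40 * b\<close>, so the
        scaled function lies below both \<open>U n\<close> and the cap, hence below
        \<open>b + g n\<close>.\<close>
      then have "2 * b * h \<le> (LINT w|?L. U n w) * (20 * b / p)"
        using p b h by (simp add: field_simps)
      also have "\<dots> = (LINT w|?L. U n w * (20 * b / p))" by simp
      also have "\<dots> \<le> (LINT w|?L. b + g n w)"
      proof (rule integral_mono)
        show "integrable ?L (\<lambda>w. U n w * (20 * b / p))"
        proof (rule L.integrable_const_bound[where B = "40 * b"], rule AE_I2)
          show "norm (U n w * (20 * b / p)) \<le> 40 * b" if "w \<in> space ?L" for w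
          proof -
            have "U n w * (20 * b / p) \<le> 2 * p * (20 * b / p)"
              using p b Up[OF that] by (intro mult_right_mono) auto
            moreover have "2 * p * (20 * b / p) = 40 * b" using p b by simp
            ultimately show ?thesis using U0[of n w] p b by (simp add: abs_mult)
          qed
        qed measurable
        show "integrable ?L (\<lambda>w. b + g n w)"
          using b by (intro L.integrable_bounded[where B = "40 * b"]) (auto simp: g_def)
        show "U n w * (20 * b / p) \<le> b + g n w" if "w \<in> space ?L" for w
        proof -
          have "U n w * (20 * b / p) \<le> U n w * 1"
            using p b U0 by (intro mult_left_mono) auto
          moreover have "U n w * (20 * b / p) \<le> 2 * p * (20 * b / p)"
            using p b Up[OF that] by (intro mult_right_mono) auto
          moreover have "2 * p * (20 * b / p) = 40 * b" using p b by simp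
          ultimately show ?thesis using b by (simp add: g_def min_def max_def)
        qed
      qed
      also have "\<dots> = b * h + (LINT w|?L. g n w)"
      proof (subst Bochner_Integration.integral_add)
        show "integrable ?L (g n)"
          using b by (intro L.integrable_bounded[where B = "40 * b"] g) (auto simp: g_def)
      qed (use measL in \<open>auto simp: mult.commute\<close>)
      finally show False using elim by simp
    qed
  qed
qed

section \<open>A multivariate continuity theorem\<close>

text \<open>The phase t provides sines, and frequency 0 provides constants, so the class is an
  algebra, and its integrals are combinations of real and imaginary parts of characteristic
  functions. The arguments are infinite sequences of which the first m entries are read; thus the
  dimension is a number and not a type.\<close>

inductive trig_polynomial :: "nat \<Rightarrow> ((nat \<Rightarrow> real) \<Rightarrow> real) \<Rightarrow> bool" for m where
  cos: "trig_polynomial m (\<lambda>y. c * cos ((\<Sum>i<m. l i * y i) + t))"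
| add: "trig_polynomial m f \<Longrightarrow> trig_polynomial m g \<Longrightarrow> trig_polynomial m (\<lambda>y. f y + g y)"

lemma trig_polynomial_const: "trig_polynomial m (\<lambda>_. c)"
  using trig_polynomial.cos[of m c "\<lambda>_. 0" 0] by simp

lemma trig_polynomial_mult:
  assumes "trig_polynomial m f" "trig_polynomial m g"
  shows "trig_polynomial m (\<lambda>y. f y * g y)"
  using assms
proof (induction arbitrary: g)
  case (cos c l t)
  from cos.prems show ?case
  proof induction
    case (cos d k s)
    have "trig_polynomial m (\<lambda>y. (c * d / 2) * cos ((\<Sum>i<m. (l i - k i) * y i) + (t - s))
        + (c * d / 2) * cos ((\<Sum>i<m. (l i + k i) * y i) + (t + s)))"
      by (intro trig_polynomial.intros)
    also have "(\<lambda>y. (c * d / 2) * cos ((\<Sum>i<m. (l i - k i) * y i) + (t - s))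
        + (c * d / 2) * cos ((\<Sum>i<m. (l i + k i) * y i) + (t + s)))
      = (\<lambda>y. c * cos ((\<Sum>i<m. l i * y i) + t) * (d * cos ((\<Sum>i<m. k i * y i) + s)))"
    proof
      fix y :: "nat \<Rightarrow> real"
      define A B where "A = (\<Sum>i<m. l i * y i) + t" and "B = (\<Sum>i<m. k i * y i) + s"
      have *: "(\<Sum>i<m. (l i - k i) * y i) + (t - s) = A - B" "(\<Sum>i<m. (l i + k i) * y i) + (t + s) = A + B"
        by (simp_all add: A_def B_def algebra_simps sum.distrib sum_subtractf)
      show "(c * d / 2) * cos ((\<Sum>i<m. (l i - k i) * y i) + (t - s))
        + (c * d / 2) * cos ((\<Sum>i<m. (l i + k i) * y i) + (t + s))
        = c * cos ((\<Sum>i<m. l i * y i) + t) * (d * cos ((\<Sum>i<m. k i * y i) + s))"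
        unfolding * unfolding A_def[symmetric] B_def[symmetric]
        by (simp only: cos_add cos_diff) (simp add: algebra_simps)
    qed
    finally show ?case .
  next
    case (add f g)
    then show ?case by (simp add: distrib_left trig_polynomial.add)
  qed
next
  case (add f1 f2)
  then show ?case by (simp add: distrib_right trig_polynomial.add)
qed

lemma trig_polynomial_continuous:
  assumes "trig_polynomial m f" shows "continuous_on UNIV f"
  using assms by induction (auto intro!: continuous_intros continuous_on_product_coordinates)

lemma trig_polynomial_bounded:
  assumes "trig_polynomial m f" obtains A where "0 < A" "\<And>y. \<bar>f y\<bar> \<le> A"
proof -
  have "\<exists>A>0. \<forall>y. \<bar>f y\<bar> \<le> A"
    using assms
  proof induction
    case (cos c l t)
    have "\<bar>c * cos z\<bar> \<le> \<bar>c\<bar> + 1" for z :: real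
      using abs_cos_le_one[of z] mult_left_le[of "\<bar>cos z\<bar>" "\<bar>c\<bar>"] by (simp add: abs_mult)
    then show ?case by (intro exI[of _ "\<bar>c\<bar> + 1"]) auto
  next
    case (add f g)
    then obtain A B where "A > 0" "\<forall>y. \<bar>f y\<bar> \<le> A" "B > 0" "\<forall>y. \<bar>g y\<bar> \<le> B" by auto
    then show ?case
      by (intro exI[of _ "A + B"]) (auto intro: order_trans[OF abs_triangle_ineq] add_mono)
  qed
  then show thesis using that by auto
qed

lemma trig_polynomial_compose_polynomial:
  assumes q: "real_polynomial_function q" and p: "trig_polynomial m p"
  shows "trig_polynomial m (\<lambda>y. q (p y))"
  using q
proof induction
  case (linear f)
  interpret bounded_linear f by fact
  have "f x = f 1 * x" for x using scaleR[of x 1] by simp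
  then have "(\<lambda>y. f (p y)) = (\<lambda>y. f 1 * p y)" by (intro ext)
  then show ?case by (simp only: trig_polynomial_mult[OF trig_polynomial_const p])
qed (use trig_polynomial_const trig_polynomial_mult trig_polynomial.add in auto)

lemma measurable_truncated_sequence [measurable]:
  fixes Y :: "nat \<Rightarrow> 'w \<Rightarrow> real"
  assumes [measurable]: "\<And>i. i < m \<Longrightarrow> Y i \<in> borel_measurable M"
  shows "(\<lambda>x i. if i < m then Y i x else (0::real)) \<in> borel_measurable M"
proof (rule measurable_coordinatewise_then_product)
  show "(\<lambda>x. if i < m then Y i x else 0) \<in> borel_measurable M" for i
    by (cases "i < m") simp_all
qed

lemma trig_polynomial_integral_tendsto:
  fixes M :: "nat \<Rightarrow> 'w measure" and N :: "'v measure"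
  assumes finM: "\<And>n. finite_measure (M n)" and finN: "finite_measure N"
    and Y: "\<And>n i. i < m \<Longrightarrow> Y n i \<in> borel_measurable (M n)"
    and Z: "\<And>i. i < m \<Longrightarrow> Z i \<in> borel_measurable N"
    and conv: "\<And>l. (\<lambda>n. CLINT x|M n. iexp (\<Sum>i<m. l i * Y n i x))
      \<longlonglongrightarrow> (CLINT x|N. iexp (\<Sum>i<m. l i * Z i x))"
    and p: "trig_polynomial m p"
  shows "(\<lambda>n. LINT x|M n. p (\<lambda>i. if i < m then Y n i x else 0))
    \<longlonglongrightarrow> (LINT x|N. p (\<lambda>i. if i < m then Z i x else 0))"
proof -
  have Y': "\<forall>i<m. Y n i \<in> borel_measurable (M n)" and Z': "\<forall>i<m. Z i \<in> borel_measurable N" for n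
    using Y Z by auto
  show ?thesis
    using p
  proof induction
  case (cos c l t)
  \<comment> \<open>Stated for an arbitrary measure, because the \<open>M n\<close> and the limit
    \<open>N\<close> live on different types and both need it.\<close>
  have *: "(LINT x|M. c * cos ((\<Sum>i<m. l i * (if i < m then Y i x else 0)) + t))
     = c * (cos t * Re (CLINT x|M. iexp (\<Sum>i<m. l i * Y i x)) - sin t * Im (CLINT x|M. iexp (\<Sum>i<m. l i * Y i x)))"
    if "finite_measure M" and Ym: "\<forall>i<m. Y i \<in> borel_measurable M"
    for M :: "'u measure" and Y :: "nat \<Rightarrow> 'u \<Rightarrow> real"
  proof -
    interpret finite_measure M by fact
    have [measurable]: "Y i \<in> borel_measurable M" if "i < m" for i using that Ym by simp
    have sum[measurable]: "(\<lambda>x. \<Sum>i<m. l i * Y i x) \<in> borel_measurable M"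
      by (intro borel_measurable_sum) auto
    have int: "integrable M (\<lambda>x. iexp (\<Sum>i<m. l i * Y i x))"
      by (intro integrable_bounded[where B=1]) (auto simp: norm_exp_i_times)
    have "(LINT x|M. c * cos ((\<Sum>i<m. l i * (if i < m then Y i x else 0)) + t))
      = (LINT x|M. c * (cos t * Re (iexp (\<Sum>i<m. l i * Y i x)) - sin t * Im (iexp (\<Sum>i<m. l i * Y i x))))"
    proof (intro Bochner_Integration.integral_cong refl arg_cong[where f = "\<lambda>z. c * z"])
      fix x
      have "(\<Sum>i<m. l i * (if i < m then Y i x else 0)) = (\<Sum>i<m. l i * Y i x)"
        by (intro sum.cong) auto
      then show "cos ((\<Sum>i<m. l i * (if i < m then Y i x else 0)) + t)
         = cos t * Re (iexp (\<Sum>i<m. l i * Y i x)) - sin t * Im (iexp (\<Sum>i<m. l i * Y i x))"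
        by (simp add: cos_add Re_exp Im_exp)
    qed
    also have "\<dots> = c * (cos t * (LINT x|M. Re (iexp (\<Sum>i<m. l i * Y i x)))
         - sin t * (LINT x|M. Im (iexp (\<Sum>i<m. l i * Y i x))))"
      using integrable_Re[OF int] integrable_Im[OF int]
      by (subst integral_mult_right_zero, subst Bochner_Integration.integral_diff) auto
    finally show ?thesis using int by simp
  qed
  show ?case
    unfolding *[OF finM Y'] *[OF finN Z'] by (intro tendsto_intros conv)
next
  case (add f g)
  have int: "integrable M (\<lambda>x. p (\<lambda>i. if i < m then Y i x else 0))"
    if "finite_measure M" and Ym: "\<forall>i<m. Y i \<in> borel_measurable M" and p: "trig_polynomial m p"
    for M :: "'u measure" and Y :: "nat \<Rightarrow> 'u \<Rightarrow> real" and p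
  proof -
    interpret finite_measure M by fact
    have [measurable]: "Y i \<in> borel_measurable M" if "i < m" for i using that Ym by simp
    obtain A where "\<And>y. \<bar>p y\<bar> \<le> A" using trig_polynomial_bounded[OF p] by metis
    moreover have "p \<in> borel_measurable borel"
      using trig_polynomial_continuous[OF p] by (rule borel_measurable_continuous_onI)
    ultimately show ?thesis
      by (intro integrable_bounded[where B=A]) (auto intro: measurable_compose measurable_truncated_sequence)
  qed
  show ?case
    using int[OF finM Y' add.hyps(1)] int[OF finM Y' add.hyps(2)] int[OF finN Z' add.hyps(1)] int[OF finN Z' add.hyps(2)] add.IH
    by (simp add: Bochner_Integration.integral_add tendsto_add)
qed
qed

text \<open>Tychonoff: the coordinates from m on are pinned to 0. Consequently two distinct points
  of the box differ in one of the first m coordinates, which is what trigonometric polynomials can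
  detect.\<close>

lemma compact_box_sequence:
  "compact {y :: nat \<Rightarrow> real. \<forall>i. y i \<in> (if i < m then {-R..R} else {0})}"
proof -
  have "compactin (product_topology (\<lambda>i. euclidean) UNIV) (PiE UNIV (\<lambda>i::nat. if i < m then {-R..R} else {0::real}))"
    by (subst compactin_PiE) auto
  moreover have "PiE UNIV (\<lambda>i::nat. if i < m then {-R..R} else {0::real})
      = {y. \<forall>i. y i \<in> (if i < m then {-R..R} else {0::real})}"
    by (simp add: PiE_UNIV_domain Pi_def)
  ultimately show ?thesis by (simp add: euclidean_product_topology)
qed

text \<open>The approximating function is the clipping of a trigonometric polynomial that approximates
  \<open>F\<close> on the box.  Unlike that polynomial it is small outside of the box, and it is again a
  uniform limit of trigonometric polynomials.\<close>

lemma clipped_trig_approximation: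
  fixes F :: "(nat \<Rightarrow> real) \<Rightarrow> real"
  assumes F: "continuous_on UNIV F" "\<And>y. \<bar>F y\<bar> \<le> B" and B: "0 < B"
    and e: "0 < e" and R: "0 < R"
  obtains G where "trig_polynomial m G" "\<And>y. \<bar>G y\<bar> \<le> B + e"
    "\<And>y. (\<And>i. y i \<in> (if i < m then {-R..R} else {0})) \<Longrightarrow> \<bar>F y - G y\<bar> \<le> 2 * e"
proof -
  define S where "S = {y :: nat \<Rightarrow> real. \<forall>i. y i \<in> (if i < m then {-R..R} else {0::real})}"
  have "\<exists>p. trig_polynomial m p \<and> (\<forall>y\<in>S. \<bar>F y - p y\<bar> < e)"
  proof (rule Stone_Weierstrass_HOL[where P = "trig_polynomial m"])
    show "\<exists>f. trig_polynomial m f \<and> f x \<noteq> f y" if xy: "x \<in> S \<and> y \<in> S \<and> x \<noteq> y" for x y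
    proof -
      obtain i where i: "x i \<noteq> y i" using xy by auto
      then have im: "i < m" using xy by (auto simp: S_def dest!: spec[of _ i] split: if_splits)
      then have b: "\<bar>x i\<bar> \<le> R" "\<bar>y i\<bar> \<le> R" using xy by (auto simp: S_def dest!: spec[of _ i])
      \<comment> \<open>Division by R moves the coordinate into [-1, 1], inside [-pi/2, pi/2], where
        the sine is injective. The phase -pi/2 turns the cosine into a sine.\<close>
      define l where "l j = (if j = i then 1 / R else 0)" for j
      have sum: "(\<Sum>j<m. l j * z j) = z i / R" for z :: "nat \<Rightarrow> real"
        using im by (simp add: l_def if_distrib[of "\<lambda>u. u * _"] cong: if_cong)
      have "\<bar>x i / R\<bar> \<le> 1" "\<bar>y i / R\<bar> \<le> 1"
        using b R by (auto simp: abs_divide divide_le_eq)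
      then have "- (pi/2) \<le> x i / R" "x i / R \<le> pi/2" "- (pi/2) \<le> y i / R" "y i / R \<le> pi/2"
        using pi_ge_two unfolding abs_le_iff by linarith+
      moreover have "x i / R \<noteq> y i / R" using i R by simp
      ultimately have "sin (x i / R) \<noteq> sin (y i / R)"
        using sin_inj_pi[of "x i / R" "y i / R"] by blast
      then have "1 * cos ((\<Sum>j<m. l j * x j) + - (pi/2)) \<noteq> 1 * cos ((\<Sum>j<m. l j * y j) + - (pi/2))"
        unfolding sum by (simp add: cos_diff)
      then show ?thesis using trig_polynomial.cos[of m 1 l "- (pi/2)"] by blast
    qed
    show "compact S" unfolding S_def by (rule compact_box_sequence)
    show "continuous_on S F" using F(1) by (rule continuous_on_subset) simp
    show "continuous_on S f" if "trig_polynomial m f" for f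
      using trig_polynomial_continuous[OF that] by (rule continuous_on_subset) simp
  qed (use trig_polynomial_const trig_polynomial_mult trig_polynomial.add e in auto)
  then obtain p where p: "trig_polynomial m p" "\<And>y. y \<in> S \<Longrightarrow> \<bar>F y - p y\<bar> < e" by auto
  obtain A where A: "0 < A" "\<And>y. \<bar>p y\<bar> \<le> A" using trig_polynomial_bounded[OF p(1)] by metis
  define clip where "clip z = max (- B) (min B z)" for z :: real
  have "continuous_on {-A..A} clip" unfolding clip_def by (intro continuous_intros)
  then obtain q where q: "real_polynomial_function q" "\<And>z. z \<in> {-A..A} \<Longrightarrow> \<bar>clip z - q z\<bar> < e"
    using Stone_Weierstrass_real_polynomial_function[of "{-A..A}" clip e] e by auto
  have q': "\<bar>clip (p y) - q (p y)\<bar> < e" for y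
    using q(2)[of "p y"] A(2)[of y] by (auto simp: abs_le_iff)
  show thesis
  proof (rule that[OF trig_polynomial_compose_polynomial[OF q(1) p(1)]])
    fix y
    have "\<bar>clip (p y)\<bar> \<le> B" using B by (auto simp: clip_def)
    then show "\<bar>q (p y)\<bar> \<le> B + e" using q'[of y] by arith
    assume "\<And>i. y i \<in> (if i < m then {-R..R} else {0})"
    then have "y \<in> S" by (simp add: S_def)
    have "\<bar>clip (F y) - clip (p y)\<bar> \<le> \<bar>F y - p y\<bar>" by (auto simp: clip_def)
    moreover have "clip (F y) = F y" using F(2)[of y] by (auto simp: clip_def)
    ultimately show "\<bar>F y - q (p y)\<bar> \<le> 2 * e" using p(2)[OF \<open>y \<in> S\<close>] q'[of y] by arith
  qed
qed

lemma (in finite_measure) truncated_moment_tendsto_0: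
  assumes [measurable]: "Y \<in> borel_measurable M"
  shows "((\<lambda>h. LINT x|M. min 1 ((h * Y x)\<^sup>2)) \<longlongrightarrow> 0) (at_right (0::real))"
proof (rule tendsto_at_right_sequentially[where b = 1])
  fix h :: "nat \<Rightarrow> real" assume h: "\<And>n. 0 < h n" "h \<longlonglongrightarrow> 0"
  have "(\<lambda>n. LINT x|M. min 1 ((h n * Y x)\<^sup>2)) \<longlonglongrightarrow> (LINT x|M. min 1 ((0 * Y x)\<^sup>2))"
  proof (rule integral_dominated_convergence[where w = "\<lambda>_. 1"])
    show "AE x in M. (\<lambda>n. min 1 ((h n * Y x)\<^sup>2)) \<longlonglongrightarrow> min 1 ((0 * Y x)\<^sup>2)"
      by (intro AE_I2 tendsto_intros h)
  qed auto
  then show "(\<lambda>n. LINT x|M. min 1 ((h n * Y x)\<^sup>2)) \<longlonglongrightarrow> 0" by simp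
qed simp

text \<open>Tightness in the form of truncated moments, which bound the mass beyond 1/h. The moment
  of the limit is made small first; this makes the limit of each integral of 1 - cos (w Y) small for
  w in [0, h], and \<open>eventually_truncated_moment_le\<close> copes with the missing uniformity
  in w.\<close>

lemma tight_by_characteristic_functions:
  fixes M :: "nat \<Rightarrow> 'w measure" and N :: "'v measure"
  assumes finM: "\<And>n. finite_measure (M n)" and finN: "finite_measure N"
    and Y: "\<And>n. Y n \<in> borel_measurable (M n)"
    and Z: "Z \<in> borel_measurable N"
    and conv: "\<And>w. (\<lambda>n. CLINT x|M n. iexp (w * Y n x)) \<longlonglongrightarrow> (CLINT x|N. iexp (w * Z x))"
    and e: "0 < e"
  shows "\<forall>\<^sub>F h in at_right 0. (LINT x|N. min 1 ((h * Z x)\<^sup>2)) \<le> e \<and>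
    (\<forall>\<^sub>F n in sequentially. (LINT x|M n. min 1 ((h * Y n x)\<^sup>2)) \<le> e)"
proof -
  interpret N: finite_measure N by (rule finN)
  note [measurable] = Y Z
  have Uconv: "(\<lambda>n. LINT x|M n. 1 - cos (w * Y n x)) \<longlonglongrightarrow> (LINT x|N. 1 - cos (w * Z x))" for w
  proof -
    have *: "(LINT x|M. 1 - cos (w * Y x)) = Re (CLINT x|M. iexp (0 * Y x)) - Re (CLINT x|M. iexp (w * Y x))"
      if "finite_measure M" and [measurable]: "Y \<in> borel_measurable M" for M :: "'u measure" and Y :: "'u \<Rightarrow> real"
    proof -
      interpret finite_measure M by fact
      have int: "integrable M (\<lambda>x. iexp (v * Y x))" for v
        by (intro integrable_bounded[where B=1]) (auto simp: norm_exp_i_times)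
      have "(LINT x|M. 1 - cos (w * Y x)) = (LINT x|M. Re (iexp (0 * Y x)) - Re (iexp (w * Y x)))"
        by (intro Bochner_Integration.integral_cong) (auto simp: Re_exp)
      also have "\<dots> = (LINT x|M. Re (iexp (0 * Y x))) - (LINT x|M. Re (iexp (w * Y x)))"
        using integrable_Re[OF int] by (rule Bochner_Integration.integral_diff) (rule integrable_Re[OF int])
      finally show ?thesis using int[of 0] int[of w] by simp
    qed
    show ?thesis unfolding *[OF finM Y] *[OF finN Z] by (intro tendsto_intros conv)
  qed
  define s where "s h = (LINT x|N. min 1 ((h * Z x)\<^sup>2))" for h
  have Ule: "(LINT x|N. 1 - cos (w * Z x)) \<le> 2 * s h" if "0 \<le> w" "w \<le> h" for w h
  proof -
    have "(LINT x|N. 1 - cos (w * Z x)) \<le> (LINT x|N. 2 * min 1 ((h * Z x)\<^sup>2))"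
    proof (rule integral_mono)
      show "integrable N (\<lambda>x. 1 - cos (w * Z x))"
        by (rule N.integrable_bounded[where B=2]) (auto simp: abs_le_iff one_minus_cos_le_two)
      show "integrable N (\<lambda>x. 2 * min 1 ((h * Z x)\<^sup>2))"
        by (rule N.integrable_bounded[where B=2]) auto
      show "1 - cos (w * Z x) \<le> 2 * min 1 ((h * Z x)\<^sup>2)" for x
      proof -
        have "(w * Z x)\<^sup>2 \<le> (h * Z x)\<^sup>2"
          using that by (simp add: power_mult_distrib mult_right_mono power_mono)
        then show ?thesis using one_minus_cos_le[of "w * Z x"] by (auto simp: min_def split: if_splits)
      qed
    qed
    then show ?thesis by (simp add: s_def)
  qed
  \<comment> \<open>The constant leaves room: the integrals of 1 - cos are at most 2 e / 100 < e /
    20 in the limit, and the moment lemma multiplies e / 20 by 20.\<close>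
  have "\<forall>\<^sub>F h in at_right 0. s h < e / 100"
    using N.truncated_moment_tendsto_0[OF Z] e unfolding s_def by (intro order_tendstoD) auto
  moreover have "\<forall>\<^sub>F h in at_right (0::real). 0 < h" by (simp add: eventually_at_filter)
  ultimately show ?thesis
  proof eventually_elim
    case (elim h)
    have "\<forall>\<^sub>F n in sequentially. (LINT x|M n. min 1 ((h * Y n x)\<^sup>2)) \<le> 20 * (e / 20)"
    proof (rule eventually_truncated_moment_le[OF finM Y])
      fix w assume "0 \<le> w" "w \<le> h"
      then have "(LINT x|N. 1 - cos (w * Z x)) < e / 20" using Ule[of w h] elim e by linarith
      then have "\<forall>\<^sub>F n in sequentially. (LINT x|M n. 1 - cos (w * Y n x)) < e / 20"
        by (rule order_tendstoD[OF Uconv])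
      then show "\<forall>\<^sub>F n in sequentially. (LINT x|M n. 1 - cos (w * Y n x)) \<le> e / 20"
        by eventually_elim simp
    qed (use elim e in auto)
    then show ?case using elim e by (auto simp: s_def)
  qed
qed

text \<open>Levy's continuity theorem for finite measures of varying mass; the masses converge
  because frequency 0 is among those in \<open>conv\<close>. It serves twice: for the weighted
  measures in \<open>weighted_limit\<close>, and for the finite dimensional distributions at the
  very end.\<close>

theorem integral_tendsto_by_characteristic_functions:
  fixes M :: "nat \<Rightarrow> 'w measure" and N :: "'v measure" and F :: "(nat \<Rightarrow> real) \<Rightarrow> real"
  assumes finM: "\<And>n. finite_measure (M n)" and finN: "finite_measure N"
    and Y: "\<And>n i. i < m \<Longrightarrow> Y n i \<in> borel_measurable (M n)"
    and Z: "\<And>i. i < m \<Longrightarrow> Z i \<in> borel_measurable N"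
    and conv: "\<And>l. (\<lambda>n. CLINT x|M n. iexp (\<Sum>i<m. l i * Y n i x))
      \<longlonglongrightarrow> (CLINT x|N. iexp (\<Sum>i<m. l i * Z i x))"
    and F: "continuous_on UNIV F" "\<And>y. \<bar>F y\<bar> \<le> B"
  shows "(\<lambda>n. LINT x|M n. F (\<lambda>i. if i < m then Y n i x else 0))
    \<longlonglongrightarrow> (LINT x|N. F (\<lambda>i. if i < m then Z i x else 0))"
proof -
  define B' where "B' = \<bar>B\<bar> + 1"
  have B': "0 < B'" "\<And>y. \<bar>F y\<bar> \<le> B'" using F(2) by (auto simp: B'_def intro!: order_trans[OF F(2)])
  have Fm[measurable]: "F \<in> borel_measurable borel" by (rule borel_measurable_continuous_onI) fact
  have mass: "(\<lambda>n. measure (M n) (space (M n))) \<longlonglongrightarrow> measure N (space N)"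
    using tendsto_Re[OF conv[of "\<lambda>_. 0"]] by simp
  define c where "c = measure N (space N) + 1"
  have c1: "1 \<le> c" by (simp add: c_def)
  \<comment> \<open>The comparison of F with G is paid for under \<open>M n\<close> and under
    \<open>N\<close>; the last 1 is for the convergence of the integrals of G.\<close>
  define K where "K = 2 * (2 * c + (2 * B' + 1) * real m) + 1"
  \<comment> \<open>On the box F and G differ by at most 2 e. Outside it some truncated square
    equals 1, so the difference, at most 2 B' + e, is dominated by a multiple of the sum of the
    truncated squares.\<close>
  have close: "\<bar>(LINT x|M. F (\<lambda>i. if i < m then Y i x else 0)) - (LINT x|M. G (\<lambda>i. if i < m then Y i x else 0))\<bar>
      \<le> (2 * c + (2 * B' + 1) * real m) * e"
    if "finite_measure M" and [measurable]: "\<And>i. i < m \<Longrightarrow> Y i \<in> borel_measurable M"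
      and mass: "measure M (space M) \<le> c"
      and p: "\<And>i. i < m \<Longrightarrow> (LINT x|M. min 1 ((h * Y i x)\<^sup>2)) \<le> e"
      and G: "trig_polynomial m G" "\<And>y. \<bar>G y\<bar> \<le> B' + e"
        "\<And>y. (\<And>i. y i \<in> (if i < m then {-(1/h)..1/h} else {0})) \<Longrightarrow> \<bar>F y - G y\<bar> \<le> 2 * e"
      and h: "0 < h" and e: "0 < e" "e < 1"
    for M :: "'u measure" and Y :: "nat \<Rightarrow> 'u \<Rightarrow> real" and h e G
  proof -
    interpret finite_measure M by fact
    have [measurable]: "G \<in> borel_measurable borel"
      by (rule borel_measurable_continuous_onI) (rule trig_polynomial_continuous[OF G(1)])
    let ?y = "\<lambda>x i. if i < m then Y i x else 0"
    have intF: "integrable M (\<lambda>x. F (?y x))"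
      using B'(2) by (intro integrable_bounded[where B=B']) auto
    have intG: "integrable M (\<lambda>x. G (?y x))"
      using G(2) by (intro integrable_bounded[where B="B'+e"]) auto
    have intp: "integrable M (\<lambda>x. min 1 ((h * Y i x)\<^sup>2))" if "i < m" for i
      using that by (intro integrable_bounded[where B=1]) auto
    have "\<bar>(LINT x|M. F (?y x)) - (LINT x|M. G (?y x))\<bar> = \<bar>LINT x|M. F (?y x) - G (?y x)\<bar>"
      using intF intG by simp
    also have "\<dots> \<le> (LINT x|M. \<bar>F (?y x) - G (?y x)\<bar>)"
      by (rule integral_abs_bound)
    also have "\<dots> \<le> (LINT x|M. 2 * e + (2 * B' + 1) * (\<Sum>i<m. min 1 ((h * Y i x)\<^sup>2)))"
    proof (rule integral_mono)
      show "\<bar>F (?y x) - G (?y x)\<bar> \<le> 2 * e + (2 * B' + 1) * (\<Sum>i<m. min 1 ((h * Y i x)\<^sup>2))" for x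
      proof (cases "\<forall>i<m. \<bar>Y i x\<bar> \<le> 1 / h")
        case True
        then have "\<bar>F (?y x) - G (?y x)\<bar> \<le> 2 * e"
          by (intro G(3)) (auto simp: abs_le_iff)
        moreover have "0 \<le> (2 * B' + 1) * (\<Sum>i<m. min 1 ((h * Y i x)\<^sup>2))"
          using B' by (intro mult_nonneg_nonneg sum_nonneg) auto
        ultimately show ?thesis by linarith
      next
        case False
        then obtain i where i: "i < m" "1 / h < \<bar>Y i x\<bar>" by (auto simp: not_le)
        then have "1 < h * \<bar>Y i x\<bar>" using h by (simp add: field_simps)
        then have "1\<^sup>2 \<le> (h * \<bar>Y i x\<bar>)\<^sup>2" by (intro power_mono) auto
        then have "1 = min 1 ((h * Y i x)\<^sup>2)" by (simp add: power_mult_distrib)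
        also have "\<dots> \<le> (\<Sum>i<m. min 1 ((h * Y i x)\<^sup>2))"
          using i by (intro member_le_sum) auto
        finally have "(2 * B' + 1) * 1 \<le> (2 * B' + 1) * (\<Sum>i<m. min 1 ((h * Y i x)\<^sup>2))"
          using B' by (intro mult_left_mono) auto
        moreover have "\<bar>F (?y x) - G (?y x)\<bar> \<le> B' + (B' + e)"
          using B'(2)[of "?y x"] G(2)[of "?y x"] by linarith
        moreover have "B' + (B' + e) \<le> 2 * e + (2 * B' + 1) * 1" using e by simp
        ultimately show ?thesis by (meson add_left_mono order_trans)
      qed
      show "integrable M (\<lambda>x. 2 * e + (2 * B' + 1) * (\<Sum>i<m. min 1 ((h * Y i x)\<^sup>2)))"
        using intp by (intro Bochner_Integration.integrable_add integrable_mult_right Bochner_Integration.integrable_sum) auto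
    qed (use intF intG in auto)
    also have "\<dots> = 2 * e * measure M (space M) + (2 * B' + 1) * (\<Sum>i<m. (LINT x|M. min 1 ((h * Y i x)\<^sup>2)))"
    proof -
      have ints: "integrable M (\<lambda>x. \<Sum>i<m. min 1 ((h * Y i x)\<^sup>2))"
        using intp by (intro Bochner_Integration.integrable_sum) auto
      have "(LINT x|M. (\<Sum>i<m. min 1 ((h * Y i x)\<^sup>2))) = (\<Sum>i<m. (LINT x|M. min 1 ((h * Y i x)\<^sup>2)))"
        using intp by (intro Bochner_Integration.integral_sum) auto
      then show ?thesis using ints by (simp add: Bochner_Integration.integral_add)
    qed
    also have "\<dots> \<le> 2 * e * c + (2 * B' + 1) * (\<Sum>i<m. e)"
      using e mass p B' by (intro add_mono mult_left_mono sum_mono) auto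
    finally show ?thesis by (simp add: algebra_simps)
  qed
  have main: "\<forall>\<^sub>F n in sequentially. \<bar>(LINT x|M n. F (\<lambda>i. if i < m then Y n i x else 0))
      - (LINT x|N. F (\<lambda>i. if i < m then Z i x else 0))\<bar> \<le> K * e" if e: "0 < e" "e < 1" for e
  proof -
    have conv1: "(\<lambda>n. CLINT x|M n. iexp (w * Y n i x)) \<longlonglongrightarrow> (CLINT x|N. iexp (w * Z i x))" if "i < m" for i w
      using that conv[of "\<lambda>j. if j = i then w else 0"]
      by (simp add: if_distrib[of "\<lambda>u. u * _"] cong: if_cong)
    have "\<forall>\<^sub>F h in at_right 0. \<forall>i\<in>{..<m}. (LINT x|N. min 1 ((h * Z i x)\<^sup>2)) \<le> e \<and>
      (\<forall>\<^sub>F n in sequentially. (LINT x|M n. min 1 ((h * Y n i x)\<^sup>2)) \<le> e)"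
      by (intro eventually_ball_finite ballI tight_by_characteristic_functions finM finN conv1 e)
         (use Y Z in auto)
    moreover have "\<forall>\<^sub>F h in at_right (0::real). 0 < h" by (simp add: eventually_at_filter)
    ultimately have "\<forall>\<^sub>F h in at_right (0::real). 0 < h \<and> (\<forall>i\<in>{..<m}. (LINT x|N. min 1 ((h * Z i x)\<^sup>2)) \<le> e \<and>
      (\<forall>\<^sub>F n in sequentially. (LINT x|M n. min 1 ((h * Y n i x)\<^sup>2)) \<le> e))"
      by eventually_elim auto
    from eventually_happens[OF this] obtain h where h: "0 < h"
        "\<And>i. i < m \<Longrightarrow> (LINT x|N. min 1 ((h * Z i x)\<^sup>2)) \<le> e"
        "\<And>i. i < m \<Longrightarrow> \<forall>\<^sub>F n in sequentially. (LINT x|M n. min 1 ((h * Y n i x)\<^sup>2)) \<le> e"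
      by auto
    obtain G where G: "trig_polynomial m G" "\<And>y. \<bar>G y\<bar> \<le> B' + e"
        "\<And>y. (\<And>i. y i \<in> (if i < m then {-(1/h)..1/h} else {0})) \<Longrightarrow> \<bar>F y - G y\<bar> \<le> 2 * e"
      using clipped_trig_approximation[OF F(1) B'(2,1) e(1), of "1/h" m] h(1) by auto
    have "\<forall>\<^sub>F n in sequentially. \<forall>i\<in>{..<m}. (LINT x|M n. min 1 ((h * Y n i x)\<^sup>2)) \<le> e"
      using h(3) by (intro eventually_ball_finite) auto
    moreover have "\<forall>\<^sub>F n in sequentially. measure (M n) (space (M n)) < c"
      by (rule order_tendstoD[OF mass]) (simp add: c_def)
    moreover have "\<forall>\<^sub>F n in sequentially. \<bar>(LINT x|M n. G (\<lambda>i. if i < m then Y n i x else 0))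
      - (LINT x|N. G (\<lambda>i. if i < m then Z i x else 0))\<bar> < e"
      using tendstoD[OF trig_polynomial_integral_tendsto[OF finM finN Y Z conv G(1)] e(1)]
      by (simp add: dist_real_def)
    ultimately show ?thesis
    proof eventually_elim
      case (elim n)
      have "\<bar>(LINT x|M n. F (\<lambda>i. if i < m then Y n i x else 0)) - (LINT x|M n. G (\<lambda>i. if i < m then Y n i x else 0))\<bar>
        \<le> (2 * c + (2 * B' + 1) * real m) * e"
        by (rule close[OF finM Y _ _ G h(1) e]) (use elim in auto)
      moreover have "\<bar>(LINT x|N. F (\<lambda>i. if i < m then Z i x else 0)) - (LINT x|N. G (\<lambda>i. if i < m then Z i x else 0))\<bar>
        \<le> (2 * c + (2 * B' + 1) * real m) * e"
        by (rule close[OF finN Z _ _ G h(1) e]) (use h(2) in \<open>auto simp: c_def\<close>)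
      ultimately show ?case using elim(3) by (simp add: K_def algebra_simps abs_le_iff abs_less_iff)
    qed
  qed
  have K: "1 \<le> K" using c1 B' by (simp add: K_def)
  show ?thesis
  proof (rule LIMSEQ_I)
    fix r :: real assume r: "0 < r"
    define e where "e = min (1/2) (r / (2 * K))"
    have e: "0 < e" "e < 1" using r K by (auto simp: e_def)
    have "K * e \<le> K * (r / (2 * K))" using K by (intro mult_left_mono) (auto simp: e_def)
    also have "\<dots> < r" using K r by simp
    finally show "\<exists>no. \<forall>n\<ge>no. norm ((LINT x|M n. F (\<lambda>i. if i < m then Y n i x else 0))
      - (LINT x|N. F (\<lambda>i. if i < m then Z i x else 0))) < r"
      using main[OF e] unfolding eventually_sequentially by (auto intro: le_less_trans)
  qed
qed

section \<open>Levy measures\<close>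

lemma cmod_iexp_minus_one_le: "cmod (iexp y - 1) \<le> 2 * min 1 \<bar>y\<bar>"
proof -
  have "cmod (iexp y - 1) \<le> \<bar>y\<bar>" using iexp_approx1[of y 0] by simp
  moreover have "cmod (iexp y - 1) \<le> 2"
    using norm_triangle_ineq4[of "iexp y" 1] by (simp add: norm_exp_i_times)
  ultimately show ?thesis by (auto simp: min_def)
qed

lemma min_one_sum_squares_le: "min 1 ((a + b)\<^sup>2) \<le> 2 * min 1 (a\<^sup>2) + 2 * (b::real)\<^sup>2"
proof -
  have "(a + b)\<^sup>2 \<le> 2 * a\<^sup>2 + 2 * b\<^sup>2"
    using zero_le_power2[of "a - b"] by (simp add: power2_eq_square algebra_simps)
  then show ?thesis by (auto simp: min_def) (smt (verit) zero_le_power2)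
qed

lemma min_one_sum_le: "finite A \<Longrightarrow> (\<And>i. i \<in> A \<Longrightarrow> 0 \<le> f i) \<Longrightarrow> min 1 (\<Sum>i\<in>A. f i) \<le> (\<Sum>i\<in>A. min 1 (f i :: real))"
proof (induction A rule: finite_induct)
  case (insert x F)
  have "0 \<le> sum f F" using insert by (intro sum_nonneg) auto
  then have "min 1 (f x + sum f F) \<le> min 1 (f x) + min 1 (sum f F)"
    using insert.prems[of x] by (auto simp: min_def)
  also have "min 1 (sum f F) \<le> (\<Sum>i\<in>F. min 1 (f i))" using insert by auto
  finally show ?case using insert by simp
qed simp

lemma min_one_scale_le: "0 \<le> y \<Longrightarrow> min 1 (a * y) \<le> max 1 a * min 1 (y::real)"
proof -
  assume y: "0 \<le> y"
  have "a * y \<le> max 1 a * y" by (intro mult_right_mono y) auto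
  then show ?thesis by (auto simp: min_def)
qed

lemma levy_measure_integrable:
  fixes f :: "'a::euclidean_space \<Rightarrow> 'b::{banach, second_countable_topology}"
  assumes M: "levy_measure M" and f: "f \<in> borel_measurable borel"
    and le: "\<And>x. norm (f x) \<le> C * min 1 ((norm x)\<^sup>2)"
  shows "integrable M f"
proof -
  have sets: "sets M = sets borel" using M by (simp add: levy_measure_def)
  have "integrable M (\<lambda>x. min 1 ((norm x)\<^sup>2))"
  proof (rule integrableI_nonneg)
    show "(\<lambda>x. min 1 ((norm x)\<^sup>2)) \<in> borel_measurable M"
      unfolding measurable_cong_sets[OF sets refl] by measurable
  qed (use M in \<open>auto simp: levy_measure_def\<close>)
  then have "integrable M (\<lambda>x. C * min 1 ((norm x)\<^sup>2))" by simp
  then show ?thesis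
    by (rule Bochner_Integration.integrable_bound)
      (use f le in \<open>auto simp: measurable_cong_sets[OF sets refl] intro!: AE_I2 order_trans[OF le]\<close>)
qed

lemma levy_exponent_integrand_bound:
  fixes u x :: "'a::euclidean_space"
  shows "cmod (iexp (u \<bullet> x) - 1 - \<i> * of_real (u \<bullet> x) * indicator {x. norm x \<le> 1} x)
    \<le> (2 + (norm u)\<^sup>2) * min 1 ((norm x)\<^sup>2)"
proof (cases "norm x \<le> 1")
  case True
  have "cmod (iexp (u \<bullet> x) - 1 - \<i> * of_real (u \<bullet> x)) \<le> \<bar>u \<bullet> x\<bar>\<^sup>2 / 2"
    using iexp_approx1[of "u \<bullet> x" 1] by (simp add: algebra_simps power2_eq_square)
  also have "\<dots> \<le> (norm u * norm x)\<^sup>2 / 2"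
    using Cauchy_Schwarz_ineq2[of u x] by (intro divide_right_mono power_mono) auto
  also have "\<dots> \<le> (2 + (norm u)\<^sup>2) * (norm x)\<^sup>2"
    by (simp add: power_mult_distrib algebra_simps)
  finally show ?thesis using True by (simp add: abs_square_le_1)
next
  case False
  have "cmod (iexp (u \<bullet> x) - 1) \<le> 2"
    using cmod_iexp_minus_one_le[of "u \<bullet> x"] by simp
  moreover have "1 \<le> (norm x)\<^sup>2" using False by (simp add: one_le_power)
  ultimately show ?thesis using False by (simp add: min_def add_increasing2)
qed

text \<open>The integrand vanishes at the origin, so the set integral over the complement of {0} is
  an ordinary integral.\<close>

lemma levy_exponent_eq:
  assumes M: "levy_measure M"
  shows "levy_exponent a (\<lambda>_. 0) M u = \<i> * of_real (u \<bullet> a) +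
      (CLINT x|M. iexp (u \<bullet> x) - 1 - \<i> * of_real (u \<bullet> x) * indicator {x. norm x \<le> 1} x)"
    and "integrable M (\<lambda>x. iexp (u \<bullet> x) - 1 - \<i> * of_real (u \<bullet> x) * indicator {x. norm x \<le> 1} x)"
proof -
  have "(CLINT x:-{0}|M. iexp (u \<bullet> x) - 1 - \<i> * of_real (u \<bullet> x) * indicator {x. norm x \<le> 1} x)
    = (CLINT x|M. iexp (u \<bullet> x) - 1 - \<i> * of_real (u \<bullet> x) * indicator {x. norm x \<le> 1} x)"
    unfolding set_lebesgue_integral_def
    by (intro Bochner_Integration.integral_cong) (auto simp: indicator_def)
  then show "levy_exponent a (\<lambda>_. 0) M u = \<i> * of_real (u \<bullet> a) +
      (CLINT x|M. iexp (u \<bullet> x) - 1 - \<i> * of_real (u \<bullet> x) * indicator {x. norm x \<le> 1} x)"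
    by (simp add: levy_exponent_def)
  show "integrable M (\<lambda>x. iexp (u \<bullet> x) - 1 - \<i> * of_real (u \<bullet> x) * indicator {x. norm x \<le> 1} x)"
    by (rule levy_measure_integrable[OF M _ levy_exponent_integrand_bound]) measurable
qed

text \<open>Here h is an inverse scale. For h tending to 0 the quantity controls the mass beyond
  1/h. Multiplied by d^2 at h = 1/d it is the integral of min(d^2, |x|^2), which for d tending to 0
  controls the small jumps.\<close>

definition truncated_moment :: "'a::euclidean_space measure \<Rightarrow> real \<Rightarrow> real"
  where "truncated_moment M h = (LINT x|M. min 1 ((h * norm x)\<^sup>2))"

lemma truncated_square_le:
  fixes x :: "'a::real_normed_vector"
  shows "min 1 ((h * norm x)\<^sup>2) \<le> max 1 (h\<^sup>2) * min 1 ((norm x)\<^sup>2)"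
  using min_one_scale_le[of "(norm x)\<^sup>2" "h\<^sup>2"] by (simp add: power_mult_distrib)

lemma integrable_truncated_square:
  assumes M: "levy_measure M"
  shows "integrable M (\<lambda>x. min 1 ((h * norm x)\<^sup>2))"
  by (rule levy_measure_integrable[OF M, where C = "max 1 (h\<^sup>2)"])
    (use truncated_square_le in \<open>auto simp: abs_of_nonneg\<close>)

lemma truncated_moment_nonneg: "0 \<le> truncated_moment M h"
  unfolding truncated_moment_def by (intro integral_nonneg_AE) simp

lemma levy_truncated_moment_tendsto_0:
  assumes M: "levy_measure M"
  shows "(truncated_moment M \<longlongrightarrow> 0) (at_right 0)"
proof (rule tendsto_at_right_sequentially[where b = 1])
  fix h :: "nat \<Rightarrow> real" assume h: "\<And>n. 0 < h n" "\<And>n. h n < 1" "h \<longlonglongrightarrow> 0"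
  have sets: "sets M = sets borel" using M by (simp add: levy_measure_def)
  have "(\<lambda>n. LINT x|M. min 1 ((h n * norm x)\<^sup>2)) \<longlonglongrightarrow> (LINT x|M. min 1 ((0 * norm x)\<^sup>2))"
  proof (rule integral_dominated_convergence[where w = "\<lambda>x. min 1 ((norm x)\<^sup>2)"])
    show "AE x in M. (\<lambda>n. min 1 ((h n * norm x)\<^sup>2)) \<longlonglongrightarrow> min 1 ((0 * norm x)\<^sup>2)"
      by (intro AE_I2 tendsto_intros h)
    show "AE x in M. norm (min 1 ((h n * norm x)\<^sup>2)) \<le> min 1 ((norm x)\<^sup>2)" for n
    proof (rule AE_I2)
      fix x :: 'a
      have "(h n)\<^sup>2 \<le> 1" using h(1,2)[of n] by (simp add: abs_square_le_1)
      then show "norm (min 1 ((h n * norm x)\<^sup>2)) \<le> min 1 ((norm x)\<^sup>2)"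
        using truncated_square_le[of "h n" x] by (simp add: max_def split: if_splits)
    qed
  qed (use integrable_truncated_square[OF M, of 1] in \<open>auto simp: measurable_cong_sets[OF sets refl]\<close>)
  then show "(\<lambda>n. truncated_moment M (h n)) \<longlonglongrightarrow> 0" by (simp add: truncated_moment_def)
qed simp

text \<open>After rewriting as the integral of min(d^2, |x|^2) this is dominated convergence.
  Combined with \<open>moment_bound\<close> it makes the second moment of the small rescaled jumps
  negligible, that is, it excludes a Gaussian contribution.\<close>

lemma truncated_moment_subquadratic:
  assumes M: "levy_measure M"
  shows "((\<lambda>d. d\<^sup>2 * truncated_moment M (1 / d)) \<longlongrightarrow> 0) (at_right 0)"
proof (rule tendsto_at_right_sequentially[where b = 1])
  fix d :: "nat \<Rightarrow> real" assume d: "\<And>n. 0 < d n" "\<And>n. d n < 1" "d \<longlonglongrightarrow> 0"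
  have sets: "sets M = sets borel" using M by (simp add: levy_measure_def)
  have "(\<lambda>n. LINT x|M. min ((d n)\<^sup>2) ((norm x)\<^sup>2)) \<longlonglongrightarrow> (LINT x|M. min (0\<^sup>2) ((norm x)\<^sup>2))"
  proof (rule integral_dominated_convergence[where w = "\<lambda>x. min 1 ((norm x)\<^sup>2)"])
    show "AE x in M. (\<lambda>n. min ((d n)\<^sup>2) ((norm x)\<^sup>2)) \<longlonglongrightarrow> min (0\<^sup>2) ((norm x)\<^sup>2)"
      by (intro AE_I2 tendsto_intros d)
    show "AE x in M. norm (min ((d n)\<^sup>2) ((norm x)\<^sup>2)) \<le> min 1 ((norm x)\<^sup>2)" for n
    proof (rule AE_I2)
      fix x :: 'a
      have "(d n)\<^sup>2 \<le> 1" using d(1,2)[of n] by (simp add: abs_square_le_1)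
      then show "norm (min ((d n)\<^sup>2) ((norm x)\<^sup>2)) \<le> min 1 ((norm x)\<^sup>2)" by (auto simp: min_def)
    qed
  qed (use integrable_truncated_square[OF M, of 1] in \<open>auto simp: measurable_cong_sets[OF sets refl]\<close>)
  moreover have "(LINT x|M. min ((d n)\<^sup>2) ((norm x)\<^sup>2)) = (d n)\<^sup>2 * truncated_moment M (1 / d n)" for n
  proof -
    have "min ((d n)\<^sup>2) ((norm x)\<^sup>2) = (d n)\<^sup>2 * min 1 ((1 / d n * norm x)\<^sup>2)" for x :: 'a
      using d(1)[of n] by (simp add: min_def power_divide field_simps)
    then show ?thesis by (simp add: truncated_moment_def)
  qed
  ultimately show "(\<lambda>n. (d n)\<^sup>2 * truncated_moment M (1 / d n)) \<longlonglongrightarrow> 0"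
    by (simp add: min_def)
qed simp

lemma levy_measure_moment_inner_le:
  assumes M: "levy_measure M" and w: "\<bar>w\<bar> \<le> 1"
  shows "(LINT x|M. 1 - cos (w * (u \<bullet> x))) \<le> 2 * truncated_moment M (norm u)"
    and "integrable M (\<lambda>x. 1 - cos (w * (u \<bullet> x)))"
proof -
  have le: "1 - cos (w * (u \<bullet> x)) \<le> 2 * min 1 ((norm u * norm x)\<^sup>2)" for x
  proof -
    have "\<bar>w * (u \<bullet> x)\<bar> \<le> 1 * (norm u * norm x)"
      unfolding abs_mult using w Cauchy_Schwarz_ineq2[of u x] by (intro mult_mono) auto
    then have "(w * (u \<bullet> x))\<^sup>2 \<le> (norm u * norm x)\<^sup>2"
      by (metis abs_le_square_iff abs_of_nonneg mult_1 mult_nonneg_nonneg norm_ge_zero)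
    then show ?thesis using one_minus_cos_le[of "w * (u \<bullet> x)"] by (auto simp: min_def split: if_splits)
  qed
  show int: "integrable M (\<lambda>x. 1 - cos (w * (u \<bullet> x)))"
  proof (rule levy_measure_integrable[OF M])
    show "norm (1 - cos (w * (u \<bullet> x))) \<le> (2 * max 1 ((norm u)\<^sup>2)) * min 1 ((norm x)\<^sup>2)" for x
      using le[of x] truncated_square_le[of "norm u" x] by simp
  qed measurable
  have "(LINT x|M. 1 - cos (w * (u \<bullet> x))) \<le> (LINT x|M. 2 * min 1 ((norm u * norm x)\<^sup>2))"
    by (rule integral_mono[OF int]) (use integrable_truncated_square[OF M] le in auto)
  then show "(LINT x|M. 1 - cos (w * (u \<bullet> x))) \<le> 2 * truncated_moment M (norm u)"
    by (simp add: truncated_moment_def)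
qed

text \<open>Drift and compensator are purely imaginary, so the modulus retains the symmetric part of
  the exponent alone.\<close>

lemma cmod_exp_levy_exponent:
  assumes M: "levy_measure M"
  shows "cmod (exp (levy_exponent a (\<lambda>_. 0) M u)) = exp (- (LINT x|M. 1 - cos (u \<bullet> x)))"
proof -
  let ?f = "\<lambda>x. iexp (u \<bullet> x) - 1 - \<i> * of_real (u \<bullet> x) * indicator {x. norm x \<le> 1} x"
  note int = levy_exponent_eq(2)[OF M, of u]
  have "Re (levy_exponent a (\<lambda>_. 0) M u) = Re (CLINT x|M. ?f x)"
    by (subst levy_exponent_eq(1)[OF M]) simp
  also have "\<dots> = (LINT x|M. Re (?f x))" by (rule integral_Re[OF int, symmetric])
  also have "\<dots> = (LINT x|M. - (1 - cos (u \<bullet> x)))"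
    by (intro Bochner_Integration.integral_cong) (auto simp: Re_exp indicator_def)
  also have "\<dots> = - (LINT x|M. 1 - cos (u \<bullet> x))"
    using levy_measure_moment_inner_le(2)[OF M, of 1 u] by (subst integral_minus[symmetric]) simp_all
  finally show ?thesis by simp
qed

text \<open>Vanishing of all the second moments in the directions \<open>b / k\<close> (\<open>b\<close> a basis vector) forces
  \<open>M = 0\<close>: a number \<open>b \<bullet> x / k\<close> in \<open>(-\<pi>, \<pi>)\<close> has cosine 1 only if it vanishes.\<close>

lemma levy_measure_trivial:
  assumes M: "levy_measure M" and 0: "\<And>u. (LINT x|M. 1 - cos (u \<bullet> x)) = 0"
  shows "emeasure M UNIV = 0"
proof -
  have sets: "sets M = sets borel" using M by (simp add: levy_measure_def)
  then have space: "space M = UNIV" using sets_eq_imp_space_eq by fastforce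
  have "AE x in M. 1 - cos ((b /\<^sub>R real (Suc k)) \<bullet> x) = 0" for k b
    using 0[of "b /\<^sub>R real (Suc k)"] levy_measure_moment_inner_le(2)[OF M, of 1 "b /\<^sub>R real (Suc k)"]
    by (subst (asm) integral_nonneg_eq_0_iff_AE) auto
  then have "AE x in M. \<forall>b\<in>Basis. \<forall>k. 1 - cos ((b /\<^sub>R real (Suc k)) \<bullet> x) = 0"
    by (intro AE_finite_allI finite_Basis) (simp add: AE_all_countable)
  then have "AE x in M. x = 0"
  proof eventually_elim
    case (elim x)
    have "b \<bullet> x = 0" if b: "b \<in> Basis" for b
    proof (rule ccontr)
      assume nz: "b \<bullet> x \<noteq> 0"
      obtain k where k: "\<bar>b \<bullet> x\<bar> < real k" using reals_Archimedean2 by blast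
      define z where "z = \<bar>b \<bullet> x\<bar> / real (Suc k)"
      have z: "0 < z" "z < 1" using nz k by (auto simp: z_def field_simps)
      have "cos z = 1"
        using elim[rule_format, OF b, of k]
        by (simp add: z_def abs_if divide_inverse_commute del: of_nat_Suc)
      moreover have "cos z < cos 0" using z pi_ge_two by (intro cos_monotone_0_pi) auto
      ultimately show False by simp
    qed
    then show ?case by (simp add: euclidean_eq_iff[of x 0] inner_commute)
  qed
  then have "emeasure M (UNIV - {0}) = 0"
    by (subst (asm) AE_iff_measurable[where N = "UNIV - {0}"]) (auto simp: sets space)
  moreover have "emeasure M {0} = 0" using M by (simp add: levy_measure_def)
  ultimately have "emeasure M ((UNIV - {0}) \<union> {0}) = 0"
    by (intro emeasure_Un_null_set[THEN trans]) (auto simp: null_sets_def sets)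
  moreover have "(UNIV - {0}) \<union> {0} = (UNIV :: 'a set)" by auto
  ultimately show ?thesis by simp
qed

text \<open>The moment lemma applied to the finite measures n P, realised as densities with a
  constant.\<close>

lemma eventually_scaled_truncated_moment_le:
  fixes Y :: "nat \<Rightarrow> 'w \<Rightarrow> real"
  assumes fin: "finite_measure P" and Y[measurable]: "\<And>n. Y n \<in> borel_measurable P" and b: "0 < b"
    and ev: "\<And>w. 0 \<le> w \<Longrightarrow> w \<le> 1 \<Longrightarrow>
      \<forall>\<^sub>F n in sequentially. real n * (LINT x|P. 1 - cos (w * Y n x)) \<le> b"
  shows "\<forall>\<^sub>F n in sequentially. real n * (LINT x|P. min 1 ((Y n x)\<^sup>2)) \<le> 20 * b"
proof -
  interpret finite_measure P by fact
  define M where "M n = density P (\<lambda>_. ennreal (real n))" for n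
  have int: "(LINT x|M n. f x) = real n * (LINT x|P. f x)" if [measurable]: "f \<in> borel_measurable P" for n f
    unfolding M_def by (subst integral_density) auto
  have "\<forall>\<^sub>F n in sequentially. (LINT x|M n. min 1 ((1 * Y n x)\<^sup>2)) \<le> 20 * b"
  proof (rule eventually_truncated_moment_le)
    show "finite_measure (M n)" for n
    proof (rule finite_measureI)
      have "emeasure (M n) (space (M n)) = ennreal (real n) * emeasure P (space P)"
        unfolding M_def by (subst emeasure_density) (auto simp: nn_integral_cmult_indicator)
      then show "emeasure (M n) (space (M n)) \<noteq> \<infinity>"
        by (simp add: ennreal_mult_eq_top_iff)
    qed
    show "Y n \<in> borel_measurable (M n)" for n unfolding M_def by measurable
    show "\<forall>\<^sub>F n in sequentially. (LINT x|M n. 1 - cos (w * Y n x)) \<le> b" if "0 \<le> w" "w \<le> 1" for w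
      using ev[OF that] by (subst int) auto
  qed (use b in auto)
  then show ?thesis by (subst (asm) int) auto
qed

text \<open>The power determines n Ln (r n) only modulo 2 pi i. The bound 2 on \<open>z n\<close>
  and on D keeps everything in the strip where the principal logarithm inverts exp: replacing n Ln
  (r n) by \<open>z n\<close> costs at most 8 / n, and 2 + 8/10 < 3 < pi once n is at least
  10.\<close>

lemma power_limit_log:
  fixes r z :: "nat \<Rightarrow> complex"
  assumes z: "\<forall>\<^sub>F n in sequentially. cmod (z n) \<le> 2"
    and r: "\<And>n. n > 0 \<Longrightarrow> r n = 1 + z n / of_nat n"
    and lim: "(\<lambda>n. r n ^ n) \<longlonglongrightarrow> exp D" and D: "cmod D \<le> 2"
  shows "z \<longlonglongrightarrow> D"
proof -
  define L where "L n = of_nat n * Ln (r n)" for n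
  have bound: "\<forall>\<^sub>F n in sequentially. cmod (L n - z n) \<le> 8 / real n \<and> exp (L n) = r n ^ n"
    using z eventually_ge_at_top[of 4]
  proof eventually_elim
    case (elim n)
    define w where "w = z n / of_nat n"
    have w: "cmod w \<le> 2 / real n" using elim by (simp add: w_def norm_divide divide_right_mono)
    also have "\<dots> \<le> 1/2" using elim by (simp add: field_simps)
    finally have w2: "cmod w \<le> 1/2" .
    have r': "r n = 1 + w" using elim r[of n] by (simp add: w_def)
    have "r n \<noteq> 0"
    proof
      assume "r n = 0"
      then have "w = -1" using r' by (simp add: add_eq_0_iff)
      then show False using w2 by simp
    qed
    then have "exp (L n) = r n ^ n" by (simp add: L_def exp_of_nat_mult)
    have "cmod (Ln (1 + w) - w) \<le> cmod w ^ 2 / (1 - cmod w)" using w2 by (intro Ln_approx_linear) auto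
    also have "\<dots> \<le> cmod w ^ 2 / (1/2)" using w2 by (intro divide_left_mono) auto
    also have "\<dots> \<le> (2 / real n)\<^sup>2 * 2" using w by (simp add: power_mono)
    finally have *: "cmod (Ln (1 + w) - w) \<le> (2 / real n)\<^sup>2 * 2" .
    have "L n - z n = of_nat n * (Ln (1 + w) - w)"
      using elim by (simp add: L_def r' w_def algebra_simps)
    then have "cmod (L n - z n) = real n * cmod (Ln (1 + w) - w)" by (simp add: norm_mult)
    also have "\<dots> \<le> real n * ((2 / real n)\<^sup>2 * 2)" using * by (intro mult_left_mono) auto
    also have "\<dots> = 8 / real n" using elim by (simp add: power2_eq_square field_simps)
    finally show ?case using \<open>exp (L n) = r n ^ n\<close> by simp
  qed
  have "(\<lambda>n. L n - z n) \<longlonglongrightarrow> 0"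
  proof (rule Lim_null_comparison)
    show "\<forall>\<^sub>F n in sequentially. norm (L n - z n) \<le> 8 / real n"
      using bound by eventually_elim auto
    show "(\<lambda>n. 8 / real n) \<longlonglongrightarrow> 0" by (rule lim_const_over_n)
  qed
  have "\<forall>\<^sub>F n in sequentially. cmod (L n) < pi"
    using bound z eventually_ge_at_top[of 10]
  proof eventually_elim
    case (elim n)
    have "8 / real n \<le> 8/10" using elim by (intro divide_left_mono) auto
    then have "cmod (L n - z n) \<le> 8/10" using elim by linarith
    then have "cmod (L n) \<le> 2 + 8/10"
      using norm_triangle_ineq[of "L n - z n" "z n"] elim by simp
    then show ?case using pi_gt3 by linarith
  qed
  then have "\<forall>\<^sub>F n in sequentially. L n = Ln (r n ^ n)"
    using bound
  proof eventually_elim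
    case (elim n)
    have "\<bar>Im (L n)\<bar> < pi" using abs_Im_le_cmod[of "L n"] elim by linarith
    then have "Ln (exp (L n)) = L n" by (intro Ln_exp) auto
    then show ?case using elim by simp
  qed
  moreover have "(\<lambda>n. Ln (r n ^ n)) \<longlonglongrightarrow> Ln (exp D)"
  proof (rule tendsto_Ln[OF lim])
    have "\<bar>Im D\<bar> < pi" using abs_Im_le_cmod[of D] D pi_gt3 by linarith
    then have ln: "Ln (exp D) = D" by (intro Ln_exp) auto
    show "exp D \<notin> \<real>\<^sub>\<le>\<^sub>0"
    proof
      assume "exp D \<in> \<real>\<^sub>\<le>\<^sub>0"
      then have "Im (Ln (exp D)) = pi"
        by (subst Im_Ln_eq_pi) (use exp_not_eq_zero[of D] in \<open>auto simp: complex_nonpos_Reals_iff less_le complex_eq_iff\<close>)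
      then show False using ln \<open>\<bar>Im D\<bar> < pi\<close> by simp
    qed
  qed
  moreover have "Ln (exp D) = D"
  proof -
    have "\<bar>Im D\<bar> < pi" using abs_Im_le_cmod[of D] D pi_gt3 by linarith
    then show ?thesis by (intro Ln_exp) auto
  qed
  ultimately have "L \<longlonglongrightarrow> D" by (simp add: tendsto_cong)
  from tendsto_diff[OF this \<open>(\<lambda>n. L n - z n) \<longlonglongrightarrow> 0\<close>] show ?thesis by simp
qed

lemma mult_min_one_le:
  fixes A y :: real
  assumes "0 \<le> A" "A \<le> 1" "0 \<le> y"
  shows "A * min 1 y \<le> min 1 (A * y)"
  using assms mult_left_mono[of 1 y A] mult_left_mono[of y 1 A] by (auto simp: min_def)

lemma Re_iexp: "Re (iexp y) = cos y" and Im_iexp: "Im (iexp y) = sin y"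
  by (simp_all add: cis_conv_exp[symmetric])

section \<open>Vague convergence under attraction to a non-Gaussian law\<close>

text \<open>The attraction hypothesis in terms of characteristic functions, for a general Levy
  measure M and vanishing Gaussian part. \<open>M_nonzero\<close> excludes a degenerate limit, which
  would not force \<open>c n\<close> to grow.\<close>

locale attracted = prob_space \<mu> for \<mu> :: "'a::euclidean_space measure" +
  fixes c :: "nat \<Rightarrow> real" and d :: "nat \<Rightarrow> 'a" and a :: 'a and M :: "'a measure"
  assumes sets_mu: "sets \<mu> = sets borel"
    and c_pos: "\<And>n. 0 < c n"
    and levy: "levy_measure M"
    and M_nonzero: "emeasure M UNIV \<noteq> 0"
    and char_limit: "\<And>u. (\<lambda>n. (CLINT x|\<mu>. iexp (u \<bullet> (x /\<^sub>R c n))) ^ n * iexp (- (u \<bullet> d n)))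
      \<longlonglongrightarrow> exp (levy_exponent a (\<lambda>_. 0) M u)"
begin

lemma sets_M: "sets M = sets borel"
  using levy by (simp add: levy_measure_def)

lemma space_mu: "space \<mu> = UNIV"
  using sets_eq_imp_space_eq[OF sets_mu] by simp

lemma measurable_mu [simp]: "measurable \<mu> N = measurable borel N"
  by (rule measurable_cong_sets[OF sets_mu refl])

abbreviation PP :: "('a \<times> 'a) measure"
  where "PP \<equiv> \<mu> \<Otimes>\<^sub>M \<mu>"

definition \<phi> :: "nat \<Rightarrow> 'a \<Rightarrow> complex"
  where "\<phi> n u = (CLINT x|\<mu>. iexp (u \<bullet> (x /\<^sub>R c n)))"

lemma integrable_iexp_mu: "integrable \<mu> (\<lambda>x. iexp (u \<bullet> (x /\<^sub>R c n)))"
  by (intro integrable_bounded[where B=1]) (auto simp: norm_exp_i_times)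

lemma cmod_phi_power_tendsto:
  "(\<lambda>n. cmod (\<phi> n u) ^ n) \<longlonglongrightarrow> exp (- (LINT x|M. 1 - cos (u \<bullet> x)))"
proof -
  have "(\<lambda>n. \<phi> n u ^ n * iexp (- (u \<bullet> d n))) \<longlonglongrightarrow> exp (levy_exponent a (\<lambda>_. 0) M u)"
    unfolding \<phi>_def by (rule char_limit)
  from tendsto_norm[OF this] show ?thesis
    by (simp only: norm_mult norm_power norm_exp_i_times mult_1_right cmod_exp_levy_exponent[OF levy])
qed

text \<open>The squared modulus is the characteristic function of the difference of two independent
  copies, realised on the product space; it is real and free of any centering.\<close>

lemma one_minus_cmod_phi_square:
  "1 - (cmod (\<phi> n u))\<^sup>2 = (LINT z|PP. 1 - cos (u \<bullet> ((fst z - snd z) /\<^sub>R c n)))"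
proof -
  interpret pair_prob_space \<mu> \<mu> ..
  let ?f = "\<lambda>x. iexp (u \<bullet> (x /\<^sub>R c n))"
  have m[measurable]: "(\<lambda>x. x) \<in> borel_measurable \<mu>" by simp
  have int: "integrable (\<mu> \<Otimes>\<^sub>M \<mu>) (\<lambda>z. iexp (u \<bullet> ((fst z - snd z) /\<^sub>R c n)))"
    by (intro P.integrable_bounded[where B=1]) (auto simp: norm_exp_i_times)
  have "of_real ((cmod (\<phi> n u))\<^sup>2) = \<phi> n u * cnj (\<phi> n u)"
    by (rule complex_norm_square)
  also have "\<dots> = (CLINT x|\<mu>. ?f x) * (CLINT y|\<mu>. cnj (?f y))"
    by (simp add: \<phi>_def)
  also have "\<dots> = (CLINT x|\<mu>. CLINT y|\<mu>. ?f x * cnj (?f y))"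
    by simp
  also have "\<dots> = (CLINT x|\<mu>. CLINT y|\<mu>. iexp (u \<bullet> ((x - y) /\<^sub>R c n)))"
    by (simp add: exp_cnj exp_add[symmetric] algebra_simps inner_diff_right)
  also have "\<dots> = (CLINT z|PP. iexp (u \<bullet> ((fst z - snd z) /\<^sub>R c n)))"
    using integral_fst'[OF int] by simp
  finally have "(cmod (\<phi> n u))\<^sup>2 = Re (CLINT z|PP. iexp (u \<bullet> ((fst z - snd z) /\<^sub>R c n)))"
    by (metis Re_complex_of_real)
  also have "\<dots> = (LINT z|PP. cos (u \<bullet> ((fst z - snd z) /\<^sub>R c n)))"
    by (subst integral_Re[OF int, symmetric]) (simp only: Re_iexp)
  finally have "(cmod (\<phi> n u))\<^sup>2 = \<dots>" .
  moreover have "integrable (\<mu> \<Otimes>\<^sub>M \<mu>) (\<lambda>z. cos (u \<bullet> ((fst z - snd z) /\<^sub>R c n)))"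
    using integrable_Re[OF int] by (simp only: Re_iexp)
  ultimately show ?thesis
    by (simp add: P.prob_space)
qed

text \<open>Since 1 - t^2 \<le> - 2 ln t, n times the integral of 1 - cos is at most -2 ln of the
  n-th power of the modulus, whose limit is at most 4 times the truncated moment of M. The factor 20
  of the moment lemma makes 80.\<close>

lemma symmetrized_moment_bound:
  assumes e: "0 < e"
  shows "\<forall>\<^sub>F n in sequentially. real n * (LINT z|PP. min 1 ((u \<bullet> ((fst z - snd z) /\<^sub>R c n))\<^sup>2))
    \<le> 80 * truncated_moment M (norm u) + e"
proof -
  interpret pair_prob_space \<mu> \<mu> ..
  have m[measurable]: "(\<lambda>x. x) \<in> borel_measurable \<mu>" by simp
  define b where "b = 4 * truncated_moment M (norm u) + e / 20"
  have b: "0 < b" using truncated_moment_nonneg[of M "norm u"] e by (simp add: b_def add_nonneg_pos)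
  have "\<forall>\<^sub>F n in sequentially. real n * (LINT z|PP. min 1 ((u \<bullet> ((fst z - snd z) /\<^sub>R c n))\<^sup>2)) \<le> 20 * b"
  proof (rule eventually_scaled_truncated_moment_le)
    fix w :: real assume w: "0 \<le> w" "w \<le> 1"
    let ?R = "LINT x|M. 1 - cos (w * (u \<bullet> x))"
    have R: "?R \<le> 2 * truncated_moment M (norm u)"
      using w by (intro levy_measure_moment_inner_le levy) auto
    have lim: "(\<lambda>n. cmod (\<phi> n (w *\<^sub>R u)) ^ n) \<longlonglongrightarrow> exp (- ?R)"
      using cmod_phi_power_tendsto[of "w *\<^sub>R u"] by simp
    have "(\<lambda>n. - 2 * ln (cmod (\<phi> n (w *\<^sub>R u)) ^ n)) \<longlonglongrightarrow> - 2 * ln (exp (- ?R))"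
      by (intro tendsto_intros lim) simp
    moreover have "- 2 * ln (exp (- ?R)) < b"
      using R truncated_moment_nonneg[of M "norm u"] e by (simp add: b_def)
    ultimately have "\<forall>\<^sub>F n in sequentially. - 2 * ln (cmod (\<phi> n (w *\<^sub>R u)) ^ n) < b"
      by (rule order_tendstoD)
    moreover have "\<forall>\<^sub>F n in sequentially. 0 < cmod (\<phi> n (w *\<^sub>R u)) ^ n"
      using lim by (rule order_tendstoD) simp
    ultimately show "\<forall>\<^sub>F n in sequentially.
        real n * (LINT z|PP. 1 - cos (w * (u \<bullet> ((fst z - snd z) /\<^sub>R c n)))) \<le> b"
      using eventually_gt_at_top[of 0]
    proof eventually_elim
      case (elim n)
      define t where "t = cmod (\<phi> n (w *\<^sub>R u))"
      have t: "0 < t" using elim(2,3) by (simp add: t_def zero_less_power_eq)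
           (metis norm_eq_zero power_eq_0_iff zero_less_norm_iff less_irrefl)
      have "1 - t\<^sup>2 \<le> - ln (t\<^sup>2)"
        using ln_le_minus_one[of "t\<^sup>2"] t by simp
      then have "real n * (1 - t\<^sup>2) \<le> real n * (- ln (t\<^sup>2))" by (intro mult_left_mono) auto
      also have "\<dots> = - 2 * ln (t ^ n)" using t by (simp add: ln_realpow)
      finally have "real n * (1 - t\<^sup>2) \<le> b" using elim(1) by (simp add: t_def)
      then show ?case unfolding t_def one_minus_cmod_phi_square by (simp add: mult.left_commute)
    qed
  qed (use b in \<open>auto intro: P.finite_measure_axioms\<close>)
  then show ?thesis by (simp add: b_def)
qed

text \<open>If every u annihilated the difference of two copies almost surely, all characteristic
  functions would have modulus 1, and \<open>levy_measure_trivial\<close> would give M = 0.\<close>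

lemma nondegenerate_direction:
  obtains u where "\<And>r. 0 < r \<Longrightarrow> 0 < (LINT z|PP. min 1 ((r * (u \<bullet> (fst z - snd z)))\<^sup>2))"
proof -
  interpret pair_prob_space \<mu> \<mu> ..
  have m[measurable]: "(\<lambda>x. x) \<in> borel_measurable \<mu>" by simp
  have int: "integrable (\<mu> \<Otimes>\<^sub>M \<mu>) (\<lambda>z. min 1 ((r * (u \<bullet> (fst z - snd z)))\<^sup>2))" for r u
    by (intro P.integrable_bounded[where B=1]) auto
  have "\<exists>u. \<not> (AE z in PP. u \<bullet> (fst z - snd z) = 0)"
  proof (rule ccontr)
    assume "\<not> ?thesis"
    then have ae: "AE z in PP. u \<bullet> (fst z - snd z) = 0" for u by blast
    have "cmod (\<phi> n u) ^ n = 1" for n u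
    proof -
      have "1 - (cmod (\<phi> n u))\<^sup>2 = (LINT z|PP. 0)"
        unfolding one_minus_cmod_phi_square using ae[of u] by (intro integral_cong_AE) auto
      then have "(cmod (\<phi> n u))\<^sup>2 = 1" by simp
      then have "cmod (\<phi> n u) = 1" by (simp add: power2_eq_1_iff) (metis norm_ge_zero neg_0_le_iff_le not_one_le_zero)
      then show ?thesis by simp
    qed
    then have "exp (- (LINT x|M. 1 - cos (u \<bullet> x))) = 1" for u
      using cmod_phi_power_tendsto[of u] by (simp add: LIMSEQ_const_iff)
    then have "(LINT x|M. 1 - cos (u \<bullet> x)) = 0" for u by simp
    then show False using levy_measure_trivial[OF levy] M_nonzero by blast
  qed
  then obtain u where u: "\<not> (AE z in PP. u \<bullet> (fst z - snd z) = 0)" by blast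
  show thesis
  proof (rule that[of u])
    fix r :: real assume r: "0 < r"
    have "(LINT z|PP. min 1 ((r * (u \<bullet> (fst z - snd z)))\<^sup>2)) \<noteq> 0"
    proof
      assume "(LINT z|PP. min 1 ((r * (u \<bullet> (fst z - snd z)))\<^sup>2)) = 0"
      then have "AE z in PP. min 1 ((r * (u \<bullet> (fst z - snd z)))\<^sup>2) = 0"
        by (subst (asm) integral_nonneg_eq_0_iff_AE[OF int]) auto
      then have "AE z in PP. u \<bullet> (fst z - snd z) = 0"
        by eventually_elim (use r in \<open>auto simp: min_def split: if_splits\<close>)
      then show False using u by simp
    qed
    moreover have "0 \<le> (LINT z|PP. min 1 ((r * (u \<bullet> (fst z - snd z)))\<^sup>2))"
      by (intro integral_nonneg_AE) simp
    ultimately show "0 < (LINT z|PP. min 1 ((r * (u \<bullet> (fst z - snd z)))\<^sup>2))"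
      by (metis less_le)
  qed
qed

text \<open>If \<open>c n < K0\<close> infinitely often, the symmetrized truncated moment stays
  above a fixed k > 0 along these n, so n times it is unbounded, against
  \<open>symmetrized_moment_bound\<close>.\<close>

lemma c_at_top: "filterlim c at_top sequentially"
proof (rule ccontr)
  interpret pair_prob_space \<mu> \<mu> ..
  have m[measurable]: "(\<lambda>x. x) \<in> borel_measurable \<mu>" by simp
  obtain u where u: "\<And>r. 0 < r \<Longrightarrow> 0 < (LINT z|PP. min 1 ((r * (u \<bullet> (fst z - snd z)))\<^sup>2))"
    using nondegenerate_direction by blast
  assume "\<not> ?thesis"
  then obtain K0 where "\<not> (\<forall>\<^sub>F n in sequentially. K0 \<le> c n)" by (auto simp: filterlim_at_top)
  then have freq: "\<exists>\<^sub>F n in sequentially. c n < K0" by (simp add: frequently_def not_less)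
  define K where "K = max K0 1"
  define k where "k = (LINT z|PP. min 1 (((1/K) * (u \<bullet> (fst z - snd z)))\<^sup>2))"
  have k: "0 < k" unfolding k_def by (rule u) (simp add: K_def)
  define B where "B = 80 * truncated_moment M (norm u) + 1"
  have "\<forall>\<^sub>F n in sequentially. B / k < real n"
    using filterlim_real_sequentially by (simp add: filterlim_at_top_dense)
  then have "\<forall>\<^sub>F n in sequentially. \<not> (c n < K0)"
    using symmetrized_moment_bound[of 1 u, OF zero_less_one]
  proof eventually_elim
    case (elim n)
    show ?case
    proof
      assume cn: "c n < K0"
      have "k \<le> (LINT z|PP. min 1 ((u \<bullet> ((fst z - snd z) /\<^sub>R c n))\<^sup>2))"
        unfolding k_def
      proof (rule integral_mono)
        fix z :: "'a \<times> 'a"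
        have "\<bar>(1/K) * (u \<bullet> (fst z - snd z))\<bar> \<le> \<bar>u \<bullet> ((fst z - snd z) /\<^sub>R c n)\<bar>"
          using cn c_pos[of n] by (auto simp: abs_mult K_def divide_inverse intro!: mult_right_mono)
        then have "((1/K) * (u \<bullet> (fst z - snd z)))\<^sup>2 \<le> (u \<bullet> ((fst z - snd z) /\<^sub>R c n))\<^sup>2"
          unfolding abs_le_square_iff .
        then show "min 1 (((1/K) * (u \<bullet> (fst z - snd z)))\<^sup>2) \<le> min 1 ((u \<bullet> ((fst z - snd z) /\<^sub>R c n))\<^sup>2)"
          by auto
      qed (auto intro!: P.integrable_bounded[where B=1])
      then have "real n * k \<le> B"
        using elim(2) unfolding B_def by (meson mult_left_mono of_nat_0_le_iff order_trans)
      then show False using elim(1) k by (simp add: field_simps)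
    qed
  qed
  then show False using freq by (simp add: frequently_def)
qed

text \<open>In a nondegenerate direction the truncated moment at inverse scale h / c n is at least
  (h / c n)^2 k, whereas n times it is eventually at most a small fraction of h^2. This is the
  strict improvement over normings of order sqrt n that absence of a Gaussian part provides.\<close>

lemma n_over_c_square_tendsto: "(\<lambda>n. real n / (c n)\<^sup>2) \<longlonglongrightarrow> 0"
proof -
  interpret pair_prob_space \<mu> \<mu> ..
  have m[measurable]: "(\<lambda>x. x) \<in> borel_measurable \<mu>" by simp
  obtain u where u: "\<And>r. 0 < r \<Longrightarrow> 0 < (LINT z|PP. min 1 ((r * (u \<bullet> (fst z - snd z)))\<^sup>2))"
    using nondegenerate_direction by blast
  define k where "k = (LINT z|PP. min 1 ((u \<bullet> (fst z - snd z))\<^sup>2))"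
  have k: "0 < k" using u[of 1] by (simp add: k_def)
  have "u \<noteq> 0" using k by (auto simp: k_def)
  show ?thesis
  proof (rule order_tendstoI)
    fix e :: real assume e: "0 < e"
    \<comment> \<open>320 = 4 * 80: with h = 1 / (t |u|) the limiting term 80
      \<open>truncated_moment M\<close> (h |u|) falls below a quarter of e k h^2.\<close>
    define \<eta> where "\<eta> = e * k / (320 * (norm u)\<^sup>2)"
    have "0 < \<eta>" using e k \<open>u \<noteq> 0\<close> by (simp add: \<eta>_def)
    then have "\<forall>\<^sub>F t in at_right 0. t\<^sup>2 * truncated_moment M (1 / t) < \<eta>"
      by (rule order_tendstoD[OF truncated_moment_subquadratic[OF levy]])
    moreover have "\<forall>\<^sub>F t in at_right (0::real). 0 < t" by (simp add: eventually_at_filter)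
    ultimately have "\<forall>\<^sub>F t in at_right 0. 0 < t \<and> t\<^sup>2 * truncated_moment M (1 / t) < \<eta>"
      by eventually_elim auto
    from eventually_happens[OF this] obtain t where t: "0 < t" "t\<^sup>2 * truncated_moment M (1 / t) < \<eta>"
      by auto
    define h where "h = 1 / (t * norm u)"
    have h: "0 < h" using t \<open>u \<noteq> 0\<close> by (simp add: h_def)
    have hu: "norm (h *\<^sub>R u) = 1 / t" using h t \<open>u \<noteq> 0\<close> by (simp add: h_def)
    have small: "80 * truncated_moment M (norm (h *\<^sub>R u)) < e * k * h\<^sup>2 / 4"
    proof -
      have "truncated_moment M (1 / t) < \<eta> / t\<^sup>2"
        using t by (subst pos_less_divide_eq) (auto simp: mult.commute)
      also have "\<eta> / t\<^sup>2 = e * k * h\<^sup>2 / 320"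
        by (simp add: \<eta>_def h_def power_mult_distrib power_divide)
      finally show ?thesis unfolding hu by simp
    qed
    have "\<forall>\<^sub>F n in sequentially. h \<le> c n"
      using c_at_top by (simp add: filterlim_at_top)
    moreover have "\<forall>\<^sub>F n in sequentially. real n * (LINT z|PP. min 1 (((h *\<^sub>R u) \<bullet> ((fst z - snd z) /\<^sub>R c n))\<^sup>2))
        \<le> 80 * truncated_moment M (norm (h *\<^sub>R u)) + e * k * h\<^sup>2 / 4"
      using e k h by (intro symmetrized_moment_bound) auto
    ultimately show "\<forall>\<^sub>F n in sequentially. real n / (c n)\<^sup>2 < e"
    proof eventually_elim
      case (elim n)
      have "(h / c n)\<^sup>2 * k = (LINT z|PP. (h / c n)\<^sup>2 * min 1 ((u \<bullet> (fst z - snd z))\<^sup>2))"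
        by (simp add: k_def)
      also have "\<dots> \<le> (LINT z|PP. min 1 (((h *\<^sub>R u) \<bullet> ((fst z - snd z) /\<^sub>R c n))\<^sup>2))"
      proof (rule integral_mono)
        fix z :: "'a \<times> 'a"
        have "((h *\<^sub>R u) \<bullet> ((fst z - snd z) /\<^sub>R c n))\<^sup>2 = (h / c n)\<^sup>2 * (u \<bullet> (fst z - snd z))\<^sup>2"
          by (simp add: power_mult_distrib power_divide power_inverse divide_inverse)
        moreover have "(h / c n)\<^sup>2 \<le> 1" using elim(1) h c_pos[of n] by (intro power_le_one) auto
        ultimately show "(h / c n)\<^sup>2 * min 1 ((u \<bullet> (fst z - snd z))\<^sup>2) \<le> min 1 (((h *\<^sub>R u) \<bullet> ((fst z - snd z) /\<^sub>R c n))\<^sup>2)"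
          by (simp only: mult_min_one_le zero_le_power2)
      qed (auto intro!: P.integrable_bounded[where B=1] integrable_mult_right)
      finally have "real n * ((h / c n)\<^sup>2 * k) < e * k * h\<^sup>2"
      proof -
        assume "(h / c n)\<^sup>2 * k \<le> (LINT z|PP. min 1 (((h *\<^sub>R u) \<bullet> ((fst z - snd z) /\<^sub>R c n))\<^sup>2))"
        then have "real n * ((h / c n)\<^sup>2 * k) \<le> real n * (LINT z|PP. min 1 (((h *\<^sub>R u) \<bullet> ((fst z - snd z) /\<^sub>R c n))\<^sup>2))"
          by (intro mult_left_mono) auto
        also note elim(2)
        also have "80 * truncated_moment M (norm (h *\<^sub>R u)) + e * k * h\<^sup>2 / 4 < e * k * h\<^sup>2"
          using small mult_pos_pos[OF mult_pos_pos[OF e k] zero_less_power[OF h, of 2]] by linarith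
        finally show ?thesis .
      qed
      then have "(real n / (c n)\<^sup>2) * (h\<^sup>2 * k) < e * (h\<^sup>2 * k)"
        by (simp add: power_divide algebra_simps)
      then show ?case by (rule mult_right_less_imp_less) (use h k in auto)
    qed
  next
    show "\<forall>\<^sub>F n in sequentially. e < real n / (c n)\<^sup>2" if "e < 0" for e
      using that by (auto intro!: always_eventually less_le_trans[OF that])
  qed
qed

text \<open>Desymmetrization. The second copy is confined to a ball of mass above 1/2; there X is
  the difference plus a vector of norm at most k, whose rescaled contribution of order n / c n^2
  vanishes. The losses, a factor 2 from the mass and a factor 2 from squaring a sum, give 320 = 4 *
  80.\<close>

lemma moment_bound_inner:
  assumes e: "0 < e"
  shows "\<forall>\<^sub>F n in sequentially. real n * (LINT x|\<mu>. min 1 ((u \<bullet> (x /\<^sub>R c n))\<^sup>2))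
    \<le> 320 * truncated_moment M (norm u) + e"
proof -
  define S where "S k = {x::'a. norm x \<le> real k}" for k
  have S[measurable]: "S k \<in> sets \<mu>" for k unfolding S_def sets_mu by measurable
  have "(\<lambda>k. measure \<mu> (S k)) \<longlonglongrightarrow> measure \<mu> (\<Union>k. S k)"
  proof (rule finite_Lim_measure_incseq)
    show "range S \<subseteq> sets \<mu>" using S by auto
  qed (auto simp: S_def incseq_def)
  moreover have "(\<Union>k. S k) = space \<mu>"
    by (auto simp: S_def space_mu real_arch_simple)
  ultimately have "(\<lambda>k. measure \<mu> (S k)) \<longlonglongrightarrow> 1" by (simp add: prob_space)
  then have "\<forall>\<^sub>F k in sequentially. 1/2 < measure \<mu> (S k)" by (rule order_tendstoD) simp
  from eventually_happens[OF this] obtain k where k: "1/2 < measure \<mu> (S k)" by auto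
  interpret pair_prob_space \<mu> \<mu> ..
  have m[measurable]: "(\<lambda>x. x) \<in> borel_measurable \<mu>" by simp
  have half: "(LINT x|\<mu>. min 1 ((u \<bullet> (x /\<^sub>R c n))\<^sup>2)) / 2
      \<le> 2 * (LINT z|PP. min 1 ((u \<bullet> ((fst z - snd z) /\<^sub>R c n))\<^sup>2)) + 2 * (norm u * real k)\<^sup>2 / (c n)\<^sup>2" for n
  proof -
    let ?f = "\<lambda>x. min 1 ((u \<bullet> (x /\<^sub>R c n))\<^sup>2)"
    let ?g = "\<lambda>z. min 1 ((u \<bullet> ((fst z - snd z) /\<^sub>R c n))\<^sup>2)"
    have int1: "integrable PP (\<lambda>z. ?f (fst z) * indicator (S k) (snd z))"
      by (intro P.integrable_bounded[where B=1]) (auto simp: indicator_def)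
    have int2: "integrable PP ?g" by (intro P.integrable_bounded[where B=1]) auto
    have "(LINT x|\<mu>. ?f x) / 2 \<le> (LINT x|\<mu>. ?f x) * measure \<mu> (S k)"
      using k mult_left_mono[of "1/2" "measure \<mu> (S k)" "LINT x|\<mu>. ?f x"]
      by (simp add: integral_nonneg_AE)
    also have "\<dots> = (LINT x|\<mu>. LINT y|\<mu>. ?f x * indicator (S k) y)"
      by (simp add: space_mu)
    also have "\<dots> = (LINT z|PP. ?f (fst z) * indicator (S k) (snd z))"
      using integral_fst'[OF int1] by simp
    also have "\<dots> \<le> (LINT z|PP. 2 * ?g z + 2 * (norm u * real k)\<^sup>2 / (c n)\<^sup>2)"
    proof (rule integral_mono[OF int1])
      fix z :: "'a \<times> 'a"
      show "?f (fst z) * indicator (S k) (snd z) \<le> 2 * ?g z + 2 * (norm u * real k)\<^sup>2 / (c n)\<^sup>2"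
      proof (cases "snd z \<in> S k")
        case True
        let ?a = "u \<bullet> ((fst z - snd z) /\<^sub>R c n)" and ?b = "u \<bullet> (snd z /\<^sub>R c n)"
        have "u \<bullet> (fst z /\<^sub>R c n) = ?a + ?b" by (simp add: inner_diff_right algebra_simps)
        then have "?f (fst z) \<le> 2 * ?g z + 2 * ?b\<^sup>2" using min_one_sum_squares_le[of ?a ?b] by simp
        also have "?b\<^sup>2 \<le> (norm u * real k / c n)\<^sup>2"
        proof -
          have "\<bar>?b\<bar> \<le> norm u * norm (snd z /\<^sub>R c n)" by (rule Cauchy_Schwarz_ineq2)
          also have "\<dots> = norm u * norm (snd z) / c n" using c_pos[of n] by (simp add: divide_inverse)
          also have "\<dots> \<le> norm u * real k / c n"
            using True c_pos[of n] by (intro divide_right_mono mult_left_mono) (auto simp: S_def)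
          finally have "\<bar>?b\<bar>\<^sup>2 \<le> (norm u * real k / c n)\<^sup>2" by (intro power_mono) auto
          then show ?thesis by simp
        qed
        finally show ?thesis using True by (simp add: power_divide)
      qed auto
    qed (use int2 in auto)
    also have "\<dots> = 2 * (LINT z|PP. ?g z) + 2 * (norm u * real k)\<^sup>2 / (c n)\<^sup>2"
      using int2 by (simp add: P.prob_space)
    finally show ?thesis .
  qed
  have "(\<lambda>n. 4 * (norm u * real k)\<^sup>2 * (real n / (c n)\<^sup>2)) \<longlonglongrightarrow> 4 * (norm u * real k)\<^sup>2 * 0"
    by (intro tendsto_intros n_over_c_square_tendsto)
  then have "\<forall>\<^sub>F n in sequentially. 4 * (norm u * real k)\<^sup>2 * (real n / (c n)\<^sup>2) < e / 2"
    using e by (intro order_tendstoD) auto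
  moreover have "\<forall>\<^sub>F n in sequentially. real n * (LINT z|PP. min 1 ((u \<bullet> ((fst z - snd z) /\<^sub>R c n))\<^sup>2))
    \<le> 80 * truncated_moment M (norm u) + e / 8" using e by (intro symmetrized_moment_bound) auto
  ultimately show ?thesis
  proof eventually_elim
    case (elim n)
    have "real n * (LINT x|\<mu>. min 1 ((u \<bullet> (x /\<^sub>R c n))\<^sup>2))
      = real n * ((LINT x|\<mu>. min 1 ((u \<bullet> (x /\<^sub>R c n))\<^sup>2)) / 2) * 2" by simp
    also have "\<dots> \<le> real n * (2 * (LINT z|PP. min 1 ((u \<bullet> ((fst z - snd z) /\<^sub>R c n))\<^sup>2))
         + 2 * (norm u * real k)\<^sup>2 / (c n)\<^sup>2) * 2"
      using half[of n] by (intro mult_right_mono mult_left_mono) auto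
    also have "\<dots> = 4 * (real n * (LINT z|PP. min 1 ((u \<bullet> ((fst z - snd z) /\<^sub>R c n))\<^sup>2)))
         + 4 * (norm u * real k)\<^sup>2 * (real n / (c n)\<^sup>2)"
      by (simp add: algebra_simps)
    also have "\<dots> \<le> 4 * (80 * truncated_moment M (norm u) + e / 8) + e / 2"
      using elim by (intro add_mono mult_left_mono) auto
    finally show ?case by simp
  qed
qed

text \<open>The counterpart of \<open>truncated_moment\<close> for n times the law of x / c n under
  \<mu>.\<close>

definition pmom :: "nat \<Rightarrow> real \<Rightarrow> real"
  where "pmom n h = real n * (LINT x|\<mu>. min 1 ((h * norm (x /\<^sub>R c n))\<^sup>2))"

text \<open>The constant of \<open>moment_bound_inner\<close>, once for each coordinate
  direction.\<close>

definition KD :: real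
  where "KD = 320 * real DIM('a)"

lemma KD_ge: "320 \<le> KD"
  unfolding KD_def by (simp add: Suc_leI)

lemma moment_bound:
  assumes h: "0 < h" and e: "0 < e"
  shows "\<forall>\<^sub>F n in sequentially. pmom n h \<le> KD * truncated_moment M h + e"
proof -
  have "\<forall>\<^sub>F n in sequentially. \<forall>b\<in>Basis. real n * (LINT x|\<mu>. min 1 (((h *\<^sub>R b) \<bullet> (x /\<^sub>R c n))\<^sup>2))
    \<le> 320 * truncated_moment M (norm (h *\<^sub>R b :: 'a)) + e / real DIM('a)"
    using e by (intro eventually_ball_finite finite_Basis ballI moment_bound_inner) auto
  then show ?thesis
  proof eventually_elim
    case (elim n)
    have int: "integrable \<mu> (\<lambda>x. min 1 (((h *\<^sub>R b) \<bullet> (x /\<^sub>R c n))\<^sup>2))" for b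
      by (intro integrable_bounded[where B=1]) auto
    have "(LINT x|\<mu>. min 1 ((h * norm (x /\<^sub>R c n))\<^sup>2)) \<le> (LINT x|\<mu>. (\<Sum>b\<in>Basis. min 1 (((h *\<^sub>R b) \<bullet> (x /\<^sub>R c n))\<^sup>2)))"
    proof (rule integral_mono)
      fix x :: 'a
      define y where "y = x /\<^sub>R c n"
      have "(norm y)\<^sup>2 = (\<Sum>b\<in>Basis. (y \<bullet> b)\<^sup>2)"
        unfolding power2_norm_eq_inner by (subst euclidean_inner) (simp add: power2_eq_square)
      then have "(h * norm y)\<^sup>2 = h\<^sup>2 * (\<Sum>b\<in>Basis. (y \<bullet> b)\<^sup>2)"
        by (simp add: power_mult_distrib)
      also have "\<dots> = (\<Sum>b\<in>Basis. ((h *\<^sub>R b) \<bullet> y)\<^sup>2)"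
        by (simp add: power_mult_distrib sum_distrib_left inner_commute)
      finally show "min 1 ((h * norm (x /\<^sub>R c n))\<^sup>2) \<le> (\<Sum>b\<in>Basis. min 1 (((h *\<^sub>R b) \<bullet> (x /\<^sub>R c n))\<^sup>2))"
        unfolding y_def[symmetric] by (simp only:) (intro min_one_sum_le, auto)
    qed (auto intro!: integrable_bounded[where B=1] Bochner_Integration.integrable_sum)
    also have "\<dots> = (\<Sum>b\<in>Basis. (LINT x|\<mu>. min 1 (((h *\<^sub>R b) \<bullet> (x /\<^sub>R c n))\<^sup>2)))"
      using int by (rule Bochner_Integration.integral_sum)
    finally have "pmom n h \<le> real n * (\<Sum>b\<in>Basis. (LINT x|\<mu>. min 1 (((h *\<^sub>R b) \<bullet> (x /\<^sub>R c n))\<^sup>2)))"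
      unfolding pmom_def by (intro mult_left_mono) auto
    also have "\<dots> = (\<Sum>b\<in>Basis. real n * (LINT x|\<mu>. min 1 (((h *\<^sub>R b) \<bullet> (x /\<^sub>R c n))\<^sup>2)))"
      by (rule sum_distrib_left)
    also have "\<dots> \<le> (\<Sum>b\<in>(Basis::'a set). 320 * truncated_moment M (norm (h *\<^sub>R b :: 'a)) + e / real DIM('a))"
      using elim by (intro sum_mono) auto
    also have "\<dots> = (\<Sum>b\<in>(Basis::'a set). 320 * truncated_moment M h + e / real DIM('a))"
      using h by (intro sum.cong) auto
    also have "\<dots> = KD * truncated_moment M h + e"
      by (simp add: KD_def distrib_left)
    finally show ?case .
  qed
qed

text \<open>A truncated first moment without the factor n. It controls how much the characteristic
  function changes when its argument moves by a vector of length h.\<close>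

definition smom :: "nat \<Rightarrow> real \<Rightarrow> real"
  where "smom n h = (LINT x|\<mu>. min 1 (h * norm (x /\<^sub>R c n)))"

lemma smom_nonneg: "0 \<le> h \<Longrightarrow> 0 \<le> smom n h"
  unfolding smom_def by (intro integral_nonneg_AE) simp

text \<open>Split according to \<open>\<parallel>x\<parallel> \<le> \<delta>\<close>: the square of the first moment of the small part is at most
  the second moment, and the large part has a mean of order \<open>1 / n\<close>.\<close>

lemma smom_square_tendsto:
  assumes h: "0 < h"
  shows "(\<lambda>n. real n * (smom n h)\<^sup>2) \<longlonglongrightarrow> 0"
proof (rule order_tendstoI)
  fix e :: real assume e: "0 < e"
  \<comment> \<open>Chosen so that 2 h^2 KD \<eta> = e / 4. The slack in B contributes another e /
    4, which leaves e / 2 for the large part.\<close>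
  define \<eta> where "\<eta> = e / (8 * h\<^sup>2 * KD)"
  have \<eta>: "0 < \<eta>" using e h KD_ge by (simp add: \<eta>_def)
  then have "\<forall>\<^sub>F t in at_right 0. t\<^sup>2 * truncated_moment M (1 / t) < \<eta>"
    by (rule order_tendstoD[OF truncated_moment_subquadratic[OF levy]])
  moreover have "\<forall>\<^sub>F t in at_right (0::real). 0 < t" by (simp add: eventually_at_filter)
  ultimately have "\<forall>\<^sub>F t in at_right 0. 0 < t \<and> t\<^sup>2 * truncated_moment M (1 / t) < \<eta>"
    by eventually_elim auto
  from eventually_happens[OF this] obtain t where t: "0 < t" "t\<^sup>2 * truncated_moment M (1 / t) < \<eta>"
    by auto
  define B where "B = KD * truncated_moment M (1 / t) + e / (8 * h\<^sup>2 * t\<^sup>2)"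
  have B: "2 * h\<^sup>2 * t\<^sup>2 * B < e / 2"
  proof -
    have "2 * h\<^sup>2 * t\<^sup>2 * B = 2 * h\<^sup>2 * KD * (t\<^sup>2 * truncated_moment M (1 / t)) + e / 4"
      using h t by (simp add: B_def field_simps)
    also have "\<dots> < 2 * h\<^sup>2 * KD * \<eta> + e / 4"
      using t h KD_ge by (intro add_strict_right_mono mult_strict_left_mono) auto
    also have "2 * h\<^sup>2 * KD * \<eta> = e / 4" using h KD_ge by (simp add: \<eta>_def)
    finally show ?thesis by simp
  qed
  have "\<forall>\<^sub>F n in sequentially. pmom n (1 / t) \<le> B"
    unfolding B_def using t h e by (intro moment_bound) auto
  moreover have "(\<lambda>n. 2 * B\<^sup>2 / real n) \<longlonglongrightarrow> 0" by (rule lim_const_over_n)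
  then have "\<forall>\<^sub>F n in sequentially. 2 * B\<^sup>2 / real n < e / 2" using e by (intro order_tendstoD) auto
  ultimately show "\<forall>\<^sub>F n in sequentially. real n * (smom n h)\<^sup>2 < e"
    using eventually_gt_at_top[of 0]
  proof eventually_elim
    case (elim n)
    define P where "P = (LINT x|\<mu>. min 1 ((1 / t * norm (x /\<^sub>R c n))\<^sup>2))"
    have nP: "real n * P \<le> B" "0 \<le> P"
      using elim(1) by (auto simp: P_def pmom_def integral_nonneg_AE)
    define s where "s x = min (norm (x /\<^sub>R c n)) t" for x :: 'a
    have [measurable]: "s \<in> borel_measurable borel" unfolding s_def by measurable
    have s: "0 \<le> s x" "s x \<le> t" for x using t by (auto simp: s_def)
    have ints: "integrable \<mu> s" using s t by (intro integrable_bounded[where B=t]) auto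
    have ints2: "integrable \<mu> (\<lambda>x. (s x)\<^sup>2)"
      using s t by (intro integrable_bounded[where B="t\<^sup>2"]) (auto intro: power_mono)
    have int1: "integrable \<mu> (\<lambda>x. min 1 ((1 / t * norm (x /\<^sub>R c n))\<^sup>2))"
      by (intro integrable_bounded[where B=1]) auto
    have "(LINT x|\<mu>. s x)\<^sup>2 \<le> (LINT x|\<mu>. (s x)\<^sup>2)"
      using jensens_inequality[where q = "\<lambda>x. x\<^sup>2" and X = s and I = UNIV] ints ints2 convex_power2
      by (auto intro: convex_power2)
    also have "(LINT x|\<mu>. (s x)\<^sup>2) = (LINT x|\<mu>. t\<^sup>2 * min 1 ((1 / t * norm (x /\<^sub>R c n))\<^sup>2))"
    proof (intro Bochner_Integration.integral_cong refl)
      fix x :: 'a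
      define z where "z = norm (x /\<^sub>R c n)"
      have z: "0 \<le> z" by (simp add: z_def)
      have "(min z t)\<^sup>2 = t\<^sup>2 * min 1 ((1 / t * z)\<^sup>2)"
      proof (cases "z \<le> t")
        case True
        then have "z\<^sup>2 \<le> t\<^sup>2" using z by (intro power_mono) auto
        then show ?thesis using True t by (simp add: power_divide min_def)
      next
        case False
        then have "t\<^sup>2 \<le> z\<^sup>2" using t by (intro power_mono) auto
        then show ?thesis using False t by (simp add: power_divide min_def)
      qed
      then show "(s x)\<^sup>2 = t\<^sup>2 * min 1 ((1 / t * norm (x /\<^sub>R c n))\<^sup>2)" by (simp only: s_def z_def)
    qed
    finally have s2: "(LINT x|\<mu>. s x)\<^sup>2 \<le> t\<^sup>2 * P" by (simp add: P_def)
    have "smom n h \<le> (LINT x|\<mu>. h * s x + min 1 ((1 / t * norm (x /\<^sub>R c n))\<^sup>2))"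
      unfolding smom_def
    proof (rule integral_mono)
      fix x :: 'a
      define z where "z = norm (x /\<^sub>R c n)"
      have z: "0 \<le> z" by (simp add: z_def)
      have "min 1 (h * z) \<le> h * min z t + min 1 ((1 / t * z)\<^sup>2)"
      proof (cases "z \<le> t")
        case True
        then show ?thesis by (auto simp: min_def intro: add_increasing2)
      next
        case False
        then have "t\<^sup>2 \<le> z\<^sup>2" using t by (intro power_mono) auto
        then have "min 1 ((1 / t * z)\<^sup>2) = 1" using t by (simp add: power_divide)
        then show ?thesis using t h z by (auto simp: min_def intro: add_increasing)
      qed
      then show "min 1 (h * norm (x /\<^sub>R c n)) \<le> h * s x + min 1 ((1 / t * norm (x /\<^sub>R c n))\<^sup>2)"
        by (simp only: s_def z_def)
    qed (use ints int1 h in \<open>auto intro!: integrable_bounded[where B=1]\<close>)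
    also have "\<dots> = h * (LINT x|\<mu>. s x) + P"
      using ints int1 by (simp add: P_def)
    finally have "(smom n h)\<^sup>2 \<le> (h * (LINT x|\<mu>. s x) + P)\<^sup>2"
      using smom_nonneg[of h n] h by (intro power_mono) auto
    also have "\<dots> \<le> 2 * h\<^sup>2 * (LINT x|\<mu>. s x)\<^sup>2 + 2 * P\<^sup>2"
      using zero_le_power2[of "h * (LINT x|\<mu>. s x) - P"] by (simp add: power2_eq_square algebra_simps)
    also have "\<dots> \<le> 2 * h\<^sup>2 * (t\<^sup>2 * P) + 2 * P\<^sup>2" using s2 by (intro add_mono mult_left_mono) auto
    finally have "real n * (smom n h)\<^sup>2 \<le> real n * (2 * h\<^sup>2 * (t\<^sup>2 * P) + 2 * P\<^sup>2)"
      by (intro mult_left_mono) auto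
    also have "\<dots> = 2 * h\<^sup>2 * t\<^sup>2 * (real n * P) + 2 * (real n * P)\<^sup>2 / real n"
      using elim(3) by (simp add: power2_eq_square algebra_simps)
    also have "\<dots> \<le> 2 * h\<^sup>2 * t\<^sup>2 * B + 2 * B\<^sup>2 / real n"
      using nP by (intro add_mono mult_left_mono divide_right_mono power_mono) auto
    finally show ?case using B elim(2) by linarith
  qed
next
  show "\<forall>\<^sub>F n in sequentially. e < real n * (smom n h)\<^sup>2" if "e < 0" for e
    using that by (auto intro!: always_eventually less_le_trans[OF that])
qed

lemma smom_tendsto:
  assumes h: "0 < h"
  shows "(\<lambda>n. smom n h) \<longlonglongrightarrow> 0"
proof (rule Lim_null_comparison)
  show "(\<lambda>n. sqrt (real n * (smom n h)\<^sup>2)) \<longlonglongrightarrow> 0"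
    using tendsto_real_sqrt[OF smom_square_tendsto[OF h]] by simp
  show "\<forall>\<^sub>F n in sequentially. norm (smom n h) \<le> sqrt (real n * (smom n h)\<^sup>2)"
    using eventually_ge_at_top[of 1]
  proof eventually_elim
    case (elim n)
    have "(smom n h)\<^sup>2 \<le> real n * (smom n h)\<^sup>2" using elim by (simp add: mult_le_cancel_right1)
    then have "sqrt ((smom n h)\<^sup>2) \<le> sqrt (real n * (smom n h)\<^sup>2)" by (rule real_sqrt_le_mono)
    then show ?case by simp
  qed
qed

lemma cmod_phi_diff_le: "cmod (\<phi> n (u + w) - \<phi> n u) \<le> 2 * smom n (norm w)"
proof -
  have "\<phi> n (u + w) - \<phi> n u = (CLINT x|\<mu>. iexp (u \<bullet> (x /\<^sub>R c n)) * (iexp (w \<bullet> (x /\<^sub>R c n)) - 1))"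
    unfolding \<phi>_def
    by (subst Bochner_Integration.integral_diff[symmetric])
       (simp_all only: integrable_iexp_mu, simp add: inner_add_left exp_add algebra_simps)
  also have "cmod \<dots> \<le> (LINT x|\<mu>. cmod (iexp (u \<bullet> (x /\<^sub>R c n)) * (iexp (w \<bullet> (x /\<^sub>R c n)) - 1)))"
    by (rule integral_norm_bound)
  also have "\<dots> \<le> (LINT x|\<mu>. 2 * min 1 (norm w * norm (x /\<^sub>R c n)))"
  proof (rule integral_mono)
    fix x :: 'a
    have "cmod (iexp (u \<bullet> (x /\<^sub>R c n)) * (iexp (w \<bullet> (x /\<^sub>R c n)) - 1)) = cmod (iexp (w \<bullet> (x /\<^sub>R c n)) - 1)"
      by (simp only: norm_mult norm_exp_i_times mult_1_left)
    also have "\<dots> \<le> 2 * min 1 \<bar>w \<bullet> (x /\<^sub>R c n)\<bar>" by (rule cmod_iexp_minus_one_le)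
    also have "\<dots> \<le> 2 * min 1 (norm w * norm (x /\<^sub>R c n))"
      using Cauchy_Schwarz_ineq2[of w "x /\<^sub>R c n"] by (auto simp: min_def)
    finally show "cmod (iexp (u \<bullet> (x /\<^sub>R c n)) * (iexp (w \<bullet> (x /\<^sub>R c n)) - 1)) \<le> 2 * min 1 (norm w * norm (x /\<^sub>R c n))" .
  next
    show "integrable \<mu> (\<lambda>x. cmod (iexp (u \<bullet> (x /\<^sub>R c n)) * (iexp (w \<bullet> (x /\<^sub>R c n)) - 1)))"
    proof (rule integrable_bounded[where B=2])
      fix x :: 'a
      show "norm (cmod (iexp (u \<bullet> (x /\<^sub>R c n)) * (iexp (w \<bullet> (x /\<^sub>R c n)) - 1))) \<le> 2"
        using cmod_iexp_minus_one_le[of "w \<bullet> (x /\<^sub>R c n)"]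
        by (simp only: norm_mult norm_exp_i_times mult_1_left real_norm_def abs_norm_cancel)
    qed simp
    show "integrable \<mu> (\<lambda>x. 2 * min 1 (norm w * norm (x /\<^sub>R c n)))"
      by (rule integrable_bounded[where B=2]) auto
  qed
  finally show ?thesis by (simp add: smom_def)
qed

end

section \<open>Second differences of characteristic functions and of Levy exponents\<close>

lemma integral_second_difference:
  fixes f g h :: "'b \<Rightarrow> complex"
  assumes "integrable M f" "integrable M g" "integrable M h"
  shows "(CLINT x|M. f x) + (CLINT x|M. g x) - 2 * (CLINT x|M. h x) = (CLINT x|M. f x + g x - 2 * h x)"
  using assms by simp

text \<open>The source of the weight 1 - cos t: it vanishes to second order at 0 and therefore turns
  Levy measures into finite measures.\<close>

lemma iexp_second_difference:
  "iexp (s + t) + iexp (s - t) - 2 * iexp s = - 2 * (iexp s * of_real (1 - cos t))"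
proof -
  have "iexp (s + t) = iexp s * iexp t" "iexp (s - t) = iexp s * iexp (- t)"
    by (simp_all add: exp_add[symmetric] algebra_simps)
  moreover have "iexp t + iexp (- t) = of_real (2 * cos t)"
    by (rule complex_eqI)
       (simp_all only: plus_complex.sel Re_iexp Im_iexp Re_complex_of_real Im_complex_of_real, simp_all)
  ultimately have "iexp (s + t) + iexp (s - t) - 2 * iexp s = iexp s * of_real (2 * cos t) - 2 * iexp s"
    by (simp only: distrib_left[symmetric])
  then show ?thesis by (simp only:) (simp add: algebra_simps)
qed

context attracted
begin

lemma phi_tendsto_1: "(\<lambda>n. \<phi> n u) \<longlonglongrightarrow> 1"
proof -
  have z: "\<phi> n 0 = 1" for n by (simp add: \<phi>_def prob_space)
  show ?thesis
  proof (cases "u = 0")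
    case False
    have "(\<lambda>n. \<phi> n u - 1) \<longlonglongrightarrow> 0"
    proof (rule Lim_null_comparison)
      show "\<forall>\<^sub>F n in sequentially. norm (\<phi> n u - 1) \<le> 2 * smom n (norm u)"
        using cmod_phi_diff_le[of _ 0 u] by (simp add: z)
      show "(\<lambda>n. 2 * smom n (norm u)) \<longlonglongrightarrow> 0"
        using tendsto_mult[OF tendsto_const smom_tendsto, of "norm u" 2] False by simp
    qed
    then show ?thesis by (simp add: LIM_zero_iff)
  qed (simp add: z)
qed

text \<open>Drift and compensator are linear in the argument and cancel in second
  differences.\<close>

lemma levy_exponent_second_difference:
  "levy_exponent a (\<lambda>_. 0) M (u + w) + levy_exponent a (\<lambda>_. 0) M (u - w) - 2 * levy_exponent a (\<lambda>_. 0) M u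
    = - 2 * (CLINT x|M. iexp (u \<bullet> x) * of_real (1 - cos (w \<bullet> x)))"
proof -
  let ?f = "\<lambda>u x. iexp (u \<bullet> x) - 1 - \<i> * of_real (u \<bullet> x) * indicator {x. norm x \<le> 1} x"
  note int = levy_exponent_eq(2)[OF levy]
  have "(CLINT x|M. ?f (u + w) x) + (CLINT x|M. ?f (u - w) x) - 2 * (CLINT x|M. ?f u x)
      = (CLINT x|M. ?f (u + w) x + ?f (u - w) x - 2 * ?f u x)"
    by (rule integral_second_difference[OF int int int])
  also have "\<dots> = (CLINT x|M. - 2 * (iexp (u \<bullet> x) * of_real (1 - cos (w \<bullet> x))))"
  proof (intro Bochner_Integration.integral_cong refl)
    fix x
    have "?f (u + w) x + ?f (u - w) x - 2 * ?f u x
        = iexp (u \<bullet> x + w \<bullet> x) + iexp (u \<bullet> x - w \<bullet> x) - 2 * iexp (u \<bullet> x)"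
      by (simp only: inner_add_left inner_diff_left of_real_add of_real_diff) (simp add: algebra_simps)
    also have "\<dots> = - 2 * (iexp (u \<bullet> x) * of_real (1 - cos (w \<bullet> x)))"
      by (rule iexp_second_difference)
    finally show "?f (u + w) x + ?f (u - w) x - 2 * ?f u x = - 2 * (iexp (u \<bullet> x) * of_real (1 - cos (w \<bullet> x)))" .
  qed
  also have "\<dots> = - 2 * (CLINT x|M. iexp (u \<bullet> x) * of_real (1 - cos (w \<bullet> x)))" by (rule integral_mult_right_zero)
  finally have *: "(CLINT x|M. ?f (u + w) x) + (CLINT x|M. ?f (u - w) x) - 2 * (CLINT x|M. ?f u x)
    = - 2 * (CLINT x|M. iexp (u \<bullet> x) * of_real (1 - cos (w \<bullet> x)))" .
  have lin: "\<i> * of_real ((u + w) \<bullet> a) + \<i> * of_real ((u - w) \<bullet> a) - 2 * (\<i> * of_real (u \<bullet> a)) = 0"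
    by (simp add: inner_add_left inner_diff_left algebra_simps)
  show ?thesis
    unfolding levy_exponent_eq(1)[OF levy] *[symmetric] using lin by (simp only: algebra_simps) algebra
qed

text \<open>The Fourier transform at u of n times the law of x / c n, weighted by 1 - cos (w
  \<bullet> x).\<close>

definition wint :: "nat \<Rightarrow> 'a \<Rightarrow> 'a \<Rightarrow> complex"
  where "wint n u w = of_nat n * (CLINT x|\<mu>. iexp (u \<bullet> (x /\<^sub>R c n)) * of_real (1 - cos (w \<bullet> (x /\<^sub>R c n))))"

lemma cmod_wint_le: "cmod (wint n u w) \<le> 2 * pmom n (norm w)"
proof -
  have "cmod (CLINT x|\<mu>. iexp (u \<bullet> (x /\<^sub>R c n)) * of_real (1 - cos (w \<bullet> (x /\<^sub>R c n))))
    \<le> (LINT x|\<mu>. cmod (iexp (u \<bullet> (x /\<^sub>R c n)) * of_real (1 - cos (w \<bullet> (x /\<^sub>R c n)))))"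
    by (rule integral_norm_bound)
  also have "\<dots> = (LINT x|\<mu>. 1 - cos (w \<bullet> (x /\<^sub>R c n)))"
    by (simp only: norm_mult norm_exp_i_times norm_of_real mult_1_left) simp
  also have "\<dots> \<le> (LINT x|\<mu>. 2 * min 1 ((norm w * norm (x /\<^sub>R c n))\<^sup>2))"
  proof (rule integral_mono)
    show "integrable \<mu> (\<lambda>x. 1 - cos (w \<bullet> (x /\<^sub>R c n)))"
      by (rule integrable_bounded[where B=2]) (auto simp: abs_le_iff one_minus_cos_le_two)
    show "integrable \<mu> (\<lambda>x. 2 * min 1 ((norm w * norm (x /\<^sub>R c n))\<^sup>2))"
      by (rule integrable_bounded[where B=2]) auto
    fix x :: 'a
    have "(w \<bullet> (x /\<^sub>R c n))\<^sup>2 \<le> (norm w * norm (x /\<^sub>R c n))\<^sup>2"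
      using Cauchy_Schwarz_ineq2[of w "x /\<^sub>R c n"] by (metis abs_ge_zero power2_abs power_mono)
    then have "min 1 ((w \<bullet> (x /\<^sub>R c n))\<^sup>2) \<le> min 1 ((norm w * norm (x /\<^sub>R c n))\<^sup>2)" by (intro min.mono) auto
    then show "1 - cos (w \<bullet> (x /\<^sub>R c n)) \<le> 2 * min 1 ((norm w * norm (x /\<^sub>R c n))\<^sup>2)"
      using one_minus_cos_le[of "w \<bullet> (x /\<^sub>R c n)"] by linarith
  qed
  finally have "cmod (CLINT x|\<mu>. iexp (u \<bullet> (x /\<^sub>R c n)) * of_real (1 - cos (w \<bullet> (x /\<^sub>R c n))))
    \<le> 2 * (LINT x|\<mu>. min 1 ((norm w * norm (x /\<^sub>R c n))\<^sup>2))" by simp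
  then have "real n * cmod (CLINT x|\<mu>. iexp (u \<bullet> (x /\<^sub>R c n)) * of_real (1 - cos (w \<bullet> (x /\<^sub>R c n))))
    \<le> real n * (2 * (LINT x|\<mu>. min 1 ((norm w * norm (x /\<^sub>R c n))\<^sup>2)))" by (rule mult_left_mono) simp
  then show ?thesis unfolding wint_def pmom_def norm_mult norm_of_nat by (simp only: mult.left_commute)
qed

lemma wint_eq: "\<phi> n (u + w) + \<phi> n (u - w) - 2 * \<phi> n u
    = - 2 * (CLINT x|\<mu>. iexp (u \<bullet> (x /\<^sub>R c n)) * of_real (1 - cos (w \<bullet> (x /\<^sub>R c n))))"
proof -
  have "\<phi> n (u + w) + \<phi> n (u - w) - 2 * \<phi> n u =
    (CLINT x|\<mu>. iexp ((u + w) \<bullet> (x /\<^sub>R c n)) + iexp ((u - w) \<bullet> (x /\<^sub>R c n)) - 2 * iexp (u \<bullet> (x /\<^sub>R c n)))"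
    unfolding \<phi>_def by (rule integral_second_difference) (rule integrable_iexp_mu)+
  also have "\<dots> = (CLINT x|\<mu>. - 2 * (iexp (u \<bullet> (x /\<^sub>R c n)) * of_real (1 - cos (w \<bullet> (x /\<^sub>R c n)))))"
    by (simp only: inner_add_left inner_diff_left iexp_second_difference)
  finally show ?thesis by (simp only: integral_mult_right_zero)
qed

text \<open>Second differences of the logarithm of the characteristic function are insensitive to the
  centering \<open>d n\<close>, and for small \<open>w\<close> they stay within the range in which the logarithm is
  single-valued.\<close>

lemma wint_tendsto:
  assumes w: "w \<noteq> 0" and small: "8 * KD * truncated_moment M (norm w) \<le> 1"
  shows "(\<lambda>n. wint n u w) \<longlonglongrightarrow> (CLINT x|M. iexp (u \<bullet> x) * of_real (1 - cos (w \<bullet> x)))"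
proof -
  let ?J = "CLINT x|M. iexp (u \<bullet> x) * of_real (1 - cos (w \<bullet> x))"
  define A B C where "A n = \<phi> n (u + w)" and "B n = \<phi> n (u - w)" and "C n = \<phi> n u" for n
  \<comment> \<open>The n-th power of this ratio equals the same ratio of the centred n-th powers:
    the phases of \<open>d n\<close> at u + w and u - w multiply to the square of the phase at
    u.\<close>
  define r where "r n = A n * B n / (C n)\<^sup>2" for n
  define z where "z n = of_nat n * (r n - 1)" for n
  \<comment> \<open>The smallness of w makes \<open>KD * truncated_moment M (norm w)\<close> at most
    1/8; with slack 1/8 and the factor 2 of \<open>cmod_wint_le\<close>, \<open>wint\<close> is
    eventually bounded by 1/2.\<close>
  have "\<forall>\<^sub>F n in sequentially. pmom n (norm w) \<le> KD * truncated_moment M (norm w) + 1/8"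
    using w by (intro moment_bound) auto
  then have I: "\<forall>\<^sub>F n in sequentially. cmod (wint n u w) \<le> 1/2"
  proof eventually_elim
    case (elim n)
    moreover have "KD * truncated_moment M (norm w) \<le> 1/8" using small by simp
    ultimately show ?case using cmod_wint_le[of n u w] by linarith
  qed
  have C1: "C \<longlonglongrightarrow> 1" unfolding C_def by (rule phi_tendsto_1)
  have C0: "\<forall>\<^sub>F n in sequentially. C n \<noteq> 0" using C1 by (rule tendsto_imp_eventually_ne) simp
  \<comment> \<open>With X = A + B - 2 C one has A B - C^2 = X C + (A - C) (B - C). Multiplied by n,
    the first term is - 2 \<open>wint\<close> up to the factor C, which tends to 1, and the second
    is of order n times the square of \<open>smom\<close>, hence negligible.\<close>
  have zI: "(\<lambda>n. z n + 2 * wint n u w) \<longlonglongrightarrow> 0"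
  proof (rule Lim_null_comparison)
    show "\<forall>\<^sub>F n in sequentially. norm (z n + 2 * wint n u w)
       \<le> norm (1 - 1 / C n) + 4 * (real n * (smom n (norm w))\<^sup>2) * norm (1 / (C n)\<^sup>2)"
      using C0 I
    proof eventually_elim
      case (elim n)
      define X E where "X = A n + B n - 2 * C n" and "E = (A n - C n) * (B n - C n)"
      have X: "of_nat n * X = - 2 * wint n u w"
        using wint_eq[of n u w] unfolding X_def A_def B_def C_def wint_def by simp
      have "z n + 2 * wint n u w = 2 * wint n u w * (1 - 1 / C n) + of_nat n * ((A n - C n) * (B n - C n)) * (1 / (C n)\<^sup>2)"
      proof -
        have "r n - 1 = (A n * B n - (C n)\<^sup>2) / (C n)\<^sup>2" using elim by (simp add: r_def field_simps)
        also have "A n * B n - (C n)\<^sup>2 = X * C n + E"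
          by (simp add: X_def E_def power2_eq_square algebra_simps)
        finally have "r n - 1 = X / C n + E * (1 / (C n)\<^sup>2)"
          using elim by (simp add: field_simps power2_eq_square)
        then have "z n = (of_nat n * X) / C n + of_nat n * E * (1 / (C n)\<^sup>2)"
          unfolding z_def by (simp add: algebra_simps)
        then show ?thesis unfolding X E_def by (simp add: algebra_simps)
      qed
      also have "norm \<dots> \<le> norm (2 * wint n u w * (1 - 1 / C n)) + norm (of_nat n * ((A n - C n) * (B n - C n)) * (1 / (C n)\<^sup>2))"
        by (rule norm_triangle_ineq)
      also have "\<dots> \<le> norm (1 - 1 / C n) + 4 * (real n * (smom n (norm w))\<^sup>2) * norm (1 / (C n)\<^sup>2)"
      proof (rule add_mono)
        have "norm (2 * wint n u w * (1 - 1 / C n)) = (2 * cmod (wint n u w)) * norm (1 - 1 / C n)"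
          by (simp add: norm_mult)
        also have "\<dots> \<le> 1 * norm (1 - 1 / C n)" using elim by (intro mult_right_mono) auto
        finally show "norm (2 * wint n u w * (1 - 1 / C n)) \<le> norm (1 - 1 / C n)" by simp
        have "cmod (A n - C n) \<le> 2 * smom n (norm w)" "cmod (B n - C n) \<le> 2 * smom n (norm w)"
          using cmod_phi_diff_le[of n u w] cmod_phi_diff_le[of n u "- w"] by (auto simp: A_def B_def C_def)
        then have "cmod (A n - C n) * cmod (B n - C n) \<le> (2 * smom n (norm w)) * (2 * smom n (norm w))"
          by (intro mult_mono) (auto simp: smom_nonneg)
        then have "real n * (cmod (A n - C n) * cmod (B n - C n)) \<le> real n * (4 * (smom n (norm w))\<^sup>2)"
          by (intro mult_left_mono) (auto simp: power2_eq_square)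
        then show "norm (of_nat n * ((A n - C n) * (B n - C n)) * (1 / (C n)\<^sup>2))
           \<le> 4 * (real n * (smom n (norm w))\<^sup>2) * norm (1 / (C n)\<^sup>2)"
          unfolding norm_mult norm_of_nat by (intro mult_right_mono) auto
      qed
      finally show ?case .
    qed
    have "(\<lambda>n. norm (1 - 1 / C n) + 4 * (real n * (smom n (norm w))\<^sup>2) * norm (1 / (C n)\<^sup>2))
      \<longlonglongrightarrow> norm (1 - 1 / (1::complex)) + 4 * 0 * norm (1 / (1::complex)\<^sup>2)"
      using w by (intro tendsto_intros C1 smom_square_tendsto) auto
    then show "(\<lambda>n. norm (1 - 1 / C n) + 4 * (real n * (smom n (norm w))\<^sup>2) * norm (1 / (C n)\<^sup>2)) \<longlonglongrightarrow> 0"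
      by simp
  qed
  have "z \<longlonglongrightarrow> - 2 * ?J"
  proof (rule power_limit_log)
    have "\<forall>\<^sub>F n in sequentially. cmod (z n + 2 * wint n u w) < 1"
      using tendstoD[OF zI, of 1] by simp
    then show "\<forall>\<^sub>F n in sequentially. cmod (z n) \<le> 2"
      using I
    proof eventually_elim
      case (elim n)
      have "cmod (z n) \<le> cmod (z n + 2 * wint n u w) + cmod (2 * wint n u w)"
        using norm_triangle_ineq4[of "z n + 2 * wint n u w" "2 * wint n u w"] by simp
      then show ?case using elim by (simp add: norm_mult)
    qed
    show "r n = 1 + z n / of_nat n" if "0 < n" for n using that by (simp add: z_def)
    define f where "f v n = \<phi> n v ^ n * iexp (- (v \<bullet> d n))" for v n
    have f: "f v \<longlonglongrightarrow> exp (levy_exponent a (\<lambda>_. 0) M v)" for v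
      unfolding f_def \<phi>_def by (rule char_limit)
    have f3: "(\<lambda>n. f (u + w) n * f (u - w) n / (f u n)\<^sup>2) \<longlonglongrightarrow>
      exp (levy_exponent a (\<lambda>_. 0) M (u + w)) * exp (levy_exponent a (\<lambda>_. 0) M (u - w)) / (exp (levy_exponent a (\<lambda>_. 0) M u))\<^sup>2"
      by (intro tendsto_intros f) simp
    have "exp (levy_exponent a (\<lambda>_. 0) M (u + w)) * exp (levy_exponent a (\<lambda>_. 0) M (u - w)) / (exp (levy_exponent a (\<lambda>_. 0) M u))\<^sup>2
      = exp (levy_exponent a (\<lambda>_. 0) M (u + w) + levy_exponent a (\<lambda>_. 0) M (u - w) - 2 * levy_exponent a (\<lambda>_. 0) M u)"
      by (simp add: exp_add exp_diff exp_double)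
    also have "\<dots> = exp (- 2 * ?J)"
      by (simp only: levy_exponent_second_difference)
    finally have E3: "exp (levy_exponent a (\<lambda>_. 0) M (u + w)) * exp (levy_exponent a (\<lambda>_. 0) M (u - w)) / (exp (levy_exponent a (\<lambda>_. 0) M u))\<^sup>2
      = exp (- 2 * ?J)" .
    have r3: "(\<lambda>n. f (u + w) n * f (u - w) n / (f u n)\<^sup>2) = (\<lambda>n. r n ^ n)"
    proof
      fix n
      have "iexp (- ((u + w) \<bullet> d n)) * iexp (- ((u - w) \<bullet> d n)) = (iexp (- (u \<bullet> d n)))\<^sup>2"
        unfolding exp_double[symmetric] exp_add[symmetric]
        by (simp add: inner_add_left inner_diff_left algebra_simps)
      then have "f (u + w) n * f (u - w) n = (A n * B n) ^ n * (iexp (- (u \<bullet> d n)))\<^sup>2"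
        unfolding f_def A_def B_def power_mult_distrib by (simp only: mult_ac)
      then show "f (u + w) n * f (u - w) n / (f u n)\<^sup>2 = r n ^ n"
        unfolding r_def f_def C_def power_mult_distrib power_divide
        by (simp add: power_mult[symmetric] mult.commute)
    qed
    show "(\<lambda>n. r n ^ n) \<longlonglongrightarrow> exp (- 2 * ?J)"
      using f3 unfolding E3 r3 .
    have "cmod ?J \<le> (LINT x|M. cmod (iexp (u \<bullet> x) * of_real (1 - cos (w \<bullet> x))))"
      by (rule integral_norm_bound)
    also have "\<dots> = (LINT x|M. 1 - cos (1 * (w \<bullet> x)))"
      by (simp only: norm_mult norm_exp_i_times norm_of_real mult_1_left) simp
    also have "\<dots> \<le> 2 * truncated_moment M (norm w)"
      by (rule levy_measure_moment_inner_le[OF levy]) simp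
    also have "2 * truncated_moment M (norm w) \<le> 1"
      using small KD_ge truncated_moment_nonneg[of M "norm w"]
        mult_right_mono[of 320 KD "truncated_moment M (norm w)"] by simp
    finally show "cmod (- 2 * ?J) \<le> 2" by (simp add: norm_mult)
  qed
  from tendsto_diff[OF zI this] have "(\<lambda>n. 2 * wint n u w) \<longlonglongrightarrow> 2 * ?J" by simp
  from tendsto_mult[OF tendsto_const[of "1/2"] this] show ?thesis by simp
qed

end

lemma finite_measure_density_integrable:
  fixes g :: "'b \<Rightarrow> real"
  assumes g: "integrable M g" "\<And>x. 0 \<le> g x"
  shows "finite_measure (density M (\<lambda>x. ennreal (g x)))"
proof (rule finite_measureI)
  have [measurable]: "g \<in> borel_measurable M" using g by auto
  have "emeasure (density M (\<lambda>x. ennreal (g x))) (space M) = (\<integral>\<^sup>+x. ennreal (g x) \<partial>M)"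
    by (subst emeasure_density) (auto intro!: nn_integral_cong)
  also have "\<dots> = ennreal (LINT x|M. g x)" using g by (intro nn_integral_eq_integral) auto
  finally show "emeasure (density M (\<lambda>x. ennreal (g x))) (space (density M (\<lambda>x. ennreal (g x)))) \<noteq> \<infinity>"
    by simp
qed

section \<open>Localization to annuli and vague convergence\<close>

definition annulus_cutoff :: "real \<Rightarrow> real \<Rightarrow> real \<Rightarrow> real"
  where "annulus_cutoff t R r = min 1 (max 0 (r / t - 1)) * min 1 (max 0 (2 - r / R))"

lemma annulus_cutoff_bounds: "0 \<le> annulus_cutoff t R r" "annulus_cutoff t R r \<le> 1"
  unfolding annulus_cutoff_def by (auto intro!: mult_nonneg_nonneg mult_le_one)

lemma annulus_cutoff_continuous [continuous_intros]:
  "0 < t \<Longrightarrow> 0 < R \<Longrightarrow> continuous_on S f \<Longrightarrow> continuous_on S (\<lambda>x. annulus_cutoff t R (f x))"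
  unfolding annulus_cutoff_def by (intro continuous_intros) auto

lemma annulus_cutoff_eq_0:
  "0 < t \<Longrightarrow> 0 < R \<Longrightarrow> r \<le> t \<or> 2 * R \<le> r \<Longrightarrow> annulus_cutoff t R r = 0"
  unfolding annulus_cutoff_def by (auto simp: divide_le_eq le_divide_eq)

lemma annulus_cutoff_eq_1:
  "0 < t \<Longrightarrow> 0 < R \<Longrightarrow> 2 * t \<le> r \<Longrightarrow> r \<le> R \<Longrightarrow> annulus_cutoff t R r = 1"
  unfolding annulus_cutoff_def by (auto simp: divide_le_eq le_divide_eq min_def max_def field_simps)

text \<open>What the cutoff removes is seen by two truncated moments: for |x| < 2 t the truncated
  square at scale 2 t is a multiple of |x|^2 itself, and beyond R the one at scale R equals
  1.\<close>

lemma annulus_cutoff_error: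
  fixes x :: "'a::real_normed_vector"
  assumes t: "0 < t" and R: "0 < R" and f: "\<bar>f\<bar> \<le> K * min 1 ((norm x)\<^sup>2)" and K: "0 \<le> K"
  shows "\<bar>f * (1 - annulus_cutoff t R (norm x))\<bar>
    \<le> K * ((2 * t)\<^sup>2 * min 1 ((1 / (2 * t) * norm x)\<^sup>2)) + K * min 1 ((1 / R * norm x)\<^sup>2)"
    (is "?l \<le> ?a + ?b")
proof -
  have nn: "0 \<le> ?a" "0 \<le> ?b" using K by auto
  have cut: "\<bar>f * (1 - annulus_cutoff t R (norm x))\<bar> \<le> \<bar>f\<bar>"
    using annulus_cutoff_bounds[of t R "norm x"] by (simp add: abs_mult mult_left_le)
  consider "norm x < 2 * t" | "R < norm x" | "2 * t \<le> norm x" "norm x \<le> R" by linarith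
  then show ?thesis
  proof cases
    case 1
    then have "(1 / (2 * t) * norm x)\<^sup>2 \<le> 1" using t by (intro power_le_one) auto
    then have "(2 * t)\<^sup>2 * min 1 ((1 / (2 * t) * norm x)\<^sup>2) = (norm x)\<^sup>2"
      using t by (simp add: power_divide power_mult_distrib)
    then have "\<bar>f\<bar> \<le> ?a" using order_trans[OF f mult_left_mono[OF min.cobounded2 K]] by simp
    then show ?thesis using cut nn by linarith
  next
    case 2
    then have "1 \<le> (1 / R * norm x)\<^sup>2" using R by (intro one_le_power) (simp add: le_divide_eq)
    then have "?b = K" by simp
    moreover have "\<bar>f\<bar> \<le> K" using order_trans[OF f mult_left_mono[OF min.cobounded1 K]] by simp
    ultimately show ?thesis using cut nn by linarith
  next
    case 3
    then show ?thesis using annulus_cutoff_eq_1[OF t R] nn by simp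
  qed
qed

context attracted
begin

text \<open>\<open>wint_tendsto\<close> is convergence of the Fourier transforms of the weighted
  measures. In the coordinates of the enumerated basis \<open>bs\<close> the continuity theorem
  extends it to all bounded continuous test functions.\<close>

lemma weighted_limit:
  fixes f :: "'a \<Rightarrow> real"
  assumes w: "w \<noteq> 0" and small: "8 * KD * truncated_moment M (norm w) \<le> 1"
    and f: "continuous_on UNIV f" "\<And>x. \<bar>f x\<bar> \<le> K"
  shows "(\<lambda>n. real n * (LINT x|\<mu>. f (x /\<^sub>R c n) * (1 - cos (w \<bullet> (x /\<^sub>R c n)))))
    \<longlonglongrightarrow> (LINT x|M. f x * (1 - cos (w \<bullet> x)))"
proof -
  obtain bs :: "nat \<Rightarrow> 'a" where bs: "bij_betw bs {..<DIM('a)} Basis"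
    using ex_bij_betw_nat_finite[OF finite_Basis] by (auto simp: atLeast0LessThan)
  have repr: "(\<Sum>i<DIM('a). (bs i \<bullet> x) *\<^sub>R bs i) = x" for x
    using sum.reindex_bij_betw[OF bs, of "\<lambda>b. (b \<bullet> x) *\<^sub>R b"] euclidean_representation[of x]
    by (simp add: inner_commute)
  have fm[measurable]: "f \<in> borel_measurable borel" using f(1) by (rule borel_measurable_continuous_onI)
  have measM: "measurable M N = measurable borel N" for N :: "'c measure"
    by (rule measurable_cong_sets[OF sets_M refl])
  define Mn where "Mn n = density \<mu> (\<lambda>x. ennreal (real n * (1 - cos (w \<bullet> (x /\<^sub>R c n)))))" for n
  define N where "N = density M (\<lambda>x. ennreal (1 - cos (w \<bullet> x)))"
  have intMn: "integral\<^sup>L (Mn n) g = (\<integral>x. (real n * (1 - cos (w \<bullet> (x /\<^sub>R c n)))) *\<^sub>R g x \<partial>\<mu>)"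
    if "g \<in> borel_measurable borel" for g :: "'a \<Rightarrow> 'b::{banach, second_countable_topology}" and n
    unfolding Mn_def using that by (subst integral_density) auto
  have intN: "integral\<^sup>L N g = (\<integral>x. (1 - cos (w \<bullet> x)) *\<^sub>R g x \<partial>M)"
    if "g \<in> borel_measurable borel" for g :: "'a \<Rightarrow> 'b::{banach, second_countable_topology}"
    unfolding N_def using that by (subst integral_density) (auto simp: measM)
  define F where "F y = f (\<Sum>i<DIM('a). y i *\<^sub>R bs i)" for y :: "nat \<Rightarrow> real"
  have "(\<lambda>n. LINT x|Mn n. F (\<lambda>i. if i < DIM('a) then bs i \<bullet> (x /\<^sub>R c n) else 0))
    \<longlonglongrightarrow> (LINT x|N. F (\<lambda>i. if i < DIM('a) then bs i \<bullet> x else 0))"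
  proof (rule integral_tendsto_by_characteristic_functions)
    show "finite_measure (Mn n)" for n
      unfolding Mn_def
    proof (rule finite_measure_density_integrable)
      show "integrable \<mu> (\<lambda>x. real n * (1 - cos (w \<bullet> (x /\<^sub>R c n))))"
        by (rule integrable_bounded[where B="real n * 2"])
          (auto simp: abs_mult abs_le_iff one_minus_cos_le_two intro!: mult_left_mono)
    qed simp
    show "finite_measure N"
      unfolding N_def
    proof (rule finite_measure_density_integrable)
      show "integrable M (\<lambda>x. 1 - cos (w \<bullet> x))"
        using levy_measure_moment_inner_le(2)[OF levy, of 1 w] by simp
    qed simp
    show "(\<lambda>x. bs i \<bullet> (x /\<^sub>R c n)) \<in> borel_measurable (Mn n)" for n i
      unfolding Mn_def by simp
    show "(\<lambda>x. bs i \<bullet> x) \<in> borel_measurable N" for i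
      unfolding N_def by (simp add: measM)
    show "\<bar>F y\<bar> \<le> K" for y unfolding F_def by (rule f(2))
    show "continuous_on UNIV F"
      unfolding F_def by (rule continuous_on_compose2[OF f(1)])
        (auto intro!: continuous_intros continuous_on_product_coordinates)
    fix l :: "nat \<Rightarrow> real"
    define u where "u = (\<Sum>i<DIM('a). l i *\<^sub>R bs i)"
    have u: "(\<Sum>i<DIM('a). l i * (bs i \<bullet> x)) = u \<bullet> x" for x
      by (simp add: u_def inner_sum_left)
    have "wint n u w = (CLINT x|Mn n. iexp (\<Sum>i<DIM('a). l i * (bs i \<bullet> (x /\<^sub>R c n))))" for n
      unfolding u wint_def by (subst intMn)
        (simp_all add: scaleR_conv_of_real mult_ac integral_mult_right_zero[symmetric] del: integral_mult_right_zero)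
    moreover have "(CLINT x|M. iexp (u \<bullet> x) * of_real (1 - cos (w \<bullet> x))) = (CLINT x|N. iexp (\<Sum>i<DIM('a). l i * (bs i \<bullet> x)))"
      unfolding u by (subst intN) (simp_all add: scaleR_conv_of_real mult_ac)
    ultimately show "(\<lambda>n. CLINT x|Mn n. iexp (\<Sum>i<DIM('a). l i * (bs i \<bullet> (x /\<^sub>R c n))))
      \<longlonglongrightarrow> (CLINT x|N. iexp (\<Sum>i<DIM('a). l i * (bs i \<bullet> x)))"
      using wint_tendsto[OF w small, of u] by simp
  qed
  moreover have "F (\<lambda>i. if i < DIM('a) then bs i \<bullet> x else 0) = f x" for x
    unfolding F_def using repr[of x] by simp
  ultimately have "(\<lambda>n. LINT x|Mn n. f (x /\<^sub>R c n)) \<longlonglongrightarrow> (LINT x|N. f x)" by simp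
  moreover have "(LINT x|Mn n. f (x /\<^sub>R c n)) = real n * (LINT x|\<mu>. f (x /\<^sub>R c n) * (1 - cos (w \<bullet> (x /\<^sub>R c n))))" for n
  proof -
    have "(LINT x|Mn n. f (x /\<^sub>R c n)) = (LINT x|\<mu>. real n * (f (x /\<^sub>R c n) * (1 - cos (w \<bullet> (x /\<^sub>R c n)))))"
      by (subst intMn) (simp_all only: real_scaleR_def mult_ac, measurable)
    then show ?thesis by simp
  qed
  moreover have "(LINT x|N. f x) = (LINT x|M. f x * (1 - cos (w \<bullet> x)))"
    by (subst intN) (simp_all add: mult_ac)
  ultimately show ?thesis by simp
qed

text \<open>Removal of the weight. A single 1 - cos (w \<bullet> x) vanishes on a hyperplane, but
  the sum S over the directions h b is positive for 0 < |x| \<le> 2 R: with h = 1/(2 R) all products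
  have modulus at most 1, and one of them is nonzero. On the compact annulus S is bounded away from
  0, so one may divide by it.\<close>

lemma limit_on_annulus:
  fixes f :: "'a \<Rightarrow> real"
  assumes f: "continuous_on UNIV f" "\<And>x. \<bar>f x\<bar> \<le> K"
    and t: "0 < t" and R: "0 < R" and small: "8 * KD * truncated_moment M (1 / (2 * R)) \<le> 1"
  shows "(\<lambda>n. real n * (LINT x|\<mu>. f (x /\<^sub>R c n) * annulus_cutoff t R (norm (x /\<^sub>R c n))))
    \<longlonglongrightarrow> (LINT x|M. f x * annulus_cutoff t R (norm x))"
proof -
  define h where "h = 1 / (2 * R)"
  have h: "0 < h" using R by (simp add: h_def)
  define S where "S x = (\<Sum>b\<in>Basis. 1 - cos ((h *\<^sub>R b) \<bullet> x))" for x :: 'a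
  have S_cont: "continuous_on A S" for A unfolding S_def by (intro continuous_intros)
  have S_pos: "0 < S x" if x: "x \<noteq> 0" "norm x \<le> 2 * R" for x
  proof -
    obtain b where b: "b \<in> Basis" "b \<bullet> x \<noteq> 0"
      using x(1) by (metis euclidean_all_zero_iff inner_commute)
    have "\<bar>(h *\<^sub>R b) \<bullet> x\<bar> = h * \<bar>b \<bullet> x\<bar>" using h by (simp add: abs_mult)
    also have "\<dots> \<le> h * (2 * R)"
      using h x(2) Basis_le_norm[OF b(1), of x] by (intro mult_left_mono) (auto simp: inner_commute)
    also have "\<dots> = 1" using R by (simp add: h_def)
    finally have y: "\<bar>(h *\<^sub>R b) \<bullet> x\<bar> \<le> 1" .
    have "cos \<bar>(h *\<^sub>R b) \<bullet> x\<bar> < cos 0"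
      using y b h pi_ge_two by (intro cos_monotone_0_pi) auto
    then have "0 < 1 - cos ((h *\<^sub>R b) \<bullet> x)" by (metis cos_abs_real cos_zero diff_gt_0_iff_gt)
    also have "\<dots> \<le> S x" unfolding S_def by (rule member_le_sum[OF b(1)]) auto
    finally show ?thesis .
  qed
  define D where "D = {x::'a. t \<le> norm x \<and> norm x \<le> 2 * R}"
  have "compact D"
  proof -
    have "D = cball 0 (2 * R) - ball 0 t" by (auto simp: D_def)
    then show ?thesis by (simp add: compact_diff)
  qed
  obtain s0 where s0: "0 < s0" "\<And>x. x \<in> D \<Longrightarrow> s0 \<le> S x"
  proof (cases "D = {}")
    case False
    then obtain x0 where x0: "x0 \<in> D" "\<And>x. x \<in> D \<Longrightarrow> S x0 \<le> S x"
      using continuous_attains_inf[OF \<open>compact D\<close> _ S_cont] by blast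
    have "0 < S x0" using x0(1) t by (intro S_pos) (auto simp: D_def)
    then show thesis using x0 that by blast
  qed (use that[of 1] in auto)
  \<comment> \<open>The maximum keeps the denominator positive and continuous everywhere; it changes
    the quotient only where the cutoff makes the numerator vanish.\<close>
  define g where "g x = f x * annulus_cutoff t R (norm x) / max s0 (S x)" for x
  have gS: "f x * annulus_cutoff t R (norm x) = g x * S x" for x
  proof (cases "x \<in> D")
    case True
    then show ?thesis using s0(1) s0(2)[of x] by (simp add: g_def max_def)
  next
    case False
    then have "annulus_cutoff t R (norm x) = 0" using t R by (intro annulus_cutoff_eq_0) (auto simp: D_def)
    then show ?thesis by (simp add: g_def)
  qed
  have K: "0 \<le> K" using f(2)[of 0] by linarith
  have g_cont: "continuous_on UNIV g"
    unfolding g_def using s0(1) t R by (intro continuous_intros f S_cont) auto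
  have g_bd: "\<bar>g x\<bar> \<le> K / s0" for x
  proof -
    have "\<bar>f x * annulus_cutoff t R (norm x)\<bar> \<le> K * 1"
      unfolding abs_mult using f(2)[of x] annulus_cutoff_bounds[of t R "norm x"] K by (intro mult_mono) auto
    then show ?thesis using s0(1) K unfolding g_def abs_divide
      by (intro frac_le) auto
  qed
  have lim: "(\<lambda>n. real n * (LINT x|\<mu>. g (x /\<^sub>R c n) * (1 - cos ((h *\<^sub>R b) \<bullet> (x /\<^sub>R c n)))))
    \<longlonglongrightarrow> (LINT x|M. g x * (1 - cos ((h *\<^sub>R b) \<bullet> x)))" if "b \<in> Basis" for b
    by (rule weighted_limit[OF _ _ g_cont g_bd]) (use that h small in \<open>auto simp: h_def nonzero_Basis\<close>)
  have gm[measurable]: "g \<in> borel_measurable borel" using g_cont by (rule borel_measurable_continuous_onI)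
  have "real n * (LINT x|\<mu>. f (x /\<^sub>R c n) * annulus_cutoff t R (norm (x /\<^sub>R c n)))
    = (\<Sum>b\<in>Basis. real n * (LINT x|\<mu>. g (x /\<^sub>R c n) * (1 - cos ((h *\<^sub>R b) \<bullet> (x /\<^sub>R c n)))))" for n
  proof -
    have int: "integrable \<mu> (\<lambda>x. g (x /\<^sub>R c n) * (1 - cos ((h *\<^sub>R b) \<bullet> (x /\<^sub>R c n))))" for b
    proof (rule integrable_bounded[where B="K / s0 * 2"])
      show "norm (g (x /\<^sub>R c n) * (1 - cos ((h *\<^sub>R b) \<bullet> (x /\<^sub>R c n)))) \<le> K / s0 * 2" for x
        unfolding real_norm_def abs_mult using g_bd[of "x /\<^sub>R c n"] one_minus_cos_le_two[of "(h *\<^sub>R b) \<bullet> (x /\<^sub>R c n)"] K s0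
        by (intro mult_mono) (auto simp del: inner_scaleR_left inner_scaleR_right)
    qed simp
    show ?thesis
      unfolding gS S_def sum_distrib_left by (subst Bochner_Integration.integral_sum) (auto simp: int sum_distrib_left simp del: inner_scaleR_left inner_scaleR_right intro!: int)
  qed
  moreover have "(LINT x|M. f x * annulus_cutoff t R (norm x)) = (\<Sum>b\<in>Basis. (LINT x|M. g x * (1 - cos ((h *\<^sub>R b) \<bullet> x))))"
  proof -
    have int: "integrable M (\<lambda>x. g x * (1 - cos ((h *\<^sub>R b) \<bullet> x)))" for b
    proof (rule Bochner_Integration.integrable_bound)
      show "integrable M (\<lambda>x. (K / s0) * (1 - cos (1 * ((h *\<^sub>R b) \<bullet> x))))"
        by (intro integrable_mult_right levy_measure_moment_inner_le(2) levy) simp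
      show "(\<lambda>x. g x * (1 - cos ((h *\<^sub>R b) \<bullet> x))) \<in> borel_measurable M"
        unfolding measurable_cong_sets[OF sets_M refl] by measurable
      show "AE x in M. norm (g x * (1 - cos ((h *\<^sub>R b) \<bullet> x))) \<le> norm ((K / s0) * (1 - cos (1 * ((h *\<^sub>R b) \<bullet> x))))"
        unfolding real_norm_def abs_mult using g_bd K s0(1) by (intro AE_I2 mult_mono) auto
    qed
    show ?thesis unfolding gS S_def sum_distrib_left by (rule Bochner_Integration.integral_sum) (rule int)
  qed
  ultimately show ?thesis using tendsto_sum[OF lim] by simp
qed

text \<open>On an annulus the limit is known. Outside it, domination by min(1, |x|^2) leaves
  truncated moments, which are small for M and, by \<open>moment_bound\<close>, uniformly small for
  the rescaled law.\<close>

theorem functional_limit: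
  fixes f :: "'a \<Rightarrow> real"
  assumes f: "continuous_on UNIV f" "\<And>x. \<bar>f x\<bar> \<le> K * min 1 ((norm x)\<^sup>2)"
  shows "(\<lambda>n. real n * (LINT x|\<mu>. f (x /\<^sub>R c n))) \<longlonglongrightarrow> (LINT x|M. f x)"
proof (rule LIMSEQ_I)
  fix e :: real assume e: "0 < e"
  have fm[measurable]: "f \<in> borel_measurable borel" using f(1) by (rule borel_measurable_continuous_onI)
  define L where "L = max K 1"
  have L: "1 \<le> L" "\<bar>f x\<bar> \<le> L * min 1 ((norm x)\<^sup>2)" for x
  proof -
    have "K * min 1 ((norm x)\<^sup>2) \<le> L * min 1 ((norm x)\<^sup>2)" by (intro mult_right_mono) (auto simp: L_def)
    then show "\<bar>f x\<bar> \<le> L * min 1 ((norm x)\<^sup>2)" using f(2)[of x] by linarith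
  qed (simp add: L_def)
  have fb: "\<bar>f x\<bar> \<le> L" for x using order_trans[OF L(2) mult_left_mono[OF min.cobounded1]] L(1) by fastforce
  \<comment> \<open>L KD \<eta> = e / 16; the two ends of the annulus and the slack e' then cost at
    most e / 16 each.\<close>
  define \<eta> where "\<eta> = e / (16 * L * KD)"
  have \<eta>: "0 < \<eta>" using e L KD_ge by (simp add: \<eta>_def)
  have pos: "\<forall>\<^sub>F s in at_right (0::real). 0 < s" by (simp add: eventually_at_filter)
  have "\<forall>\<^sub>F s in at_right 0. s\<^sup>2 * truncated_moment M (1 / s) < \<eta>"
    by (rule order_tendstoD(2)[OF truncated_moment_subquadratic[OF levy] \<eta>])
  with pos have "\<forall>\<^sub>F s in at_right 0. 0 < s \<and> s\<^sup>2 * truncated_moment M (1 / s) < \<eta>"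
    by eventually_elim auto
  from eventually_happens[OF this] obtain s where s: "0 < s" "s\<^sup>2 * truncated_moment M (1 / s) < \<eta>"
    by auto
  define t where "t = s / 2"
  have t: "0 < t" "2 * t = s" using s by (auto simp: t_def)
  have "\<forall>\<^sub>F h in at_right 0. truncated_moment M h < min \<eta> (1 / (8 * KD))"
    using \<eta> KD_ge by (intro order_tendstoD[OF levy_truncated_moment_tendsto_0[OF levy]]) auto
  \<comment> \<open>The value at h / 2 is required separately: \<open>limit_on_annulus\<close> uses
    directions of length 1 / (2 R) = h / 2.\<close>
  moreover have "\<forall>\<^sub>F h in at_right 0. truncated_moment M (h / 2) < min \<eta> (1 / (8 * KD))"
  proof -
    have "filterlim (\<lambda>h::real. h / 2) (at_right 0) (at_right 0)"
      unfolding filterlim_at by (auto intro!: tendsto_eq_intros simp: eventually_at_filter)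
    from filterlim_compose[OF levy_truncated_moment_tendsto_0[OF levy] this]
    show ?thesis using \<eta> KD_ge by (intro order_tendstoD) auto
  qed
  ultimately have "\<forall>\<^sub>F h in at_right 0. 0 < h \<and> truncated_moment M h < min \<eta> (1 / (8 * KD)) \<and>
      truncated_moment M (h / 2) < min \<eta> (1 / (8 * KD))"
    using pos by eventually_elim auto
  from eventually_happens[OF this] obtain h where h: "0 < h" "truncated_moment M h < \<eta>"
      "truncated_moment M (h / 2) < 1 / (8 * KD)" by auto
  define R where "R = 1 / h"
  have R: "0 < R" "1 / R = h" "1 / (2 * R) = h / 2" using h by (auto simp: R_def)
  have small: "8 * KD * truncated_moment M (1 / (2 * R)) \<le> 1"
    using h(3) KD_ge unfolding R by (simp add: field_simps)
  let ?cut = "\<lambda>x. annulus_cutoff t R (norm x)"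
  have [measurable]: "(\<lambda>x::'a. ?cut x) \<in> borel_measurable borel"
    using t R by (intro borel_measurable_continuous_onI continuous_intros) auto
  have err: "\<bar>f x * (1 - ?cut x)\<bar> \<le> L * (s\<^sup>2 * min 1 ((1 / s * norm x)\<^sup>2)) + L * min 1 ((h * norm x)\<^sup>2)" for x
    using annulus_cutoff_error[OF t(1) R(1) L(2)[of x]] L(1) unfolding t(2) R(2) by simp
  have lim: "(\<lambda>n. real n * (LINT x|\<mu>. f (x /\<^sub>R c n) * ?cut (x /\<^sub>R c n))) \<longlonglongrightarrow> (LINT x|M. f x * ?cut x)"
    by (rule limit_on_annulus[OF f(1) fb t(1) R(1) small])
  have intM: "integrable M f" "integrable M (\<lambda>x. f x * ?cut x)"
  proof -
    show "integrable M f" by (rule levy_measure_integrable[OF levy fm]) (use f(2) in auto)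
    then show "integrable M (\<lambda>x. f x * ?cut x)"
      by (rule Bochner_Integration.integrable_bound)
         (auto simp: measurable_cong_sets[OF sets_M refl] abs_mult annulus_cutoff_bounds mult_left_le intro!: AE_I2)
  qed
  have limerr: "\<bar>(LINT x|M. f x) - (LINT x|M. f x * ?cut x)\<bar> \<le> e / 8"
  proof -
    have "\<bar>(LINT x|M. f x) - (LINT x|M. f x * ?cut x)\<bar> = \<bar>LINT x|M. f x * (1 - ?cut x)\<bar>"
      using intM by (simp add: right_diff_distrib)
    also have "\<dots> \<le> (LINT x|M. \<bar>f x * (1 - ?cut x)\<bar>)" by (rule integral_abs_bound)
    also have "\<dots> \<le> (LINT x|M. L * (s\<^sup>2 * min 1 ((1 / s * norm x)\<^sup>2)) + L * min 1 ((h * norm x)\<^sup>2))"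
    proof (rule integral_mono[OF _ _ err])
      show "integrable M (\<lambda>x. \<bar>f x * (1 - ?cut x)\<bar>)"
        using intM by (simp only: right_diff_distrib mult_1_right integrable_abs Bochner_Integration.integrable_diff)
      show "integrable M (\<lambda>x. L * (s\<^sup>2 * min 1 ((1 / s * norm x)\<^sup>2)) + L * min 1 ((h * norm x)\<^sup>2))"
        by (intro Bochner_Integration.integrable_add integrable_mult_right integrable_truncated_square levy)
    qed
    also have "\<dots> = L * (s\<^sup>2 * truncated_moment M (1 / s)) + L * truncated_moment M h"
      unfolding truncated_moment_def
      by (subst Bochner_Integration.integral_add, (intro integrable_mult_right integrable_truncated_square levy)+)
         (simp only: integral_mult_right_zero)
    also have "\<dots> \<le> L * \<eta> + L * \<eta>" using L s h by (intro add_mono mult_left_mono) auto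
    also have "\<dots> = e / (8 * KD)" using L KD_ge by (simp add: \<eta>_def field_simps)
    also have "\<dots> \<le> e / 8" using e KD_ge by (intro divide_left_mono) auto
    finally show ?thesis .
  qed
  define W where "W = L * (s\<^sup>2 + 1)"
  have W: "0 < W" using L by (simp add: W_def add_nonneg_pos)
  define e' where "e' = e / (16 * W)"
  have e': "0 < e'" using e W by (simp add: e'_def)
  have "\<forall>\<^sub>F n in sequentially. pmom n (1 / s) \<le> KD * truncated_moment M (1 / s) + e'"
    using s e' by (intro moment_bound) auto
  moreover have "\<forall>\<^sub>F n in sequentially. pmom n h \<le> KD * truncated_moment M h + e'"
    using h e' by (intro moment_bound) auto
  moreover have "\<forall>\<^sub>F n in sequentially. \<bar>real n * (LINT x|\<mu>. f (x /\<^sub>R c n) * ?cut (x /\<^sub>R c n)) - (LINT x|M. f x * ?cut x)\<bar> < e / 8"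
    using tendstoD[OF lim, of "e / 8"] e by (simp add: dist_real_def)
  ultimately have "\<forall>\<^sub>F n in sequentially. \<bar>real n * (LINT x|\<mu>. f (x /\<^sub>R c n)) - (LINT x|M. f x)\<bar> < e"
  proof eventually_elim
    case (elim n)
    have int1: "integrable \<mu> (\<lambda>x. f (x /\<^sub>R c n))" using fb by (intro integrable_bounded[where B=L]) auto
    have int2: "integrable \<mu> (\<lambda>x. f (x /\<^sub>R c n) * ?cut (x /\<^sub>R c n))"
    proof (rule Bochner_Integration.integrable_bound[OF int1])
      show "AE x in \<mu>. norm (f (x /\<^sub>R c n) * ?cut (x /\<^sub>R c n)) \<le> norm (f (x /\<^sub>R c n))"
        unfolding real_norm_def abs_mult
        using annulus_cutoff_bounds[of t R] by (intro AE_I2 mult_left_le) auto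
      show "(\<lambda>x. f (x /\<^sub>R c n) * ?cut (x /\<^sub>R c n)) \<in> borel_measurable \<mu>"
        unfolding measurable_mu by measurable
    qed
    have int3: "integrable \<mu> (\<lambda>x. min 1 ((r * norm (x /\<^sub>R c n))\<^sup>2))" for r
      by (intro integrable_bounded[where B=1]) auto
    have "\<bar>(LINT x|\<mu>. f (x /\<^sub>R c n)) - (LINT x|\<mu>. f (x /\<^sub>R c n) * ?cut (x /\<^sub>R c n))\<bar> = \<bar>LINT x|\<mu>. f (x /\<^sub>R c n) * (1 - ?cut (x /\<^sub>R c n))\<bar>"
      using int1 int2 by (simp only: right_diff_distrib mult_1_right Bochner_Integration.integral_diff)
    also have "\<dots> \<le> (LINT x|\<mu>. \<bar>f (x /\<^sub>R c n) * (1 - ?cut (x /\<^sub>R c n))\<bar>)" by (rule integral_abs_bound)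
    also have "\<dots> \<le> (LINT x|\<mu>. L * (s\<^sup>2 * min 1 ((1 / s * norm (x /\<^sub>R c n))\<^sup>2)) + L * min 1 ((h * norm (x /\<^sub>R c n))\<^sup>2))"
    proof (rule integral_mono)
      show "integrable \<mu> (\<lambda>x. \<bar>f (x /\<^sub>R c n) * (1 - ?cut (x /\<^sub>R c n))\<bar>)"
        using int1 int2 by (simp only: right_diff_distrib mult_1_right integrable_abs Bochner_Integration.integrable_diff)
      show "integrable \<mu> (\<lambda>x. L * (s\<^sup>2 * min 1 ((1 / s * norm (x /\<^sub>R c n))\<^sup>2)) + L * min 1 ((h * norm (x /\<^sub>R c n))\<^sup>2))"
        by (intro Bochner_Integration.integrable_add integrable_mult_right int3)
    qed (rule err)
    also have "\<dots> = L * (s\<^sup>2 * (LINT x|\<mu>. min 1 ((1 / s * norm (x /\<^sub>R c n))\<^sup>2))) + L * (LINT x|\<mu>. min 1 ((h * norm (x /\<^sub>R c n))\<^sup>2))"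
      by (subst Bochner_Integration.integral_add, (intro integrable_mult_right int3)+) (simp only: integral_mult_right_zero)
    finally have "real n * \<bar>(LINT x|\<mu>. f (x /\<^sub>R c n)) - (LINT x|\<mu>. f (x /\<^sub>R c n) * ?cut (x /\<^sub>R c n))\<bar>
      \<le> real n * (L * (s\<^sup>2 * (LINT x|\<mu>. min 1 ((1 / s * norm (x /\<^sub>R c n))\<^sup>2))) + L * (LINT x|\<mu>. min 1 ((h * norm (x /\<^sub>R c n))\<^sup>2)))"
      by (rule mult_left_mono) simp
    also have "\<dots> = L * (s\<^sup>2 * pmom n (1 / s)) + L * pmom n h"
      by (simp only: pmom_def distrib_left mult_ac)
    also have "\<dots> \<le> L * (s\<^sup>2 * (KD * truncated_moment M (1 / s) + e')) + L * (KD * truncated_moment M h + e')"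
      using elim L by (intro add_mono mult_left_mono) auto
    also have "\<dots> = L * KD * (s\<^sup>2 * truncated_moment M (1 / s)) + L * KD * truncated_moment M h + W * e'"
      by (simp add: W_def algebra_simps)
    also have "\<dots> \<le> L * KD * \<eta> + L * KD * \<eta> + e / 16"
    proof (intro add_mono mult_left_mono)
      show "W * e' \<le> e / 16" using W by (simp add: e'_def)
    qed (use s h L KD_ge in auto)
    also have "\<dots> \<le> e / 4" using L KD_ge e by (simp add: \<eta>_def)
    finally have "\<bar>real n * (LINT x|\<mu>. f (x /\<^sub>R c n)) - real n * (LINT x|\<mu>. f (x /\<^sub>R c n) * ?cut (x /\<^sub>R c n))\<bar> \<le> e / 4"
      by (simp add: right_diff_distrib[symmetric] abs_mult)
    then show ?case using limerr elim(3) e by linarith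
  qed
  then show "\<exists>no. \<forall>n\<ge>no. norm (real n * (LINT x|\<mu>. f (x /\<^sub>R c n)) - (LINT x|M. f x)) < e"
    by (simp add: eventually_sequentially)
qed

end

section \<open>Tempering\<close>

lemma nn_integral_powr_tail:
  assumes a: "0 < a" and x: "0 < (x::real)"
  shows "(\<integral>\<^sup>+r. ennreal (if x < r then r powr (- a - 1) else 0) \<partial>lborel) = ennreal (x powr (- a) / a)"
proof -
  have "(\<integral>\<^sup>+r. ennreal (if x < r then r powr (- a - 1) else 0) \<partial>lborel)
    = (\<integral>\<^sup>+r. ennreal (r powr (- a - 1)) * indicator {x ..} r \<partial>lborel)"
  proof (rule nn_integral_cong_AE)
    have "AE r in lborel. r \<noteq> x" by (rule AE_lborel_singleton)
    then show "AE r in lborel. ennreal (if x < r then r powr (- a - 1) else 0) = ennreal (r powr (- a - 1)) * indicator {x ..} r"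
      by eventually_elim (auto simp: indicator_def)
  qed
  also have "\<dots> = ennreal (0 - (- (x powr (- a) / a)))"
  proof (rule nn_integral_FTC_atLeast)
    show "((\<lambda>r. - (r powr (- a) / a)) \<longlongrightarrow> 0) at_top"
    proof -
      have "((\<lambda>r::real. r powr (- a)) \<longlongrightarrow> 0) at_top"
        using a by (intro tendsto_neg_powr filterlim_ident) auto
      from tendsto_minus[OF tendsto_divide[OF this tendsto_const[of a]]] show ?thesis using a by simp
    qed
    show "((\<lambda>r. - (r powr (- a) / a)) has_real_derivative r powr (- a - 1)) (at r)" if "x \<le> r" for r
      using x that a by (auto intro!: derivative_eq_intros)
  qed auto
  finally show ?thesis by simp
qed

lemma nn_integral_powr_segment:
  assumes a: "0 < a" and x: "0 < (x::real)"
  shows "(\<integral>\<^sup>+r. ennreal (if x < r \<and> r < b then a * r powr (a - 1) else 0) \<partial>lborel)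
    = ennreal (if x < b then b powr a - x powr a else 0)"
proof (cases "x < b")
  case True
  have "(\<integral>\<^sup>+r. ennreal (if x < r \<and> r < b then a * r powr (a - 1) else 0) \<partial>lborel)
    = (\<integral>\<^sup>+r. ennreal (a * r powr (a - 1)) * indicator {x .. b} r \<partial>lborel)"
  proof (rule nn_integral_cong_AE)
    have "AE r in lborel. r \<noteq> x" "AE r in lborel. r \<noteq> b" by (rule AE_lborel_singleton)+
    then show "AE r in lborel. ennreal (if x < r \<and> r < b then a * r powr (a - 1) else 0)
        = ennreal (a * r powr (a - 1)) * indicator {x .. b} r"
      by eventually_elim (auto simp: indicator_def)
  qed
  also have "\<dots> = ennreal (b powr a - x powr a)"
  proof (rule nn_integral_FTC_Icc)
    show "((\<lambda>r. r powr a) has_real_derivative a * r powr (a - 1)) (at r)" if "r \<in> {x..b}" for r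
      using x that a by (auto intro!: derivative_eq_intros)
    show "0 \<le> a * r powr (a - 1)" if "r \<in> {x..b}" for r using a by simp
  qed (use True in auto)
  finally show ?thesis using True by simp
next
  case False
  then have "(\<lambda>r. ennreal (if x < r \<and> r < b then a * r powr (a - 1) else 0)) = (\<lambda>r. 0)" by auto
  then show ?thesis using False by simp
qed

locale tempering =
  fixes \<alpha> :: real and q :: "real \<Rightarrow> 'a::euclidean_space \<Rightarrow> real"
  assumes alpha_pos: "0 < \<alpha>" and tempering: "tempering_function \<alpha> q"
begin

text \<open>Continuation of q by 0, so that sign, bound, monotonicity in r and joint measurability
  hold without restricting the arguments to the domain, off which q is arbitrary.\<close>

definition qq :: "real \<Rightarrow> 'a \<Rightarrow> real"
  where "qq r s = (if 0 < r \<and> s \<in> sphere 0 1 then q r s else 0)"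

lemma q_antimono: "s \<in> sphere 0 1 \<Longrightarrow> 0 < r \<Longrightarrow> r \<le> r' \<Longrightarrow> q r' s \<le> q r s"
  using tempering by (auto simp: tempering_function_def monotone_on_def)

lemma qq_nonneg: "0 \<le> qq r s"
proof (cases "0 < r \<and> s \<in> sphere 0 1")
  case True
  have "((\<lambda>r. q r s) \<longlongrightarrow> 0) at_top" using tempering True by (auto simp: tempering_function_def)
  moreover have "\<forall>\<^sub>F r' in at_top. q r' s \<le> q r s"
    using eventually_ge_at_top[of r] by eventually_elim (use True q_antimono in auto)
  ultimately have "0 \<le> q r s" by (intro tendsto_upperbound[of _ 0 at_top]) auto
  then show ?thesis by (simp add: qq_def)
qed (auto simp: qq_def)

lemma qq_le: "qq r s \<le> \<alpha>"
proof (cases "0 < r \<and> s \<in> sphere 0 1")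
  case True
  have "((\<lambda>r. q r s) \<longlongrightarrow> \<alpha>) (at_right 0)" using tempering True by (auto simp: tempering_function_def)
  moreover have "\<forall>\<^sub>F r' in at_right 0. q r s \<le> q r' s"
    using True unfolding eventually_at_right_field by (intro exI[of _ r]) (auto intro: q_antimono)
  ultimately have "q r s \<le> \<alpha>" by (intro tendsto_lowerbound[of _ \<alpha> "at_right 0"]) auto
  then show ?thesis using True by (simp add: qq_def)
qed (use alpha_pos in \<open>auto simp: qq_def\<close>)

lemma qq_antimono: "0 < r \<Longrightarrow> r \<le> r' \<Longrightarrow> qq r' s \<le> qq r s"
  using q_antimono[of s r r'] by (auto simp: qq_def)

lemma qq_measurable [measurable]:
  assumes [measurable]: "f \<in> borel_measurable M" "h \<in> borel_measurable M"
  shows "(\<lambda>x. qq (f x) (h x)) \<in> borel_measurable M"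
proof -
  let ?D = "{0<..} \<times> sphere 0 1 :: (real \<times> 'a) set"
  have D: "?D \<in> sets borel" by (simp add: borel_prod[symmetric] borel_closed borel_open pair_measureI del: borel_prod)
  have "(\<lambda>(r, s). q r s) \<in> borel_measurable (restrict_space borel ?D)"
    using tempering by (simp add: tempering_function_def)
  then have "(\<lambda>z. indicator ?D z *\<^sub>R (case z of (r, s) \<Rightarrow> q r s)) \<in> borel_measurable borel"
    using D by (subst (asm) borel_measurable_restrict_space_iff) auto
  also have "(\<lambda>z. indicator ?D z *\<^sub>R (case z of (r, s) \<Rightarrow> q r s)) = (\<lambda>z. qq (fst z) (snd z))"
    by (auto simp: qq_def fun_eq_iff indicator_def)
  finally have "(\<lambda>z. qq (fst z) (snd z)) \<in> borel_measurable borel" .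
  from measurable_compose[OF _ this, of "\<lambda>x. (f x, h x)" M] show ?thesis
    by (simp add: borel_prod[symmetric] del: borel_prod)
qed

definition g :: "real \<Rightarrow> 'a \<Rightarrow> real"
  where "g r s = r powr (- \<alpha> - 1) * qq r s"

lemma g_nonneg: "0 \<le> g r s"
  by (simp add: g_def qq_nonneg)

lemma g_measurable [measurable]:
  assumes [measurable]: "f \<in> borel_measurable M" "h \<in> borel_measurable M"
  shows "(\<lambda>x. g (f x) (h x)) \<in> borel_measurable M"
  unfolding g_def by measurable

lemma g_antimono: "0 < r \<Longrightarrow> r \<le> r' \<Longrightarrow> g r' s \<le> g r s"
  unfolding g_def using alpha_pos by (intro mult_mono powr_mono2' qq_antimono qq_nonneg) auto

definition tail :: "real \<Rightarrow> 'a \<Rightarrow> real"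
  where "tail u s = (LINT r|lborel. (if u < r then g r s else 0))"

lemma tail_integrand_bound: "0 < u \<Longrightarrow> (if u < r then g r s else 0) \<le> qq u s * (if u < r then r powr (- \<alpha> - 1) else 0)"
  using qq_antimono[of u r s] by (auto simp: g_def mult.commute intro!: mult_left_mono)

lemma integrable_powr_tail:
  "0 < u \<Longrightarrow> integrable lborel (\<lambda>r. if u < r then r powr (- \<alpha> - 1) else 0)"
  "0 < u \<Longrightarrow> (LINT r|lborel. (if u < r then r powr (- \<alpha> - 1) else 0)) = u powr (- \<alpha>) / \<alpha>"
proof -
  assume u: "0 < u"
  have "has_bochner_integral lborel (\<lambda>r. if u < r then r powr (- \<alpha> - 1) else 0) (u powr (- \<alpha>) / \<alpha>)"
    using nn_integral_powr_tail[OF alpha_pos u] alpha_pos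
    by (intro has_bochner_integral_nn_integral) auto
  then show "integrable lborel (\<lambda>r. if u < r then r powr (- \<alpha> - 1) else 0)"
    and "(LINT r|lborel. (if u < r then r powr (- \<alpha> - 1) else 0)) = u powr (- \<alpha>) / \<alpha>"
    by (auto simp: has_bochner_integral_iff)
qed

lemma tail_integrable: "0 < u \<Longrightarrow> integrable lborel (\<lambda>r. if u < r then g r s else 0)"
proof -
  assume u: "0 < u"
  show ?thesis
  proof (rule Bochner_Integration.integrable_bound)
    show "integrable lborel (\<lambda>r. qq u s * (if u < r then r powr (- \<alpha> - 1) else 0))"
      using integrable_powr_tail[OF u] by simp
    show "AE r in lborel. norm (if u < r then g r s else 0) \<le> norm (qq u s * (if u < r then r powr (- \<alpha> - 1) else 0))"
    proof (rule AE_I2)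
      fix r
      have "norm (if u < r then g r s else 0) = (if u < r then g r s else 0)" by (simp add: g_nonneg)
      also have "\<dots> \<le> qq u s * (if u < r then r powr (- \<alpha> - 1) else 0)" by (rule tail_integrand_bound[OF u])
      finally show "norm (if u < r then g r s else 0) \<le> norm (qq u s * (if u < r then r powr (- \<alpha> - 1) else 0))" by simp
    qed
  qed measurable
qed

lemma tail_nonneg: "0 \<le> tail u s"
  unfolding tail_def by (intro integral_nonneg_AE) (simp add: g_nonneg)

lemma nn_tail: "0 < u \<Longrightarrow> (\<integral>\<^sup>+r. ennreal (if u < r then g r s else 0) \<partial>lborel) = ennreal (tail u s)"
  unfolding tail_def by (intro nn_integral_eq_integral tail_integrable) (auto simp: g_nonneg)

lemma tail_le: "0 < u \<Longrightarrow> tail u s \<le> qq u s * (u powr (- \<alpha>) / \<alpha>)"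
proof -
  assume u: "0 < u"
  have "tail u s \<le> (LINT r|lborel. qq u s * (if u < r then r powr (- \<alpha> - 1) else 0))"
    unfolding tail_def
    using integrable_powr_tail(1)[OF u] by (intro integral_mono tail_integrable u tail_integrand_bound) auto
  then show ?thesis using integrable_powr_tail(2)[OF u] by simp
qed

lemma tail_measurable [measurable]:
  assumes [measurable]: "f \<in> borel_measurable M" "h \<in> borel_measurable M"
  shows "(\<lambda>x. tail (f x) (h x)) \<in> borel_measurable M"
  unfolding tail_def by measurable

lemma tail_diff_bounds:
  assumes u: "0 < u" "u \<le> v"
  shows "(v - u) * g v s \<le> tail u s - tail v s" "tail u s - tail v s \<le> (v - u) * g u s"
proof -
  have "tail u s - tail v s = (LINT r|lborel. (if u < r then g r s else 0) - (if v < r then g r s else 0))"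
    unfolding tail_def using u by (intro Bochner_Integration.integral_diff[symmetric] tail_integrable) auto
  also have "\<dots> = (LINT r|lborel. indicator {u<..v} r * g r s)"
    using u by (intro Bochner_Integration.integral_cong) (auto simp: indicator_def)
  finally have eq: "tail u s - tail v s = (LINT r|lborel. indicator {u<..v} r * g r s)" .
  have int: "integrable lborel (\<lambda>r. indicator {u<..v} r * g r s)"
  proof (rule Bochner_Integration.integrable_bound[OF tail_integrable[OF u(1), of s]])
    show "AE r in lborel. norm (indicator {u<..v} r * g r s) \<le> norm (if u < r then g r s else 0)"
      by (auto simp: indicator_def)
  qed measurable
  have const: "(LINT r|lborel. indicator {u<..v} r * k) = (v - u) * k" "integrable lborel (\<lambda>r. indicator {u<..v} r * k)" for k :: real
    using u by auto
  have "(LINT r|lborel. indicator {u<..v} r * g v s) \<le> (LINT r|lborel. indicator {u<..v} r * g r s)"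
    using u by (intro integral_mono int const) (auto simp: indicator_def intro!: g_antimono)
  then show "(v - u) * g v s \<le> tail u s - tail v s" unfolding eq const .
  have "(LINT r|lborel. indicator {u<..v} r * g r s) \<le> (LINT r|lborel. indicator {u<..v} r * g u s)"
    using u by (intro integral_mono int const) (auto simp: indicator_def intro!: g_antimono)
  then show "tail u s - tail v s \<le> (v - u) * g u s" unfolding eq const .
qed

text \<open>Monotonicity of the integrand squeezes the difference quotient between - g u and - g (u
  + h), so continuity at the single point u is enough.\<close>

lemma tail_derivative:
  assumes u: "0 < u" and c: "isCont (\<lambda>r. g r s) u"
  shows "((\<lambda>u. tail u s) has_real_derivative - g u s) (at u)"
  unfolding has_field_derivative_def DERIV_def
proof -
  have "(\<lambda>h. (tail (u + h) s - tail u s) / h - (- g u s)) \<midarrow>0\<rightarrow> 0"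
  proof (rule Lim_null_comparison)
    show "(\<lambda>h. \<bar>g (u + h) s - g u s\<bar>) \<midarrow>0\<rightarrow> 0"
      using c tendsto_rabs[of "\<lambda>h. g (u + h) s - g u s" 0 "at 0"]
      unfolding isCont_iff by (simp add: LIM_zero_iff LIM_zero)
    have "\<forall>\<^sub>F h in at 0. - u < h" using u by (intro order_tendstoD(1)[OF tendsto_ident_at]) auto
    moreover have "\<forall>\<^sub>F h in at (0::real). h \<noteq> 0" by (simp add: eventually_at_filter)
    ultimately show "\<forall>\<^sub>F h in at 0. norm ((tail (u + h) s - tail u s) / h - (- g u s)) \<le> \<bar>g (u + h) s - g u s\<bar>"
    proof eventually_elim
      case (elim h)
      show ?case
      proof (cases "0 < h")
        case True
        have "h * g (u + h) s \<le> tail u s - tail (u + h) s" "tail u s - tail (u + h) s \<le> h * g u s"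
          using tail_diff_bounds[of u "u + h" s] u True by auto
        then have "- g u s \<le> (tail (u + h) s - tail u s) / h" "(tail (u + h) s - tail u s) / h \<le> - g (u + h) s"
          using True by (auto simp: le_divide_eq divide_le_eq algebra_simps)
        then show ?thesis by (auto simp: abs_le_iff abs_if)
      next
        case False
        then have h: "h < 0" using elim by simp
        have "(- h) * g u s \<le> tail (u + h) s - tail u s" "tail (u + h) s - tail u s \<le> (- h) * g (u + h) s"
          using tail_diff_bounds[of "u + h" u s] u h elim by auto
        then have "(tail (u + h) s - tail u s) / h \<le> - g u s" "- g (u + h) s \<le> (tail (u + h) s - tail u s) / h"
          using h by (auto simp: neg_le_divide_eq neg_divide_le_eq algebra_simps)
        then show ?thesis by (auto simp: abs_le_iff abs_if)
      qed
    qed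
  qed
  then show "((\<lambda>u. tail u s) has_derivative (*) (- g u s)) (at u)"
    unfolding has_field_derivative_def[symmetric] DERIV_def by (simp add: LIM_zero_iff LIM_zero_cancel)
qed

definition pi' :: "real \<Rightarrow> 'a \<Rightarrow> real"
  where "pi' u s = u powr \<alpha> * tail u s"

lemma pi'_nonneg: "0 \<le> pi' u s"
  by (simp add: pi'_def tail_nonneg)

lemma pi'_le: "0 < u \<Longrightarrow> \<alpha> * pi' u s \<le> qq u s"
proof -
  assume u: "0 < u"
  have "\<alpha> * pi' u s = (\<alpha> * u powr \<alpha>) * tail u s" by (simp add: pi'_def)
  also have "\<dots> \<le> (\<alpha> * u powr \<alpha>) * (qq u s * (u powr (- \<alpha>) / \<alpha>))"
    using alpha_pos by (intro mult_left_mono tail_le u) auto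
  also have "\<dots> = qq u s" using u alpha_pos by (simp add: powr_minus)
  finally show ?thesis .
qed

lemma pi'_le_1: "0 < u \<Longrightarrow> pi' u s \<le> 1"
proof -
  assume "0 < u"
  then have "\<alpha> * pi' u s \<le> \<alpha> * 1" using pi'_le[of u s] qq_le[of u s] by linarith
  then show ?thesis using alpha_pos by simp
qed

lemma pi'_measurable [measurable]:
  assumes [measurable]: "f \<in> borel_measurable M" "h \<in> borel_measurable M"
  shows "(\<lambda>x. pi' (f x) (h x)) \<in> borel_measurable M"
  unfolding pi'_def by measurable

text \<open>This is the negative of the u-derivative of \<open>pi'\<close>: differentiating
  u^\<alpha> \<open>tail\<close> gives \<alpha> u^(\<alpha>-1) \<open>tail\<close> - u^\<alpha> g =
  (\<alpha> \<open>pi'\<close> - \<open>qq\<close>) / u. Unlike a derivative the formula makes sense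
  at every u and is jointly measurable.\<close>

definition dens :: "real \<Rightarrow> 'a \<Rightarrow> real"
  where "dens u s = (if 0 < u then (qq u s - \<alpha> * pi' u s) / u else 0)"

lemma dens_nonneg: "0 \<le> dens u s"
  using pi'_le[of u s] by (simp add: dens_def)

lemma dens_le: "0 < u \<Longrightarrow> dens u s \<le> \<alpha> / u"
proof -
  assume u: "0 < u"
  have "qq u s - \<alpha> * pi' u s \<le> \<alpha>"
    using qq_le[of u s] mult_nonneg_nonneg[of \<alpha> "pi' u s"] alpha_pos pi'_nonneg[of u s] by linarith
  then show ?thesis using u by (simp add: dens_def divide_right_mono)
qed

lemma dens_measurable [measurable]:
  assumes [measurable]: "f \<in> borel_measurable M" "h \<in> borel_measurable M"
  shows "(\<lambda>x. dens (f x) (h x)) \<in> borel_measurable M"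
  unfolding dens_def by measurable

lemma temper_tail_eq:
  assumes "s \<in> sphere 0 1" "0 < u"
  shows "temper_tail \<alpha> q u s = pi' u s"
  unfolding temper_tail_def pi'_def tail_def set_lebesgue_integral_def
  using assms by (intro arg_cong2[where f="(*)"] refl Bochner_Integration.integral_cong)
    (auto simp: g_def qq_def indicator_def)

text \<open>The monotone function q(., s) has at most countably many discontinuities. Off this null
  set \<open>temper_tail\<close> is differentiable with derivative - \<open>dens\<close>; on it
  \<open>deriv\<close> may take any value without affecting the measure.\<close>

lemma temper_law_eq:
  assumes s: "s \<in> sphere 0 1"
  shows "temper_law \<alpha> q s = density lborel (\<lambda>u. ennreal (dens u s))"
proof -
  have "mono_on {0<..} (\<lambda>r. - qq r s)" using qq_antimono by (auto simp: mono_on_def)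
  then have "countable {r\<in>{0<..}. \<not> isCont (\<lambda>r. - qq r s) r}"
    by (intro mono_on_ctble_discont_open) auto
  then have "{r\<in>{0<..}. \<not> isCont (\<lambda>r. - qq r s) r} \<in> null_sets lborel"
    by (rule countable_imp_null_set_lborel)
  then have "AE r in lborel. r \<notin> {r\<in>{0<..}. \<not> isCont (\<lambda>r. - qq r s) r}" by (rule AE_not_in)
  then have ae: "AE u in lborel. ennreal (indicator {0<..} u * (- deriv (\<lambda>u'. temper_tail \<alpha> q u' s) u)) = ennreal (dens u s)"
  proof eventually_elim
    case (elim u)
    show ?case
    proof (cases "0 < u")
      case u: True
      then have "isCont (\<lambda>r. - qq r s) u" using elim by auto
      then have "isCont (\<lambda>r. - (- qq r s)) u" by (rule isCont_minus)
      then have "isCont (\<lambda>r. g r s) u"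
        unfolding g_def using u by (auto intro!: continuous_intros)
      then have "((\<lambda>u. tail u s) has_real_derivative - g u s) (at u)" by (rule tail_derivative[OF u])
      then have "((\<lambda>u. pi' u s) has_real_derivative - dens u s) (at u)"
        unfolding pi'_def using u
        by (auto intro!: derivative_eq_intros simp: dens_def g_def pi'_def powr_diff powr_minus field_simps)
      then have "((\<lambda>u'. temper_tail \<alpha> q u' s) has_real_derivative - dens u s) (at u)"
        by (rule has_field_derivative_transform_within_open[where S = "{0<..}"])
          (use u temper_tail_eq[OF s] in auto)
      then show ?thesis using u by (simp add: DERIV_imp_deriv)
    qed (simp add: dens_def)
  qed
  \<comment> \<open>The measures are compared through \<open>nn_integral_cong_AE\<close>, which does
    not ask for measurability of the \<open>deriv\<close> expression.\<close>
  have "(\<lambda>A. \<integral>\<^sup>+u. ennreal (indicator {0<..} u * (- deriv (\<lambda>u'. temper_tail \<alpha> q u' s) u)) * indicator A u \<partial>lborel)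
    = (\<lambda>A. \<integral>\<^sup>+u. ennreal (dens u s) * indicator A u \<partial>lborel)"
    by (intro ext nn_integral_cong_AE, use ae in eventually_elim) auto
  then show ?thesis unfolding temper_law_def density_def by simp
qed

text \<open>The fundamental theorem for \<open>pi'\<close>, which need not be differentiable
  everywhere; hence Tonelli instead. One writes \<open>qq\<close> / u as \<open>dens\<close> plus
  \<alpha> u^(\<alpha>-1) \<open>tail\<close> and exchanges the integrals in the second summand,
  whose inner integral becomes min(y, r)^\<alpha> - x^\<alpha>. The additive form avoids subtraction
  of extended reals.\<close>

lemma dens_integral_segment:
  assumes x: "0 < x" "x < y"
  shows "(\<integral>\<^sup>+u. ennreal (if x < u \<and> u < y then dens u s else 0) \<partial>lborel) + ennreal (pi' y s) = ennreal (pi' x s)"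
proof -
  define D where "D = (\<integral>\<^sup>+u. ennreal (if x < u \<and> u < y then dens u s else 0) \<partial>lborel)"
  define A where "A = (\<integral>\<^sup>+u. ennreal (if x < u \<and> u < y then qq u s / u else 0) \<partial>lborel)"
  define B where "B = (\<integral>\<^sup>+u. ennreal (if x < u \<and> u < y then \<alpha> * u powr (\<alpha> - 1) * tail u s else 0) \<partial>lborel)"
  have "A = (\<integral>\<^sup>+u. ennreal (if x < u \<and> u < y then dens u s else 0)
      + ennreal (if x < u \<and> u < y then \<alpha> * u powr (\<alpha> - 1) * tail u s else 0) \<partial>lborel)"
    unfolding A_def
  proof (intro nn_integral_cong)
    fix u :: real
    have "qq u s / u = dens u s + \<alpha> * u powr (\<alpha> - 1) * tail u s" if "x < u"
      using x that by (simp add: dens_def pi'_def powr_diff diff_divide_distrib)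
    then show "ennreal (if x < u \<and> u < y then qq u s / u else 0) = ennreal (if x < u \<and> u < y then dens u s else 0)
      + ennreal (if x < u \<and> u < y then \<alpha> * u powr (\<alpha> - 1) * tail u s else 0)"
      using alpha_pos by (auto simp: dens_nonneg tail_nonneg intro!: ennreal_plus)
  qed
  also have "\<dots> = D + B" unfolding D_def B_def by (rule nn_integral_add) measurable
  finally have AD: "A = D + B" .
  have "B = (\<integral>\<^sup>+u. \<integral>\<^sup>+r. ennreal (if x < u \<and> u < min y r then \<alpha> * u powr (\<alpha> - 1) else 0) * ennreal (g r s) \<partial>lborel \<partial>lborel)"
    unfolding B_def
  proof (intro nn_integral_cong)
    fix u :: real
    show "ennreal (if x < u \<and> u < y then \<alpha> * u powr (\<alpha> - 1) * tail u s else 0)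
      = (\<integral>\<^sup>+r. ennreal (if x < u \<and> u < min y r then \<alpha> * u powr (\<alpha> - 1) else 0) * ennreal (g r s) \<partial>lborel)"
    proof (cases "x < u \<and> u < y")
      case True
      then have "ennreal (\<alpha> * u powr (\<alpha> - 1) * tail u s) = ennreal (\<alpha> * u powr (\<alpha> - 1)) * (\<integral>\<^sup>+r. ennreal (if u < r then g r s else 0) \<partial>lborel)"
        using x alpha_pos by (subst nn_tail) (auto simp: ennreal_mult tail_nonneg)
      also have "\<dots> = (\<integral>\<^sup>+r. ennreal (\<alpha> * u powr (\<alpha> - 1)) * ennreal (if u < r then g r s else 0) \<partial>lborel)"
        by (rule nn_integral_cmult[symmetric]) measurable
      also have "\<dots> = (\<integral>\<^sup>+r. ennreal (if x < u \<and> u < min y r then \<alpha> * u powr (\<alpha> - 1) else 0) * ennreal (g r s) \<partial>lborel)"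
        using True by (intro nn_integral_cong) auto
      finally show ?thesis using True by simp
    qed auto
  qed
  also have "\<dots> = (\<integral>\<^sup>+r. \<integral>\<^sup>+u. ennreal (if x < u \<and> u < min y r then \<alpha> * u powr (\<alpha> - 1) else 0) * ennreal (g r s) \<partial>lborel \<partial>lborel)"
    by (rule lborel_pair.Fubini') measurable
  also have "\<dots> = (\<integral>\<^sup>+r. ennreal (if x < r then (min y r powr \<alpha> - x powr \<alpha>) * g r s else 0) \<partial>lborel)"
  proof (intro nn_integral_cong)
    fix r :: real
    have "(\<integral>\<^sup>+u. ennreal (if x < u \<and> u < min y r then \<alpha> * u powr (\<alpha> - 1) else 0) * ennreal (g r s) \<partial>lborel)
      = ennreal (if x < min y r then min y r powr \<alpha> - x powr \<alpha> else 0) * ennreal (g r s)"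
      using nn_integral_powr_segment[OF alpha_pos x(1), of "min y r"]
      by (subst nn_integral_multc) auto
    also have "\<dots> = ennreal (if x < r then (min y r powr \<alpha> - x powr \<alpha>) * g r s else 0)"
      using x alpha_pos by (auto simp: ennreal_mult'[symmetric] g_nonneg ennreal_mult'' min_def)
    finally show "(\<integral>\<^sup>+u. ennreal (if x < u \<and> u < min y r then \<alpha> * u powr (\<alpha> - 1) else 0) * ennreal (g r s) \<partial>lborel)
      = ennreal (if x < r then (min y r powr \<alpha> - x powr \<alpha>) * g r s else 0)" .
  qed
  finally have B: "B = (\<integral>\<^sup>+r. ennreal (if x < r then (min y r powr \<alpha> - x powr \<alpha>) * g r s else 0) \<partial>lborel)" .
  have pi': "ennreal (pi' z s) = (\<integral>\<^sup>+r. ennreal (if z < r then z powr \<alpha> * g r s else 0) \<partial>lborel)" if "0 < z" for z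
  proof -
    have "ennreal (pi' z s) = ennreal (z powr \<alpha>) * (\<integral>\<^sup>+r. ennreal (if z < r then g r s else 0) \<partial>lborel)"
      unfolding nn_tail[OF that] by (simp add: pi'_def ennreal_mult tail_nonneg)
    also have "\<dots> = (\<integral>\<^sup>+r. ennreal (z powr \<alpha>) * ennreal (if z < r then g r s else 0) \<partial>lborel)"
      by (rule nn_integral_cmult[symmetric]) measurable
    also have "\<dots> = (\<integral>\<^sup>+r. ennreal (if z < r then z powr \<alpha> * g r s else 0) \<partial>lborel)"
      by (intro nn_integral_cong) (auto simp: ennreal_mult g_nonneg)
    finally show ?thesis .
  qed
  have "B + ennreal (pi' x s) = (\<integral>\<^sup>+r. ennreal (if x < r then (min y r powr \<alpha> - x powr \<alpha>) * g r s else 0)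
      + ennreal (if x < r then x powr \<alpha> * g r s else 0) \<partial>lborel)"
    unfolding B pi'[OF x(1)] by (rule nn_integral_add[symmetric]) measurable
  also have "\<dots> = (\<integral>\<^sup>+r. ennreal (if x < r \<and> r < y then qq r s / r else 0)
      + ennreal (if y < r then y powr \<alpha> * g r s else 0) \<partial>lborel)"
  proof (rule nn_integral_cong_AE)
    have "AE r in lborel. r \<noteq> y" by (rule AE_lborel_singleton)
    then show "AE r in lborel. ennreal (if x < r then (min y r powr \<alpha> - x powr \<alpha>) * g r s else 0)
      + ennreal (if x < r then x powr \<alpha> * g r s else 0) = ennreal (if x < r \<and> r < y then qq r s / r else 0)
      + ennreal (if y < r then y powr \<alpha> * g r s else 0)"
    proof eventually_elim
      case (elim r)
      have "ennreal ((min y r powr \<alpha> - x powr \<alpha>) * g r s) + ennreal (x powr \<alpha> * g r s) = ennreal (min y r powr \<alpha> * g r s)" if "x < r"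
        using x that alpha_pos by (subst ennreal_plus[symmetric])
          (auto simp: g_nonneg min_def algebra_simps intro!: mult_nonneg_nonneg mult_right_mono powr_mono2)
      moreover have "r powr \<alpha> * g r s = qq r s / r" if "x < r"
        using x that by (simp add: g_def powr_diff powr_minus field_simps)
      ultimately show ?case using elim x by (auto simp: min_def)
    qed
  qed
  also have "\<dots> = A + ennreal (pi' y s)"
    unfolding A_def pi'[OF less_trans[OF x]] by (rule nn_integral_add) measurable
  finally have "B + ennreal (pi' x s) = (D + B) + ennreal (pi' y s)" unfolding AD .
  \<comment> \<open>B occurs on both sides and can be cancelled only if it is finite.\<close>
  moreover have "B < \<infinity>"
  proof -
    have "B \<le> (\<integral>\<^sup>+r. ennreal (if x < r then y powr \<alpha> * g r s else 0) \<partial>lborel)"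
      unfolding B
    proof (rule nn_integral_mono)
      fix r :: real
      have "(min y r powr \<alpha> - x powr \<alpha>) * g r s \<le> y powr \<alpha> * g r s" if "x < r"
      proof (rule mult_right_mono[OF _ g_nonneg])
        have "min y r powr \<alpha> \<le> y powr \<alpha>" using x that alpha_pos by (intro powr_mono2) auto
        moreover have "0 \<le> x powr \<alpha>" by simp
        ultimately show "min y r powr \<alpha> - x powr \<alpha> \<le> y powr \<alpha>" by linarith
      qed
      then show "ennreal (if x < r then (min y r powr \<alpha> - x powr \<alpha>) * g r s else 0)
        \<le> ennreal (if x < r then y powr \<alpha> * g r s else 0)" by (auto intro: ennreal_leI)
    qed
    also have "\<dots> = ennreal (y powr \<alpha>) * ennreal (tail x s)"
    proof -
      have "ennreal (y powr \<alpha>) * ennreal (tail x s) = (\<integral>\<^sup>+r. ennreal (y powr \<alpha>) * ennreal (if x < r then g r s else 0) \<partial>lborel)"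
        unfolding nn_tail[OF x(1), symmetric] by (rule nn_integral_cmult[symmetric]) measurable
      also have "\<dots> = (\<integral>\<^sup>+r. ennreal (if x < r then y powr \<alpha> * g r s else 0) \<partial>lborel)"
        by (intro nn_integral_cong) (auto simp: ennreal_mult g_nonneg)
      finally show ?thesis by simp
    qed
    also have "\<dots> < \<infinity>" by (simp add: ennreal_mult_less_top)
    finally show ?thesis .
  qed
  ultimately have "B + (D + ennreal (pi' y s)) = B + ennreal (pi' x s)" "B \<noteq> \<top>"
    by (auto simp: ac_simps)
  then have "D + ennreal (pi' y s) = ennreal (pi' x s)"
    unfolding ennreal_add_left_cancel by simp
  then show ?thesis by (simp add: D_def)
qed

end

section \<open>Tempering laws and averaging over them\<close>

lemma tendsto_if_eventually:
  assumes "\<forall>\<^sub>F n in F. P n" "(f \<longlongrightarrow> l) F"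
  shows "((\<lambda>n. if P n then f n else z) \<longlongrightarrow> l) F"
  using assms(2) by (rule Lim_transform_eventually) (use assms(1) in \<open>auto elim: eventually_mono\<close>)

context tempering
begin

lemma pi'_tendsto_0: "((\<lambda>y. pi' y s) \<longlongrightarrow> 0) at_top"
proof (rule Lim_null_comparison)
  have "((\<lambda>y. qq y s) \<longlongrightarrow> 0) at_top"
  proof (cases "s \<in> sphere 0 1")
    case True
    have "((\<lambda>r. q r s) \<longlongrightarrow> 0) at_top" using tempering True by (auto simp: tempering_function_def)
    moreover have "\<forall>\<^sub>F r in at_top. q r s = qq r s"
      using eventually_gt_at_top[of 0] by eventually_elim (use True in \<open>auto simp: qq_def\<close>)
    ultimately show ?thesis by (rule Lim_transform_eventually)
  qed (simp add: qq_def)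
  from tendsto_divide[OF this tendsto_const[of \<alpha>]] show "((\<lambda>y. qq y s / \<alpha>) \<longlongrightarrow> 0) at_top"
    using alpha_pos by simp
  show "\<forall>\<^sub>F y in at_top. norm (pi' y s) \<le> qq y s / \<alpha>"
    using eventually_gt_at_top[of 0]
  proof eventually_elim
    case (elim y)
    show ?case using pi'_le[OF elim, of s] alpha_pos pi'_nonneg[of y s] by (simp add: field_simps)
  qed
qed

definition D :: "'a \<Rightarrow> real measure"
  where "D s = density lborel (\<lambda>u. ennreal (dens u s))"

lemma emeasure_D: "A \<in> sets borel \<Longrightarrow> emeasure (D s) A = (\<integral>\<^sup>+u. ennreal (dens u s) * indicator A u \<partial>lborel)"
  unfolding D_def by (rule emeasure_density) auto

text \<open>Exhaustion by bounded segments; the boundary term \<open>pi'\<close> at the far end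
  tends to 0.\<close>

lemma emeasure_D_greater:
  assumes x: "0 < x"
  shows "emeasure (D s) {x<..} = ennreal (pi' x s)"
proof -
  define A where "A n = {x<..<x + real (Suc n)}" for n
  have A: "emeasure (D s) (A n) + ennreal (pi' (x + real (Suc n)) s) = ennreal (pi' x s)" for n
  proof -
    have "emeasure (D s) (A n) = (\<integral>\<^sup>+u. ennreal (if x < u \<and> u < x + real (Suc n) then dens u s else 0) \<partial>lborel)"
      unfolding A_def by (subst emeasure_D) (auto intro!: nn_integral_cong)
    then show ?thesis using dens_integral_segment[of x "x + real (Suc n)" s] x by simp
  qed
  have "(\<lambda>n. emeasure (D s) (A n)) \<longlonglongrightarrow> emeasure (D s) (\<Union>n. A n)"
    by (rule Lim_emeasure_incseq) (auto simp: A_def D_def incseq_def)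
  moreover have "(\<Union>n. A n) = {x<..}"
  proof -
    have "\<exists>n. u < x + real (Suc n)" for u
    proof -
      obtain n where "u - x < real n" using reals_Archimedean2 by blast
      then show ?thesis by (intro exI[of _ n]) auto
    qed
    then show ?thesis by (auto simp: A_def)
  qed
  ultimately have "(\<lambda>n. emeasure (D s) (A n)) \<longlonglongrightarrow> emeasure (D s) {x<..}" by simp
  moreover have "(\<lambda>n. ennreal (pi' (x + real (Suc n)) s)) \<longlonglongrightarrow> ennreal 0"
  proof (intro tendsto_ennrealI)
    have "filterlim (\<lambda>n. x + real (Suc n)) at_top sequentially"
      by (intro filterlim_tendsto_add_at_top[OF tendsto_const]
          filterlim_compose[OF filterlim_real_sequentially filterlim_Suc])
    then show "(\<lambda>n. pi' (x + real (Suc n)) s) \<longlonglongrightarrow> 0" by (rule filterlim_compose[OF pi'_tendsto_0])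
  qed
  ultimately have "(\<lambda>n. emeasure (D s) (A n) + ennreal (pi' (x + real (Suc n)) s)) \<longlonglongrightarrow> emeasure (D s) {x<..} + ennreal 0"
    by (rule tendsto_add)
  then show ?thesis unfolding A by (simp add: LIMSEQ_const_iff)
qed

lemma emeasure_D_UNIV_le: "emeasure (D s) UNIV \<le> 1"
proof -
  have "(\<lambda>n. emeasure (D s) {1 / real (Suc n)<..}) \<longlonglongrightarrow> emeasure (D s) (\<Union>n. {1 / real (Suc n)<..})"
  proof (rule Lim_emeasure_incseq)
    show "incseq (\<lambda>n. {1 / real (Suc n)<..})"
    proof (intro incseq_SucI subsetI)
      fix n and u :: real
      assume "u \<in> {1 / real (Suc n)<..}"
      moreover have "1 / real (Suc (Suc n)) \<le> 1 / real (Suc n)" by (intro divide_left_mono) auto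
      ultimately show "u \<in> {1 / real (Suc (Suc n))<..}" by auto
    qed
  qed (auto simp: D_def)
  moreover have "(\<Union>n. {1 / real (Suc n)<..}) = {0::real<..}"
  proof (intro set_eqI iffI)
    fix u :: real assume "u \<in> {0<..}"
    then obtain n where "1 / real (Suc n) < u" using nat_approx_posE by auto
    then show "u \<in> (\<Union>n. {1 / real (Suc n)<..})" by auto
  next
    fix u :: real assume "u \<in> (\<Union>n. {1 / real (Suc n)<..})"
    then obtain n where "1 / real (Suc n) < u" by auto
    moreover have "0 < 1 / real (Suc n)" by simp
    ultimately show "u \<in> {0<..}" unfolding greaterThan_iff by (rule less_trans[rotated])
  qed
  ultimately have "(\<lambda>n. emeasure (D s) {1 / real (Suc n)<..}) \<longlonglongrightarrow> emeasure (D s) {0<..}" by simp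
  then have "emeasure (D s) {0<..} \<le> 1"
    by (rule LIMSEQ_le_const2) (auto simp: emeasure_D_greater pi'_le_1)
  moreover have "emeasure (D s) UNIV = emeasure (D s) {0<..}"
    by (simp add: emeasure_D) (auto intro!: nn_integral_cong simp: dens_def indicator_def)
  ultimately show ?thesis by simp
qed

lemma dens_integrable: "integrable lborel (\<lambda>u. dens u s)" "(LINT u|lborel. dens u s) \<le> 1"
proof -
  have le: "(\<integral>\<^sup>+u. ennreal (dens u s) \<partial>lborel) \<le> 1"
    using emeasure_D_UNIV_le[of s] by (simp add: emeasure_D)
  show "integrable lborel (\<lambda>u. dens u s)"
    using le by (intro integrableI_nonneg) (auto simp: dens_nonneg intro: le_less_trans)
  then have "ennreal (LINT u|lborel. dens u s) \<le> 1"
    using le by (subst nn_integral_eq_integral[symmetric]) (auto simp: dens_nonneg)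
  then show "(LINT u|lborel. dens u s) \<le> 1" by simp
qed

text \<open>The expectation of \<open>f (min \<parallel>x\<parallel> T \<cdot> x / \<parallel>x\<parallel>)\<close> if \<open>T\<close> has the law \<open>\<Pi>(\<cdot>, x / \<parallel>x\<parallel>)\<close>.\<close>

definition kf :: "('a \<Rightarrow> real) \<Rightarrow> 'a \<Rightarrow> real"
  where "kf f x = (LINT u|lborel. (if u < norm x then dens u (sgn x) * f (u *\<^sub>R sgn x) else 0)) + f x * pi' (norm x) (sgn x)"

lemma norm_scaled_sgn_le: "0 \<le> u \<Longrightarrow> norm (u *\<^sub>R sgn (x::'a)) \<le> u"
  by (simp add: norm_sgn)

text \<open>Two majorants with different purposes. The first integrates to a multiple of min(1,
  |x|^2) and bounds \<open>kf\<close>; the second does not involve the direction of x and dominates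
  when x varies.\<close>

lemma kf_integrand_bound:
  assumes f: "\<And>x. \<bar>f x\<bar> \<le> K * min 1 ((norm x)\<^sup>2)" and K: "0 \<le> K"
  shows "\<bar>if u < norm x then dens u (sgn x) * f (u *\<^sub>R sgn x) else 0\<bar> \<le> dens u (sgn x) * (K * min 1 ((norm x)\<^sup>2))"
    and "\<bar>if u < norm x then dens u (sgn x) * f (u *\<^sub>R sgn x) else 0\<bar> \<le> \<alpha> * K * indicator {0..norm x} u"
proof -
  have 1: "\<bar>dens u (sgn x) * f (u *\<^sub>R sgn x)\<bar> \<le> dens u (sgn x) * (K * min 1 (u\<^sup>2))"
  proof (cases "0 < u")
    case True
    have "(norm (u *\<^sub>R sgn x))\<^sup>2 \<le> u\<^sup>2" using norm_scaled_sgn_le[of u x] True by (intro power_mono) auto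
    then have "\<bar>f (u *\<^sub>R sgn x)\<bar> \<le> K * min 1 (u\<^sup>2)"
      by (intro order_trans[OF f] mult_left_mono K min.mono) auto
    then show ?thesis unfolding abs_mult using dens_nonneg[of u "sgn x"] by (simp add: mult_left_mono)
  qed (simp add: dens_def)
  \<comment> \<open>The singularity \<alpha> / u of the density bound is absorbed by min(1, u^2)
    \<le> u.\<close>
  have 2: "dens u (sgn x) * (K * min 1 (u\<^sup>2)) \<le> \<alpha> * K" if "0 < u"
  proof -
    have "dens u (sgn x) * (K * min 1 (u\<^sup>2)) \<le> (\<alpha> / u) * (K * min 1 (u\<^sup>2))"
      using dens_le[OF that] K by (intro mult_right_mono) auto
    also have "\<dots> = \<alpha> * K * (min 1 (u\<^sup>2) / u)" by simp
    also have "min 1 (u\<^sup>2) / u \<le> 1"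
    proof (cases "u \<le> 1")
      case True
      then have "u\<^sup>2 \<le> u" using that by (simp add: power2_eq_square mult_left_le)
      then show ?thesis using that by (simp add: divide_le_eq)
    qed (use that in \<open>auto simp: divide_le_eq\<close>)
    then have "\<alpha> * K * (min 1 (u\<^sup>2) / u) \<le> \<alpha> * K * 1" using alpha_pos K by (intro mult_left_mono) auto
    finally show ?thesis by simp
  qed
  show "\<bar>if u < norm x then dens u (sgn x) * f (u *\<^sub>R sgn x) else 0\<bar> \<le> dens u (sgn x) * (K * min 1 ((norm x)\<^sup>2))"
  proof (cases "0 < u \<and> u < norm x")
    case True
    then have "u\<^sup>2 \<le> (norm x)\<^sup>2" by (intro power_mono) auto
    then have "dens u (sgn x) * (K * min 1 (u\<^sup>2)) \<le> dens u (sgn x) * (K * min 1 ((norm x)\<^sup>2))"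
      using K by (intro mult_left_mono dens_nonneg) auto
    then show ?thesis using 1 True by simp
  next
    case False
    have "0 \<le> dens u (sgn x) * (K * min 1 ((norm x)\<^sup>2))" using K by (intro mult_nonneg_nonneg dens_nonneg) auto
    then show ?thesis using False by (auto simp: dens_def)
  qed
  show "\<bar>if u < norm x then dens u (sgn x) * f (u *\<^sub>R sgn x) else 0\<bar> \<le> \<alpha> * K * indicator {0..norm x} u"
    using 1 2 alpha_pos K by (cases "0 < u") (auto simp: indicator_def dens_def intro: order_trans)
qed

lemma kf_integrand_integrable:
  assumes [measurable]: "f \<in> borel_measurable borel"
    and f: "\<And>x. \<bar>f x\<bar> \<le> K * min 1 ((norm x)\<^sup>2)" and K: "0 \<le> K"
  shows "integrable lborel (\<lambda>u. if u < norm x then dens u (sgn x) * f (u *\<^sub>R sgn x) else 0)"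
proof (rule Bochner_Integration.integrable_bound)
  show "integrable lborel (\<lambda>u. dens u (sgn x) * (K * min 1 ((norm x)\<^sup>2)))"
    by (intro integrable_mult_left dens_integrable)
  show "AE u in lborel. norm (if u < norm x then dens u (sgn x) * f (u *\<^sub>R sgn x) else 0) \<le> norm (dens u (sgn x) * (K * min 1 ((norm x)\<^sup>2)))"
  proof (rule AE_I2)
    fix u
    show "norm (if u < norm x then dens u (sgn x) * f (u *\<^sub>R sgn x) else 0) \<le> norm (dens u (sgn x) * (K * min 1 ((norm x)\<^sup>2)))"
      using kf_integrand_bound(1)[OF f K, of u x] by (metis abs_ge_self order_trans real_norm_def)
  qed
qed measurable

text \<open>The factor 2 adds up the case of a shortened jump, where the density has mass at most 1,
  and that of an intact jump, where \<open>pi'\<close> is at most 1.\<close>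

lemma kf_bound:
  assumes fm: "f \<in> borel_measurable borel"
    and f: "\<And>x. \<bar>f x\<bar> \<le> K * min 1 ((norm x)\<^sup>2)" and K: "0 \<le> K"
  shows "\<bar>kf f x\<bar> \<le> 2 * K * min 1 ((norm x)\<^sup>2)"
proof -
  let ?m = "K * min 1 ((norm x)\<^sup>2)"
  have m: "0 \<le> ?m" using K by simp
  have "\<bar>LINT u|lborel. (if u < norm x then dens u (sgn x) * f (u *\<^sub>R sgn x) else 0)\<bar>
    \<le> (LINT u|lborel. \<bar>if u < norm x then dens u (sgn x) * f (u *\<^sub>R sgn x) else 0\<bar>)"
    by (rule integral_abs_bound)
  also have "\<dots> \<le> (LINT u|lborel. dens u (sgn x) * ?m)"
    by (intro integral_mono kf_integrand_bound(1)[OF f K] integrable_abs kf_integrand_integrable[OF fm f K]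
        integrable_mult_left dens_integrable)
  also have "\<dots> = (LINT u|lborel. dens u (sgn x)) * ?m" by (rule integral_mult_left_zero)
  also have "\<dots> \<le> 1 * ?m" using dens_integrable(2) m by (intro mult_right_mono) auto
  finally have 1: "\<bar>LINT u|lborel. (if u < norm x then dens u (sgn x) * f (u *\<^sub>R sgn x) else 0)\<bar> \<le> ?m" by simp
  have "\<bar>f x * pi' (norm x) (sgn x)\<bar> \<le> ?m"
  proof (cases "x = 0")
    case False
    then have "\<bar>f x\<bar> * \<bar>pi' (norm x) (sgn x)\<bar> \<le> ?m * 1"
      using f[of x] m pi'_le_1[of "norm x" "sgn x"] pi'_nonneg[of "norm x" "sgn x"] by (intro mult_mono) auto
    then show ?thesis by (simp add: abs_mult)
  qed (use f[of 0] in auto)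
  with 1 show ?thesis unfolding kf_def by (intro order_trans[OF abs_triangle_ineq]) simp
qed

lemma qq_continuous:
  assumes u: "0 < u" and s: "S \<longlonglongrightarrow> s" "\<forall>\<^sub>F n in sequentially. S n \<in> sphere 0 1" "s \<in> sphere 0 1"
  shows "(\<lambda>n. qq u (S n)) \<longlonglongrightarrow> qq u s"
proof -
  have "continuous_on (sphere 0 1) (q u)" using tempering u by (auto simp: tempering_function_def)
  then have "(\<lambda>n. q u (S n)) \<longlonglongrightarrow> q u s" by (rule continuous_on_tendsto_compose[OF _ s(1,3,2)])
  moreover have "\<forall>\<^sub>F n in sequentially. q u (S n) = qq u (S n)"
    using s(2) by eventually_elim (use u in \<open>auto simp: qq_def\<close>)
  ultimately have "(\<lambda>n. qq u (S n)) \<longlonglongrightarrow> q u s" by (rule Lim_transform_eventually)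
  then show ?thesis using u s(3) by (simp add: qq_def)
qed

lemma pi'_continuous:
  assumes u: "0 < u" "U \<longlonglongrightarrow> u" and s: "S \<longlonglongrightarrow> s" "\<forall>\<^sub>F n in sequentially. S n \<in> sphere 0 1" "s \<in> sphere 0 1"
  shows "(\<lambda>n. pi' (U n) (S n)) \<longlonglongrightarrow> pi' u s"
proof -
  \<comment> \<open>Clipping at u / 2 does not change the sequence eventually, but gives one
    dominating function for all n.\<close>
  define V where "V n = max (U n) (u / 2)" for n
  have V: "\<forall>\<^sub>F n in sequentially. U n = V n"
  proof -
    have "\<forall>\<^sub>F n in sequentially. u / 2 < U n" using u by (intro order_tendstoD(1)[OF u(2)]) auto
    then show ?thesis by eventually_elim (simp add: V_def)
  qed
  have Vlim: "V \<longlonglongrightarrow> u"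
    using tendsto_max[OF u(2) tendsto_const[of "u/2"]] u by (simp add: V_def[abs_def] max_def)
  have "(\<lambda>n. tail (V n) (S n)) \<longlonglongrightarrow> tail u s"
    unfolding tail_def
  proof (rule integral_dominated_convergence)
    show "integrable lborel (\<lambda>r. \<alpha> * (if u / 4 < r then r powr (- \<alpha> - 1) else 0))"
      using u by (intro integrable_mult_right integrable_powr_tail) auto
    show "AE r in lborel. norm (if V n < r then g r (S n) else 0) \<le> \<alpha> * (if u / 4 < r then r powr (- \<alpha> - 1) else 0)" for n
    proof (rule AE_I2)
      fix r
      have "u / 4 < r" if "V n < r" using that u by (simp add: V_def)
      moreover have "g r (S n) \<le> \<alpha> * r powr (- \<alpha> - 1)"
        unfolding g_def using mult_right_mono[OF qq_le, of "r powr (- \<alpha> - 1)" r "S n"] by (simp add: mult.commute)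
      ultimately show "norm (if V n < r then g r (S n) else 0) \<le> \<alpha> * (if u / 4 < r then r powr (- \<alpha> - 1) else 0)"
        using alpha_pos by (auto simp: g_nonneg)
    qed
    have "AE r in lborel. r \<noteq> u" by (rule AE_lborel_singleton)
    then show "AE r in lborel. (\<lambda>n. if V n < r then g r (S n) else 0) \<longlonglongrightarrow> (if u < r then g r s else 0)"
    proof eventually_elim
      case (elim r)
      show ?case
      proof (cases "u < r")
        case True
        have "\<forall>\<^sub>F n in sequentially. V n < r" by (rule order_tendstoD(2)[OF Vlim True])
        moreover have "(\<lambda>n. g r (S n)) \<longlonglongrightarrow> g r s"
          unfolding g_def using True u by (intro tendsto_intros qq_continuous s) auto
        ultimately show ?thesis using True by (simp add: tendsto_if_eventually)
      next
        case False
        then have "\<forall>\<^sub>F n in sequentially. r < V n" using elim by (intro order_tendstoD(1)[OF Vlim]) auto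
        then show ?thesis using False by (intro tendsto_eventually) (auto elim: eventually_mono)
      qed
    qed
  qed measurable
  then have "(\<lambda>n. pi' (V n) (S n)) \<longlonglongrightarrow> pi' u s"
    unfolding pi'_def using u Vlim by (intro tendsto_intros) auto
  then show ?thesis by (rule Lim_transform_eventually) (use V in \<open>auto elim: eventually_mono\<close>)
qed

text \<open>Away from 0 the polar coordinates converge, and continuity of q in the direction passes
  to the density and to \<open>pi'\<close>, so that dominated convergence applies. At 0 the
  direction \<open>sgn\<close> is discontinuous, and continuity comes from \<open>kf_bound\<close>
  instead.\<close>

lemma kf_continuous:
  assumes fc: "continuous_on UNIV f"
    and f: "\<And>x. \<bar>f x\<bar> \<le> K * min 1 ((norm x)\<^sup>2)" and K: "0 \<le> K"
  shows "continuous_on UNIV (kf f)"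
proof (rule continuous_at_imp_continuous_on, rule ballI, subst continuous_at_sequentially, intro allI impI)
  have fm[measurable]: "f \<in> borel_measurable borel" using fc by (rule borel_measurable_continuous_onI)
  have flim: "(\<lambda>n. f (Y n)) \<longlonglongrightarrow> f y" if "Y \<longlonglongrightarrow> y" for Y y
    using continuous_on_tendsto_compose[OF fc that] by simp
  fix x :: 'a and X :: "nat \<Rightarrow> 'a" assume X: "X \<longlonglongrightarrow> x"
  show "(kf f \<circ> X) \<longlonglongrightarrow> kf f x"
  proof (cases "x = 0")
    case True
    have "(\<lambda>n. kf f (X n)) \<longlonglongrightarrow> 0"
    proof (rule Lim_null_comparison)
      show "\<forall>\<^sub>F n in sequentially. norm (kf f (X n)) \<le> 2 * K * min 1 ((norm (X n))\<^sup>2)"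
        using kf_bound[OF fm f K] by simp
      have "(\<lambda>n. 2 * K * min 1 ((norm (X n))\<^sup>2)) \<longlonglongrightarrow> 2 * K * min 1 ((norm x)\<^sup>2)"
        by (intro tendsto_intros X)
      then show "(\<lambda>n. 2 * K * min 1 ((norm (X n))\<^sup>2)) \<longlonglongrightarrow> 0" using True by simp
    qed
    moreover have "kf f x = 0" using kf_bound[OF fm f K, of x] True by simp
    ultimately show ?thesis by (simp add: comp_def)
  next
    case False
    have S: "(\<lambda>n. sgn (X n)) \<longlonglongrightarrow> sgn x" using X False by (intro tendsto_sgn)
    have "\<forall>\<^sub>F n in sequentially. X n \<noteq> 0" using X False by (rule tendsto_imp_eventually_ne)
    then have Ssph: "\<forall>\<^sub>F n in sequentially. sgn (X n) \<in> sphere 0 1"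
      by eventually_elim (simp add: norm_sgn)
    have ssph: "sgn x \<in> sphere 0 1" using False by (simp add: norm_sgn)
    have N: "(\<lambda>n. norm (X n)) \<longlonglongrightarrow> norm x" by (intro tendsto_intros X)
    have N0: "0 < norm x" using False by simp
    obtain R where R: "\<And>n. norm (X n) \<le> R"
      using convergent_imp_Bseq[OF convergentI[OF X]] by (auto simp: Bseq_def)
    have "(\<lambda>n. LINT u|lborel. (if u < norm (X n) then dens u (sgn (X n)) * f (u *\<^sub>R sgn (X n)) else 0))
      \<longlonglongrightarrow> (LINT u|lborel. (if u < norm x then dens u (sgn x) * f (u *\<^sub>R sgn x) else 0))"
    proof (rule integral_dominated_convergence)
      show "integrable lborel (\<lambda>u. \<alpha> * K * indicator {0..R} u)"
        by (intro integrable_mult_right integrable_real_indicator) (auto simp: emeasure_lborel_Icc_eq)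
      show "AE u in lborel. norm (if u < norm (X n) then dens u (sgn (X n)) * f (u *\<^sub>R sgn (X n)) else 0)
         \<le> \<alpha> * K * indicator {0..R} u" for n
      proof (rule AE_I2)
        fix u
        have "\<alpha> * K * indicator {0..norm (X n)} u \<le> \<alpha> * K * indicator {0..R} u"
          using R[of n] alpha_pos K by (intro mult_left_mono) (auto simp: indicator_def)
        then show "norm (if u < norm (X n) then dens u (sgn (X n)) * f (u *\<^sub>R sgn (X n)) else 0)
          \<le> \<alpha> * K * indicator {0..R} u"
          using kf_integrand_bound(2)[OF f K, of u "X n"] by (simp only: real_norm_def)
      qed
      have "AE u in lborel. u \<noteq> norm x" by (rule AE_lborel_singleton)
      then show "AE u in lborel. (\<lambda>n. if u < norm (X n) then dens u (sgn (X n)) * f (u *\<^sub>R sgn (X n)) else 0)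
        \<longlonglongrightarrow> (if u < norm x then dens u (sgn x) * f (u *\<^sub>R sgn x) else 0)"
      proof eventually_elim
        case (elim u)
        consider "u \<le> 0" | "0 < u" "u < norm x" | "norm x < u" using elim by linarith
        then show ?case
        proof cases
          case 1
          then have "dens u s = 0" for s by (simp add: dens_def)
          then show ?thesis by (simp cong: if_cong)
        next
          case 2
          have "\<forall>\<^sub>F n in sequentially. u < norm (X n)" by (rule order_tendstoD(1)[OF N 2(2)])
          moreover have "(\<lambda>n. dens u (sgn (X n)) * f (u *\<^sub>R sgn (X n))) \<longlonglongrightarrow> dens u (sgn x) * f (u *\<^sub>R sgn x)"
            unfolding dens_def using 2 S Ssph ssph
            by (auto intro!: tendsto_intros qq_continuous pi'_continuous flim)
          ultimately show ?thesis using 2 by (simp add: tendsto_if_eventually)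
        next
          case 3
          have "\<forall>\<^sub>F n in sequentially. norm (X n) < u" by (rule order_tendstoD(2)[OF N 3])
          then show ?thesis using 3 by (intro tendsto_eventually) (auto elim: eventually_mono)
        qed
      qed
    qed measurable
    then show ?thesis
      unfolding comp_def kf_def by (intro tendsto_intros flim X pi'_continuous N0 N S Ssph ssph)
  qed
qed

text \<open>The integral splits at u = |x|: below, the jump is shortened to length u; above, it
  stays intact, and the mass there is \<open>pi'\<close> at |x|.\<close>

lemma nn_integral_min_dens:
  fixes f :: "'a \<Rightarrow> real"
  assumes fm[measurable]: "f \<in> borel_measurable borel" and f0: "\<And>x. 0 \<le> f x"
    and f: "\<And>x. f x \<le> K * min 1 ((norm x)\<^sup>2)" and x: "x \<noteq> 0"
  shows "(\<integral>\<^sup>+u. ennreal (dens u (sgn x)) * ennreal (f (min (norm x) u *\<^sub>R sgn x)) \<partial>lborel) = ennreal (kf f x)"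
    and "ennreal (kf f x) = (\<integral>\<^sup>+u. ennreal (if u < norm x then dens u (sgn x) * f (u *\<^sub>R sgn x) else 0) \<partial>lborel)
      + ennreal (f x * pi' (norm x) (sgn x))" and "0 \<le> kf f x"
proof -
  have K: "0 \<le> K"
  proof -
    have "0 \<le> K * min 1 ((norm x)\<^sup>2)" using f0[of x] f[of x] by linarith
    moreover have "0 < min 1 ((norm x)\<^sup>2)" using x by simp
    ultimately show ?thesis by (metis linorder_not_le mult_less_0_iff order_less_asym)
  qed
  have f': "\<bar>f x\<bar> \<le> K * min 1 ((norm x)\<^sup>2)" for x using f0 f by simp
  have I0: "0 \<le> (LINT u|lborel. (if u < norm x then dens u (sgn x) * f (u *\<^sub>R sgn x) else 0))"
    by (intro integral_nonneg_AE) (simp add: dens_nonneg f0)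
  have eq: "(\<integral>\<^sup>+u. ennreal (if u < norm x then dens u (sgn x) * f (u *\<^sub>R sgn x) else 0) \<partial>lborel)
    = ennreal (LINT u|lborel. (if u < norm x then dens u (sgn x) * f (u *\<^sub>R sgn x) else 0))"
    by (intro nn_integral_eq_integral kf_integrand_integrable[OF fm f' K]) (auto simp: dens_nonneg f0)
  show k: "ennreal (kf f x) = (\<integral>\<^sup>+u. ennreal (if u < norm x then dens u (sgn x) * f (u *\<^sub>R sgn x) else 0) \<partial>lborel)
      + ennreal (f x * pi' (norm x) (sgn x))"
    unfolding eq kf_def using I0 f0 pi'_nonneg by (simp add: ennreal_plus)
  show "0 \<le> kf f x" unfolding kf_def using I0 f0 pi'_nonneg by (intro add_nonneg_nonneg) auto
  have "(\<integral>\<^sup>+u. ennreal (dens u (sgn x)) * ennreal (f (min (norm x) u *\<^sub>R sgn x)) \<partial>lborel)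
    = (\<integral>\<^sup>+u. ennreal (if u < norm x then dens u (sgn x) * f (u *\<^sub>R sgn x) else 0)
        + ennreal (dens u (sgn x)) * indicator {norm x<..} u * ennreal (f x) \<partial>lborel)"
  proof (rule nn_integral_cong_AE)
    have "AE u in lborel. u \<noteq> norm x" by (rule AE_lborel_singleton)
    then show "AE u in lborel. ennreal (dens u (sgn x)) * ennreal (f (min (norm x) u *\<^sub>R sgn x))
      = ennreal (if u < norm x then dens u (sgn x) * f (u *\<^sub>R sgn x) else 0)
        + ennreal (dens u (sgn x)) * indicator {norm x<..} u * ennreal (f x)"
    proof eventually_elim
      case (elim u)
      have "norm x *\<^sub>R sgn x = x" using x by (simp add: sgn_div_norm)
      then show ?case using elim by (auto simp: min_def indicator_def ennreal_mult dens_nonneg f0)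
    qed
  qed
  also have "\<dots> = (\<integral>\<^sup>+u. ennreal (if u < norm x then dens u (sgn x) * f (u *\<^sub>R sgn x) else 0) \<partial>lborel)
    + (\<integral>\<^sup>+u. ennreal (dens u (sgn x)) * indicator {norm x<..} u \<partial>lborel) * ennreal (f x)"
    by (subst nn_integral_add) (auto simp: nn_integral_multc)
  also have "(\<integral>\<^sup>+u. ennreal (dens u (sgn x)) * indicator {norm x<..} u \<partial>lborel) = ennreal (pi' (norm x) (sgn x))"
    using emeasure_D_greater[of "norm x" "sgn x"] x by (simp add: emeasure_D)
  finally show "(\<integral>\<^sup>+u. ennreal (dens u (sgn x)) * ennreal (f (min (norm x) u *\<^sub>R sgn x)) \<partial>lborel) = ennreal (kf f x)"
    unfolding k by (simp add: ennreal_mult' f0 pi'_nonneg mult.commute)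
qed

end

section \<open>Joint law of the jump and its tempering variable\<close>

lemma subalgebra_vimage:
  assumes "H \<in> borel_measurable P"
  shows "subalgebra P (vimage_algebra (space P) H borel)"
  using assms unfolding subalgebra_def by (auto simp: sets_vimage_algebra2 intro: measurable_sets)

context tempering
begin

text \<open>The conditional law is prescribed for one Borel set at a time, with an exceptional null
  set that depends on it. On a rectangle a single set B occurs, so the two measures can be compared
  there, and rectangles determine a finite measure.\<close>

lemma joint_law:
  assumes P: "prob_space P" and H[measurable]: "H \<in> borel_measurable P" and T[measurable]: "T \<in> borel_measurable P"
    and H0: "measure P {\<omega> \<in> space P. H \<omega> = 0} = 0"
    and cond: "has_conditional_distr P T H (\<lambda>x. temper_law \<alpha> q (sgn x))"
  shows "distr P (borel \<Otimes>\<^sub>M borel) (\<lambda>\<omega>. (H \<omega>, T \<omega>))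
    = density (distr P borel H \<Otimes>\<^sub>M lborel) (\<lambda>(x, u). ennreal (dens u (sgn x)))" (is "?\<mu>1 = ?\<mu>2")
proof -
  interpret P: prob_space P by fact
  let ?F = "vimage_algebra (space P) H borel"
  interpret F: finite_measure_subalgebra P ?F
    by standard (rule subalgebra_vimage[OF H])
  \<comment> \<open>\<open>temper_law\<close> is identified with \<open>D\<close> at unit vectors
    only, and \<open>sgn 0 = 0\<close>; the event H = 0 has to be discarded.\<close>
  have H0': "AE \<omega> in P. H \<omega> \<noteq> 0"
    using H0 by (intro AE_I[where N = "{\<omega> \<in> space P. H \<omega> = 0}"]) (auto simp: P.emeasure_eq_measure)
  have setsp: "sets (distr P borel H \<Otimes>\<^sub>M lborel) = sets (borel \<Otimes>\<^sub>M borel)"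
    by (rule sets_pair_measure_cong) auto
  have dm[measurable]: "(\<lambda>(x, u). ennreal (dens u (sgn x))) \<in> borel_measurable (distr P borel H \<Otimes>\<^sub>M lborel)"
    unfolding measurable_cong_sets[OF setsp refl] split_beta by measurable
  have rect: "emeasure ?\<mu>1 (A \<times> B) = emeasure ?\<mu>2 (A \<times> B)" if AB[measurable]: "A \<in> sets borel" "B \<in> sets borel" for A B
  proof -
    let ?k = "\<lambda>\<omega>. measure (temper_law \<alpha> q (sgn (H \<omega>))) B"
    define A' where "A' = H -` A \<inter> space P"
    have A'F: "A' \<in> sets ?F" unfolding A'_def using AB by (intro in_vimage_algebra)
    have A'P[measurable]: "A' \<in> sets P" unfolding A'_def by measurable
    have intB: "integrable P (\<lambda>\<omega>. indicator B (T \<omega>) :: real)"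
      by (intro P.integrable_bounded[where B=1]) auto
    have "AE \<omega> in P. real_cond_exp P ?F (\<lambda>\<omega>. indicator B (T \<omega>)) \<omega> = ?k \<omega>"
      using cond AB by (auto simp: has_conditional_distr_def)
    then have ae: "AE \<omega> in P. ennreal (real_cond_exp P ?F (\<lambda>\<omega>. indicator B (T \<omega>)) \<omega>) = emeasure (D (sgn (H \<omega>))) B
       \<and> 0 \<le> real_cond_exp P ?F (\<lambda>\<omega>. indicator B (T \<omega>)) \<omega>"
      using H0'
    proof eventually_elim
      case (elim \<omega>)
      have "sgn (H \<omega>) \<in> sphere 0 1" using elim by (simp add: norm_sgn)
      then have eq: "temper_law \<alpha> q (sgn (H \<omega>)) = D (sgn (H \<omega>))" unfolding D_def by (rule temper_law_eq)
      have "emeasure (D (sgn (H \<omega>))) B \<le> emeasure (D (sgn (H \<omega>))) UNIV"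
        by (rule emeasure_mono) (auto simp: D_def)
      also have "\<dots> \<le> 1" by (rule emeasure_D_UNIV_le)
      finally have "emeasure (D (sgn (H \<omega>))) B \<noteq> \<top>" by (auto simp: top_unique)
      then have "emeasure (D (sgn (H \<omega>))) B = ennreal (measure (D (sgn (H \<omega>))) B)"
        by (rule emeasure_eq_ennreal_measure)
      then show ?case using elim eq by simp
    qed
    have intc: "integrable P (\<lambda>\<omega>. indicator A' \<omega> * real_cond_exp P ?F (\<lambda>\<omega>. indicator B (T \<omega>)) \<omega>)"
      using integrable_real_mult_indicator[OF A'P F.real_cond_exp_int(1)[OF intB]]
      by (simp only: mult.commute)
    have "emeasure ?\<mu>1 (A \<times> B) = emeasure P {\<omega> \<in> space P. H \<omega> \<in> A \<and> T \<omega> \<in> B}"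
      by (subst emeasure_distr) (auto intro!: arg_cong[where f = "emeasure P"])
    also have "\<dots> = ennreal (LINT \<omega>|P. indicator {\<omega> \<in> space P. H \<omega> \<in> A \<and> T \<omega> \<in> B} \<omega>)"
      by (simp add: P.emeasure_eq_measure)
    also have "(LINT \<omega>|P. indicator {\<omega> \<in> space P. H \<omega> \<in> A \<and> T \<omega> \<in> B} \<omega>) = (LINT \<omega>:A'|P. indicator B (T \<omega>) :: real)"
      unfolding set_lebesgue_integral_def
      by (intro Bochner_Integration.integral_cong) (auto simp: A'_def indicator_def)
    also have "\<dots> = (LINT \<omega>:A'|P. real_cond_exp P ?F (\<lambda>\<omega>. indicator B (T \<omega>)) \<omega>)"
      by (rule F.real_cond_exp_intA[OF intB A'F])
    also have "ennreal \<dots> = (\<integral>\<^sup>+\<omega>. ennreal (indicator A' \<omega> * real_cond_exp P ?F (\<lambda>\<omega>. indicator B (T \<omega>)) \<omega>) \<partial>P)"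
      unfolding set_lebesgue_integral_def using intc ae
      by (subst nn_integral_eq_integral) (auto simp: indicator_def elim: eventually_mono)
    also have "\<dots> = (\<integral>\<^sup>+\<omega>. indicator A (H \<omega>) * emeasure (D (sgn (H \<omega>))) B \<partial>P)"
    proof (rule nn_integral_cong_AE)
      show "AE \<omega> in P. ennreal (indicator A' \<omega> * real_cond_exp P ?F (\<lambda>\<omega>. indicator B (T \<omega>)) \<omega>)
         = indicator A (H \<omega>) * emeasure (D (sgn (H \<omega>))) B"
        using ae AE_space by eventually_elim (auto simp: A'_def indicator_def)
    qed
    also have "\<dots> = (\<integral>\<^sup>+x. (\<integral>\<^sup>+u. ennreal (dens u (sgn x)) * indicator (A \<times> B) (x, u) \<partial>lborel) \<partial>distr P borel H)"
    proof -
      have "(\<integral>\<^sup>+x. (\<integral>\<^sup>+u. ennreal (dens u (sgn x)) * indicator (A \<times> B) (x, u) \<partial>lborel) \<partial>distr P borel H)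
        = (\<integral>\<^sup>+\<omega>. (\<integral>\<^sup>+u. ennreal (dens u (sgn (H \<omega>))) * indicator (A \<times> B) (H \<omega>, u) \<partial>lborel) \<partial>P)"
        by (rule nn_integral_distr) measurable
      also have "\<dots> = (\<integral>\<^sup>+\<omega>. indicator A (H \<omega>) * emeasure (D (sgn (H \<omega>))) B \<partial>P)"
        using AB(2) by (intro nn_integral_cong) (auto simp: emeasure_D indicator_def)
      finally show ?thesis by simp
    qed
    also have "\<dots> = (\<integral>\<^sup>+z. (case z of (x, u) \<Rightarrow> ennreal (dens u (sgn x))) * indicator (A \<times> B) z \<partial>(distr P borel H \<Otimes>\<^sub>M lborel))"
      by (subst lborel.nn_integral_fst[symmetric]) (auto simp: setsp)
    also have "\<dots> = emeasure ?\<mu>2 (A \<times> B)"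
      by (subst emeasure_density) (auto simp: setsp)
    finally show ?thesis .
  qed
  show ?thesis
  proof (rule measure_eqI_generator_eq[where E = "{A \<times> B | A B. A \<in> sets borel \<and> B \<in> sets borel}" and \<Omega> = UNIV and A = "\<lambda>_. UNIV"])
    show "Int_stable {A \<times> B | A B. A \<in> sets (borel :: 'a measure) \<and> B \<in> sets (borel :: real measure)}"
      using Int_stable_pair_measure_generator[of "borel :: 'a measure" "borel :: real measure"] .
    show "sets ?\<mu>1 = sigma_sets UNIV {A \<times> B | A B. A \<in> sets borel \<and> B \<in> sets borel}"
      by (simp add: sets_pair_measure)
    show "sets ?\<mu>2 = sigma_sets UNIV {A \<times> B | A B. A \<in> sets borel \<and> B \<in> sets borel}"
      using setsp by (simp add: sets_pair_measure)
    show "range (\<lambda>_::nat. UNIV) \<subseteq> {A \<times> B | A B. A \<in> sets (borel :: 'a measure) \<and> B \<in> sets (borel :: real measure)}"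
      by (auto intro!: exI[of _ UNIV])
    show "emeasure ?\<mu>1 UNIV \<noteq> \<infinity>"
      using sets.top[of "borel \<Otimes>\<^sub>M borel :: ('a \<times> real) measure"]
      by (subst emeasure_distr) (auto simp: P.emeasure_eq_measure space_pair_measure)
  qed (auto intro: rect)
qed

lemma joint_nn_integral:
  assumes P: "prob_space P" and H[measurable]: "H \<in> borel_measurable P" and T[measurable]: "T \<in> borel_measurable P"
    and H0: "measure P {\<omega> \<in> space P. H \<omega> = 0} = 0"
    and cond: "has_conditional_distr P T H (\<lambda>x. temper_law \<alpha> q (sgn x))"
    and F: "F \<in> borel_measurable (borel \<Otimes>\<^sub>M borel)"
  shows "(\<integral>\<^sup>+\<omega>. F (H \<omega>, T \<omega>) \<partial>P) = (\<integral>\<^sup>+\<omega>. (\<integral>\<^sup>+u. ennreal (dens u (sgn (H \<omega>))) * F (H \<omega>, u) \<partial>lborel) \<partial>P)"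
proof -
  note [measurable] = F
  have setsp: "sets (distr P borel H \<Otimes>\<^sub>M lborel) = sets (borel \<Otimes>\<^sub>M borel)"
    by (rule sets_pair_measure_cong) auto
  have dm[measurable]: "(\<lambda>(x, u). ennreal (dens u (sgn x))) \<in> borel_measurable (distr P borel H \<Otimes>\<^sub>M lborel)"
    unfolding measurable_cong_sets[OF setsp refl] split_beta by measurable
  have Fm[measurable]: "F \<in> borel_measurable (distr P borel H \<Otimes>\<^sub>M lborel)"
    unfolding measurable_cong_sets[OF setsp refl] by (rule F)
  have "(\<integral>\<^sup>+\<omega>. F (H \<omega>, T \<omega>) \<partial>P) = (\<integral>\<^sup>+z. F z \<partial>distr P (borel \<Otimes>\<^sub>M borel) (\<lambda>\<omega>. (H \<omega>, T \<omega>)))"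
    by (subst nn_integral_distr) auto
  also have "\<dots> = (\<integral>\<^sup>+z. (case z of (x, u) \<Rightarrow> ennreal (dens u (sgn x))) * F z \<partial>(distr P borel H \<Otimes>\<^sub>M lborel))"
    unfolding joint_law[OF P H T H0 cond] by (rule nn_integral_density) measurable
  also have "\<dots> = (\<integral>\<^sup>+x. (\<integral>\<^sup>+u. ennreal (dens u (sgn x)) * F (x, u) \<partial>lborel) \<partial>distr P borel H)"
    by (subst lborel.nn_integral_fst[symmetric]) auto
  also have "\<dots> = (\<integral>\<^sup>+\<omega>. (\<integral>\<^sup>+u. ennreal (dens u (sgn (H \<omega>))) * F (H \<omega>, u) \<partial>lborel) \<partial>P)"
    by (subst nn_integral_distr) measurable
  finally show ?thesis .
qed

end

section \<open>Integration in polar coordinates\<close>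

lemma nn_integral_polar:
  fixes \<sigma> :: "'a::euclidean_space measure"
  assumes \<sigma>: "spherical_measure \<sigma>"
    and h[measurable]: "(\<lambda>z. h' (fst z) (snd z)) \<in> borel_measurable (borel \<Otimes>\<^sub>M borel)"
    and eq: "\<And>r s. 0 < r \<Longrightarrow> s \<in> sphere 0 1 \<Longrightarrow> h r s = h' r s"
    and f[measurable]: "f \<in> borel_measurable borel"
  shows "(\<integral>\<^sup>+x. f x \<partial>polar_levy_measure \<alpha> h \<sigma>)
    = (\<integral>\<^sup>+s. (\<integral>\<^sup>+r. (if 0 < r then ennreal (r powr (- \<alpha> - 1) * h' r s) * f (r *\<^sub>R s) else 0) \<partial>lborel) \<partial>\<sigma>)"
proof -
  let ?L = "restrict_space lborel {0::real<..}"
  have sets: "sets \<sigma> = sets (restrict_space borel (sphere 0 1))" and fin: "finite_measure \<sigma>"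
    using \<sigma> by (auto simp: spherical_measure_def)
  interpret \<sigma>: finite_measure \<sigma> by fact
  interpret L: sigma_finite_measure ?L by (intro sigma_finite_measure_restrict_space lborel.sigma_finite_measure_axioms) auto
  interpret pair_sigma_finite ?L \<sigma> ..
  have space: "space \<sigma> = sphere 0 1"
    using sets_eq_imp_space_eq[OF sets] by (simp add: space_restrict_space)
  have [measurable]: "(\<lambda>s. s) \<in> borel_measurable \<sigma>"
    unfolding measurable_cong_sets[OF sets refl] by (simp add: measurable_restrict_space1)
  have [measurable]: "(\<lambda>r. r) \<in> borel_measurable ?L" by (simp add: measurable_restrict_space1)
  have hm[measurable]: "(\<lambda>z. h' (f1 z) (f2 z)) \<in> borel_measurable N"
    if [measurable]: "f1 \<in> borel_measurable N" "f2 \<in> borel_measurable N" for f1 f2 and N :: "'z measure"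
    using measurable_compose[OF _ h, of "\<lambda>z. (f1 z, f2 z)" N] by simp
  let ?w = "\<lambda>(r, s). ennreal (r powr (- \<alpha> - 1) * h r s)"
  \<comment> \<open>The radial weight h is controlled only for r > 0 and unit vectors s; the
    globally measurable h' agrees with it there.\<close>
  have w: "?w \<in> borel_measurable (?L \<Otimes>\<^sub>M \<sigma>)"
  proof (subst measurable_cong)
    show "?w z = ennreal (fst z powr (- \<alpha> - 1) * h' (fst z) (snd z))" if "z \<in> space (?L \<Otimes>\<^sub>M \<sigma>)" for z
      using that eq by (auto simp: space_pair_measure space_restrict_space space)
  qed measurable
  have "(\<integral>\<^sup>+x. f x \<partial>polar_levy_measure \<alpha> h \<sigma>) = (\<integral>\<^sup>+z. f (case z of (r, s) \<Rightarrow> r *\<^sub>R s) \<partial>density (?L \<Otimes>\<^sub>M \<sigma>) ?w)"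
    unfolding polar_levy_measure_def by (rule nn_integral_distr) (auto simp: split_beta)
  also have "\<dots> = (\<integral>\<^sup>+z. ?w z * f (case z of (r, s) \<Rightarrow> r *\<^sub>R s) \<partial>(?L \<Otimes>\<^sub>M \<sigma>))"
    by (rule nn_integral_density[OF w]) (auto simp: split_beta)
  also have "\<dots> = (\<integral>\<^sup>+z. ennreal (fst z powr (- \<alpha> - 1) * h' (fst z) (snd z)) * f (fst z *\<^sub>R snd z) \<partial>(?L \<Otimes>\<^sub>M \<sigma>))"
    using eq by (intro nn_integral_cong) (auto simp: space_pair_measure space_restrict_space space)
  also have "\<dots> = (\<integral>\<^sup>+s. (\<integral>\<^sup>+r. ennreal (r powr (- \<alpha> - 1) * h' r s) * f (r *\<^sub>R s) \<partial>?L) \<partial>\<sigma>)"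
    by (subst nn_integral_snd[symmetric]) auto
  also have "\<dots> = (\<integral>\<^sup>+s. (\<integral>\<^sup>+r. (if 0 < r then ennreal (r powr (- \<alpha> - 1) * h' r s) * f (r *\<^sub>R s) else 0) \<partial>lborel) \<partial>\<sigma>)"
    by (subst nn_integral_restrict_space) (auto intro!: nn_integral_cong simp: indicator_def)
  finally show ?thesis .
qed

lemma nn_integral_polar_1:
  fixes \<sigma> :: "'a::euclidean_space measure"
  assumes \<sigma>: "spherical_measure \<sigma>" and f: "f \<in> borel_measurable borel"
  shows "(\<integral>\<^sup>+x. f x \<partial>polar_levy_measure \<alpha> (\<lambda>_ _. 1) \<sigma>)
    = (\<integral>\<^sup>+s. (\<integral>\<^sup>+r. (if 0 < r then ennreal (r powr (- \<alpha> - 1)) * f (r *\<^sub>R s) else 0) \<partial>lborel) \<partial>\<sigma>)"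
  using nn_integral_polar[OF \<sigma> _ _ f, of "\<lambda>_ _. 1" "\<lambda>_ _. 1" \<alpha>]
  by (simp only: mult_1_right borel_measurable_const simp_thms)

lemma measurable_spherical_id:
  "spherical_measure \<sigma> \<Longrightarrow> (\<lambda>s. s) \<in> borel_measurable \<sigma>"
  by (auto simp: spherical_measure_def measurable_restrict_space1 cong: measurable_cong_sets)

lemma space_spherical: "spherical_measure \<sigma> \<Longrightarrow> space \<sigma> = sphere 0 1"
  unfolding spherical_measure_def using sets_eq_imp_space_eq[of \<sigma> "restrict_space borel (sphere 0 1)"]
  by (auto simp: space_restrict_space)

text \<open>Homogeneity of the stable Levy measure, by the substitution of t r for r in each
  direction.\<close>

lemma nn_integral_polar_scale:
  fixes \<sigma> :: "'a::euclidean_space measure"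
  assumes \<sigma>: "spherical_measure \<sigma>" and f[measurable]: "f \<in> borel_measurable borel" and t: "0 < t"
  shows "(\<integral>\<^sup>+x. f (t *\<^sub>R x) \<partial>polar_levy_measure \<alpha> (\<lambda>_ _. 1) \<sigma>)
    = ennreal (t powr \<alpha>) * (\<integral>\<^sup>+x. f x \<partial>polar_levy_measure \<alpha> (\<lambda>_ _. 1) \<sigma>)"
proof -
  note [measurable] = measurable_spherical_id[OF \<sigma>]
  have "(\<integral>\<^sup>+r. (if 0 < r then ennreal (r powr (- \<alpha> - 1)) * f (t *\<^sub>R (r *\<^sub>R s)) else 0) \<partial>lborel)
    = ennreal (t powr \<alpha>) * (\<integral>\<^sup>+r. (if 0 < r then ennreal (r powr (- \<alpha> - 1)) * f (r *\<^sub>R s) else 0) \<partial>lborel)" for s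
  proof -
    have affine: "(\<integral>\<^sup>+r. G r \<partial>lborel) = ennreal t * (\<integral>\<^sup>+r. G (t * r) \<partial>lborel)" if "G \<in> borel_measurable borel" for G
      using nn_integral_real_affine[OF that, of t 0] t by simp
    have "ennreal (t powr \<alpha>) * (\<integral>\<^sup>+r. (if 0 < r then ennreal (r powr (- \<alpha> - 1)) * f (r *\<^sub>R s) else 0) \<partial>lborel)
      = ennreal (t powr \<alpha>) * (ennreal t * (\<integral>\<^sup>+r. (if 0 < t * r then ennreal ((t * r) powr (- \<alpha> - 1)) * f ((t * r) *\<^sub>R s) else 0) \<partial>lborel))"
      by (subst affine) measurable
    also have "\<dots> = (\<integral>\<^sup>+r. ennreal (t powr \<alpha> * t) * (if 0 < t * r then ennreal ((t * r) powr (- \<alpha> - 1)) * f ((t * r) *\<^sub>R s) else 0) \<partial>lborel)"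
      using t by (subst nn_integral_cmult) (auto simp: ennreal_mult mult.assoc)
    also have "\<dots> = (\<integral>\<^sup>+r. (if 0 < r then ennreal (r powr (- \<alpha> - 1)) * f (t *\<^sub>R (r *\<^sub>R s)) else 0) \<partial>lborel)"
    proof (intro nn_integral_cong)
      fix r :: real
      have "t powr \<alpha> * t * (t * r) powr (- \<alpha> - 1) = r powr (- \<alpha> - 1)" if "0 < r"
        using t that by (simp add: powr_mult powr_diff powr_minus field_simps)
      then have "ennreal (t powr \<alpha> * t) * ennreal ((t * r) powr (- \<alpha> - 1)) = ennreal (r powr (- \<alpha> - 1))" if "0 < r"
        using t that by (subst ennreal_mult[symmetric]) auto
      then show "ennreal (t powr \<alpha> * t) * (if 0 < t * r then ennreal ((t * r) powr (- \<alpha> - 1)) * f ((t * r) *\<^sub>R s) else 0)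
        = (if 0 < r then ennreal (r powr (- \<alpha> - 1)) * f (t *\<^sub>R (r *\<^sub>R s)) else 0)"
        using t by (auto simp: mult.assoc[symmetric] zero_less_mult_iff)
    qed
    finally show ?thesis by simp
  qed
  then show ?thesis
    by (simp add: nn_integral_polar_1[OF \<sigma>] nn_integral_cmult)
qed

lemma emeasure_polar_tail:
  fixes \<sigma> :: "'a::euclidean_space measure"
  assumes \<sigma>: "spherical_measure \<sigma>" and a: "0 < \<alpha>" and y: "0 < y"
  shows "emeasure (polar_levy_measure \<alpha> (\<lambda>_ _. 1) \<sigma>) {x. y < norm x} = ennreal (measure \<sigma> (sphere 0 1) * (y powr (- \<alpha>) / \<alpha>))"
proof -
  interpret finite_measure \<sigma> using \<sigma> by (simp add: spherical_measure_def)
  have "emeasure (polar_levy_measure \<alpha> (\<lambda>_ _. 1) \<sigma>) {x. y < norm x}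
    = (\<integral>\<^sup>+x. indicator {x. y < norm x} x \<partial>polar_levy_measure \<alpha> (\<lambda>_ _. 1) \<sigma>)"
    by (rule nn_integral_indicator[symmetric]) (simp add: polar_levy_measure_def)
  also have "\<dots> = (\<integral>\<^sup>+s. (\<integral>\<^sup>+r. (if 0 < r then ennreal (r powr (- \<alpha> - 1)) * indicator {x. y < norm x} (r *\<^sub>R s) else 0) \<partial>lborel) \<partial>\<sigma>)"
    by (rule nn_integral_polar_1[OF \<sigma>]) measurable
  also have "\<dots> = (\<integral>\<^sup>+s. ennreal (y powr (- \<alpha>) / \<alpha>) \<partial>\<sigma>)"
  proof (rule nn_integral_cong)
    fix s assume "s \<in> space \<sigma>"
    then have "norm s = 1" using space_spherical[OF \<sigma>] by simp
    then have "(\<integral>\<^sup>+r. (if 0 < r then ennreal (r powr (- \<alpha> - 1)) * indicator {x. y < norm x} (r *\<^sub>R s) else 0) \<partial>lborel)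
      = (\<integral>\<^sup>+r. ennreal (if y < r then r powr (- \<alpha> - 1) else 0) \<partial>lborel)"
      using y by (intro nn_integral_cong) (auto simp: indicator_def)
    then show "(\<integral>\<^sup>+r. (if 0 < r then ennreal (r powr (- \<alpha> - 1)) * indicator {x. y < norm x} (r *\<^sub>R s) else 0) \<partial>lborel)
      = ennreal (y powr (- \<alpha>) / \<alpha>)" using nn_integral_powr_tail[OF a y] by simp
  qed
  also have "\<dots> = ennreal (measure \<sigma> (sphere 0 1) * (y powr (- \<alpha>) / \<alpha>))"
    using a by (simp add: space_spherical[OF \<sigma>] emeasure_eq_measure ennreal_mult'[symmetric] mult.commute)
  finally show ?thesis .
qed

context tempering
begin

text \<open>Averaging \<alpha> M0 over the tempering variable yields M. A jump shortened to length u
  may come from any r > u, which integrates to u^(-\<alpha>) \<open>dens\<close>; intact jumps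
  contribute \<alpha> r^(-\<alpha>-1) \<open>pi'\<close>. By the formula for \<open>dens\<close> the
  terms with \<open>pi'\<close> cancel, and r^(-\<alpha>-1) q is left.\<close>

lemma nn_integral_kf_polar:
  fixes f :: "'a \<Rightarrow> real"
  assumes \<sigma>: "spherical_measure \<sigma>" and fc: "continuous_on UNIV f" and f0: "\<And>x. 0 \<le> f x"
    and f: "\<And>x. f x \<le> K * min 1 ((norm x)\<^sup>2)" and K: "0 \<le> K"
  shows "ennreal \<alpha> * (\<integral>\<^sup>+x. ennreal (kf f x) \<partial>polar_levy_measure \<alpha> (\<lambda>_ _. 1) \<sigma>)
    = (\<integral>\<^sup>+x. ennreal (f x) \<partial>polar_levy_measure \<alpha> q \<sigma>)"
proof -
  note [measurable] = measurable_spherical_id[OF \<sigma>]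
  have fm[measurable]: "f \<in> borel_measurable borel" using fc by (rule borel_measurable_continuous_onI)
  have kc: "continuous_on UNIV (kf f)" by (rule kf_continuous[OF fc _ K]) (use f0 f in auto)
  have [measurable]: "kf f \<in> borel_measurable borel" using kc by (rule borel_measurable_continuous_onI)
  have inner: "ennreal \<alpha> * (\<integral>\<^sup>+r. (if 0 < r then ennreal (r powr (- \<alpha> - 1)) * ennreal (kf f (r *\<^sub>R s)) else 0) \<partial>lborel)
    = (\<integral>\<^sup>+r. (if 0 < r then ennreal (r powr (- \<alpha> - 1) * qq r s) * ennreal (f (r *\<^sub>R s)) else 0) \<partial>lborel)"
    if "s \<in> space \<sigma>" for s
  proof -
    have s: "norm s = 1" using that space_spherical[OF \<sigma>] by simp
    have kfr: "ennreal (kf f (r *\<^sub>R s)) = (\<integral>\<^sup>+u. ennreal (if u < r then dens u s * f (u *\<^sub>R s) else 0) \<partial>lborel)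
      + ennreal (f (r *\<^sub>R s) * pi' r s)" if "0 < r" for r
    proof -
      have n: "norm (r *\<^sub>R s) = r" and g: "sgn (r *\<^sub>R s) = s" and nz: "r *\<^sub>R s \<noteq> 0"
        using that s by (auto simp: sgn_div_norm)
      show ?thesis using nn_integral_min_dens(2)[OF fm f0 f nz] unfolding n g .
    qed
    have "ennreal \<alpha> * (\<integral>\<^sup>+r. (if 0 < r then ennreal (r powr (- \<alpha> - 1)) * ennreal (kf f (r *\<^sub>R s)) else 0) \<partial>lborel)
      = (\<integral>\<^sup>+r. ennreal \<alpha> * (if 0 < r then ennreal (r powr (- \<alpha> - 1)) * ennreal (kf f (r *\<^sub>R s)) else 0) \<partial>lborel)"
      by (rule nn_integral_cmult[symmetric]) measurable
    also have "\<dots> = (\<integral>\<^sup>+r. (\<integral>\<^sup>+u. ennreal (if 0 < r \<and> u < r then (\<alpha> * r powr (- \<alpha> - 1)) * (dens u s * f (u *\<^sub>R s)) else 0) \<partial>lborel)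
       + ennreal (if 0 < r then (\<alpha> * r powr (- \<alpha> - 1)) * (f (r *\<^sub>R s) * pi' r s) else 0) \<partial>lborel)"
    proof (intro nn_integral_cong)
      fix r :: real
      show "ennreal \<alpha> * (if 0 < r then ennreal (r powr (- \<alpha> - 1)) * ennreal (kf f (r *\<^sub>R s)) else 0)
        = (\<integral>\<^sup>+u. ennreal (if 0 < r \<and> u < r then (\<alpha> * r powr (- \<alpha> - 1)) * (dens u s * f (u *\<^sub>R s)) else 0) \<partial>lborel)
         + ennreal (if 0 < r then (\<alpha> * r powr (- \<alpha> - 1)) * (f (r *\<^sub>R s) * pi' r s) else 0)"
      proof (cases "0 < r")
        case True
        have "(\<integral>\<^sup>+u. ennreal (if u < r then (\<alpha> * r powr (- \<alpha> - 1)) * (dens u s * f (u *\<^sub>R s)) else 0) \<partial>lborel)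
          = (\<integral>\<^sup>+u. ennreal (\<alpha> * r powr (- \<alpha> - 1)) * ennreal (if u < r then dens u s * f (u *\<^sub>R s) else 0) \<partial>lborel)"
          using alpha_pos by (intro nn_integral_cong) (auto simp: ennreal_mult dens_nonneg f0)
        also have "\<dots> = ennreal (\<alpha> * r powr (- \<alpha> - 1)) * (\<integral>\<^sup>+u. ennreal (if u < r then dens u s * f (u *\<^sub>R s) else 0) \<partial>lborel)"
          by (rule nn_integral_cmult) measurable
        finally show ?thesis
          using True alpha_pos kfr[OF True]
          by (simp add: ennreal_mult f0 pi'_nonneg distrib_left mult.assoc)
      qed simp
    qed
    also have "\<dots> = (\<integral>\<^sup>+r. (\<integral>\<^sup>+u. ennreal (if 0 < r \<and> u < r then (\<alpha> * r powr (- \<alpha> - 1)) * (dens u s * f (u *\<^sub>R s)) else 0) \<partial>lborel) \<partial>lborel)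
       + (\<integral>\<^sup>+r. ennreal (if 0 < r then (\<alpha> * r powr (- \<alpha> - 1)) * (f (r *\<^sub>R s) * pi' r s) else 0) \<partial>lborel)"
      by (rule nn_integral_add) measurable
    also have "(\<integral>\<^sup>+r. (\<integral>\<^sup>+u. ennreal (if 0 < r \<and> u < r then (\<alpha> * r powr (- \<alpha> - 1)) * (dens u s * f (u *\<^sub>R s)) else 0) \<partial>lborel) \<partial>lborel)
      = (\<integral>\<^sup>+u. (\<integral>\<^sup>+r. ennreal (if 0 < r \<and> u < r then (\<alpha> * r powr (- \<alpha> - 1)) * (dens u s * f (u *\<^sub>R s)) else 0) \<partial>lborel) \<partial>lborel)"
      by (rule lborel_pair.Fubini') measurable
    also have "\<dots> = (\<integral>\<^sup>+u. ennreal (if 0 < u then u powr (- \<alpha>) * (dens u s * f (u *\<^sub>R s)) else 0) \<partial>lborel)"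
    proof (intro nn_integral_cong)
      fix u :: real
      show "(\<integral>\<^sup>+r. ennreal (if 0 < r \<and> u < r then (\<alpha> * r powr (- \<alpha> - 1)) * (dens u s * f (u *\<^sub>R s)) else 0) \<partial>lborel)
        = ennreal (if 0 < u then u powr (- \<alpha>) * (dens u s * f (u *\<^sub>R s)) else 0)"
      proof (cases "0 < u")
        case True
        have "(\<integral>\<^sup>+r. ennreal (if 0 < r \<and> u < r then (\<alpha> * r powr (- \<alpha> - 1)) * (dens u s * f (u *\<^sub>R s)) else 0) \<partial>lborel)
          = (\<integral>\<^sup>+r. ennreal (\<alpha> * (dens u s * f (u *\<^sub>R s))) * ennreal (if u < r then r powr (- \<alpha> - 1) else 0) \<partial>lborel)"
          using True alpha_pos by (intro nn_integral_cong) (auto simp: ennreal_mult[symmetric] dens_nonneg f0 mult_ac)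
        also have "\<dots> = ennreal (\<alpha> * (dens u s * f (u *\<^sub>R s))) * ennreal (u powr (- \<alpha>) / \<alpha>)"
          using nn_integral_powr_tail[OF alpha_pos True] by (subst nn_integral_cmult) auto
        also have "\<dots> = ennreal (u powr (- \<alpha>) * (dens u s * f (u *\<^sub>R s)))"
          using alpha_pos by (subst ennreal_mult[symmetric]) (auto simp: dens_nonneg f0)
        finally show ?thesis using True by simp
      qed (simp add: dens_def cong: if_cong)
    qed
    also have "\<dots> + (\<integral>\<^sup>+r. ennreal (if 0 < r then (\<alpha> * r powr (- \<alpha> - 1)) * (f (r *\<^sub>R s) * pi' r s) else 0) \<partial>lborel)
      = (\<integral>\<^sup>+r. ennreal (if 0 < r then r powr (- \<alpha>) * (dens r s * f (r *\<^sub>R s)) else 0)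
        + ennreal (if 0 < r then (\<alpha> * r powr (- \<alpha> - 1)) * (f (r *\<^sub>R s) * pi' r s) else 0) \<partial>lborel)"
      by (rule nn_integral_add[symmetric]) measurable
    also have "\<dots> = (\<integral>\<^sup>+r. (if 0 < r then ennreal (r powr (- \<alpha> - 1) * qq r s) * ennreal (f (r *\<^sub>R s)) else 0) \<partial>lborel)"
    proof (intro nn_integral_cong)
      fix r :: real
      have "r powr (- \<alpha>) * (dens r s * f (r *\<^sub>R s)) + (\<alpha> * r powr (- \<alpha> - 1)) * (f (r *\<^sub>R s) * pi' r s)
        = r powr (- \<alpha> - 1) * qq r s * f (r *\<^sub>R s)" if "0 < r"
        using that by (simp add: dens_def powr_diff field_simps)
      then show "ennreal (if 0 < r then r powr (- \<alpha>) * (dens r s * f (r *\<^sub>R s)) else 0)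
        + ennreal (if 0 < r then (\<alpha> * r powr (- \<alpha> - 1)) * (f (r *\<^sub>R s) * pi' r s) else 0)
        = (if 0 < r then ennreal (r powr (- \<alpha> - 1) * qq r s) * ennreal (f (r *\<^sub>R s)) else 0)"
        using alpha_pos by (auto simp: ennreal_plus[symmetric] ennreal_mult[symmetric] dens_nonneg f0 pi'_nonneg qq_nonneg simp del: ennreal_plus)
    qed
    finally show ?thesis .
  qed
  have "ennreal \<alpha> * (\<integral>\<^sup>+x. ennreal (kf f x) \<partial>polar_levy_measure \<alpha> (\<lambda>_ _. 1) \<sigma>)
    = (\<integral>\<^sup>+s. ennreal \<alpha> * (\<integral>\<^sup>+r. (if 0 < r then ennreal (r powr (- \<alpha> - 1)) * ennreal (kf f (r *\<^sub>R s)) else 0) \<partial>lborel) \<partial>\<sigma>)"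
    by (subst nn_integral_polar_1[OF \<sigma>]) (auto simp: nn_integral_cmult)
  also have "\<dots> = (\<integral>\<^sup>+s. (\<integral>\<^sup>+r. (if 0 < r then ennreal (r powr (- \<alpha> - 1) * qq r s) * ennreal (f (r *\<^sub>R s)) else 0) \<partial>lborel) \<partial>\<sigma>)"
    using inner by (rule nn_integral_cong)
  also have "\<dots> = (\<integral>\<^sup>+x. ennreal (f x) \<partial>polar_levy_measure \<alpha> q \<sigma>)"
  proof (rule nn_integral_polar[OF \<sigma>, symmetric])
    show "(\<lambda>z. qq (fst z) (snd z)) \<in> borel_measurable (borel \<Otimes>\<^sub>M borel)" by measurable
    show "q r s = qq r s" if "0 < r" "s \<in> sphere 0 1" for r s using that by (simp add: qq_def)
  qed measurable
  finally show ?thesis .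
qed

end

section \<open>Norming constants and quantiles\<close>

text \<open>Piecewise linear interpolation between 0 up to y and 1 from z on: a continuous
  substitute for tail indicators, to which \<open>functional_limit\<close> applies.\<close>

definition ramp :: "real \<Rightarrow> real \<Rightarrow> real \<Rightarrow> real"
  where "ramp y z r = min 1 (max 0 ((r - y) / (z - y)))"

lemma ramp_props:
  assumes "0 < y" "y < z"
  shows "continuous_on UNIV (\<lambda>x::'a::real_normed_vector. ramp y z (norm x))"
    and "\<bar>ramp y z (norm (x::'a))\<bar> \<le> 1 / min 1 (y\<^sup>2) * min 1 ((norm x)\<^sup>2)"
    and "ramp y z r \<le> indicator {y<..} r" and "indicator {z<..} r \<le> ramp y z r"
proof -
  show "continuous_on UNIV (\<lambda>x::'a. ramp y z (norm x))"
    unfolding ramp_def using assms by (intro continuous_intros) auto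
  show i: "ramp y z r \<le> indicator {y<..} r" for r
    using assms by (auto simp: ramp_def indicator_def divide_le_0_iff)
  show "indicator {z<..} r \<le> ramp y z r"
    using assms by (auto simp: ramp_def indicator_def le_divide_eq)
  have r0: "0 \<le> ramp y z r" for r by (simp add: ramp_def)
  show "\<bar>ramp y z (norm x)\<bar> \<le> 1 / min 1 (y\<^sup>2) * min 1 ((norm x)\<^sup>2)"
  proof (cases "y < norm x")
    case True
    then have "y\<^sup>2 \<le> (norm x)\<^sup>2" using assms by (intro power_mono) auto
    then have "min 1 (y\<^sup>2) \<le> min 1 ((norm x)\<^sup>2)" by auto
    moreover have "0 < min 1 (y\<^sup>2)" using assms by simp
    ultimately have "1 \<le> 1 / min 1 (y\<^sup>2) * min 1 ((norm x)\<^sup>2)" by (simp add: le_divide_eq)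
    moreover have "ramp y z (norm x) \<le> 1" by (simp add: ramp_def)
    ultimately show ?thesis unfolding abs_of_nonneg[OF r0] by (rule order_trans[rotated])
  next
    case False
    then have "ramp y z (norm x) = 0" using i[of "norm x"] r0[of "norm x"] by simp
    moreover have "0 \<le> 1 / min 1 (y\<^sup>2) * min 1 ((norm x)\<^sup>2)" using assms by (intro mult_nonneg_nonneg) auto
    ultimately show ?thesis by simp
  qed
qed

context attracted
begin

lemma tail_measure:
  assumes "0 < y" "y < z"
  shows "(LINT x|M. ramp y z (norm x)) \<le> measure M {x. y < norm x}"
    "measure M {x. z < norm x} \<le> (LINT x|M. ramp y z (norm x))"
    "measure \<mu> {x. c n * z < norm x} \<le> (LINT x|\<mu>. ramp y z (norm (x /\<^sub>R c n)))"
    "(LINT x|\<mu>. ramp y z (norm (x /\<^sub>R c n))) \<le> measure \<mu> {x. c n * y < norm x}"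
proof -
  have [measurable]: "(\<lambda>x::'a. ramp y z (norm x)) \<in> borel_measurable borel"
    using ramp_props(1)[OF assms] by (rule borel_measurable_continuous_onI)
  have spM: "space M = UNIV" using sets_eq_imp_space_eq[OF sets_M] by simp
  have intr: "integrable M (\<lambda>x::'a. ramp p r (norm x))" if "0 < p" "p < r" for p r
  proof (rule levy_measure_integrable[OF levy])
    show "norm (ramp p r (norm x)) \<le> 1 / min 1 (p\<^sup>2) * min 1 ((norm x)\<^sup>2)" for x :: 'a
      using ramp_props(2)[OF that, of x] by (simp only: real_norm_def)
  qed (use ramp_props(1)[OF that] in \<open>rule borel_measurable_continuous_onI\<close>)
  have int: "integrable M (\<lambda>x. ramp y z (norm x))" by (rule intr[OF assms])
  have fin: "integrable M (indicator {x. w < norm x} :: 'a \<Rightarrow> real)" if "0 < w" for w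
  proof (rule Bochner_Integration.integrable_bound)
    show "integrable M (\<lambda>x. ramp (w/2) w (norm x))" using that by (intro intr) auto
    show "AE x in M. norm (indicator {x. w < norm x} x :: real) \<le> norm (ramp (w/2) w (norm x))"
    proof (rule AE_I2)
      fix x :: 'a
      have "indicator {w<..} (norm x) \<le> ramp (w/2) w (norm x)" using that by (intro ramp_props(4)) auto
      then show "norm (indicator {x. w < norm x} x :: real) \<le> norm (ramp (w/2) w (norm x))"
        by (simp add: indicator_def split: if_splits)
    qed
    show "(indicator {x. w < norm x} :: 'a \<Rightarrow> real) \<in> borel_measurable M"
      unfolding measurable_cong_sets[OF sets_M refl] by measurable
  qed
  have z: "0 < z" using assms by linarith
  have "(LINT x|M. ramp y z (norm x)) \<le> (LINT x|M. indicator {x. y < norm x} x)"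
    by (intro integral_mono int fin assms) (use ramp_props(3)[OF assms] in \<open>simp add: indicator_def\<close>)
  then show "(LINT x|M. ramp y z (norm x)) \<le> measure M {x. y < norm x}" by (simp add: sets_M spM)
  have "(LINT x|M. indicator {x. z < norm x} x) \<le> (LINT x|M. ramp y z (norm x))"
    by (intro integral_mono int fin z) (use ramp_props(4)[OF assms] in \<open>simp add: indicator_def\<close>)
  then show "measure M {x. z < norm x} \<le> (LINT x|M. ramp y z (norm x))" by (simp add: sets_M spM)
  have int': "integrable \<mu> (\<lambda>x. ramp y z (norm (x /\<^sub>R c n)))"
    by (intro integrable_bounded[where B=1]) (auto simp: ramp_def)
  have scale: "w < norm (x /\<^sub>R c n) \<longleftrightarrow> c n * w < norm x" for w and x :: 'a
    using c_pos[of n] by (simp add: field_simps)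
  have "(LINT x|\<mu>. indicator {x. c n * z < norm x} x) \<le> (LINT x|\<mu>. ramp y z (norm (x /\<^sub>R c n)))"
  proof (rule integral_mono[OF _ int'])
    show "indicator {x. c n * z < norm x} x \<le> ramp y z (norm (x /\<^sub>R c n))" for x :: 'a
      using ramp_props(4)[OF assms, of "norm (x /\<^sub>R c n)"] scale[of z x] by (simp only: indicator_def mem_Collect_eq greaterThan_iff)
  qed (rule integrable_bounded[where B=1], auto split: split_indicator)
  then show "measure \<mu> {x. c n * z < norm x} \<le> (LINT x|\<mu>. ramp y z (norm (x /\<^sub>R c n)))" by (simp add: sets_mu space_mu)
  have "(LINT x|\<mu>. ramp y z (norm (x /\<^sub>R c n))) \<le> (LINT x|\<mu>. indicator {x. c n * y < norm x} x)"
  proof (rule integral_mono[OF int'])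
    show "ramp y z (norm (x /\<^sub>R c n)) \<le> indicator {x. c n * y < norm x} x" for x :: 'a
      using ramp_props(3)[OF assms, of "norm (x /\<^sub>R c n)"] scale[of y x] by (simp only: indicator_def mem_Collect_eq greaterThan_iff)
  qed (rule integrable_bounded[where B=1], auto split: split_indicator)
  then show "(LINT x|\<mu>. ramp y z (norm (x /\<^sub>R c n))) \<le> measure \<mu> {x. c n * y < norm x}" by (simp add: sets_mu space_mu)
qed

lemma ramp_limit:
  assumes "0 < y" "y < z"
  shows "(\<lambda>n. real n * (LINT x|\<mu>. ramp y z (norm (x /\<^sub>R c n)))) \<longlonglongrightarrow> (LINT x|M. ramp y z (norm x))"
  by (rule functional_limit[OF ramp_props(1,2)[OF assms]])

text \<open>The gap between y and z leaves room for a continuous ramp between the indicators of the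
  two tails.\<close>

lemma tail_upper:
  assumes "0 < y" "y < z" and b: "measure M {x. y < norm x} < b"
  shows "\<forall>\<^sub>F n in sequentially. real n * measure \<mu> {x. c n * z < norm x} < b"
proof -
  have "(LINT x|M. ramp y z (norm x)) < b" using tail_measure(1)[OF assms(1,2)] b by linarith
  from order_tendstoD(2)[OF ramp_limit[OF assms(1,2)] this] show ?thesis
  proof eventually_elim
    case (elim n)
    have "real n * measure \<mu> {x. c n * z < norm x} \<le> real n * (LINT x|\<mu>. ramp y z (norm (x /\<^sub>R c n)))"
      by (intro mult_left_mono tail_measure(3) assms) auto
    then show ?case using elim by linarith
  qed
qed

lemma tail_lower:
  assumes "0 < y" "y < z" and b: "b < measure M {x. z < norm x}"
  shows "\<forall>\<^sub>F n in sequentially. b < real n * measure \<mu> {x. c n * y < norm x}"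
proof -
  have "b < (LINT x|M. ramp y z (norm x))" using tail_measure(2)[OF assms(1,2)] b by linarith
  from order_tendstoD(1)[OF ramp_limit[OF assms(1,2)] this] show ?thesis
  proof eventually_elim
    case (elim n)
    have "real n * (LINT x|\<mu>. ramp y z (norm (x /\<^sub>R c n))) \<le> real n * measure \<mu> {x. c n * y < norm x}"
      by (intro mult_left_mono tail_measure(4) assms) auto
    then show ?case using elim by linarith
  qed
qed

text \<open>Passing from \<open>c n\<close> to another norming introduces a factor that converges
  but is not constant. On the annulus, whose mass is bounded, uniform continuity of f absorbs the
  change; the rest is again small by moment bounds.\<close>

lemma functional_limit_scaled:
  fixes f :: "'a \<Rightarrow> real"
  assumes f: "continuous_on UNIV f" "\<And>x. \<bar>f x\<bar> \<le> K * min 1 ((norm x)\<^sup>2)" and K: "0 \<le> K"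
    and \<theta>: "\<theta>s \<longlonglongrightarrow> \<theta>" "0 < \<theta>"
  shows "(\<lambda>n. real n * (LINT x|\<mu>. f (\<theta>s n *\<^sub>R (x /\<^sub>R c n)))) \<longlonglongrightarrow> (LINT x|M. f (\<theta> *\<^sub>R x))"
proof -
  have fm[measurable]: "f \<in> borel_measurable borel" using f(1) by (rule borel_measurable_continuous_onI)
  define L where "L = max 1 ((2 * \<theta>)\<^sup>2) * (K + 1)"
  have L1: "1 \<le> L"
  proof -
    have "1 * 1 \<le> max 1 ((2 * \<theta>)\<^sup>2) * (K + 1)" using K by (intro mult_mono) auto
    then show ?thesis by (simp add: L_def)
  qed
  have fL: "\<bar>f (t *\<^sub>R x)\<bar> \<le> L * min 1 ((norm x)\<^sup>2)" if "0 \<le> t" "t \<le> 2 * \<theta>" for t x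
  proof -
    have "min 1 ((norm (t *\<^sub>R x))\<^sup>2) = min 1 ((t * norm x)\<^sup>2)" using that by simp
    also have "\<dots> \<le> min 1 ((2 * \<theta> * norm x)\<^sup>2)" using that \<theta> by (intro min.mono power_mono mult_right_mono) auto
    also have "\<dots> \<le> max 1 ((2 * \<theta>)\<^sup>2) * min 1 ((norm x)\<^sup>2)" by (rule truncated_square_le)
    finally have "K * min 1 ((norm (t *\<^sub>R x))\<^sup>2) \<le> (K + 1) * (max 1 ((2 * \<theta>)\<^sup>2) * min 1 ((norm x)\<^sup>2))"
      using K by (intro mult_mono) auto
    then show ?thesis using f(2)[of "t *\<^sub>R x"] by (simp add: L_def mult_ac)
  qed
  have lim: "(\<lambda>n. real n * (LINT x|\<mu>. f (\<theta> *\<^sub>R (x /\<^sub>R c n)))) \<longlonglongrightarrow> (LINT x|M. f (\<theta> *\<^sub>R x))"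
  proof (rule functional_limit)
    show "continuous_on UNIV (\<lambda>x. f (\<theta> *\<^sub>R x))"
      by (rule continuous_on_compose2[OF f(1)]) (auto intro!: continuous_intros)
    show "\<bar>f (\<theta> *\<^sub>R x)\<bar> \<le> L * min 1 ((norm x)\<^sup>2)" for x using \<theta> by (intro fL) auto
  qed
  have "(\<lambda>n. real n * (LINT x|\<mu>. f (\<theta>s n *\<^sub>R (x /\<^sub>R c n))) - real n * (LINT x|\<mu>. f (\<theta> *\<^sub>R (x /\<^sub>R c n)))) \<longlonglongrightarrow> 0"
  proof (rule LIMSEQ_I)
    fix e :: real assume e: "0 < e"
    define \<eta> where "\<eta> = e / (16 * L * KD)"
    have \<eta>: "0 < \<eta>" using e L1 KD_ge by (simp add: \<eta>_def)
    have pos: "\<forall>\<^sub>F s in at_right (0::real). 0 < s" by (simp add: eventually_at_filter)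
    have "\<forall>\<^sub>F s in at_right 0. s\<^sup>2 * truncated_moment M (1 / s) < \<eta>"
      by (rule order_tendstoD(2)[OF truncated_moment_subquadratic[OF levy] \<eta>])
    with pos have "\<forall>\<^sub>F s in at_right 0. 0 < s \<and> s\<^sup>2 * truncated_moment M (1 / s) < \<eta>"
      by eventually_elim auto
    from eventually_happens[OF this] obtain s where s: "0 < s" "s\<^sup>2 * truncated_moment M (1 / s) < \<eta>"
      by auto
    have "\<forall>\<^sub>F h in at_right 0. truncated_moment M h < \<eta>"
      by (rule order_tendstoD(2)[OF levy_truncated_moment_tendsto_0[OF levy] \<eta>])
    with pos have "\<forall>\<^sub>F h in at_right 0. 0 < h \<and> truncated_moment M h < \<eta>"
      by eventually_elim auto
    from eventually_happens[OF this] obtain h where h: "0 < h" "truncated_moment M h < \<eta>" by auto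
    define t R where "t = s / 2" and "R = 1 / h"
    have t: "0 < t" "2 * t = s" and R: "0 < R" "1 / R = h" using s h by (auto simp: t_def R_def)
    \<comment> \<open>Bounds n times the probability of |x / c n| > t, because the truncated square
      at inverse scale 1 / t equals 1 there.\<close>
    define B where "B = KD * truncated_moment M (1 / t) + 1"
    have B: "0 < B" using truncated_moment_nonneg[of M "1/t"] KD_ge by (simp add: B_def add_nonneg_pos)
    define \<epsilon> where "\<epsilon> = e / (8 * B)"
    have \<epsilon>: "0 < \<epsilon>" using e B by (simp add: \<epsilon>_def)
    \<comment> \<open>For |x| \<le> 2 R this ball contains \<theta> x and, once the factor is at
      most 2 \<theta>, the perturbed point too.\<close>
    let ?ball = "cball (0::'a) (2 * \<theta> * (2 * R))"
    have "uniformly_continuous_on ?ball f"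
      by (intro compact_uniformly_continuous continuous_on_subset[OF f(1)]) auto
    then obtain \<delta> where \<delta>: "0 < \<delta>" "\<And>x y. x \<in> ?ball \<Longrightarrow> y \<in> ?ball \<Longrightarrow> dist x y < \<delta> \<Longrightarrow> \<bar>f x - f y\<bar> < \<epsilon>"
      unfolding uniformly_continuous_on_def dist_real_def using \<epsilon> by metis
    define W where "W = L * (s\<^sup>2 + 1)"
    have W: "0 < W" using L1 by (simp add: W_def add_nonneg_pos)
    define e' where "e' = e / (16 * W)"
    have e': "0 < e'" using e W by (simp add: e'_def)
    have "\<forall>\<^sub>F n in sequentially. dist (\<theta>s n) \<theta> < min \<theta> (\<delta> / (2 * R))"
      using \<theta> \<delta> R by (intro tendstoD) auto
    moreover have "\<forall>\<^sub>F n in sequentially. pmom n (1 / s) \<le> KD * truncated_moment M (1 / s) + e'"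
      using s e' by (intro moment_bound) auto
    moreover have "\<forall>\<^sub>F n in sequentially. pmom n h \<le> KD * truncated_moment M h + e'"
      using h e' by (intro moment_bound) auto
    moreover have "\<forall>\<^sub>F n in sequentially. pmom n (1 / t) \<le> B"
      unfolding B_def using t by (intro moment_bound) auto
    ultimately have "\<forall>\<^sub>F n in sequentially. \<bar>real n * (LINT x|\<mu>. f (\<theta>s n *\<^sub>R (x /\<^sub>R c n))) - real n * (LINT x|\<mu>. f (\<theta> *\<^sub>R (x /\<^sub>R c n)))\<bar> < e"
    proof eventually_elim
      case (elim n)
      have th: "0 < \<theta>s n" "\<theta>s n \<le> 2 * \<theta>" "\<bar>\<theta>s n - \<theta>\<bar> * (2 * R) < \<delta>"
        using elim(1) R by (auto simp: dist_real_def pos_less_divide_eq abs_if split: if_splits)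
      define G where "G x = f (\<theta>s n *\<^sub>R x) - f (\<theta> *\<^sub>R x)" for x
      have [measurable]: "G \<in> borel_measurable borel" unfolding G_def by measurable
      have Gb: "\<bar>G x\<bar> \<le> 2 * L * min 1 ((norm x)\<^sup>2)" for x
        using fL[of "\<theta>s n" x] fL[of \<theta> x] th \<theta> by (simp add: G_def abs_le_iff)
      have Gle: "\<bar>G x\<bar> \<le> \<epsilon> * min 1 ((1 / t * norm x)\<^sup>2)
          + (2 * L * (s\<^sup>2 * min 1 ((1 / s * norm x)\<^sup>2)) + 2 * L * min 1 ((h * norm x)\<^sup>2))" for x
      proof -
        let ?cut = "annulus_cutoff t R (norm x)"
        have "\<bar>G x * (1 - ?cut)\<bar> \<le> 2 * L * ((2 * t)\<^sup>2 * min 1 ((1 / (2 * t) * norm x)\<^sup>2)) + 2 * L * min 1 ((1 / R * norm x)\<^sup>2)"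
          using L1 by (intro annulus_cutoff_error t R Gb) auto
        moreover have "\<bar>G x * ?cut\<bar> \<le> \<epsilon> * min 1 ((1 / t * norm x)\<^sup>2)"
        proof (cases "t < norm x \<and> norm x < 2 * R")
          case True
          have "norm (\<theta>s n *\<^sub>R x) \<le> 2 * \<theta> * (2 * R)" "norm (\<theta> *\<^sub>R x) \<le> 2 * \<theta> * (2 * R)"
          proof -
            have "\<theta>s n * norm x \<le> (2 * \<theta>) * (2 * R)"
              by (rule mult_mono; use True th \<theta> R in simp)
            moreover have "\<theta> * norm x \<le> (2 * \<theta>) * (2 * R)"
              by (rule mult_mono; use True th \<theta> R in simp)
            ultimately show "norm (\<theta>s n *\<^sub>R x) \<le> 2 * \<theta> * (2 * R)" "norm (\<theta> *\<^sub>R x) \<le> 2 * \<theta> * (2 * R)"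
              using th \<theta> by simp_all
          qed
          moreover have "dist (\<theta>s n *\<^sub>R x) (\<theta> *\<^sub>R x) < \<delta>"
          proof -
            have "dist (\<theta>s n *\<^sub>R x) (\<theta> *\<^sub>R x) = \<bar>\<theta>s n - \<theta>\<bar> * norm x"
              by (simp add: dist_norm scaleR_diff_left[symmetric])
            also have "\<dots> \<le> \<bar>\<theta>s n - \<theta>\<bar> * (2 * R)" using True by (intro mult_left_mono) auto
            finally show ?thesis using th by linarith
          qed
          ultimately have "\<bar>G x\<bar> < \<epsilon>" unfolding G_def by (intro \<delta>) auto
          moreover have "\<bar>G x * ?cut\<bar> \<le> \<bar>G x\<bar>"
            using annulus_cutoff_bounds[of t R "norm x"] by (simp add: abs_mult mult_left_le)
          moreover have "1 \<le> (1 / t * norm x)\<^sup>2" using True t by (intro one_le_power) (simp add: le_divide_eq)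
          ultimately show ?thesis by simp
        next
          case False
          then have "?cut = 0" using t R by (intro annulus_cutoff_eq_0) auto
          then show ?thesis using \<epsilon> by simp
        qed
        moreover have "\<bar>G x\<bar> \<le> \<bar>G x * ?cut\<bar> + \<bar>G x * (1 - ?cut)\<bar>"
          using abs_triangle_ineq[of "G x * ?cut" "G x * (1 - ?cut)"] by (simp add: right_diff_distrib)
        ultimately show ?thesis unfolding t(2) R(2) by linarith
      qed
      have int3: "integrable \<mu> (\<lambda>x. min 1 ((r * norm (x /\<^sub>R c n))\<^sup>2))" for r
        by (intro integrable_bounded[where B=1]) auto
      have LB: "L * min 1 ((norm x)\<^sup>2) \<le> L" for x :: 'a using L1 by (intro mult_left_le) auto
      have int1: "integrable \<mu> (\<lambda>x. f (r *\<^sub>R (x /\<^sub>R c n)))" if "0 \<le> r" "r \<le> 2 * \<theta>" for r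
      proof (rule integrable_bounded[where B=L])
        show "norm (f (r *\<^sub>R (x /\<^sub>R c n))) \<le> L" for x
          using order_trans[OF fL[OF that] LB, of "x /\<^sub>R c n"] by (simp only: real_norm_def)
      qed simp
      have "\<bar>(LINT x|\<mu>. f (\<theta>s n *\<^sub>R (x /\<^sub>R c n))) - (LINT x|\<mu>. f (\<theta> *\<^sub>R (x /\<^sub>R c n)))\<bar> = \<bar>LINT x|\<mu>. G (x /\<^sub>R c n)\<bar>"
        unfolding G_def using th \<theta> by (subst Bochner_Integration.integral_diff) (auto intro!: int1 simp del: scaleR_scaleR)
      also have "\<dots> \<le> (LINT x|\<mu>. \<bar>G (x /\<^sub>R c n)\<bar>)" by (rule integral_abs_bound)
      also have "\<dots> \<le> (LINT x|\<mu>. \<epsilon> * min 1 ((1 / t * norm (x /\<^sub>R c n))\<^sup>2)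
          + (2 * L * (s\<^sup>2 * min 1 ((1 / s * norm (x /\<^sub>R c n))\<^sup>2)) + 2 * L * min 1 ((h * norm (x /\<^sub>R c n))\<^sup>2)))"
      proof (rule integral_mono[OF _ _ Gle])
        show "integrable \<mu> (\<lambda>x. \<bar>G (x /\<^sub>R c n)\<bar>)"
          unfolding G_def using th \<theta> by (intro integrable_abs Bochner_Integration.integrable_diff int1) auto
      qed (intro Bochner_Integration.integrable_add integrable_mult_right int3)
      also have "\<dots> = \<epsilon> * (LINT x|\<mu>. min 1 ((1 / t * norm (x /\<^sub>R c n))\<^sup>2))
          + (2 * L * (s\<^sup>2 * (LINT x|\<mu>. min 1 ((1 / s * norm (x /\<^sub>R c n))\<^sup>2))) + 2 * L * (LINT x|\<mu>. min 1 ((h * norm (x /\<^sub>R c n))\<^sup>2)))"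
        by (subst Bochner_Integration.integral_add, (intro Bochner_Integration.integrable_add integrable_mult_right int3)+,
            subst Bochner_Integration.integral_add, (intro integrable_mult_right int3)+) (simp only: integral_mult_right_zero)
      finally have "real n * \<bar>(LINT x|\<mu>. f (\<theta>s n *\<^sub>R (x /\<^sub>R c n))) - (LINT x|\<mu>. f (\<theta> *\<^sub>R (x /\<^sub>R c n)))\<bar>
        \<le> real n * (\<epsilon> * (LINT x|\<mu>. min 1 ((1 / t * norm (x /\<^sub>R c n))\<^sup>2))
          + (2 * L * (s\<^sup>2 * (LINT x|\<mu>. min 1 ((1 / s * norm (x /\<^sub>R c n))\<^sup>2))) + 2 * L * (LINT x|\<mu>. min 1 ((h * norm (x /\<^sub>R c n))\<^sup>2))))"
        by (rule mult_left_mono) simp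
      also have "\<dots> = \<epsilon> * pmom n (1 / t) + (2 * L * (s\<^sup>2 * pmom n (1 / s)) + 2 * L * pmom n h)"
        by (simp only: pmom_def distrib_left mult_ac)
      also have "\<dots> \<le> \<epsilon> * B + (2 * L * (s\<^sup>2 * (KD * truncated_moment M (1 / s) + e')) + 2 * L * (KD * truncated_moment M h + e'))"
        using elim L1 \<epsilon> by (intro add_mono mult_left_mono) auto
      also have "\<dots> = \<epsilon> * B + 2 * L * KD * (s\<^sup>2 * truncated_moment M (1 / s)) + 2 * L * KD * truncated_moment M h + 2 * (W * e')"
        by (simp add: W_def algebra_simps)
      also have "\<dots> \<le> e / 8 + 2 * L * KD * \<eta> + 2 * L * KD * \<eta> + 2 * (e / 16)"
      proof (intro add_mono mult_left_mono)
        show "W * e' \<le> e / 16" using W by (simp add: e'_def)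
        show "\<epsilon> * B \<le> e / 8" using B by (simp add: \<epsilon>_def)
      qed (use s h L1 KD_ge in auto)
      also have "2 * L * KD * \<eta> = e / 8" using L1 KD_ge by (simp add: \<eta>_def)
      finally have "real n * \<bar>(LINT x|\<mu>. f (\<theta>s n *\<^sub>R (x /\<^sub>R c n))) - (LINT x|\<mu>. f (\<theta> *\<^sub>R (x /\<^sub>R c n)))\<bar> < e"
        using e by simp
      then show ?case by (simp add: right_diff_distrib[symmetric] abs_mult del: scaleR_scaleR)
    qed
    then show "\<exists>no. \<forall>n\<ge>no. norm (real n * (LINT x|\<mu>. f (\<theta>s n *\<^sub>R (x /\<^sub>R c n))) - real n * (LINT x|\<mu>. f (\<theta> *\<^sub>R (x /\<^sub>R c n))) - 0) < e"
      by (simp add: eventually_sequentially)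
  qed
  from tendsto_add[OF this lim] show ?thesis by simp
qed

end

text \<open>The tail of the limit measure is (\<beta> / y)^\<alpha>, which crosses the level 1 at y
  = \<beta>. Eventually n P(|H| > c n y) is thus below 1 for fixed y > \<beta> and above 1 for fixed
  positive y < \<beta>, which traps the quantile.\<close>

lemma norm_quantile_limit:
  fixes \<sigma> :: "'a::euclidean_space measure"
  assumes P: "prob_space P" and H[measurable]: "H \<in> borel_measurable P"
    and att: "attracted (distr P borel H) c d a (polar_levy_measure \<alpha> (\<lambda>_ _. 1) \<sigma>)"
    and \<sigma>: "spherical_measure \<sigma>" and \<alpha>: "0 < \<alpha>"
  shows "(\<lambda>n. norm_quantile P H n / c n) \<longlonglongrightarrow> (measure \<sigma> (sphere 0 1) / \<alpha>) powr (1 / \<alpha>)"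
proof -
  interpret P: prob_space P by fact
  interpret attracted "distr P borel H" c d a "polar_levy_measure \<alpha> (\<lambda>_ _. 1) \<sigma>" by fact
  define S where "S = measure \<sigma> (sphere 0 1)"
  have S: "0 < S"
  proof -
    interpret \<sigma>: finite_measure \<sigma> using \<sigma> by (simp add: spherical_measure_def)
    have "emeasure \<sigma> (sphere 0 1) \<noteq> 0" using \<sigma> by (simp add: spherical_measure_def)
    then show ?thesis by (simp add: S_def \<sigma>.emeasure_eq_measure zero_less_measure_iff)
  qed
  define \<beta> where "\<beta> = (S / \<alpha>) powr (1 / \<alpha>)"
  have \<beta>: "0 < \<beta>" "\<beta> powr \<alpha> = S / \<alpha>" using S \<alpha> by (auto simp: \<beta>_def powr_powr)
  have tail: "measure (polar_levy_measure \<alpha> (\<lambda>_ _. 1) \<sigma>) {x. y < norm x} = (\<beta> / y) powr \<alpha>" if "0 < y" for y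
  proof -
    have "measure (polar_levy_measure \<alpha> (\<lambda>_ _. 1) \<sigma>) {x. y < norm x} = S * (y powr (- \<alpha>) / \<alpha>)"
      using emeasure_polar_tail[OF \<sigma> \<alpha> that] S \<alpha> unfolding S_def[symmetric]
      by (intro measure_eq_emeasure_eq_ennreal) auto
    also have "\<dots> = (\<beta> / y) powr \<alpha>" using \<beta> that by (simp add: powr_divide powr_minus field_simps)
    finally show ?thesis .
  qed
  define A where "A n = {x. measure P {\<omega> \<in> space P. norm (H \<omega>) > x} \<le> 1 / real n}" for n :: nat
  have q: "norm_quantile P H n = Inf (A n)" for n by (simp add: norm_quantile_def A_def)
  have meas: "measure (distr P borel H) {x. y < norm x} = measure P {\<omega> \<in> space P. norm (H \<omega>) > y}" for y
    by (subst measure_distr) (auto intro!: arg_cong[where f = "measure P"])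
  \<comment> \<open>For n \<ge> 2 a negative threshold is exceeded with probability 1 > 1 / n, so
    the set has a lower bound and its infimum is meaningful.\<close>
  have bdd: "0 \<le> x" if "x \<in> A n" "2 \<le> n" for x n
  proof (rule ccontr)
    assume "\<not> 0 \<le> x"
    then have "norm (H \<omega>) > x" for \<omega> using norm_ge_zero[of "H \<omega>"] by linarith
    then have "measure P {\<omega> \<in> space P. norm (H \<omega>) > x} = 1" by (simp add: P.prob_space)
    then have "1 \<le> 1 / real n" using that(1) by (simp add: A_def)
    then show False using that(2) by (simp add: le_divide_eq)
  qed
  have upper: "\<forall>\<^sub>F n in sequentially. c n * z \<in> A n" if "\<beta> < z" for z
  proof -
    define y where "y = (\<beta> + z) / 2"
    have y: "\<beta> < y" "y < z" "0 < y" using that \<beta> by (auto simp: y_def)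
    have "(\<beta> / y) powr \<alpha> < 1 powr \<alpha>" using y \<beta> \<alpha> by (intro powr_less_mono2) auto
    then have "measure (polar_levy_measure \<alpha> (\<lambda>_ _. 1) \<sigma>) {x. y < norm x} < 1" using tail[OF y(3)] by simp
    from tail_upper[OF y(3,2) this] eventually_gt_at_top[of 0] show ?thesis
      by eventually_elim (auto simp: A_def meas le_divide_eq mult.commute)
  qed
  show ?thesis
    unfolding S_def[symmetric] \<beta>_def[symmetric]
  proof (rule order_tendstoI)
    fix z assume z: "\<beta> < z"
    define w where "w = (\<beta> + z) / 2"
    have w: "\<beta> < w" "w < z" using z by (auto simp: w_def)
    from upper[OF w(1)] eventually_ge_at_top[of 2]
    show "\<forall>\<^sub>F n in sequentially. norm_quantile P H n / c n < z"
    proof eventually_elim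
      case (elim n)
      have "Inf (A n) \<le> c n * w" using elim bdd by (intro cInf_lower) (auto simp: bdd_below_def)
      also have "\<dots> < c n * z" using c_pos[of n] w by simp
      finally show ?case using c_pos[of n] by (simp add: q divide_less_eq mult.commute)
    qed
  next
    fix z assume z: "z < \<beta>"
    \<comment> \<open>The maximum with \<beta> / 2 keeps y positive when z is not.\<close>
    define y where "y = (max z (\<beta> / 2) + \<beta>) / 2"
    define y' where "y' = (y + \<beta>) / 2"
    have y: "z < y" "0 < y" "y < y'" "y' < \<beta>" using z \<beta> by (auto simp: y_def y'_def)
    have y'0: "0 < y'" using y by linarith
    have "1 powr \<alpha> < (\<beta> / y') powr \<alpha>" using y \<alpha> by (intro powr_less_mono2) auto
    then have "1 < measure (polar_levy_measure \<alpha> (\<lambda>_ _. 1) \<sigma>) {x. y' < norm x}" using tail[OF y'0] by simp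
    from tail_lower[OF y(2,3) this] upper[of "\<beta> + 1", OF less_add_one] eventually_ge_at_top[of 1]
    show "\<forall>\<^sub>F n in sequentially. z < norm_quantile P H n / c n"
    proof eventually_elim
      case (elim n)
      have "c n * y \<le> Inf (A n)"
      proof (rule cInf_greatest)
        show "A n \<noteq> {}" using elim(2) by auto
        fix x assume x: "x \<in> A n"
        show "c n * y \<le> x"
        proof (rule ccontr)
          assume "\<not> c n * y \<le> x"
          then have "measure P {\<omega> \<in> space P. norm (H \<omega>) > c n * y} \<le> measure P {\<omega> \<in> space P. norm (H \<omega>) > x}"
            by (intro P.finite_measure_mono) auto
          also have "\<dots> \<le> 1 / real n" using x by (simp add: A_def)
          finally show False using elim(1,3) by (simp add: meas field_simps)
        qed
      qed
      moreover have "c n * z < c n * y" using c_pos[of n] y by simp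
      ultimately have "c n * z < Inf (A n)" by linarith
      then show ?case using c_pos[of n] by (simp add: q less_divide_eq mult.commute)
    qed
  qed
qed

section \<open>From weak attraction to characteristic functions\<close>

lemma (in finite_measure) CLINT_iexp:
  assumes [measurable]: "Y \<in> borel_measurable M"
  shows "(CLINT x|M. iexp (Y x)) = of_real (LINT x|M. cos (Y x)) + \<i> * of_real (LINT x|M. sin (Y x))"
proof -
  have int: "integrable M (\<lambda>x. iexp (Y x))"
    by (intro integrable_bounded[where B=1]) (auto simp: norm_exp_i_times)
  have "Re (CLINT x|M. iexp (Y x)) = (LINT x|M. cos (Y x))"
    by (subst integral_Re[OF int, symmetric]) (simp only: Re_iexp)
  moreover have "Im (CLINT x|M. iexp (Y x)) = (LINT x|M. sin (Y x))"
    by (subst integral_Im[OF int, symmetric]) (simp only: Im_iexp)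
  ultimately show ?thesis by (intro complex_eqI) simp_all
qed

lemma weakly_converges_char:
  fixes \<mu>s :: "nat \<Rightarrow> 'a::euclidean_space measure"
  assumes w: "weakly_converges_in euclidean \<mu>s \<mu>"
    and fin: "\<And>n. finite_measure (\<mu>s n)" "finite_measure \<mu>"
    and sets: "\<And>n. sets (\<mu>s n) = sets borel" "sets \<mu> = sets borel"
  shows "(\<lambda>n. CLINT x|\<mu>s n. iexp (u \<bullet> x)) \<longlonglongrightarrow> (CLINT x|\<mu>. iexp (u \<bullet> x))"
proof -
  have conv: "(\<lambda>n. \<integral>x. f x \<partial>\<mu>s n) \<longlonglongrightarrow> (\<integral>x. f x \<partial>\<mu>)"
    if "continuous_on UNIV f" "\<And>x. \<bar>f x\<bar> \<le> 1" for f :: "'a \<Rightarrow> real"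
    using w that unfolding weakly_converges_in_def by (auto simp: bounded_iff)
  have m: "(\<lambda>x. u \<bullet> x) \<in> borel_measurable (\<mu>s n)" "(\<lambda>x. u \<bullet> x) \<in> borel_measurable \<mu>" for n
    by (auto simp: measurable_cong_sets[OF sets(1) refl] measurable_cong_sets[OF sets(2) refl])
  have "(CLINT x|\<mu>s n. iexp (u \<bullet> x)) = of_real (LINT x|\<mu>s n. cos (u \<bullet> x)) + \<i> * of_real (LINT x|\<mu>s n. sin (u \<bullet> x))" for n
    by (rule finite_measure.CLINT_iexp[OF fin(1) m(1)])
  moreover have "(CLINT x|\<mu>. iexp (u \<bullet> x)) = of_real (LINT x|\<mu>. cos (u \<bullet> x)) + \<i> * of_real (LINT x|\<mu>. sin (u \<bullet> x))"
    by (rule finite_measure.CLINT_iexp[OF fin(2) m(2)])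
  moreover have "(\<lambda>n. LINT x|\<mu>s n. cos (u \<bullet> x)) \<longlonglongrightarrow> (LINT x|\<mu>. cos (u \<bullet> x))"
    "(\<lambda>n. LINT x|\<mu>s n. sin (u \<bullet> x)) \<longlonglongrightarrow> (LINT x|\<mu>. sin (u \<bullet> x))"
    by (intro conv continuous_intros abs_cos_le_one abs_sin_le_one)+
  ultimately show ?thesis by (simp only:) (intro tendsto_intros)
qed

text \<open>The copies are coordinates of a product space, so the characteristic function of the sum
  factorizes into an n-th power and the centering becomes a phase. Weak convergence is tested on the
  cosine and the sine.\<close>

lemma attracted_if_domain_of_attraction:
  fixes \<mu> :: "'a::euclidean_space measure"
  assumes \<mu>: "prob_space \<mu>" "sets \<mu> = sets borel"
    and rep: "has_levy_representation \<nu> a (\<lambda>_. 0) M" and nz: "emeasure M UNIV \<noteq> 0"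
    and dom: "domain_of_attraction \<mu> \<nu>"
  obtains c d where "attracted \<mu> c d a M"
proof -
  interpret \<mu>: prob_space \<mu> by fact
  obtain c :: "nat \<Rightarrow> real" and d :: "nat \<Rightarrow> 'a" where c: "\<And>n. c n > 0"
    and w: "weakly_converges_in euclidean
        (\<lambda>n. distr (\<Pi>\<^sub>M j\<in>{1..n}. \<mu>) borel (\<lambda>x. (1 / c n) *\<^sub>R (\<Sum>j=1..n. x j) - d n)) \<nu>"
    using dom by (auto simp: domain_of_attraction_def)
  have nu: "prob_space \<nu>" "sets \<nu> = sets borel" and levy: "levy_measure M"
    and char: "\<And>u. (CLINT x|\<nu>. iexp (u \<bullet> x)) = exp (levy_exponent a (\<lambda>_. 0) M u)"
    using rep by (auto simp: has_levy_representation_def infinitely_divisible_def)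
  have [measurable_cong]: "sets \<mu> = sets borel" by (rule \<mu>(2))
  interpret product_prob_space "\<lambda>_::nat. \<mu>" UNIV ..
  show thesis
  proof (rule that)
    show "attracted \<mu> c d a M"
    proof (unfold_locales)
      fix u :: 'a
      let ?X = "\<lambda>n x. (1 / c n) *\<^sub>R (\<Sum>j=1..n. x j) - d n"
      have meas[measurable]: "?X n \<in> borel_measurable (\<Pi>\<^sub>M j\<in>{1..n}. \<mu>)" for n by measurable
      have "(CLINT x|distr (\<Pi>\<^sub>M j\<in>{1..n}. \<mu>) borel (?X n). iexp (u \<bullet> x))
        = (CLINT x|\<mu>. iexp (u \<bullet> (x /\<^sub>R c n))) ^ n * iexp (- (u \<bullet> d n))" for n
      proof -
        have "(CLINT x|distr (\<Pi>\<^sub>M j\<in>{1..n}. \<mu>) borel (?X n). iexp (u \<bullet> x)) = (CLINT x|(\<Pi>\<^sub>M j\<in>{1..n}. \<mu>). iexp (u \<bullet> ?X n x))"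
          by (rule integral_distr) measurable
        also have "\<dots> = (CLINT x|(\<Pi>\<^sub>M j\<in>{1..n}. \<mu>). (\<Prod>j=1..n. iexp (u \<bullet> (x j /\<^sub>R c n))) * iexp (- (u \<bullet> d n)))"
        proof (intro Bochner_Integration.integral_cong refl)
          fix x :: "nat \<Rightarrow> 'a"
          have "u \<bullet> ?X n x = (\<Sum>j=1..n. u \<bullet> (x j /\<^sub>R c n)) + - (u \<bullet> d n)"
            by (simp add: inner_diff_right inner_sum_right sum_distrib_left divide_inverse)
          then show "iexp (u \<bullet> ?X n x) = (\<Prod>j=1..n. iexp (u \<bullet> (x j /\<^sub>R c n))) * iexp (- (u \<bullet> d n))"
            by (simp only: of_real_add of_real_sum distrib_left exp_add sum_distrib_left exp_sum finite_atLeastAtMost)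
        qed
        also have "\<dots> = (CLINT x|(\<Pi>\<^sub>M j\<in>{1..n}. \<mu>). (\<Prod>j=1..n. iexp (u \<bullet> (x j /\<^sub>R c n)))) * iexp (- (u \<bullet> d n))"
          by (rule integral_mult_left_zero)
        also have "(CLINT x|(\<Pi>\<^sub>M j\<in>{1..n}. \<mu>). (\<Prod>j=1..n. iexp (u \<bullet> (x j /\<^sub>R c n))))
          = (\<Prod>j=1..n. (CLINT x|\<mu>. iexp (u \<bullet> (x /\<^sub>R c n))))"
          by (rule product_integral_prod) (auto intro!: \<mu>.integrable_bounded[where B=1] simp: norm_exp_i_times)
        finally show ?thesis by simp
      qed
      moreover have "(\<lambda>n. CLINT x|distr (\<Pi>\<^sub>M j\<in>{1..n}. \<mu>) borel (?X n). iexp (u \<bullet> x)) \<longlonglongrightarrow> (CLINT x|\<nu>. iexp (u \<bullet> x))"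
      proof (rule weakly_converges_char[OF w])
        show "finite_measure (distr (\<Pi>\<^sub>M j\<in>{1..n}. \<mu>) borel (?X n))" for n
        proof -
          interpret pr: prob_space "\<Pi>\<^sub>M j\<in>{1..n}. \<mu>" by (rule prob_space_PiM) (rule \<mu>(1))
          show ?thesis by (intro prob_space.finite_measure pr.prob_space_distr meas)
        qed
        show "finite_measure \<nu>" using nu(1) by (rule prob_space.finite_measure)
      qed (auto simp: nu)
      ultimately show "(\<lambda>n. (CLINT x|\<mu>. iexp (u \<bullet> (x /\<^sub>R c n))) ^ n * iexp (- (u \<bullet> d n)))
        \<longlonglongrightarrow> exp (levy_exponent a (\<lambda>_. 0) M u)" unfolding char by simp
    qed (use c levy nz \<mu> in auto)
  qed
qed

section \<open>Tempered jumps\<close>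

text \<open>The side of the theorem that concerns the walk; the limit law enters only through the
  fact that M is a Levy measure.\<close>

locale tempered_jumps = tempering \<alpha> q + prob_space P
  for \<alpha> :: real and q :: "real \<Rightarrow> 'a::euclidean_space \<Rightarrow> real" and P :: "'b measure" +
  fixes \<sigma> :: "'a measure" and H :: "'b \<Rightarrow> 'a" and T :: "'b \<Rightarrow> real"
    and Hs :: "nat \<Rightarrow> 'b \<Rightarrow> 'a" and Ts :: "nat \<Rightarrow> 'b \<Rightarrow> real" and a :: 'a and \<nu> :: "'a measure" and v :: "nat \<Rightarrow> real"
  assumes sigma: "spherical_measure \<sigma>"
    and H: "H \<in> borel_measurable P"
    and H_nonzero: "measure P {\<omega> \<in> space P. H \<omega> = 0} = 0"
    and Z: "has_levy_representation \<nu> a (\<lambda>_. 0) (polar_levy_measure \<alpha> (\<lambda>_ _. 1) \<sigma>)"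
    and attraction: "domain_of_attraction (distr P borel H) \<nu>"
    and T: "T \<in> borel_measurable P"
    and T_pos: "AE \<omega> in P. 0 < T \<omega>"
    and T_cond: "has_conditional_distr P T H (\<lambda>x. temper_law \<alpha> q (sgn x))"
    and indep: "indep_vars (\<lambda>_. borel \<Otimes>\<^sub>M borel) (\<lambda>j \<omega>. (Hs j \<omega>, Ts j \<omega>)) {1..}"
    and copies: "\<And>j. j \<ge> 1 \<Longrightarrow>
      distr P (borel \<Otimes>\<^sub>M borel) (\<lambda>\<omega>. (Hs j \<omega>, Ts j \<omega>)) =
      distr P (borel \<Otimes>\<^sub>M borel) (\<lambda>\<omega>. (H \<omega>, T \<omega>))"
    and v_pos: "\<And>n. n \<ge> 1 \<Longrightarrow> 0 < v n"
    and v_b: "(\<lambda>n. norm_quantile P H n / v n) \<longlonglongrightarrow> measure \<sigma> (sphere 0 1) powr (1 / \<alpha>)"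
    and levy: "levy_measure (polar_levy_measure \<alpha> q \<sigma>)"
begin

abbreviation M0 :: "'a measure" where "M0 \<equiv> polar_levy_measure \<alpha> (\<lambda>_ _. 1) \<sigma>"
abbreviation M :: "'a measure" where "M \<equiv> polar_levy_measure \<alpha> q \<sigma>"

definition jump :: "nat \<Rightarrow> 'a \<times> real \<Rightarrow> 'a"
  where "jump n z = (1 / v n) *\<^sub>R (min (norm (fst z)) (v n * snd z) *\<^sub>R sgn (fst z))"

lemma jump_measurable [measurable]: "jump n \<in> borel_measurable (borel \<Otimes>\<^sub>M borel)"
  unfolding jump_def by measurable

lemma tempered_jump_eq: "(1 / v n) *\<^sub>R tempered_jump v Hs Ts n j \<omega> = jump n (Hs j \<omega>, Ts j \<omega>)"
  by (simp add: tempered_jump_def jump_def)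

text \<open>After rescaling, T is compared with the length of x / v n, with no further dependence on
  n. For this reason one averaging operator \<open>kf\<close> serves all n.\<close>

lemma jump_eq: "0 < v n \<Longrightarrow> jump n (x, t) = min (norm (x /\<^sub>R v n)) t *\<^sub>R sgn (x /\<^sub>R v n)"
proof -
  assume v: "0 < v n"
  have "min (norm x) (v n * t) / v n = min (norm x / v n) t"
    using v by (auto simp: min_def field_simps)
  then show ?thesis using v by (simp add: jump_def sgn_scaleR divide_inverse mult.commute)
qed

lemma HT_measurable [measurable]: "H \<in> borel_measurable P" "T \<in> borel_measurable P"
  "j \<ge> 1 \<Longrightarrow> (\<lambda>\<omega>. (Hs j \<omega>, Ts j \<omega>)) \<in> P \<rightarrow>\<^sub>M borel \<Otimes>\<^sub>M borel"
  using H T indep by (auto simp: indep_vars_def)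

lemma expectation_copies:
  fixes f :: "'a \<times> real \<Rightarrow> 'c::{banach, second_countable_topology}"
  assumes [measurable]: "f \<in> borel_measurable (borel \<Otimes>\<^sub>M borel)" and j: "j \<ge> 1"
  shows "(\<integral>\<omega>. f (Hs j \<omega>, Ts j \<omega>) \<partial>P) = (\<integral>\<omega>. f (H \<omega>, T \<omega>) \<partial>P)"
proof -
  have "(\<integral>\<omega>. f (Hs j \<omega>, Ts j \<omega>) \<partial>P) = (\<integral>z. f z \<partial>distr P (borel \<Otimes>\<^sub>M borel) (\<lambda>\<omega>. (Hs j \<omega>, Ts j \<omega>)))"
    using j by (intro integral_distr[symmetric]) auto
  also have "\<dots> = (\<integral>\<omega>. f (H \<omega>, T \<omega>) \<partial>P)"
    unfolding copies[OF j] by (rule integral_distr) auto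
  finally show ?thesis .
qed

lemma AE_H_nonzero: "AE \<omega> in P. H \<omega> \<noteq> 0"
  using H_nonzero by (intro AE_I[where N = "{\<omega> \<in> space P. H \<omega> = 0}"]) (auto simp: emeasure_eq_measure)

lemma sphere_mass_pos: "0 < measure \<sigma> (sphere 0 1)"
proof -
  interpret \<sigma>: finite_measure \<sigma> using sigma by (simp add: spherical_measure_def)
  have "emeasure \<sigma> (sphere 0 1) \<noteq> 0" using sigma by (simp add: spherical_measure_def)
  then show ?thesis by (simp add: \<sigma>.emeasure_eq_measure zero_less_measure_iff)
qed

lemma sets_polar: "sets (polar_levy_measure \<alpha> h \<sigma>) = sets borel"
  by (simp add: polar_levy_measure_def)

lemma M0_nonzero: "emeasure M0 UNIV \<noteq> 0"
proof -
  have "emeasure M0 {x. 1 < norm x} \<le> emeasure M0 UNIV"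
    by (rule emeasure_mono) (auto simp: sets_polar)
  moreover have "0 < emeasure M0 {x. 1 < norm x}"
    using emeasure_polar_tail[OF sigma alpha_pos, of 1] sphere_mass_pos alpha_pos by simp
  ultimately show ?thesis by auto
qed

text \<open>Integrating out T replaces the tempered jump by H / v n and the test function f by
  \<open>kf f\<close>, so that the limit theorems for H become applicable.\<close>

lemma expectation_jump_eq:
  fixes f :: "'a \<Rightarrow> real"
  assumes fc: "continuous_on UNIV f" and f0: "\<And>x. 0 \<le> f x"
    and f: "\<And>x. f x \<le> K * min 1 ((norm x)\<^sup>2)" and K: "0 \<le> K" and n: "n \<ge> 1"
  shows "(\<integral>\<omega>. f (jump n (H \<omega>, T \<omega>)) \<partial>P) = (\<integral>\<omega>. kf f (H \<omega> /\<^sub>R v n) \<partial>P)"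
proof -
  have v: "0 < v n" by (rule v_pos[OF n])
  have fm[measurable]: "f \<in> borel_measurable borel" using fc by (rule borel_measurable_continuous_onI)
  have f': "\<bar>f x\<bar> \<le> K * min 1 ((norm x)\<^sup>2)" for x using f0 f by simp
  have kc: "continuous_on UNIV (kf f)" by (rule kf_continuous[OF fc f' K])
  have km[measurable]: "kf f \<in> borel_measurable borel" using kc by (rule borel_measurable_continuous_onI)
  have "(\<integral>\<^sup>+\<omega>. ennreal (f (jump n (H \<omega>, T \<omega>))) \<partial>P)
    = (\<integral>\<^sup>+\<omega>. (\<integral>\<^sup>+u. ennreal (dens u (sgn (H \<omega>))) * ennreal (f (jump n (H \<omega>, u))) \<partial>lborel) \<partial>P)"
    by (rule joint_nn_integral[OF prob_space_axioms H T H_nonzero T_cond]) measurable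
  also have "\<dots> = (\<integral>\<^sup>+\<omega>. ennreal (kf f (H \<omega> /\<^sub>R v n)) \<partial>P)"
  proof (rule nn_integral_cong_AE)
    show "AE \<omega> in P. (\<integral>\<^sup>+u. ennreal (dens u (sgn (H \<omega>))) * ennreal (f (jump n (H \<omega>, u))) \<partial>lborel) = ennreal (kf f (H \<omega> /\<^sub>R v n))"
      using AE_H_nonzero
    proof eventually_elim
      case (elim \<omega>)
      have nz: "H \<omega> /\<^sub>R v n \<noteq> 0" using elim v by simp
      have s: "sgn (H \<omega> /\<^sub>R v n) = sgn (H \<omega>)" using v by (simp add: sgn_scaleR)
      show ?case
        unfolding jump_eq[OF v] s[symmetric] by (rule nn_integral_min_dens(1)[OF fm f0 f nz])
    qed
  qed
  finally have eq: "(\<integral>\<^sup>+\<omega>. ennreal (f (jump n (H \<omega>, T \<omega>))) \<partial>P) = (\<integral>\<^sup>+\<omega>. ennreal (kf f (H \<omega> /\<^sub>R v n)) \<partial>P)" .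
  have k0: "AE \<omega> in P. 0 \<le> kf f (H \<omega> /\<^sub>R v n)"
    using AE_H_nonzero
  proof eventually_elim
    case (elim \<omega>)
    then show ?case using v by (intro nn_integral_min_dens(3)[OF fm f0 f]) auto
  qed
  have "(\<integral>\<omega>. f (jump n (H \<omega>, T \<omega>)) \<partial>P) = enn2real (\<integral>\<^sup>+\<omega>. ennreal (f (jump n (H \<omega>, T \<omega>))) \<partial>P)"
    by (rule integral_eq_nn_integral) (auto simp: f0)
  also have "\<dots> = (\<integral>\<omega>. kf f (H \<omega> /\<^sub>R v n) \<partial>P)"
    unfolding eq by (rule integral_eq_nn_integral[symmetric]) (use k0 in auto)
  finally show ?thesis .
qed

text \<open>The quantile cancels in the quotient of its two asymptotics, and so does the mass of the
  sphere: S^(1/\<alpha>) divided by (S/\<alpha>)^(1/\<alpha>).\<close>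

lemma norming_limit:
  obtains c d where "attracted (distr P borel H) c d a M0" "(\<lambda>n. c n / v n) \<longlonglongrightarrow> \<alpha> powr (1 / \<alpha>)"
proof -
  obtain c d where att: "attracted (distr P borel H) c d a M0"
    using attracted_if_domain_of_attraction[OF prob_space_distr[OF H] sets_distr Z M0_nonzero attraction] by metis
  interpret A: attracted "distr P borel H" c d a M0 by (rule att)
  let ?S = "measure \<sigma> (sphere 0 1)"
  have S: "0 < ?S" by (rule sphere_mass_pos)
  have lim: "(\<lambda>n. (norm_quantile P H n / v n) / (norm_quantile P H n / c n)) \<longlonglongrightarrow> ?S powr (1 / \<alpha>) / (?S / \<alpha>) powr (1 / \<alpha>)"
    using S alpha_pos
    by (intro tendsto_divide v_b norm_quantile_limit[OF prob_space_axioms H att sigma alpha_pos]) auto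
  have "?S powr (1 / \<alpha>) / (?S / \<alpha>) powr (1 / \<alpha>) = \<alpha> powr (1 / \<alpha>)"
    using S alpha_pos by (simp add: powr_divide)
  moreover have "\<forall>\<^sub>F n in sequentially. norm_quantile P H n / v n > 0"
    using S by (intro order_tendstoD(1)[OF v_b]) auto
  then have "\<forall>\<^sub>F n in sequentially. (norm_quantile P H n / v n) / (norm_quantile P H n / c n) = c n / v n"
    by eventually_elim (use A.c_pos in \<open>auto simp: field_simps\<close>)
  ultimately have "(\<lambda>n. c n / v n) \<longlonglongrightarrow> \<alpha> powr (1 / \<alpha>)"
    using Lim_transform_eventually[OF lim] by simp
  then show thesis using att that by blast
qed

lemma jump_functional_limit_nonneg:
  fixes f :: "'a \<Rightarrow> real"
  assumes fc: "continuous_on UNIV f" and f0: "\<And>x. 0 \<le> f x"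
    and f: "\<And>x. f x \<le> K * min 1 ((norm x)\<^sup>2)" and K: "0 \<le> K"
  shows "(\<lambda>n. real n * (\<integral>\<omega>. f (jump n (H \<omega>, T \<omega>)) \<partial>P)) \<longlonglongrightarrow> (LINT x|M. f x)"
proof -
  obtain c d where att: "attracted (distr P borel H) c d a M0" and cv: "(\<lambda>n. c n / v n) \<longlonglongrightarrow> \<alpha> powr (1 / \<alpha>)"
    by (rule norming_limit)
  interpret A: attracted "distr P borel H" c d a M0 by (rule att)
  \<comment> \<open>By homogeneity, dilating by \<theta> multiplies integrals against M0 by
    \<theta>^\<alpha> = \<alpha>, the factor in \<open>nn_integral_kf_polar\<close>.\<close>
  define \<theta> where "\<theta> = \<alpha> powr (1 / \<alpha>)"
  have \<theta>: "0 < \<theta>" "\<theta> powr \<alpha> = \<alpha>" using alpha_pos by (auto simp: \<theta>_def powr_powr)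
  have fm[measurable]: "f \<in> borel_measurable borel" using fc by (rule borel_measurable_continuous_onI)
  have f': "\<bar>f x\<bar> \<le> K * min 1 ((norm x)\<^sup>2)" for x using f0 f by simp
  have kc: "continuous_on UNIV (kf f)" by (rule kf_continuous[OF fc f' K])
  have km[measurable]: "kf f \<in> borel_measurable borel" using kc by (rule borel_measurable_continuous_onI)
  have kb: "\<bar>kf f x\<bar> \<le> (2 * K) * min 1 ((norm x)\<^sup>2)" for x using kf_bound[OF fm f' K] by simp
  have k0: "0 \<le> kf f x" for x
  proof (cases "x = 0")
    case True
    then show ?thesis using kb[of 0] by simp
  next
    case False
    then show ?thesis by (rule nn_integral_min_dens(3)[OF fm f0 f])
  qed
  have "(\<lambda>n. real n * (LINT x|distr P borel H. kf f ((c n / v n) *\<^sub>R (x /\<^sub>R c n)))) \<longlonglongrightarrow> (LINT x|M0. kf f (\<theta> *\<^sub>R x))"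
    using K \<theta> cv unfolding \<theta>_def[symmetric] by (intro A.functional_limit_scaled[OF kc kb]) auto
  moreover have "(LINT x|M0. kf f (\<theta> *\<^sub>R x)) = (LINT x|M. f x)"
  proof -
    have "(\<integral>\<^sup>+x. ennreal (kf f (\<theta> *\<^sub>R x)) \<partial>M0) = ennreal \<alpha> * (\<integral>\<^sup>+x. ennreal (kf f x) \<partial>M0)"
      using nn_integral_polar_scale[OF sigma _ \<theta>(1), of "\<lambda>x. ennreal (kf f x)" \<alpha>] \<theta>(2) by simp
    also have "\<dots> = (\<integral>\<^sup>+x. ennreal (f x) \<partial>M)"
      by (rule nn_integral_kf_polar[OF sigma fc f0 f K])
    finally have eq: "(\<integral>\<^sup>+x. ennreal (kf f (\<theta> *\<^sub>R x)) \<partial>M0) = (\<integral>\<^sup>+x. ennreal (f x) \<partial>M)" .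
    have "(LINT x|M0. kf f (\<theta> *\<^sub>R x)) = enn2real (\<integral>\<^sup>+x. ennreal (kf f (\<theta> *\<^sub>R x)) \<partial>M0)"
      by (rule integral_eq_nn_integral) (auto simp: k0 measurable_cong_sets[OF sets_polar refl])
    also have "\<dots> = (LINT x|M. f x)"
      unfolding eq by (rule integral_eq_nn_integral[symmetric]) (auto simp: f0 measurable_cong_sets[OF sets_polar refl])
    finally show ?thesis .
  qed
  moreover have "\<forall>\<^sub>F n in sequentially. real n * (LINT x|distr P borel H. kf f ((c n / v n) *\<^sub>R (x /\<^sub>R c n)))
      = real n * (\<integral>\<omega>. f (jump n (H \<omega>, T \<omega>)) \<partial>P)"
    using eventually_ge_at_top[of 1]
  proof eventually_elim
    case (elim n)
    have cancel: "(c n / v n) *\<^sub>R (x /\<^sub>R c n) = x /\<^sub>R v n" for x :: 'a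
      using A.c_pos[of n] by (simp add: divide_inverse)
    have "(LINT x|distr P borel H. kf f ((c n / v n) *\<^sub>R (x /\<^sub>R c n))) = (LINT x|distr P borel H. kf f (x /\<^sub>R v n))"
      by (simp only: cancel)
    also have "\<dots> = (\<integral>\<omega>. kf f (H \<omega> /\<^sub>R v n) \<partial>P)" by (rule integral_distr) measurable
    finally show ?case using expectation_jump_eq[OF fc f0 f K elim] by simp
  qed
  ultimately show ?thesis using Lim_transform_eventually by fastforce
qed

text \<open>Signed functions reduce to the nonnegative case by writing f as (f + m) - m with the
  majorant m of |f|.\<close>

theorem jump_functional_limit:
  fixes f :: "'a \<Rightarrow> real"
  assumes fc: "continuous_on UNIV f" and f: "\<And>x. \<bar>f x\<bar> \<le> K * min 1 ((norm x)\<^sup>2)"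
  shows "(\<lambda>n. real n * (\<integral>\<omega>. f (jump n (H \<omega>, T \<omega>)) \<partial>P)) \<longlonglongrightarrow> (LINT x|M. f x)"
proof -
  define L where "L = \<bar>K\<bar>"
  define m where "m x = L * min 1 ((norm x)\<^sup>2)" for x :: 'a
  have fL: "\<bar>f x\<bar> \<le> m x" for x
    unfolding m_def L_def by (rule order_trans[OF f]) (intro mult_right_mono, auto)
  have m0: "0 \<le> m x" for x by (simp add: m_def L_def)
  have mc: "continuous_on UNIV m" unfolding m_def by (intro continuous_intros)
  have [measurable]: "f \<in> borel_measurable borel" "m \<in> borel_measurable borel"
    using fc mc by (auto intro: borel_measurable_continuous_onI)
  have int: "integrable P (\<lambda>\<omega>. f (jump n (H \<omega>, T \<omega>)))" "integrable P (\<lambda>\<omega>. m (jump n (H \<omega>, T \<omega>)))" for n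
  proof -
    have "m x \<le> L" for x unfolding m_def L_def by (intro mult_left_le) auto
    then have "\<bar>f x\<bar> \<le> L" "\<bar>m x\<bar> \<le> L" for x using order_trans[OF fL] m0 by (auto simp: abs_of_nonneg)
    then show "integrable P (\<lambda>\<omega>. f (jump n (H \<omega>, T \<omega>)))" "integrable P (\<lambda>\<omega>. m (jump n (H \<omega>, T \<omega>)))"
      by (auto intro!: integrable_bounded[where B=L])
  qed
  have intM: "integrable M f" "integrable M m"
    by (auto intro!: levy_measure_integrable[OF levy, where C=L] simp: fL[unfolded m_def] m0, simp add: m_def L_def)
  have 1: "(\<lambda>n. real n * (\<integral>\<omega>. f (jump n (H \<omega>, T \<omega>)) + m (jump n (H \<omega>, T \<omega>)) \<partial>P)) \<longlonglongrightarrow> (LINT x|M. f x + m x)"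
  proof (rule jump_functional_limit_nonneg)
    show "continuous_on UNIV (\<lambda>x. f x + m x)" by (intro continuous_intros fc mc)
    show "0 \<le> f x + m x" "f x + m x \<le> (2 * L) * min 1 ((norm x)\<^sup>2)" for x
      using fL[of x] by (auto simp: m_def abs_le_iff)
  qed (simp add: L_def)
  have 2: "(\<lambda>n. real n * (\<integral>\<omega>. m (jump n (H \<omega>, T \<omega>)) \<partial>P)) \<longlonglongrightarrow> (LINT x|M. m x)"
    by (rule jump_functional_limit_nonneg[OF mc m0, of L]) (auto simp: m_def L_def)
  from tendsto_diff[OF 1 2] show ?thesis
    using int intM by (simp add: right_diff_distrib[symmetric])
qed

end

section \<open>Sharp truncation at the unit sphere\<close>

definition ball_cutoff :: "real \<Rightarrow> real \<Rightarrow> real"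
  where "ball_cutoff \<epsilon> r = min 1 (max 0 ((1 - r) / \<epsilon>))"

text \<open>A continuous majorant of the error made by smoothing the truncation: 1 within distance
  \<epsilon> of the sphere, 0 from distance 2 \<epsilon> on.\<close>

definition sphere_bump :: "real \<Rightarrow> real \<Rightarrow> real"
  where "sphere_bump \<epsilon> r = max 0 (1 - max 0 (\<bar>r - 1\<bar> - \<epsilon>) / \<epsilon>)"

lemma ball_cutoff_bounds: "0 \<le> ball_cutoff \<epsilon> r" "ball_cutoff \<epsilon> r \<le> 1"
  by (auto simp: ball_cutoff_def)

lemma ball_cutoff_eq_0: "0 < \<epsilon> \<Longrightarrow> 1 \<le> r \<Longrightarrow> ball_cutoff \<epsilon> r = 0"
  by (auto simp: ball_cutoff_def divide_le_0_iff)

lemma ball_cutoff_eq_1: "0 < \<epsilon> \<Longrightarrow> r \<le> 1 - \<epsilon> \<Longrightarrow> ball_cutoff \<epsilon> r = 1"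
  by (auto simp: ball_cutoff_def le_divide_eq min_def max_def)

lemma sphere_bump_nonneg: "0 \<le> sphere_bump \<epsilon> r"
  by (simp add: sphere_bump_def)

lemma sphere_bump_eq_1: "0 < \<epsilon> \<Longrightarrow> \<bar>r - 1\<bar> \<le> \<epsilon> \<Longrightarrow> sphere_bump \<epsilon> r = 1"
  by (simp add: sphere_bump_def)

lemma sphere_bump_eq_0: "0 < \<epsilon> \<Longrightarrow> 2 * \<epsilon> \<le> \<bar>r - 1\<bar> \<Longrightarrow> sphere_bump \<epsilon> r = 0"
  by (simp add: sphere_bump_def le_divide_eq max_def)

lemma sphere_bump_le:
  fixes x :: "'a::real_normed_vector"
  assumes "0 < \<epsilon>" "\<epsilon> \<le> 1/4"
  shows "sphere_bump \<epsilon> (norm x) \<le> 4 * min 1 ((norm x)\<^sup>2)"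
proof (cases "norm x < 1/2")
  case True
  then have "sphere_bump \<epsilon> (norm x) = 0" using assms by (intro sphere_bump_eq_0) auto
  then show ?thesis by simp
next
  case False
  then have "(1/2)\<^sup>2 \<le> (norm x)\<^sup>2" by (intro power_mono) auto
  then have "1 \<le> 4 * min 1 ((norm x)\<^sup>2)" by (auto simp: power2_eq_square min_def)
  moreover have "sphere_bump \<epsilon> r \<le> 1" for r using assms by (simp add: sphere_bump_def)
  ultimately show ?thesis using order_trans by blast
qed

text \<open>The centering of the walk integrates over the open unit ball, the Levy exponent
  compensates on the closed one; the same smooth cutoff approximates both.\<close>

lemma ball_cutoff_diff_le:
  assumes "0 < \<epsilon>" "0 \<le> r"
  shows "r * \<bar>ball_cutoff \<epsilon> r - indicator {..<1} r\<bar> \<le> sphere_bump \<epsilon> r"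
    and "r * \<bar>ball_cutoff \<epsilon> r - indicator {..1} r\<bar> \<le> sphere_bump \<epsilon> r"
proof -
  consider "r \<le> 1 - \<epsilon>" | "1 - \<epsilon> < r" "r \<le> 1" | "1 < r" by linarith
  then have "r * \<bar>ball_cutoff \<epsilon> r - indicator {..<1} r\<bar> \<le> sphere_bump \<epsilon> r
    \<and> r * \<bar>ball_cutoff \<epsilon> r - indicator {..1} r\<bar> \<le> sphere_bump \<epsilon> r"
  proof cases
    case 1
    then show ?thesis using assms ball_cutoff_eq_1[of \<epsilon> r] sphere_bump_nonneg[of \<epsilon> r] by simp
  next
    case 2
    then have "sphere_bump \<epsilon> r = 1" using assms by (intro sphere_bump_eq_1) auto
    moreover have "\<bar>ball_cutoff \<epsilon> r - indicator {..<1} r\<bar> \<le> 1" "\<bar>ball_cutoff \<epsilon> r - indicator {..1} r\<bar> \<le> 1"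
      using ball_cutoff_bounds[of \<epsilon> r] by (auto simp: indicator_def abs_le_iff)
    ultimately show ?thesis using 2 assms by (auto intro: mult_le_one)
  next
    case 3
    then show ?thesis using assms ball_cutoff_eq_0[of \<epsilon> r] sphere_bump_nonneg[of \<epsilon> r] by simp
  qed
  then show "r * \<bar>ball_cutoff \<epsilon> r - indicator {..<1} r\<bar> \<le> sphere_bump \<epsilon> r"
    "r * \<bar>ball_cutoff \<epsilon> r - indicator {..1} r\<bar> \<le> sphere_bump \<epsilon> r" by auto
qed

lemma abs_sin_minus_self_le: "\<bar>sin y - y\<bar> \<le> (y::real)\<^sup>2"
proof -
  have "\<bar>sin y - (\<Sum>m<2. sin_coeff m * y ^ m)\<bar> \<le> inverse (fact 2) * \<bar>y\<bar> ^ 2"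
    by (rule Maclaurin_sin_bound)
  moreover have "(\<Sum>m<2. sin_coeff m * y ^ m) = y"
    by (simp add: numeral_2_eq_2 sin_coeff_def)
  ultimately have "\<bar>sin y - y\<bar> \<le> y\<^sup>2 / 2" by simp
  then show ?thesis using zero_le_power2[of y] by linarith
qed

text \<open>For \<epsilon> \<le> 1/4 the cutoff is 1 on |x| \<le> 1/2, where sin y - y is
  quadratically small; elsewhere the truncated square is at least 1/4 and boundedness suffices. The
  constant is uniform in \<epsilon>.\<close>

lemma sin_cutoff_bound:
  fixes u x :: "'a::euclidean_space"
  assumes "0 < \<epsilon>" "\<epsilon> \<le> 1/4"
  shows "\<bar>sin (u \<bullet> x) - (u \<bullet> x) * ball_cutoff \<epsilon> (norm x)\<bar> \<le> ((norm u)\<^sup>2 + 4 * (1 + norm u)) * min 1 ((norm x)\<^sup>2)"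
proof (cases "norm x \<le> 1/2")
  case True
  have le: "(u \<bullet> x)\<^sup>2 \<le> (norm u * norm x)\<^sup>2"
    using Cauchy_Schwarz_ineq2[of u x] by (metis abs_ge_zero power2_abs power_mono)
  have "(norm x)\<^sup>2 \<le> 1" using True by (intro power_le_one) auto
  have "ball_cutoff \<epsilon> (norm x) = 1" using True assms by (intro ball_cutoff_eq_1) auto
  then have "\<bar>sin (u \<bullet> x) - (u \<bullet> x) * ball_cutoff \<epsilon> (norm x)\<bar> \<le> (norm u)\<^sup>2 * (norm x)\<^sup>2"
    using order_trans[OF abs_sin_minus_self_le le] by (simp add: power_mult_distrib)
  also have "\<dots> \<le> ((norm u)\<^sup>2 + 4 * (1 + norm u)) * (norm x)\<^sup>2" by (intro mult_right_mono) auto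
  finally show ?thesis using \<open>(norm x)\<^sup>2 \<le> 1\<close> by (simp add: min_def)
next
  case False
  then have "(1/2)\<^sup>2 \<le> (norm x)\<^sup>2" by (intro power_mono) auto
  then have m: "1 / 4 \<le> min 1 ((norm x)\<^sup>2)" by (auto simp: power2_eq_square min_def)
  have "\<bar>(u \<bullet> x) * ball_cutoff \<epsilon> (norm x)\<bar> \<le> norm u"
  proof (cases "norm x < 1")
    case True
    have "\<bar>u \<bullet> x\<bar> * \<bar>ball_cutoff \<epsilon> (norm x)\<bar> \<le> norm u * 1"
    proof (rule mult_mono)
      have "norm u * norm x \<le> norm u * 1" using True by (intro mult_left_mono) auto
      then show "\<bar>u \<bullet> x\<bar> \<le> norm u" using Cauchy_Schwarz_ineq2[of u x] by linarith
    qed (use ball_cutoff_bounds[of \<epsilon> "norm x"] in auto)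
    then show ?thesis by (simp add: abs_mult)
  qed (use ball_cutoff_eq_0[of \<epsilon> "norm x"] assms in auto)
  then have "\<bar>sin (u \<bullet> x) - (u \<bullet> x) * ball_cutoff \<epsilon> (norm x)\<bar> \<le> 1 + norm u"
    using abs_sin_le_one[of "u \<bullet> x"] by linarith
  also have "\<dots> = (4 * (1 + norm u)) * (1 / 4)" by simp
  also have "\<dots> \<le> ((norm u)\<^sup>2 + 4 * (1 + norm u)) * min 1 ((norm x)\<^sup>2)"
    using m by (intro mult_mono) auto
  finally show ?thesis .
qed

context tempered_jumps
begin

definition J :: "nat \<Rightarrow> 'b \<Rightarrow> 'a"
  where "J n \<omega> = jump n (H \<omega>, T \<omega>)"

lemma J_measurable [measurable]: "J n \<in> borel_measurable P"
  unfolding J_def by measurable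

definition cent :: "nat \<Rightarrow> 'a"
  where "cent n = real n *\<^sub>R (\<integral>\<omega>. indicator {x. norm x < 1} (J n \<omega>) *\<^sub>R J n \<omega> \<partial>P)"

definition phi :: "nat \<Rightarrow> 'a \<Rightarrow> complex"
  where "phi n u = (CLINT \<omega>|P. iexp (u \<bullet> J n \<omega>))"

lemma walk_centering_eq: "walk_centering P v Hs Ts n = cent n"
proof -
  have m[measurable]: "(\<lambda>\<omega>. jump n (Hs 1 \<omega>, Ts 1 \<omega>)) \<in> borel_measurable P"
    using measurable_compose[OF HT_measurable(3)[of 1] jump_measurable] by simp
  have "(LINT x:{x. norm x < 1}|distr P borel (\<lambda>\<omega>. (1 / v n) *\<^sub>R tempered_jump v Hs Ts n 1 \<omega>). x)
    = (\<integral>\<omega>. indicator {x. norm x < 1} (jump n (Hs 1 \<omega>, Ts 1 \<omega>)) *\<^sub>R jump n (Hs 1 \<omega>, Ts 1 \<omega>) \<partial>P)"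
    unfolding tempered_jump_eq set_lebesgue_integral_def by (subst integral_distr) auto
  also have "\<dots> = (\<integral>\<omega>. indicator {x. norm x < 1} (J n \<omega>) *\<^sub>R J n \<omega> \<partial>P)"
    unfolding J_def
    by (rule expectation_copies[of "\<lambda>z. indicator {x. norm x < 1} (jump n z) *\<^sub>R jump n z"]) auto
  finally show ?thesis by (simp add: walk_centering_def cent_def)
qed

text \<open>The radial part of M has a Lebesgue density. This reconciles the open ball of the
  centering with the closed ball of the exponent.\<close>

lemma emeasure_sphere: "AE x in M. norm x \<noteq> 1"
proof -
  have "(\<integral>\<^sup>+x. indicator {x. norm x = 1} x \<partial>M)
    = (\<integral>\<^sup>+s. (\<integral>\<^sup>+r. (if 0 < r then ennreal (r powr (- \<alpha> - 1) * qq r s) * indicator {x. norm x = 1} (r *\<^sub>R s) else 0) \<partial>lborel) \<partial>\<sigma>)"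
  proof (rule nn_integral_polar[OF sigma])
    show "(\<lambda>z. qq (fst z) (snd z)) \<in> borel_measurable (borel \<Otimes>\<^sub>M borel)" by measurable
    show "q r s = qq r s" if "0 < r" "s \<in> sphere 0 1" for r s using that by (simp add: qq_def)
  qed measurable
  also have "\<dots> = (\<integral>\<^sup>+s. 0 \<partial>\<sigma>)"
  proof (rule nn_integral_cong)
    fix s assume "s \<in> space \<sigma>"
    then have s: "norm s = 1" using space_spherical[OF sigma] by simp
    have "(\<integral>\<^sup>+r. (if 0 < r then ennreal (r powr (- \<alpha> - 1) * qq r s) * indicator {x. norm x = 1} (r *\<^sub>R s) else 0) \<partial>lborel) = (\<integral>\<^sup>+(r::real). 0 \<partial>lborel)"
    proof (rule nn_integral_cong_AE)
      have "AE r in lborel. r \<noteq> (1::real)" by (rule AE_lborel_singleton)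
      then show "AE r in lborel. (if 0 < r then ennreal (r powr (- \<alpha> - 1) * qq r s) * indicator {x. norm x = 1} (r *\<^sub>R s) else 0) = 0"
        by eventually_elim (use s in auto)
    qed
    then show "(\<integral>\<^sup>+r. (if 0 < r then ennreal (r powr (- \<alpha> - 1) * qq r s) * indicator {x. norm x = 1} (r *\<^sub>R s) else 0) \<partial>lborel) = 0" by simp
  qed
  finally have "emeasure M {x. norm x = 1} = 0"
    by (subst (asm) nn_integral_indicator) (auto simp: sets_polar)
  then show ?thesis
    by (intro AE_I[where N = "{x. norm x = 1}"]) (auto simp: sets_polar)
qed

lemma sphere_bump_continuous: "0 < \<epsilon> \<Longrightarrow> continuous_on UNIV (\<lambda>x::'a. sphere_bump \<epsilon> (norm x))"
  unfolding sphere_bump_def by (intro continuous_intros) auto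

lemma ball_cutoff_continuous: "0 < \<epsilon> \<Longrightarrow> continuous_on UNIV (\<lambda>x::'a. ball_cutoff \<epsilon> (norm x))"
  unfolding ball_cutoff_def by (intro continuous_intros) auto

lemma sphere_bump_small:
  assumes e: "0 < e"
  obtains \<epsilon> where "0 < \<epsilon>" "\<epsilon> \<le> 1/4" "(LINT x|M. sphere_bump \<epsilon> (norm x)) < e"
proof -
  define \<epsilon> where "\<epsilon> k = 1 / (real k + 4)" for k :: nat
  have \<epsilon>: "0 < \<epsilon> k" "\<epsilon> k \<le> 1/4" for k
    unfolding \<epsilon>_def by (auto intro!: divide_left_mono)
  have \<epsilon>0: "\<epsilon> \<longlonglongrightarrow> 0"
  proof (rule Lim_null_comparison[OF _ lim_inverse_n])
    show "\<forall>\<^sub>F k in sequentially. norm (\<epsilon> k) \<le> inverse (real k)"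
      using eventually_gt_at_top[of 0] by eventually_elim (auto simp: \<epsilon>_def divide_simps)
  qed
  have "(\<lambda>k. LINT x|M. sphere_bump (\<epsilon> k) (norm x)) \<longlonglongrightarrow> (LINT x|M. 0)"
  proof (rule integral_dominated_convergence)
    show "integrable M (\<lambda>x. 4 * min 1 ((norm x)\<^sup>2))"
      by (rule levy_measure_integrable[OF levy, where C=4]) auto
    show "AE x in M. norm (sphere_bump (\<epsilon> k) (norm x)) \<le> 4 * min 1 ((norm x)\<^sup>2)" for k
      using sphere_bump_le[OF \<epsilon>, of k] sphere_bump_nonneg by (intro AE_I2) (simp add: abs_of_nonneg)
    show "AE x in M. (\<lambda>k. sphere_bump (\<epsilon> k) (norm x)) \<longlonglongrightarrow> 0"
      using emeasure_sphere
    proof eventually_elim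
      case (elim x)
      have "(\<lambda>k. 2 * \<epsilon> k) \<longlonglongrightarrow> 2 * 0" by (intro tendsto_intros \<epsilon>0)
      from order_tendstoD(2)[OF this, of "\<bar>norm x - 1\<bar>"]
      have "\<forall>\<^sub>F k in sequentially. 2 * \<epsilon> k < \<bar>norm x - 1\<bar>" using elim by simp
      then show ?case
        by (intro tendsto_eventually, elim eventually_mono) (auto intro: sphere_bump_eq_0 \<epsilon>)
    qed
    show "(\<lambda>x. sphere_bump (\<epsilon> k) (norm x)) \<in> borel_measurable M" for k
      unfolding measurable_cong_sets[OF sets_polar refl]
      by (rule borel_measurable_continuous_onI[OF sphere_bump_continuous[OF \<epsilon>(1)]])
  qed auto
  then have "(\<lambda>k. LINT x|M. sphere_bump (\<epsilon> k) (norm x)) \<longlonglongrightarrow> 0" by simp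
  then have "\<forall>\<^sub>F k in sequentially. (LINT x|M. sphere_bump (\<epsilon> k) (norm x)) < e"
    by (rule order_tendstoD(2)[OF _ e])
  from eventually_happens[OF this] that \<epsilon> show thesis by auto
qed

text \<open>The integrand jumps at |x| = 1, so the functional limit applies only after smoothing the
  truncation. The error is at most U times a bump around the sphere; the bump is itself an
  admissible test function, and its limit is small because M does not charge the sphere.\<close>

lemma imaginary_part_limit:
  "(\<lambda>n. real n * (\<integral>\<omega>. sin (u \<bullet> J n \<omega>) - (u \<bullet> J n \<omega>) * indicator {..<1} (norm (J n \<omega>)) \<partial>P))
    \<longlonglongrightarrow> (LINT x|M. sin (u \<bullet> x) - (u \<bullet> x) * indicator {..1} (norm x))"
proof (rule LIMSEQ_I)
  fix e :: real assume e: "0 < e"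
  define U where "U = norm u + 1"
  have U: "0 < U" "norm u \<le> U" by (auto simp: U_def add_nonneg_pos)
  obtain \<epsilon> where \<epsilon>: "0 < \<epsilon>" "\<epsilon> \<le> 1/4" and small: "(LINT x|M. sphere_bump \<epsilon> (norm x)) < e / (4 * U)"
    using sphere_bump_small[of "e / (4 * U)"] e U by auto
  let ?b = "\<lambda>x::'a. sphere_bump \<epsilon> (norm x)"
  let ?f = "\<lambda>x::'a. sin (u \<bullet> x) - (u \<bullet> x) * ball_cutoff \<epsilon> (norm x)"
  let ?g = "\<lambda>x::'a. sin (u \<bullet> x) - (u \<bullet> x) * indicator {..<1} (norm x)"
  let ?h = "\<lambda>x::'a. sin (u \<bullet> x) - (u \<bullet> x) * indicator {..1} (norm x)"
  let ?K = "(norm u)\<^sup>2 + 4 * (1 + norm u)"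
  have bc: "continuous_on UNIV ?b" by (rule sphere_bump_continuous[OF \<epsilon>(1)])
  have fc: "continuous_on UNIV ?f" by (intro continuous_intros ball_cutoff_continuous \<epsilon>)
  have [measurable]: "?b \<in> borel_measurable borel" "?f \<in> borel_measurable borel"
    using bc fc by (auto intro: borel_measurable_continuous_onI)
  have bb: "\<bar>?b x\<bar> \<le> 4 * min 1 ((norm x)\<^sup>2)" for x
    using sphere_bump_le[OF \<epsilon>] sphere_bump_nonneg by (simp add: abs_of_nonneg)
  have fb: "\<bar>?f x\<bar> \<le> ?K * min 1 ((norm x)\<^sup>2)" for x by (rule sin_cutoff_bound[OF \<epsilon>])
  have blim: "(\<lambda>n. real n * (\<integral>\<omega>. ?b (J n \<omega>) \<partial>P)) \<longlonglongrightarrow> (LINT x|M. ?b x)"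
    unfolding J_def by (rule jump_functional_limit[OF bc bb])
  have flim: "(\<lambda>n. real n * (\<integral>\<omega>. ?f (J n \<omega>) \<partial>P)) \<longlonglongrightarrow> (LINT x|M. ?f x)"
    unfolding J_def by (rule jump_functional_limit[OF fc fb])
  have diff: "\<bar>(u \<bullet> x) * c - (u \<bullet> x) * d\<bar> \<le> U * s" if "norm x * \<bar>c - d\<bar> \<le> s" for x and c d s :: real
  proof -
    have "\<bar>(u \<bullet> x) * c - (u \<bullet> x) * d\<bar> = \<bar>u \<bullet> x\<bar> * \<bar>c - d\<bar>" by (simp add: abs_mult right_diff_distrib[symmetric])
    also have "\<dots> \<le> (norm u * norm x) * \<bar>c - d\<bar>" by (intro mult_right_mono Cauchy_Schwarz_ineq2) auto
    also have "\<dots> = norm u * (norm x * \<bar>c - d\<bar>)" by simp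
    also have "\<dots> \<le> U * s" using that U by (intro mult_mono) auto
    finally show ?thesis .
  qed
  have gf: "\<bar>?g x - ?f x\<bar> \<le> U * ?b x" for x
    using diff[OF ball_cutoff_diff_le(1)[OF \<epsilon>(1), of "norm x"]] by simp
  have hf: "\<bar>?h x - ?f x\<bar> \<le> U * ?b x" for x
    using diff[OF ball_cutoff_diff_le(2)[OF \<epsilon>(1), of "norm x"]] by simp
  have m1: "min 1 ((norm x)\<^sup>2) \<le> 1" for x :: 'a by simp
  have intb: "integrable P (\<lambda>\<omega>. ?b (J n \<omega>))" for n
    using order_trans[OF bb] by (intro integrable_bounded[where B=4]) auto
  have intf: "integrable P (\<lambda>\<omega>. ?f (J n \<omega>))" for n
  proof (rule integrable_bounded[where B="?K"])
    show "norm (?f (J n \<omega>)) \<le> ?K" for \<omega>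
      using fb[of "J n \<omega>"] mult_left_mono[OF m1, of ?K "J n \<omega>"] by simp
  qed measurable
  have gm: "?g \<in> borel_measurable borel" "?h \<in> borel_measurable borel" by measurable
  have intg: "integrable P (\<lambda>\<omega>. ?g (J n \<omega>))" for n
  proof (rule Bochner_Integration.integrable_bound)
    show "integrable P (\<lambda>\<omega>. \<bar>?f (J n \<omega>)\<bar> + U * ?b (J n \<omega>))"
      by (intro Bochner_Integration.integrable_add integrable_abs intf integrable_mult_right intb)
    show "AE \<omega> in P. norm (?g (J n \<omega>)) \<le> norm (\<bar>?f (J n \<omega>)\<bar> + U * ?b (J n \<omega>))"
      using gf[of "J n _"] by (intro AE_I2) (smt (verit) real_norm_def)
  qed measurable
  have intMb: "integrable M ?b" by (rule levy_measure_integrable[OF levy, where C=4]) (use bb in auto)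
  have intMf: "integrable M ?f" by (rule levy_measure_integrable[OF levy, where C="?K"]) (use fb in auto)
  have intMh: "integrable M ?h"
  proof (rule Bochner_Integration.integrable_bound)
    show "integrable M (\<lambda>x. \<bar>?f x\<bar> + U * ?b x)"
      by (intro Bochner_Integration.integrable_add integrable_abs intMf integrable_mult_right intMb)
    show "AE x in M. norm (?h x) \<le> norm (\<bar>?f x\<bar> + U * ?b x)"
      using hf by (intro AE_I2) (smt (verit) real_norm_def)
    show "?h \<in> borel_measurable M" unfolding measurable_cong_sets[OF sets_polar refl] by (rule gm)
  qed
  have hM: "\<bar>(LINT x|M. ?h x) - (LINT x|M. ?f x)\<bar> < e / 4"
  proof -
    have "\<bar>(LINT x|M. ?h x) - (LINT x|M. ?f x)\<bar> = \<bar>LINT x|M. ?h x - ?f x\<bar>"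
      by (subst Bochner_Integration.integral_diff[OF intMh intMf]) simp
    also have "\<dots> \<le> (LINT x|M. \<bar>?h x - ?f x\<bar>)" by (rule integral_abs_bound)
    also have "\<dots> \<le> (LINT x|M. U * ?b x)"
      by (intro integral_mono integrable_abs Bochner_Integration.integrable_diff intMh intMf integrable_mult_right intMb hf)
    also have "\<dots> = U * (LINT x|M. ?b x)" by (rule integral_mult_right_zero)
    also have "\<dots> < e / 4" using small U by (simp add: field_simps)
    finally show ?thesis .
  qed
  have "\<forall>\<^sub>F n in sequentially. real n * (\<integral>\<omega>. ?b (J n \<omega>) \<partial>P) < e / (4 * U)"
    by (rule order_tendstoD(2)[OF blim small])
  moreover have "\<forall>\<^sub>F n in sequentially. \<bar>real n * (\<integral>\<omega>. ?f (J n \<omega>) \<partial>P) - (LINT x|M. ?f x)\<bar> < e / 4"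
    using tendstoD[OF flim, of "e/4"] e by (simp add: dist_real_def)
  ultimately have "\<forall>\<^sub>F n in sequentially. \<bar>real n * (\<integral>\<omega>. ?g (J n \<omega>) \<partial>P) - (LINT x|M. ?h x)\<bar> < e"
  proof eventually_elim
    case (elim n)
    have "\<bar>(\<integral>\<omega>. ?g (J n \<omega>) \<partial>P) - (\<integral>\<omega>. ?f (J n \<omega>) \<partial>P)\<bar> = \<bar>\<integral>\<omega>. ?g (J n \<omega>) - ?f (J n \<omega>) \<partial>P\<bar>"
      by (subst Bochner_Integration.integral_diff[OF intg intf]) simp
    also have "\<dots> \<le> (\<integral>\<omega>. \<bar>?g (J n \<omega>) - ?f (J n \<omega>)\<bar> \<partial>P)" by (rule integral_abs_bound)
    also have "\<dots> \<le> (\<integral>\<omega>. U * ?b (J n \<omega>) \<partial>P)"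
      by (intro integral_mono integrable_abs Bochner_Integration.integrable_diff intg intf integrable_mult_right intb gf)
    also have "\<dots> = U * (\<integral>\<omega>. ?b (J n \<omega>) \<partial>P)" by (rule integral_mult_right_zero)
    finally have "real n * \<bar>(\<integral>\<omega>. ?g (J n \<omega>) \<partial>P) - (\<integral>\<omega>. ?f (J n \<omega>) \<partial>P)\<bar> \<le> real n * (U * (\<integral>\<omega>. ?b (J n \<omega>) \<partial>P))"
      by (rule mult_left_mono) simp
    also have "\<dots> = U * (real n * (\<integral>\<omega>. ?b (J n \<omega>) \<partial>P))" by simp
    also have "\<dots> < U * (e / (4 * U))" using elim(1) U by (intro mult_strict_left_mono) auto
    also have "\<dots> = e / 4" using U by simp
    finally have "\<bar>real n * (\<integral>\<omega>. ?g (J n \<omega>) \<partial>P) - real n * (\<integral>\<omega>. ?f (J n \<omega>) \<partial>P)\<bar> < e / 4"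
      unfolding right_diff_distrib[symmetric] abs_mult by simp
    then show ?case using elim(2) hM e by linarith
  qed
  then show "\<exists>no. \<forall>n\<ge>no. norm (real n * (\<integral>\<omega>. ?g (J n \<omega>) \<partial>P) - (LINT x|M. ?h x)) < e"
    by (simp add: eventually_sequentially)
qed

lemma real_part_limit:
  "(\<lambda>n. real n * (\<integral>\<omega>. cos (u \<bullet> J n \<omega>) - 1 \<partial>P)) \<longlonglongrightarrow> (LINT x|M. cos (u \<bullet> x) - 1)"
  unfolding J_def
proof (rule jump_functional_limit)
  show "continuous_on UNIV (\<lambda>x::'a. cos (u \<bullet> x) - 1)" by (intro continuous_intros)
  fix x :: 'a
  have "(u \<bullet> x)\<^sup>2 \<le> (norm u * norm x)\<^sup>2"
    using Cauchy_Schwarz_ineq2[of u x] by (metis abs_ge_zero power2_abs power_mono)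
  then have "min 1 ((u \<bullet> x)\<^sup>2) \<le> min 1 ((norm u * norm x)\<^sup>2)" by (intro min.mono) auto
  also have "\<dots> \<le> max 1 ((norm u)\<^sup>2) * min 1 ((norm x)\<^sup>2)" by (rule truncated_square_le)
  finally show "\<bar>cos (u \<bullet> x) - 1\<bar> \<le> (2 * max 1 ((norm u)\<^sup>2)) * min 1 ((norm x)\<^sup>2)"
    using one_minus_cos_le[of "u \<bullet> x"] by (simp add: abs_minus_commute)
qed

lemma exponent_limit:
  "(\<lambda>n. of_nat n * (phi n u - 1) - \<i> * of_real (u \<bullet> cent n)) \<longlonglongrightarrow> levy_exponent 0 (\<lambda>_. 0) M u"
proof -
  have intJ: "integrable P (\<lambda>\<omega>. indicator {x. norm x < 1} (J n \<omega>) *\<^sub>R J n \<omega>)" for n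
    by (intro integrable_bounded[where B=1]) (auto simp: indicator_def)
  have intc: "integrable P (\<lambda>\<omega>. cos (u \<bullet> J n \<omega>))" "integrable P (\<lambda>\<omega>. sin (u \<bullet> J n \<omega>))" for n
    by (auto intro!: integrable_bounded[where B=1])
  have ind: "(u \<bullet> x) * indicator {..<1} (norm x) = u \<bullet> (indicator {x. norm x < 1} x *\<^sub>R x)" for x
    by (simp add: indicator_def)
  have "of_nat n * (phi n u - 1) - \<i> * of_real (u \<bullet> cent n)
    = of_real (real n * (\<integral>\<omega>. cos (u \<bullet> J n \<omega>) - 1 \<partial>P))
      + \<i> * of_real (real n * (\<integral>\<omega>. sin (u \<bullet> J n \<omega>) - (u \<bullet> J n \<omega>) * indicator {..<1} (norm (J n \<omega>)) \<partial>P))" for n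
  proof -
    have e1: "phi n u = of_real (\<integral>\<omega>. cos (u \<bullet> J n \<omega>) \<partial>P) + \<i> * of_real (\<integral>\<omega>. sin (u \<bullet> J n \<omega>) \<partial>P)"
      unfolding phi_def by (rule CLINT_iexp) measurable
    have e2: "(\<integral>\<omega>. cos (u \<bullet> J n \<omega>) - 1 \<partial>P) = (\<integral>\<omega>. cos (u \<bullet> J n \<omega>) \<partial>P) - 1"
      using intc by (simp add: prob_space)
    have e3: "(\<integral>\<omega>. sin (u \<bullet> J n \<omega>) - (u \<bullet> J n \<omega>) * indicator {..<1} (norm (J n \<omega>)) \<partial>P)
      = (\<integral>\<omega>. sin (u \<bullet> J n \<omega>) \<partial>P) - u \<bullet> (\<integral>\<omega>. indicator {x. norm x < 1} (J n \<omega>) *\<^sub>R J n \<omega> \<partial>P)"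
      unfolding ind using intc intJ
      by (subst Bochner_Integration.integral_diff) (auto simp del: inner_scaleR_right intro: integrable_inner_right)
    show ?thesis
      unfolding e1 e2 e3 cent_def by (simp add: algebra_simps)
  qed
  moreover have "levy_exponent 0 (\<lambda>_. 0) M u = of_real (LINT x|M. cos (u \<bullet> x) - 1)
      + \<i> * of_real (LINT x|M. sin (u \<bullet> x) - (u \<bullet> x) * indicator {..1} (norm x))"
  proof -
    let ?f = "\<lambda>x. iexp (u \<bullet> x) - 1 - \<i> * of_real (u \<bullet> x) * indicator {x. norm x \<le> 1} x"
    note int = levy_exponent_eq(2)[OF levy, of u]
    have fx: "?f x = iexp (u \<bullet> x) - 1 - \<i> * of_real ((u \<bullet> x) * indicator {..1} (norm x))" for x
      by (simp add: indicator_def)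
    have "levy_exponent 0 (\<lambda>_. 0) M u = (CLINT x|M. ?f x)" by (subst levy_exponent_eq(1)[OF levy]) simp
    moreover have "Re (CLINT x|M. ?f x) = (LINT x|M. cos (u \<bullet> x) - 1)"
      by (subst integral_Re[OF int, symmetric], subst fx) (simp only: minus_complex.sel Re_iexp, simp)
    moreover have "Im (CLINT x|M. ?f x) = (LINT x|M. sin (u \<bullet> x) - (u \<bullet> x) * indicator {..1} (norm x))"
      by (subst integral_Im[OF int, symmetric], subst fx) (simp only: minus_complex.sel Im_iexp, simp)
    ultimately show ?thesis by (intro complex_eqI) simp_all
  qed
  ultimately show ?thesis
    by (simp only:) (intro tendsto_intros real_part_limit imaginary_part_limit)
qed

lemma norm_J_le: "n \<ge> 1 \<Longrightarrow> AE \<omega> in P. norm (J n \<omega>) \<le> norm (H \<omega> /\<^sub>R v n)"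
  using T_pos
proof eventually_elim
  case (elim \<omega>)
  then have v: "0 < v n" using v_pos by simp
  have "norm (J n \<omega>) = \<bar>min (norm (H \<omega> /\<^sub>R v n)) (T \<omega>)\<bar> * norm (sgn (H \<omega> /\<^sub>R v n))"
    unfolding J_def jump_eq[OF v] by simp
  also have "\<dots> \<le> norm (H \<omega> /\<^sub>R v n) * 1"
    using elim by (intro mult_mono) (auto simp: norm_sgn)
  finally show ?case by simp
qed

text \<open>Replacing Ln (1 + w) by w in about n factors costs of the order of n |w|^2. Tempering
  only shortens jumps, so the estimate is inherited from \<open>smom\<close> for H itself.\<close>

lemma phi_minus_1_square_tendsto: "(\<lambda>n. real n * (cmod (phi n u - 1))\<^sup>2) \<longlonglongrightarrow> 0"
proof -
  obtain c d where att: "attracted (distr P borel H) c d a M0" and cv: "(\<lambda>n. c n / v n) \<longlonglongrightarrow> \<alpha> powr (1 / \<alpha>)"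
    by (rule norming_limit)
  interpret A: attracted "distr P borel H" c d a M0 by (rule att)
  \<comment> \<open>The first factor eventually bounds \<open>c n / v n\<close>, the second exceeds
    the norm of u.\<close>
  define h where "h = (\<alpha> powr (1 / \<alpha>) + 1) * (norm u + 1)"
  have h: "0 < h" unfolding h_def by (intro mult_pos_pos add_nonneg_pos) auto
  have "\<forall>\<^sub>F n in sequentially. c n / v n < \<alpha> powr (1 / \<alpha>) + 1"
    by (rule order_tendstoD(2)[OF cv]) simp
  then have "\<forall>\<^sub>F n in sequentially. norm (real n * (cmod (phi n u - 1))\<^sup>2) \<le> 4 * (real n * (A.smom n h)\<^sup>2)"
    using eventually_ge_at_top[of 1]
  proof eventually_elim
    case (elim n)
    have v: "0 < v n" using v_pos elim by simp
    have intE: "integrable P (\<lambda>\<omega>. iexp (u \<bullet> J n \<omega>))"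
      by (intro integrable_bounded[where B=1]) (auto simp: norm_exp_i_times)
    have "phi n u - 1 = (CLINT \<omega>|P. iexp (u \<bullet> J n \<omega>) - 1)"
      unfolding phi_def using intE by (simp add: prob_space)
    then have "cmod (phi n u - 1) \<le> (\<integral>\<omega>. cmod (iexp (u \<bullet> J n \<omega>) - 1) \<partial>P)"
      by (simp only: integral_norm_bound)
    also have "\<dots> \<le> (\<integral>\<omega>. 2 * min 1 (h * norm (H \<omega> /\<^sub>R c n)) \<partial>P)"
    proof (rule integral_mono_AE)
      show "integrable P (\<lambda>\<omega>. cmod (iexp (u \<bullet> J n \<omega>) - 1))"
        using intE by (intro integrable_norm Bochner_Integration.integrable_diff) auto
      show "integrable P (\<lambda>\<omega>. 2 * min 1 (h * norm (H \<omega> /\<^sub>R c n)))"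
        using h by (intro integrable_bounded[where B=2]) auto
      show "AE \<omega> in P. cmod (iexp (u \<bullet> J n \<omega>) - 1) \<le> 2 * min 1 (h * norm (H \<omega> /\<^sub>R c n))"
        using norm_J_le[OF elim(2)]
      proof eventually_elim
        case (elim \<omega>)
        have "\<bar>u \<bullet> J n \<omega>\<bar> \<le> norm u * norm (J n \<omega>)" by (rule Cauchy_Schwarz_ineq2)
        also have "\<dots> \<le> (norm u + 1) * norm (H \<omega> /\<^sub>R v n)" using elim by (intro mult_mono) auto
        also have "norm (H \<omega> /\<^sub>R v n) = (c n / v n) * norm (H \<omega> /\<^sub>R c n)"
          using A.c_pos[of n] v by (simp add: field_simps)
        also have "(norm u + 1) * ((c n / v n) * norm (H \<omega> /\<^sub>R c n))
          \<le> (norm u + 1) * ((\<alpha> powr (1 / \<alpha>) + 1) * norm (H \<omega> /\<^sub>R c n))"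
          using \<open>c n / v n < \<alpha> powr (1 / \<alpha>) + 1\<close> by (intro mult_left_mono mult_right_mono) auto
        also have "\<dots> = h * norm (H \<omega> /\<^sub>R c n)" by (simp add: h_def mult_ac)
        finally have "min 1 \<bar>u \<bullet> J n \<omega>\<bar> \<le> min 1 (h * norm (H \<omega> /\<^sub>R c n))" by (intro min.mono) auto
        then show ?case using cmod_iexp_minus_one_le[of "u \<bullet> J n \<omega>"] by linarith
      qed
    qed
    also have "\<dots> = 2 * A.smom n h"
      unfolding A.smom_def by (subst integral_distr) auto
    finally have "(cmod (phi n u - 1))\<^sup>2 \<le> (2 * A.smom n h)\<^sup>2" by (intro power_mono) auto
    then have "real n * (cmod (phi n u - 1))\<^sup>2 \<le> real n * (2 * A.smom n h)\<^sup>2" by (rule mult_left_mono) simp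
    then show ?case by (simp add: power_mult_distrib)
  qed
  moreover have "(\<lambda>n. 4 * (real n * (A.smom n h)\<^sup>2)) \<longlonglongrightarrow> 0"
    using tendsto_mult[OF tendsto_const A.smom_square_tendsto[OF h], of 4] by simp
  ultimately show ?thesis by (rule Lim_null_comparison)
qed

text \<open>\<open>m n\<close> counts the jumps in a time interval of length \<tau> up to a rounding
  error, whereas the centering uses \<tau> exactly. One splits m Ln (1 + w) into m (Ln (1 + w) - w),
  (m - n \<tau>) w and n \<tau> w: the first two vanish in the limit, and the third converges
  together with the centering, though perhaps not by itself.\<close>

lemma phi_power_limit:
  fixes m :: "nat \<Rightarrow> nat"
  assumes m: "\<And>n. \<bar>real (m n) - real n * \<tau>\<bar> \<le> K"
  shows "(\<lambda>n. phi n u ^ m n * exp (- (\<i> * of_real (\<tau> * (u \<bullet> cent n))))) \<longlonglongrightarrow> exp (of_real \<tau> * levy_exponent 0 (\<lambda>_. 0) M u)"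
proof -
  define w where "w n = phi n u - 1" for n
  have sq: "(\<lambda>n. real n * (cmod (w n))\<^sup>2) \<longlonglongrightarrow> 0" unfolding w_def by (rule phi_minus_1_square_tendsto)
  have w0: "w \<longlonglongrightarrow> 0"
  proof (rule Lim_null_comparison)
    show "(\<lambda>n. sqrt (real n * (cmod (w n))\<^sup>2)) \<longlonglongrightarrow> 0" using tendsto_real_sqrt[OF sq] by simp
    show "\<forall>\<^sub>F n in sequentially. norm (w n) \<le> sqrt (real n * (cmod (w n))\<^sup>2)"
      using eventually_ge_at_top[of 1]
    proof eventually_elim
      case (elim n)
      then have "1 * (cmod (w n))\<^sup>2 \<le> real n * (cmod (w n))\<^sup>2" by (intro mult_right_mono) auto
      then have "sqrt ((cmod (w n))\<^sup>2) \<le> sqrt (real n * (cmod (w n))\<^sup>2)" by (intro real_sqrt_le_mono) simp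
      then show ?case by simp
    qed
  qed
  have half: "\<forall>\<^sub>F n in sequentially. cmod (w n) < 1/2"
    using order_tendstoD(2)[OF tendsto_norm[OF w0], of "1/2"] by simp
  have 1: "(\<lambda>n. of_nat (m n) * (Ln (1 + w n) - w n)) \<longlonglongrightarrow> 0"
  proof (rule Lim_null_comparison)
    show "\<forall>\<^sub>F n in sequentially. norm (of_nat (m n) * (Ln (1 + w n) - w n))
      \<le> 2 * (\<bar>\<tau>\<bar> * (real n * (cmod (w n))\<^sup>2) + K * (cmod (w n))\<^sup>2)"
      using half
    proof eventually_elim
      case (elim n)
      have "cmod (Ln (1 + w n) - w n) \<le> cmod (w n) ^ 2 / (1 - cmod (w n))" using elim by (intro Ln_approx_linear) auto
      also have "\<dots> \<le> cmod (w n) ^ 2 / (1/2)" using elim by (intro divide_left_mono) auto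
      finally have L: "cmod (Ln (1 + w n) - w n) \<le> 2 * (cmod (w n))\<^sup>2" by simp
      have "real n * \<tau> \<le> \<bar>\<tau>\<bar> * real n" by (simp add: mult.commute mult_right_mono)
      then have "real (m n) \<le> \<bar>\<tau>\<bar> * real n + K" using m[of n] by linarith
      then have "real (m n) * cmod (Ln (1 + w n) - w n) \<le> (\<bar>\<tau>\<bar> * real n + K) * (2 * (cmod (w n))\<^sup>2)"
        using L by (intro mult_mono) auto
      also have "\<dots> = 2 * (\<bar>\<tau>\<bar> * (real n * (cmod (w n))\<^sup>2) + K * (cmod (w n))\<^sup>2)" by (simp add: algebra_simps)
      finally show ?case by (simp only: norm_mult norm_of_nat)
    qed
    have "(\<lambda>n. 2 * (\<bar>\<tau>\<bar> * (real n * (cmod (w n))\<^sup>2) + K * (cmod (w n))\<^sup>2)) \<longlonglongrightarrow> 2 * (\<bar>\<tau>\<bar> * 0 + K * (cmod 0)\<^sup>2)"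
      by (intro tendsto_intros sq w0)
    then show "(\<lambda>n. 2 * (\<bar>\<tau>\<bar> * (real n * (cmod (w n))\<^sup>2) + K * (cmod (w n))\<^sup>2)) \<longlonglongrightarrow> 0" by simp
  qed
  have 2: "(\<lambda>n. of_real (real (m n) - real n * \<tau>) * w n) \<longlonglongrightarrow> 0"
  proof (rule Lim_null_comparison)
    show "\<forall>\<^sub>F n in sequentially. norm (of_real (real (m n) - real n * \<tau>) * w n) \<le> K * cmod (w n)"
      using m by (intro always_eventually allI) (simp only: norm_mult norm_of_real, intro mult_right_mono, auto)
    show "(\<lambda>n. K * cmod (w n)) \<longlonglongrightarrow> 0"
      using tendsto_mult[OF tendsto_const tendsto_norm[OF w0], of K] by simp
  qed
  have "(\<lambda>n. of_nat (m n) * (Ln (1 + w n) - w n) + of_real (real (m n) - real n * \<tau>) * w n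
      + of_real \<tau> * (of_nat n * (phi n u - 1) - \<i> * of_real (u \<bullet> cent n)))
    \<longlonglongrightarrow> 0 + 0 + of_real \<tau> * levy_exponent 0 (\<lambda>_. 0) M u"
    by (intro tendsto_intros 1 2 exponent_limit)
  from tendsto_exp[OF this]
  have "(\<lambda>n. exp (of_nat (m n) * (Ln (1 + w n) - w n) + of_real (real (m n) - real n * \<tau>) * w n
      + of_real \<tau> * (of_nat n * (phi n u - 1) - \<i> * of_real (u \<bullet> cent n))))
    \<longlonglongrightarrow> exp (of_real \<tau> * levy_exponent 0 (\<lambda>_. 0) M u)" by simp
  moreover have "\<forall>\<^sub>F n in sequentially. exp (of_nat (m n) * (Ln (1 + w n) - w n) + of_real (real (m n) - real n * \<tau>) * w n
      + of_real \<tau> * (of_nat n * (phi n u - 1) - \<i> * of_real (u \<bullet> cent n)))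
    = phi n u ^ m n * exp (- (\<i> * of_real (\<tau> * (u \<bullet> cent n))))"
    using half
  proof eventually_elim
    case (elim n)
    have "1 + w n \<noteq> 0"
    proof
      assume "1 + w n = 0"
      then have "w n = -1" by (simp add: add_eq_0_iff)
      then show False using elim by simp
    qed
    then have "exp (of_nat (m n) * Ln (1 + w n)) = phi n u ^ m n"
      unfolding exp_of_nat_mult by (simp add: w_def)
    moreover have "of_nat (m n) * (Ln (1 + w n) - w n) + of_real (real (m n) - real n * \<tau>) * w n
      + of_real \<tau> * (of_nat n * (phi n u - 1) - \<i> * of_real (u \<bullet> cent n))
      = of_nat (m n) * Ln (1 + w n) + - (\<i> * of_real (\<tau> * (u \<bullet> cent n)))"
      by (simp add: w_def algebra_simps)
    ultimately show ?case by (simp only: exp_add)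
  qed
  ultimately show ?thesis by (rule Lim_transform_eventually)
qed

end

section \<open>Characteristic functions of the limit process\<close>

lemma cmod_iexp_diff_le: "cmod (iexp x - iexp y) \<le> 2 * min 1 \<bar>x - y\<bar>"
proof -
  have "iexp x - iexp y = iexp y * (iexp (x - y) - 1)"
    by (simp add: exp_diff algebra_simps)
  then have "cmod (iexp x - iexp y) = cmod (iexp (x - y) - 1)"
    by (simp only: norm_mult norm_exp_i_times mult_1_left)
  then show ?thesis using cmod_iexp_minus_one_le[of "x - y"] by simp
qed

text \<open>Rewrites a linear form in the values of a path as one in its increments, over which
  independence can be used; the coefficient of an increment collects all later c i.\<close>

lemma abel_summation_inner:
  fixes g :: "nat \<Rightarrow> 'a::real_inner" and c :: "nat \<Rightarrow> 'a"
  shows "(\<Sum>i\<le>k. c i \<bullet> g i) = (\<Sum>i\<le>k. c i) \<bullet> g 0 + (\<Sum>l<k. (\<Sum>i\<in>{l<..k}. c i) \<bullet> (g (Suc l) - g l))"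
proof (induction k)
  case (Suc k)
  have "(\<Sum>l<Suc k. (\<Sum>i\<in>{l<..Suc k}. c i) \<bullet> (g (Suc l) - g l))
    = (\<Sum>l<Suc k. (\<Sum>i\<in>{l<..k}. c i) \<bullet> (g (Suc l) - g l) + c (Suc k) \<bullet> (g (Suc l) - g l))"
  proof (rule sum.cong)
    fix l assume "l \<in> {..<Suc k}"
    then have "{l<..Suc k} = insert (Suc k) {l<..k}" by auto
    then show "(\<Sum>i\<in>{l<..Suc k}. c i) \<bullet> (g (Suc l) - g l)
      = (\<Sum>i\<in>{l<..k}. c i) \<bullet> (g (Suc l) - g l) + c (Suc k) \<bullet> (g (Suc l) - g l)"
      by (simp add: inner_add_left)
  qed simp
  also have "\<dots> = (\<Sum>l<k. (\<Sum>i\<in>{l<..k}. c i) \<bullet> (g (Suc l) - g l)) + c (Suc k) \<bullet> (g (Suc k) - g 0)"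
    by (simp add: sum.distrib inner_sum_right[symmetric] sum_lessThan_telescope del: sum.lessThan_Suc)
       (simp add: sum.lessThan_Suc)
  finally show ?case using Suc.IH by (simp add: inner_add_left inner_diff_right)
qed simp

lemma levy_exponent_ray_continuous:
  assumes M: "levy_measure M"
  shows "continuous_on UNIV (\<lambda>r. levy_exponent 0 (\<lambda>_. 0) M (r *\<^sub>R u))"
proof (rule continuous_at_imp_continuous_on, rule ballI, subst continuous_at_sequentially, intro allI impI)
  fix r :: real and R :: "nat \<Rightarrow> real" assume R: "R \<longlonglongrightarrow> r"
  have sets: "sets M = sets borel" using M by (simp add: levy_measure_def)
  let ?f = "\<lambda>u x. iexp (u \<bullet> x) - 1 - \<i> * of_real (u \<bullet> x) * indicator {x. norm x \<le> 1} x"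
  obtain B where B: "\<And>n. \<bar>R n\<bar> \<le> B" using convergent_imp_Bseq[OF convergentI[OF R]] by (auto simp: Bseq_def)
  have "(\<lambda>n. CLINT x|M. ?f (R n *\<^sub>R u) x) \<longlonglongrightarrow> (CLINT x|M. ?f (r *\<^sub>R u) x)"
  proof (rule integral_dominated_convergence)
    show "integrable M (\<lambda>x. (2 + (B * norm u)\<^sup>2) * min 1 ((norm x)\<^sup>2))"
      using integrable_truncated_square[OF M, of 1] by simp
    show "AE x in M. cmod (?f (R n *\<^sub>R u) x) \<le> (2 + (B * norm u)\<^sup>2) * min 1 ((norm x)\<^sup>2)" for n
    proof (rule AE_I2)
      fix x :: 'a
      have "(norm (R n *\<^sub>R u))\<^sup>2 \<le> (B * norm u)\<^sup>2"
        using B[of n] by (intro power_mono) (auto intro!: mult_right_mono)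
      then have "(2 + (norm (R n *\<^sub>R u))\<^sup>2) * min 1 ((norm x)\<^sup>2) \<le> (2 + (B * norm u)\<^sup>2) * min 1 ((norm x)\<^sup>2)"
        by (intro mult_right_mono) auto
      then show "cmod (?f (R n *\<^sub>R u) x) \<le> (2 + (B * norm u)\<^sup>2) * min 1 ((norm x)\<^sup>2)"
        using levy_exponent_integrand_bound[of "R n *\<^sub>R u" x] by linarith
    qed
    show "AE x in M. (\<lambda>n. ?f (R n *\<^sub>R u) x) \<longlonglongrightarrow> ?f (r *\<^sub>R u) x"
      by (intro AE_I2 tendsto_intros R)
  qed (unfold measurable_cong_sets[OF sets refl], measurable)
  then show "((\<lambda>r. levy_exponent 0 (\<lambda>_. 0) M (r *\<^sub>R u)) \<circ> R) \<longlonglongrightarrow> levy_exponent 0 (\<lambda>_. 0) M (r *\<^sub>R u)"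
    by (simp add: comp_def levy_exponent_eq(1)[OF M])
qed

lemma levy_exponent_0: "levy_exponent 0 (\<lambda>_. 0) M 0 = 0"
  by (simp add: levy_exponent_def set_lebesgue_integral_def)

locale generated_levy_process =
  fixes N :: "'c measure" and X :: "real \<Rightarrow> 'c \<Rightarrow> 'a::euclidean_space" and \<rho> M :: "'a measure"
  assumes X: "levy_process_generated_by N X \<rho>" and rho: "has_levy_representation \<rho> 0 (\<lambda>_. 0) M"
begin

sublocale prob_space N
  using X by (simp add: levy_process_generated_by_def levy_process_def)

lemma X_measurable: "0 \<le> t \<Longrightarrow> X t \<in> borel_measurable N"
  using X by (simp add: levy_process_generated_by_def levy_process_def)

lemma X_0: "AE \<omega> in N. X 0 \<omega> = 0"
  using X by (simp add: levy_process_generated_by_def levy_process_def)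

lemma levy_M: "levy_measure M"
  using rho by (simp add: has_levy_representation_def)

abbreviation \<psi> :: "'a \<Rightarrow> complex"
  where "\<psi> \<equiv> levy_exponent 0 (\<lambda>_. 0) M"

text \<open>The starting value is subtracted because \<open>X 0\<close> vanishes only almost surely
  and stationarity is expressed through X h - X 0.\<close>

definition G :: "real \<Rightarrow> 'a \<Rightarrow> complex"
  where "G t u = (CLINT \<omega>|N. iexp (u \<bullet> (X t \<omega> - X 0 \<omega>)))"

lemma increment_char:
  assumes "0 \<le> s" "0 \<le> h"
  shows "(CLINT \<omega>|N. iexp (u \<bullet> (X (s + h) \<omega> - X s \<omega>))) = G h u"
proof -
  note [measurable] = X_measurable[OF assms(1)] X_measurable[OF assms(2)] X_measurable[OF add_nonneg_nonneg[OF assms]] X_measurable[of 0, simplified]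
  have "(CLINT \<omega>|N. iexp (u \<bullet> (X (s + h) \<omega> - X s \<omega>))) = (CLINT x|distr N borel (\<lambda>\<omega>. X (s + h) \<omega> - X s \<omega>). iexp (u \<bullet> x))"
    by (subst integral_distr) auto
  also have "distr N borel (\<lambda>\<omega>. X (s + h) \<omega> - X s \<omega>) = distr N borel (\<lambda>\<omega>. X h \<omega> - X 0 \<omega>)"
    using X assms by (simp add: levy_process_generated_by_def levy_process_def)
  also have "(CLINT x|distr N borel (\<lambda>\<omega>. X h \<omega> - X 0 \<omega>). iexp (u \<bullet> x)) = G h u"
    unfolding G_def by (subst integral_distr) auto
  finally show ?thesis .
qed

lemma increments_char:
  assumes t: "0 \<le> t 0" "strict_mono_on {..n} t"
  shows "(CLINT \<omega>|N. iexp (\<Sum>l<n. w l \<bullet> (X (t (Suc l)) \<omega> - X (t l) \<omega>))) = (\<Prod>l<n. G (t (Suc l) - t l) (w l))"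
proof -
  have mono: "t l \<le> t (Suc l)" "0 \<le> t l" if "l < n" for l
  proof -
    show "t l \<le> t (Suc l)" using t(2) that by (auto simp: strict_mono_on_def intro!: less_imp_le)
    have "t 0 \<le> t l" using t(2) that by (cases "l = 0") (auto simp: strict_mono_on_def intro!: less_imp_le)
    then show "0 \<le> t l" using t(1) by simp
  qed
  have "indep_vars (\<lambda>_. borel) (\<lambda>l \<omega>. X (t (Suc l)) \<omega> - X (t l) \<omega>) {..<n}"
    using X t by (simp add: levy_process_generated_by_def levy_process_def)
  then have "indep_vars (\<lambda>_. borel) (\<lambda>l \<omega>. w l \<bullet> (X (t (Suc l)) \<omega> - X (t l) \<omega>)) {..<n}"
    by (rule indep_vars_compose2) auto
  from char_distr_sum[OF this, of 1]
  have *: "char (distr N borel (\<lambda>\<omega>. \<Sum>l<n. w l \<bullet> (X (t (Suc l)) \<omega> - X (t l) \<omega>))) 1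
    = (\<Prod>l<n. char (distr N borel (\<lambda>\<omega>. w l \<bullet> (X (t (Suc l)) \<omega> - X (t l) \<omega>))) 1)" .
  have m[measurable]: "(\<lambda>\<omega>. w l \<bullet> (X (t (Suc l)) \<omega> - X (t l) \<omega>)) \<in> borel_measurable N" if "l < n" for l
    using mono[OF that] by (intro borel_measurable_inner borel_measurable_diff X_measurable) auto
  have "char (distr N borel (\<lambda>\<omega>. \<Sum>l<n. w l \<bullet> (X (t (Suc l)) \<omega> - X (t l) \<omega>))) 1
    = (CLINT \<omega>|N. iexp (\<Sum>l<n. w l \<bullet> (X (t (Suc l)) \<omega> - X (t l) \<omega>)))"
    unfolding char_def by (subst integral_distr) (auto intro!: borel_measurable_sum m)
  moreover have "char (distr N borel (\<lambda>\<omega>. w l \<bullet> (X (t (Suc l)) \<omega> - X (t l) \<omega>))) 1 = G (t (Suc l) - t l) (w l)" if "l < n" for l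
  proof -
    have "char (distr N borel (\<lambda>\<omega>. w l \<bullet> (X (t (Suc l)) \<omega> - X (t l) \<omega>))) 1
      = (CLINT \<omega>|N. iexp (w l \<bullet> (X (t l + (t (Suc l) - t l)) \<omega> - X (t l) \<omega>)))"
      unfolding char_def by (subst integral_distr) (auto intro!: m that)
    also have "\<dots> = G (t (Suc l) - t l) (w l)" using mono[OF that] by (intro increment_char) auto
    finally show ?thesis .
  qed
  ultimately show ?thesis using * by simp
qed

lemma G_0 [simp]: "G 0 u = 1" "G t 0 = 1"
  by (simp_all add: G_def prob_space)

lemma G_add: assumes "0 \<le> s" "0 \<le> h" shows "G (s + h) u = G s u * G h u"
\<comment> \<open>Independence of increments is available along strictly increasing times, so s and
  h must be positive in the main case.\<close>
proof (cases "s = 0 \<or> h = 0")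
  case False
  define t where "t i = (if i = 0 then 0 else if i = 1 then s else s + h)" for i :: nat
  have "strict_mono_on {..2} t" using False assms by (auto simp: strict_mono_on_def t_def)
  from increments_char[OF _ this, of "\<lambda>_. u"]
  have "(CLINT \<omega>|N. iexp (\<Sum>l<2. u \<bullet> (X (t (Suc l)) \<omega> - X (t l) \<omega>))) = (\<Prod>l<2. G (t (Suc l) - t l) u)"
    by (simp add: t_def)
  moreover have "(\<Prod>l<2. G (t (Suc l) - t l) u) = G s u * G h u"
    by (simp add: numeral_2_eq_2 t_def)
  moreover have "(\<Sum>l<2. u \<bullet> (X (t (Suc l)) \<omega> - X (t l) \<omega>)) = u \<bullet> (X (s + h) \<omega> - X 0 \<omega>)" for \<omega>
    by (simp add: numeral_2_eq_2 t_def inner_diff_right)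
  ultimately show ?thesis by (simp add: G_def)
qed auto

lemma G_multiple: "0 \<le> h \<Longrightarrow> G (real k * h) u = G h u ^ k"
proof (induction k)
  case (Suc k)
  have "G (real (Suc k) * h) u = G (real k * h + h) u" by (simp add: algebra_simps)
  also have "\<dots> = G (real k * h) u * G h u" using Suc by (intro G_add) auto
  finally show ?case using Suc by simp
qed simp

lemma G_1: "G 1 u = exp (\<psi> u)"
proof -
  note [measurable] = X_measurable[of 0, simplified] X_measurable[of 1, simplified]
  have "G 1 u = (CLINT \<omega>|N. iexp (u \<bullet> X 1 \<omega>))"
    unfolding G_def by (rule integral_cong_AE) (use X_0 in \<open>auto elim: eventually_mono\<close>)
  also have "\<dots> = (CLINT x|distr N borel (X 1). iexp (u \<bullet> x))" by (subst integral_distr) auto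
  also have "distr N borel (X 1) = \<rho>" using X by (simp add: levy_process_generated_by_def)
  also have "(CLINT x|\<rho>. iexp (u \<bullet> x)) = exp (\<psi> u)" using rho by (simp add: has_levy_representation_def)
  finally show ?thesis .
qed

lemma G_ray_continuous: assumes "0 \<le> t" shows "continuous_on UNIV (\<lambda>r. G t (r *\<^sub>R u))"
proof (rule continuous_at_imp_continuous_on, rule ballI, subst continuous_at_sequentially, intro allI impI)
  note [measurable] = X_measurable[of 0, simplified] X_measurable[OF assms]
  fix r :: real and R :: "nat \<Rightarrow> real" assume R: "R \<longlonglongrightarrow> r"
  have "(\<lambda>n. G t (R n *\<^sub>R u)) \<longlonglongrightarrow> G t (r *\<^sub>R u)"
    unfolding G_def
  proof (rule integral_dominated_convergence[where w = "\<lambda>_. 1"])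
    show "AE x in N. (\<lambda>n. iexp ((R n *\<^sub>R u) \<bullet> (X t x - X 0 x))) \<longlonglongrightarrow> iexp ((r *\<^sub>R u) \<bullet> (X t x - X 0 x))"
      by (intro AE_I2 tendsto_intros R)
    show "AE x in N. cmod (iexp ((R n *\<^sub>R u) \<bullet> (X t x - X 0 x))) \<le> 1" for n
      by (simp only: norm_exp_i_times order_refl) simp
  qed auto
  then show "((\<lambda>r. G t (r *\<^sub>R u)) \<circ> R) \<longlonglongrightarrow> G t (r *\<^sub>R u)" by (simp add: comp_def)
qed

text \<open>Along the ray through \<open>u\<close>, the quotient of \<open>G (1/k)\<close> and \<open>exp (\<psi> / k)\<close> is a continuous
  family of \<open>k\<close>-th roots of unity that starts at 1.\<close>

lemma G_inverse: assumes k: "0 < k" shows "G (1 / real k) u = exp (\<psi> u / of_nat k)"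
proof -
  define f where "f r = G (1 / real k) (r *\<^sub>R u) * exp (- (\<psi> (r *\<^sub>R u) / of_nat k))" for r :: real
  have root: "f r ^ k = 1" for r
  proof -
    have "G (1 / real k) (r *\<^sub>R u) ^ k = exp (\<psi> (r *\<^sub>R u))"
      using G_multiple[of "1 / real k" k "r *\<^sub>R u"] G_1 k by simp
    moreover have "exp (- (\<psi> (r *\<^sub>R u) / of_nat k)) ^ k = exp (- \<psi> (r *\<^sub>R u))"
      unfolding exp_of_nat_mult[symmetric] using k by simp
    ultimately show ?thesis by (simp add: f_def power_mult_distrib exp_minus)
  qed
  have "continuous_on UNIV f"
    unfolding f_def using k by (intro continuous_intros G_ray_continuous levy_exponent_ray_continuous levy_M) auto
  then have "connected (range f)" by (rule connected_continuous_image) (rule connected_UNIV)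
  moreover have "finite (range f)"
  proof (rule finite_subset)
    show "range f \<subseteq> {z. z ^ k = 1}" using root by auto
    show "finite {z::complex. z ^ k = 1}" using k by (intro finite_roots_unity) auto
  qed
  ultimately obtain z where z: "range f = {z}" using connected_finite_iff_sing by blast
  then have "f 1 = f 0" by (metis rangeI singletonD)
  moreover have "f 0 = 1" by (simp add: f_def levy_exponent_0)
  ultimately have "G (1 / real k) u * exp (- (\<psi> u / of_nat k)) = 1" by (simp add: f_def)
  then show ?thesis by (simp add: exp_minus field_simps)
qed

text \<open>Continuity in probability as continuity of characteristic functions: either the
  increment is at most \<epsilon>, and the exponentials are close, or an event of small probability
  occurs, on which they differ by at most 2.\<close>

lemma G_tendsto:
  assumes t: "0 \<le> t" and S: "S \<longlonglongrightarrow> t" "\<And>n. 0 \<le> S n"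
  shows "(\<lambda>n. G (S n) u) \<longlonglongrightarrow> G t u"
proof (cases "\<forall>\<^sub>F n in sequentially. S n = t")
  case True
  then show ?thesis by (intro tendsto_eventually) (auto elim: eventually_mono)
next
  case _: False
  note [measurable] = X_measurable[of 0, simplified] X_measurable[OF t] X_measurable[OF S(2)]
  have int: "integrable N (\<lambda>\<omega>. iexp (u \<bullet> (X s \<omega> - X 0 \<omega>)))" if "0 \<le> s" for s
    using X_measurable[OF that] by (intro integrable_bounded[where B=1]) (auto simp: norm_exp_i_times)
  show ?thesis
  proof (rule LIMSEQ_I)
    fix e :: real assume e: "0 < e"
    define U where "U = norm u + 1"
    define \<epsilon> where "\<epsilon> = e / (4 * U)"
    have nu: "0 < U" "norm u \<le> U" by (simp_all add: U_def add_nonneg_pos)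
    have \<epsilon>: "0 < \<epsilon>" using e nu by (simp add: \<epsilon>_def)
    let ?A = "\<lambda>s. {\<omega> \<in> space N. norm (X s \<omega> - X t \<omega>) > \<epsilon>}"
    have lim: "((\<lambda>s. measure N (?A s)) \<longlongrightarrow> 0) (at t within {0..})"
      using X t \<epsilon> by (simp add: levy_process_generated_by_def levy_process_def)
    have "\<forall>\<^sub>F s in at t within {0..}. measure N (?A s) < e / 4"
      using e by (intro order_tendstoD(2)[OF lim]) auto
    then obtain \<delta> where \<delta>: "0 < \<delta>" "\<And>s. 0 \<le> s \<Longrightarrow> s \<noteq> t \<Longrightarrow> dist s t < \<delta> \<Longrightarrow> measure N (?A s) < e / 4"
      unfolding eventually_at by auto
    \<comment> \<open>The punctured filter says nothing about s = t, where the event is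
      empty.\<close>
    have At: "measure N (?A t) = 0" using \<epsilon> by simp
    have A: "measure N (?A s) < e / 4" if "0 \<le> s" "dist s t < \<delta>" for s
      using \<delta>(2)[OF that(1) _ that(2)] At e by (cases "s = t") auto
    have main: "cmod (G s u - G t u) < e" if s: "0 \<le> s" "dist s t < \<delta>" for s
    proof -
      note [measurable] = X_measurable[OF s(1)]
      have Am[measurable]: "?A s \<in> sets N" by measurable
      have "G s u - G t u = (CLINT \<omega>|N. iexp (u \<bullet> (X s \<omega> - X 0 \<omega>)) - iexp (u \<bullet> (X t \<omega> - X 0 \<omega>)))"
        unfolding G_def by (rule Bochner_Integration.integral_diff[OF int[OF s(1)] int[OF t], symmetric])
      also have "cmod \<dots> \<le> (LINT \<omega>|N. cmod (iexp (u \<bullet> (X s \<omega> - X 0 \<omega>)) - iexp (u \<bullet> (X t \<omega> - X 0 \<omega>))))"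
        by (rule integral_norm_bound)
      also have "\<dots> \<le> (LINT \<omega>|N. e / 2 + 2 * indicator (?A s) \<omega>)"
      proof (rule integral_mono)
        show "integrable N (\<lambda>\<omega>. cmod (iexp (u \<bullet> (X s \<omega> - X 0 \<omega>)) - iexp (u \<bullet> (X t \<omega> - X 0 \<omega>))))"
          using int s t by (intro integrable_norm Bochner_Integration.integrable_diff) auto
        show "integrable N (\<lambda>\<omega>. e / 2 + 2 * indicator (?A s) \<omega>)"
          by (intro Bochner_Integration.integrable_add integrable_mult_right) (auto simp: less_top[symmetric])
        fix \<omega> assume \<omega>: "\<omega> \<in> space N"
        have eq: "u \<bullet> (X s \<omega> - X 0 \<omega>) - u \<bullet> (X t \<omega> - X 0 \<omega>) = u \<bullet> (X s \<omega> - X t \<omega>)"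
          by (simp add: inner_diff_right)
        have b: "cmod (iexp (u \<bullet> (X s \<omega> - X 0 \<omega>)) - iexp (u \<bullet> (X t \<omega> - X 0 \<omega>))) \<le> 2 * min 1 \<bar>u \<bullet> (X s \<omega> - X t \<omega>)\<bar>"
          using cmod_iexp_diff_le[of "u \<bullet> (X s \<omega> - X 0 \<omega>)" "u \<bullet> (X t \<omega> - X 0 \<omega>)"]
          unfolding eq .
        show "cmod (iexp (u \<bullet> (X s \<omega> - X 0 \<omega>)) - iexp (u \<bullet> (X t \<omega> - X 0 \<omega>))) \<le> e / 2 + 2 * indicator (?A s) \<omega>"
        proof (cases "\<omega> \<in> ?A s")
          case True
          then have "(2::real) * indicator (?A s) \<omega> = 2" by simp
          moreover have "2 * min 1 \<bar>u \<bullet> (X s \<omega> - X t \<omega>)\<bar> \<le> 2" by simp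
          ultimately show ?thesis using b e by linarith
        next
          case False
          then have "norm (X s \<omega> - X t \<omega>) \<le> \<epsilon>" using \<omega> by auto
          then have "norm u * norm (X s \<omega> - X t \<omega>) \<le> U * \<epsilon>" using nu by (intro mult_mono) auto
          also have "\<dots> = e / 4" using nu by (simp add: \<epsilon>_def)
          finally have "\<bar>u \<bullet> (X s \<omega> - X t \<omega>)\<bar> \<le> e / 4" using Cauchy_Schwarz_ineq2[of u "X s \<omega> - X t \<omega>"] by linarith
          moreover have "0 \<le> (2::real) * indicator (?A s) \<omega>" by simp
          ultimately show ?thesis using b by linarith
        qed
      qed
      also have "\<dots> = e / 2 + 2 * measure N (?A s)"
        by (subst Bochner_Integration.integral_add) (auto simp: prob_space less_top[symmetric])
      also have "\<dots> < e" using A[OF s] e by simp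
      finally show ?thesis .
    qed
    obtain n0 where "\<And>n. n \<ge> n0 \<Longrightarrow> dist (S n) t < \<delta>" using tendstoD[OF S(1) \<delta>(1)] by (auto simp: eventually_sequentially)
    then show "\<exists>n0. \<forall>n\<ge>n0. norm (G (S n) u - G t u) < e" using main S(2) by auto
  qed
qed

text \<open>At the rational times floor((n + 1) t) / (n + 1) the value is a power of
  \<open>G (1 / real (Suc n))\<close>, which \<open>G_inverse\<close> identifies;
  \<open>G_tendsto\<close> passes to t.\<close>

lemma G_eq: assumes t: "0 \<le> t" shows "G t u = exp (of_real t * \<psi> u)"
proof -
  define S where "S n = real (nat \<lfloor>real (Suc n) * t\<rfloor>) / real (Suc n)" for n
  have S: "S \<longlonglongrightarrow> t"
  proof -
    have "(\<lambda>n. S n - t) \<longlonglongrightarrow> 0"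
    proof (rule Lim_null_comparison[OF _ LIMSEQ_inverse_real_of_nat])
      show "\<forall>\<^sub>F n in sequentially. norm (S n - t) \<le> inverse (real (Suc n))"
      proof (rule always_eventually, rule allI)
        fix n
        have "0 \<le> real (Suc n) * t" using t by simp
        then have "\<bar>real (nat \<lfloor>real (Suc n) * t\<rfloor>) - real (Suc n) * t\<bar> \<le> 1"
          by (simp add: abs_le_iff) linarith
        then have "\<bar>real (nat \<lfloor>real (Suc n) * t\<rfloor>) - real (Suc n) * t\<bar> / real (Suc n) \<le> 1 / real (Suc n)"
          by (intro divide_right_mono) auto
        moreover have "S n - t = (real (nat \<lfloor>real (Suc n) * t\<rfloor>) - real (Suc n) * t) / real (Suc n)"
          by (simp add: S_def diff_divide_distrib del: of_nat_Suc)
        ultimately show "norm (S n - t) \<le> inverse (real (Suc n))"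
          by (simp add: divide_inverse abs_mult del: of_nat_Suc)
      qed
    qed
    then show ?thesis by (simp add: LIM_zero_iff)
  qed
  have "G (S n) u = exp (of_real (S n) * \<psi> u)" for n
  proof -
    have "G (S n) u = G (1 / real (Suc n)) u ^ nat \<lfloor>real (Suc n) * t\<rfloor>"
      using G_multiple[of "1 / real (Suc n)" "nat \<lfloor>real (Suc n) * t\<rfloor>" u] by (simp add: S_def)
    also have "\<dots> = exp (of_nat (nat \<lfloor>real (Suc n) * t\<rfloor>) * (\<psi> u / of_nat (Suc n)))"
      by (simp only: G_inverse[OF zero_less_Suc] exp_of_nat_mult)
    also have "of_nat (nat \<lfloor>real (Suc n) * t\<rfloor>) * (\<psi> u / of_nat (Suc n)) = of_real (S n) * \<psi> u"
      by (simp add: S_def)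
    finally show ?thesis .
  qed
  moreover have "(\<lambda>n. G (S n) u) \<longlonglongrightarrow> G t u"
    by (rule G_tendsto[OF t S]) (simp add: S_def)
  moreover have "(\<lambda>n. exp (of_real (S n) * \<psi> u)) \<longlonglongrightarrow> exp (of_real t * \<psi> u)"
    by (intro tendsto_intros S)
  ultimately show ?thesis by (simp add: LIMSEQ_unique)
qed

lemma process_char:
  assumes t: "t 0 = 0" "strict_mono_on {..k} t"
  shows "(CLINT \<omega>|N. iexp (\<Sum>i\<le>k. c i \<bullet> X (t i) \<omega>))
    = (\<Prod>l<k. exp (of_real (t (Suc l) - t l) * \<psi> (\<Sum>i\<in>{l<..k}. c i)))"
proof -
  have t0: "0 \<le> t i" if "i \<le> k" for i
    using t(1) that strict_mono_onD[OF t(2), of 0 i] by (cases "i = 0") auto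
  have m: "X (t i) \<in> borel_measurable N" if "i \<le> k" for i using X_measurable[OF t0[OF that]] .
  have "(CLINT \<omega>|N. iexp (\<Sum>i\<le>k. c i \<bullet> X (t i) \<omega>))
    = (CLINT \<omega>|N. iexp (\<Sum>l<k. (\<Sum>i\<in>{l<..k}. c i) \<bullet> (X (t (Suc l)) \<omega> - X (t l) \<omega>)))"
  proof (rule integral_cong_AE)
    show "AE \<omega> in N. iexp (\<Sum>i\<le>k. c i \<bullet> X (t i) \<omega>) = iexp (\<Sum>l<k. (\<Sum>i\<in>{l<..k}. c i) \<bullet> (X (t (Suc l)) \<omega> - X (t l) \<omega>))"
      using X_0
    proof eventually_elim
      case (elim \<omega>)
      then show ?case using abel_summation_inner[of c "\<lambda>i. X (t i) \<omega>" k] t(1) by simp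
    qed
    have "(\<lambda>\<omega>. \<Sum>i\<le>k. c i \<bullet> X (t i) \<omega>) \<in> borel_measurable N"
      by (intro borel_measurable_sum borel_measurable_inner m) auto
    then show "(\<lambda>\<omega>. iexp (\<Sum>i\<le>k. c i \<bullet> X (t i) \<omega>)) \<in> borel_measurable N" by measurable
    have "(\<lambda>\<omega>. \<Sum>l<k. (\<Sum>i\<in>{l<..k}. c i) \<bullet> (X (t (Suc l)) \<omega> - X (t l) \<omega>)) \<in> borel_measurable N"
      by (intro borel_measurable_sum borel_measurable_inner borel_measurable_diff m) auto
    then show "(\<lambda>\<omega>. iexp (\<Sum>l<k. (\<Sum>i\<in>{l<..k}. c i) \<bullet> (X (t (Suc l)) \<omega> - X (t l) \<omega>))) \<in> borel_measurable N"
      by measurable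
  qed
  also have "\<dots> = (\<Prod>l<k. G (t (Suc l) - t l) (\<Sum>i\<in>{l<..k}. c i))"
    using t by (intro increments_char) auto
  also have "\<dots> = (\<Prod>l<k. exp (of_real (t (Suc l) - t l) * \<psi> (\<Sum>i\<in>{l<..k}. c i)))"
  proof (rule prod.cong)
    fix l assume "l \<in> {..<k}"
    then have "t l < t (Suc l)" using t(2) by (auto simp: strict_mono_on_def)
    then show "G (t (Suc l) - t l) (\<Sum>i\<in>{l<..k}. c i) = exp (of_real (t (Suc l) - t l) * \<psi> (\<Sum>i\<in>{l<..k}. c i))"
      by (intro G_eq) auto
  qed simp
  finally show ?thesis .
qed

end

section \<open>Finite dimensional distributions of the walk\<close>

lemma prod_blocks:
  fixes h :: "nat \<Rightarrow> 'b::comm_monoid_mult"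
  assumes m: "m 0 = 0" "\<And>l. l < k \<Longrightarrow> m l \<le> m (Suc l)"
  shows "(\<Prod>j\<in>{1..m k}. h j) = (\<Prod>l<k. \<Prod>j\<in>{m l<..m (Suc l)}. h j)"
  using m
proof (induction k)
  case (Suc k)
  have "{1..m (Suc k)} = {1..m k} \<union> {m k<..m (Suc k)}" using Suc.prems(2)[of k] by auto
  then have "(\<Prod>j\<in>{1..m (Suc k)}. h j) = (\<Prod>j\<in>{1..m k}. h j) * (\<Prod>j\<in>{m k<..m (Suc k)}. h j)"
    by (simp only:) (rule prod.union_disjoint, auto)
  then show ?case using Suc by simp
qed simp

context tempered_jumps
begin

definition Js :: "nat \<Rightarrow> nat \<Rightarrow> 'b \<Rightarrow> 'a"
  where "Js n j \<omega> = jump n (Hs j \<omega>, Ts j \<omega>)"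

lemma Js_measurable: "j \<ge> 1 \<Longrightarrow> Js n j \<in> borel_measurable P"
  unfolding Js_def using measurable_compose[OF HT_measurable(3) jump_measurable] by simp

definition W :: "nat \<Rightarrow> real \<Rightarrow> 'b \<Rightarrow> 'a"
  where "W n t \<omega> = (1 / v n) *\<^sub>R tempered_walk v Hs Ts n (nat \<lfloor>real n * t\<rfloor>) \<omega> - t *\<^sub>R walk_centering P v Hs Ts n"

lemma W_eq: "W n t \<omega> = (\<Sum>j=1..nat \<lfloor>real n * t\<rfloor>. Js n j \<omega>) - t *\<^sub>R cent n"
  by (simp add: W_def tempered_walk_def scaleR_sum_right tempered_jump_eq Js_def walk_centering_eq)

lemma W_measurable [measurable]: "W n t \<in> borel_measurable P"
proof -
  have "(\<lambda>\<omega>. (\<Sum>j=1..nat \<lfloor>real n * t\<rfloor>. Js n j \<omega>) - t *\<^sub>R cent n) \<in> borel_measurable P"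
    by (intro borel_measurable_diff borel_measurable_sum Js_measurable) auto
  then show ?thesis by (simp add: W_eq[abs_def])
qed

lemma sum_jumps_char:
  "(CLINT \<omega>|P. iexp (\<Sum>j\<in>{1..m}. w j \<bullet> Js n j \<omega>)) = (\<Prod>j\<in>{1..m}. phi n (w j))"
proof -
  have "indep_vars (\<lambda>_. borel \<Otimes>\<^sub>M borel) (\<lambda>j \<omega>. (Hs j \<omega>, Ts j \<omega>)) {1..m}"
    by (rule indep_vars_subset[OF indep]) auto
  then have "indep_vars (\<lambda>_. borel) (\<lambda>j \<omega>. w j \<bullet> jump n (Hs j \<omega>, Ts j \<omega>)) {1..m}"
    by (rule indep_vars_compose2) measurable
  from char_distr_sum[OF this, of 1]
  have *: "char (distr P borel (\<lambda>\<omega>. \<Sum>j\<in>{1..m}. w j \<bullet> Js n j \<omega>)) 1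
    = (\<Prod>j\<in>{1..m}. char (distr P borel (\<lambda>\<omega>. w j \<bullet> Js n j \<omega>)) 1)"
    by (simp only: Js_def)
  have "char (distr P borel (\<lambda>\<omega>. w j \<bullet> Js n j \<omega>)) 1 = phi n (w j)" if "j \<in> {1..m}" for j
  proof -
    have "char (distr P borel (\<lambda>\<omega>. w j \<bullet> Js n j \<omega>)) 1 = (CLINT \<omega>|P. iexp (w j \<bullet> Js n j \<omega>))"
      unfolding char_def using that Js_measurable[of j n] by (subst integral_distr) auto
    also have "\<dots> = phi n (w j)"
      unfolding phi_def J_def Js_def using that
      by (intro expectation_copies[of "\<lambda>z. iexp (w j \<bullet> jump n z)"]) auto
    finally show ?thesis .
  qed
  moreover have "char (distr P borel (\<lambda>\<omega>. \<Sum>j\<in>{1..m}. w j \<bullet> Js n j \<omega>)) 1 = (CLINT \<omega>|P. iexp (\<Sum>j\<in>{1..m}. w j \<bullet> Js n j \<omega>))"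
    unfolding char_def using Js_measurable[of _ n]
    by (subst integral_distr) (auto intro!: borel_measurable_sum borel_measurable_inner)
  ultimately show ?thesis using * by simp
qed

text \<open>Jump j enters every partial sum with m i \<ge> j, so its coefficient is the sum of the
  corresponding c i, constant on each block of indices between consecutive m l. Blocks are empty
  when no jump separates two times, and then contribute the power 0.\<close>

lemma walk_char:
  assumes t: "t 0 = 0" "strict_mono_on {..k} t"
  shows "(CLINT \<omega>|P. iexp (\<Sum>i\<le>k. c i \<bullet> W n (t i) \<omega>))
    = (\<Prod>l<k. phi n (\<Sum>i\<in>{l<..k}. c i) ^ (nat \<lfloor>real n * t (Suc l)\<rfloor> - nat \<lfloor>real n * t l\<rfloor>)
        * exp (- (\<i> * of_real ((t (Suc l) - t l) * ((\<Sum>i\<in>{l<..k}. c i) \<bullet> cent n)))))"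
proof -
  define m where "m i = nat \<lfloor>real n * t i\<rfloor>" for i
  have t_le: "t i \<le> t j" if "i \<le> j" "j \<le> k" for i j
    using that strict_mono_onD[OF t(2), of i j] by (cases "i = j") auto
  have m_mono: "m i \<le> m j" if "i \<le> j" "j \<le> k" for i j
    unfolding m_def using t_le[OF that] by (intro nat_mono floor_mono mult_left_mono) auto
  have m0: "m 0 = 0" by (simp add: m_def t)
  define w where "w l = (\<Sum>i\<in>{l<..k}. c i)" for l
  \<comment> \<open>The total coefficient of jump j; on the block between m l and m (Suc l) it
    equals the Abel coefficient \<open>w l\<close>.\<close>
  define \<theta> where "\<theta> j = (\<Sum>i | i \<le> k \<and> j \<le> m i. c i)" for j
  have \<theta>: "\<theta> j = w l" if "l < k" "j \<in> {m l<..m (Suc l)}" for l j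
  proof -
    have "{i. i \<le> k \<and> j \<le> m i} = {l<..k}"
    proof (intro set_eqI iffI)
      fix i assume i: "i \<in> {i. i \<le> k \<and> j \<le> m i}"
      have "l < i"
      proof (rule ccontr)
        assume "\<not> l < i"
        then have "m i \<le> m l" using that(1) by (intro m_mono) auto
        then show False using i that(2) by auto
      qed
      then show "i \<in> {l<..k}" using i by auto
    next
      fix i assume i: "i \<in> {l<..k}"
      then have "m (Suc l) \<le> m i" by (intro m_mono) auto
      then show "i \<in> {i. i \<le> k \<and> j \<le> m i}" using i that(2) by auto
    qed
    then show ?thesis by (simp add: \<theta>_def w_def)
  qed
  have sum_m: "(\<Sum>i\<le>k. c i \<bullet> (\<Sum>j=1..m i. Js n j \<omega>)) = (\<Sum>j\<in>{1..m k}. \<theta> j \<bullet> Js n j \<omega>)" for \<omega>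
  proof -
    have "(\<Sum>i\<le>k. c i \<bullet> (\<Sum>j=1..m i. Js n j \<omega>)) = (\<Sum>i\<le>k. \<Sum>j\<in>{1..m k}. if j \<le> m i then c i \<bullet> Js n j \<omega> else 0)"
    proof (rule sum.cong)
      fix i assume "i \<in> {..k}"
      then have "m i \<le> m k" by (intro m_mono) auto
      then have "{1..m i} = {j \<in> {1..m k}. j \<le> m i}" by auto
      then show "c i \<bullet> (\<Sum>j=1..m i. Js n j \<omega>) = (\<Sum>j\<in>{1..m k}. if j \<le> m i then c i \<bullet> Js n j \<omega> else 0)"
        by (simp add: inner_sum_right sum.inter_filter[symmetric])
    qed simp
    also have "\<dots> = (\<Sum>j\<in>{1..m k}. \<Sum>i\<le>k. if j \<le> m i then c i \<bullet> Js n j \<omega> else 0)"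
      by (rule sum.swap)
    also have "\<dots> = (\<Sum>j\<in>{1..m k}. \<theta> j \<bullet> Js n j \<omega>)"
    proof (rule sum.cong)
      fix j
      have "{i. i \<le> k \<and> j \<le> m i} = {i \<in> {..k}. j \<le> m i}" by auto
      then show "(\<Sum>i\<le>k. if j \<le> m i then c i \<bullet> Js n j \<omega> else 0) = \<theta> j \<bullet> Js n j \<omega>"
        unfolding \<theta>_def by (simp add: inner_sum_left sum.inter_filter[symmetric])
    qed simp
    finally show ?thesis .
  qed
  have centsum: "(\<Sum>i\<le>k. c i \<bullet> (t i *\<^sub>R cent n)) = (\<Sum>l<k. (t (Suc l) - t l) * (w l \<bullet> cent n))"
    using abel_summation_inner[of c "\<lambda>i. t i *\<^sub>R cent n" k] t(1)
    by (simp add: w_def scaleR_diff_left[symmetric])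
  have "(CLINT \<omega>|P. iexp (\<Sum>i\<le>k. c i \<bullet> W n (t i) \<omega>))
    = (CLINT \<omega>|P. iexp (\<Sum>j\<in>{1..m k}. \<theta> j \<bullet> Js n j \<omega>) * iexp (- (\<Sum>l<k. (t (Suc l) - t l) * (w l \<bullet> cent n))))"
  proof (intro Bochner_Integration.integral_cong refl)
    fix \<omega>
    have "(\<Sum>i\<le>k. c i \<bullet> W n (t i) \<omega>) = (\<Sum>i\<le>k. c i \<bullet> (\<Sum>j=1..m i. Js n j \<omega>)) - (\<Sum>i\<le>k. c i \<bullet> (t i *\<^sub>R cent n))"
      by (simp only: W_eq m_def inner_diff_right sum_subtractf)
    also have "\<dots> = (\<Sum>j\<in>{1..m k}. \<theta> j \<bullet> Js n j \<omega>) + - (\<Sum>l<k. (t (Suc l) - t l) * (w l \<bullet> cent n))"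
      unfolding sum_m centsum by simp
    finally show "iexp (\<Sum>i\<le>k. c i \<bullet> W n (t i) \<omega>)
      = iexp (\<Sum>j\<in>{1..m k}. \<theta> j \<bullet> Js n j \<omega>) * iexp (- (\<Sum>l<k. (t (Suc l) - t l) * (w l \<bullet> cent n)))"
      by (simp only: of_real_add distrib_left exp_add)
  qed
  also have "\<dots> = (\<Prod>j\<in>{1..m k}. phi n (\<theta> j)) * iexp (- (\<Sum>l<k. (t (Suc l) - t l) * (w l \<bullet> cent n)))"
    by (simp only: integral_mult_left_zero sum_jumps_char)
  also have "(\<Prod>j\<in>{1..m k}. phi n (\<theta> j)) = (\<Prod>l<k. \<Prod>j\<in>{m l<..m (Suc l)}. phi n (\<theta> j))"
    by (rule prod_blocks[of m k, OF m0]) (auto intro: m_mono)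
  also have "\<dots> = (\<Prod>l<k. phi n (w l) ^ (m (Suc l) - m l))"
    by (intro prod.cong refl) (simp add: \<theta>)
  also have "iexp (- (\<Sum>l<k. (t (Suc l) - t l) * (w l \<bullet> cent n)))
    = (\<Prod>l<k. exp (- (\<i> * of_real ((t (Suc l) - t l) * (w l \<bullet> cent n)))))"
  proof -
    have "\<i> * of_real (- (\<Sum>l<k. (t (Suc l) - t l) * (w l \<bullet> cent n)))
      = (\<Sum>l<k. - (\<i> * of_real ((t (Suc l) - t l) * (w l \<bullet> cent n))))"
      by (simp add: sum_negf sum_distrib_left)
    then show ?thesis by (simp only: exp_sum finite_lessThan)
  qed
  finally show ?thesis by (simp only: prod.distrib w_def m_def)
qed

text \<open>With the times sorted and 0 adjoined, walk and limit process have product formulas over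
  the same intervals with the same coefficients, so convergence holds factor by factor.\<close>

lemma char_limit_finite_times:
  assumes gl: "generated_levy_process N X \<rho> M" and I: "finite I" "I \<subseteq> {0..}"
  shows "(\<lambda>n. CLINT \<omega>|P. iexp (\<Sum>s\<in>I. L s \<bullet> W n s \<omega>)) \<longlonglongrightarrow> (CLINT \<omega>|N. iexp (\<Sum>s\<in>I. L s \<bullet> X s \<omega>))"
proof -
  interpret X: generated_levy_process N X \<rho> M by (rule gl)
  define I' where "I' = insert 0 I"
  have I': "finite I'" "0 \<in> I'" "I' \<subseteq> {0..}" using I by (auto simp: I'_def)
  define xs where "xs = sorted_list_of_set I'"
  define k where "k = length xs - 1"
  define t where "t i = xs ! i" for i
  have len: "length xs = Suc k"
  proof -
    have "xs \<noteq> []" using I' by (auto simp: xs_def)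
    then show ?thesis by (simp add: k_def)
  qed
  have lt: "{..<length xs} = {..k}" using len by auto
  have mono: "strict_mono_on {..k} t"
  proof (rule strict_mono_onI)
    fix i j assume "i \<in> {..k}" "j \<in> {..k}" "i < j"
    then show "t i < t j" unfolding t_def xs_def using len
      by (intro sorted_wrt_nth_less[OF strict_sorted_list_of_set]) (auto simp: xs_def)
  qed
  have bij: "bij_betw t {..k} I'"
  proof -
    have "distinct xs" "I' = set xs" using I' by (simp_all add: xs_def)
    from bij_betw_nth[OF this(1) lt[symmetric] this(2)] show ?thesis by (simp add: t_def[abs_def])
  qed
  have t0: "t 0 = 0"
  proof -
    obtain i where i: "i \<le> k" "t i = 0" using bij I'(2) by (auto simp: bij_betw_def)
    have "t 0 \<in> I'" using bij by (auto simp: bij_betw_def)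
    then have "0 \<le> t 0" using I' by auto
    then show ?thesis using i strict_mono_onD[OF mono, of 0 i] by (cases "i = 0") auto
  qed
  \<comment> \<open>The adjoined time 0 gets coefficient 0 unless it belongs to I.\<close>
  define c where "c i = (if t i \<in> I then L (t i) else 0)" for i
  have reindex: "(\<Sum>s\<in>I. L s \<bullet> Y s) = (\<Sum>i\<le>k. c i \<bullet> Y (t i))" for Y :: "real \<Rightarrow> 'a"
  proof -
    have "(\<Sum>s\<in>I. L s \<bullet> Y s) = (\<Sum>s\<in>I'. (if s \<in> I then L s else 0) \<bullet> Y s)"
      using I' by (intro sum.mono_neutral_cong_left) (auto simp: I'_def)
    also have "\<dots> = (\<Sum>i\<le>k. c i \<bullet> Y (t i))"
      using sum.reindex_bij_betw[OF bij, of "\<lambda>s. (if s \<in> I then L s else 0) \<bullet> Y s"] by (simp add: c_def)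
    finally show ?thesis .
  qed
  show ?thesis
    unfolding reindex walk_char[OF t0 mono] X.process_char[OF t0 mono]
  proof (intro tendsto_prod phi_power_limit)
    fix l n assume l: "l \<in> {..<k}"
    let ?a = "nat \<lfloor>real n * t l\<rfloor>" and ?b = "nat \<lfloor>real n * t (Suc l)\<rfloor>"
    have "t l < t (Suc l)" using l by (intro strict_mono_onD[OF mono]) auto
    moreover have tl: "0 \<le> t l" using strict_mono_onD[OF mono, of 0 l] t0 l by (cases "l = 0") auto
    ultimately have le: "real n * t l \<le> real n * t (Suc l)" "0 \<le> real n * t l" by (auto intro: mult_left_mono)
    then have "?a \<le> ?b" by (intro nat_mono floor_mono)
    moreover have "\<bar>real ?a - real n * t l\<bar> \<le> 1" "\<bar>real ?b - real n * t (Suc l)\<bar> \<le> 1"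
      using le by (simp_all add: abs_le_iff) linarith+
    \<comment> \<open>The bound 2 comes from two floor functions, each with an error of at most
      1.\<close>
    ultimately show "\<bar>real (?b - ?a) - real n * (t (Suc l) - t l)\<bar> \<le> 2"
      by (simp add: of_nat_diff right_diff_distrib abs_le_iff)
  qed
qed

text \<open>The distributions live on functions from I to the Euclidean space. Pairs of a time and a
  basis vector are enumerated by numbers below m, so that the continuity theorem for sequences
  applies to the transported test function.\<close>

theorem finite_dimensional_limit:
  assumes gl: "generated_levy_process N X \<rho> M"
  shows "converges_fin_dim_distr P W N X"
  unfolding converges_fin_dim_distr_def weakly_converges_in_def
proof (intro allI impI)
  interpret X: generated_levy_process N X \<rho> M by (rule gl)
  fix I :: "real set" and f :: "(real \<Rightarrow> 'a) \<Rightarrow> real"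
  assume I: "finite I \<and> I \<subseteq> {0..}"
    and f: "continuous_map (product_topology (\<lambda>_. euclidean) I) euclideanreal f
      \<and> bounded (f ` topspace (product_topology (\<lambda>_. euclidean) I))"
  have fin: "finite (I \<times> (Basis :: 'a set))" using I by auto
  define m where "m = card (I \<times> (Basis :: 'a set))"
  obtain e where e: "bij_betw e {..<m} (I \<times> (Basis :: 'a set))"
    using ex_bij_betw_nat_finite[OF fin] unfolding m_def atLeast0LessThan by blast
  define e' where "e' = the_inv_into {..<m} e"
  have e'_e: "e' (e j) = j" if "j < m" for j
    unfolding e'_def using e that by (intro the_inv_into_f_f) (auto simp: bij_betw_def)
  have e_e': "e (e' z) = z" "e' z < m" if "z \<in> I \<times> Basis" for z
  proof -
    have z: "z \<in> e ` {..<m}" using e that by (simp add: bij_betw_def)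
    have inj: "inj_on e {..<m}" using e by (simp add: bij_betw_def)
    show "e (e' z) = z" unfolding e'_def by (rule f_the_inv_into_f[OF inj z])
    have "e' z \<in> {..<m}" unfolding e'_def by (rule the_inv_into_into[OF inj z]) simp
    then show "e' z < m" by simp
  qed
  have eJ: "fst (e j) \<in> I" "snd (e j) \<in> Basis" if "j < m" for j
  proof -
    have "e j \<in> I \<times> Basis" using e that by (auto simp: bij_betw_def)
    then show "fst (e j) \<in> I" "snd (e j) \<in> Basis" by auto
  qed
  \<comment> \<open>E rebuilds an extensional function on I from a sequence of coordinates, and C
    reads the coordinates off; E after C is restriction to I.\<close>
  define E where "E y = (\<lambda>t\<in>I. \<Sum>b\<in>Basis. y (e' (t, b)) *\<^sub>R b)" for y :: "nat \<Rightarrow> real"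
  define C where "C x j = (if j < m then x (fst (e j)) \<bullet> snd (e j) else 0)" for x :: "real \<Rightarrow> 'a" and j
  have EC: "E (C x) = restrict x I" for x
  proof
    fix t
    show "E (C x) t = restrict x I t"
    proof (cases "t \<in> I")
      case True
      have "(\<Sum>b\<in>Basis. C x (e' (t, b)) *\<^sub>R b) = (\<Sum>b\<in>Basis. (x t \<bullet> b) *\<^sub>R b)"
        using True by (intro sum.cong) (auto simp: C_def e_e')
      then show ?thesis using True by (simp add: E_def euclidean_representation)
    qed (simp add: E_def)
  qed
  define F where "F y = f (E y)" for y
  have E_in: "E y \<in> topspace (product_topology (\<lambda>_. euclidean) I)" for y by (simp add: E_def)
  have Fc: "continuous_on UNIV F"
  proof -
    have "continuous_map euclidean (product_topology (\<lambda>_. euclidean) I) E"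
      unfolding continuous_map_componentwise
    proof (intro conjI ballI)
      show "E ` topspace euclidean \<subseteq> extensional I" by (auto simp: E_def)
      fix t assume t: "t \<in> I"
      have "continuous_on UNIV (\<lambda>y::nat \<Rightarrow> real. \<Sum>b\<in>Basis. y (e' (t, b)) *\<^sub>R b)"
        by (intro continuous_intros continuous_on_product_coordinates)
      then show "continuous_map euclidean euclidean (\<lambda>y. E y t)"
        using t by (simp add: E_def)
    qed
    from continuous_map_compose[OF this conjunct1[OF f]] show ?thesis
      by (simp add: comp_def F_def[abs_def])
  qed
  obtain B where B: "\<And>x. x \<in> topspace (product_topology (\<lambda>_. euclidean) I) \<Longrightarrow> \<bar>f x\<bar> \<le> B"
    using f by (auto simp: bounded_iff)
  have FB: "\<bar>F y\<bar> \<le> B" for y unfolding F_def by (rule B[OF E_in])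
  have coords: "(\<Sum>j<m. l j * (x (fst (e j)) \<bullet> snd (e j))) = (\<Sum>t\<in>I. (\<Sum>b\<in>Basis. l (e' (t, b)) *\<^sub>R b) \<bullet> x t)"
    for l :: "nat \<Rightarrow> real" and x :: "real \<Rightarrow> 'a"
  proof -
    have "(\<Sum>j<m. l j * (x (fst (e j)) \<bullet> snd (e j))) = (\<Sum>j<m. l (e' (e j)) * (x (fst (e j)) \<bullet> snd (e j)))"
      by (intro sum.cong) (auto simp: e'_e)
    also have "\<dots> = (\<Sum>z\<in>I \<times> Basis. l (e' z) * (x (fst z) \<bullet> snd z))"
      using sum.reindex_bij_betw[OF e, of "\<lambda>z. l (e' z) * (x (fst z) \<bullet> snd z)"] by simp
    also have "\<dots> = (\<Sum>t\<in>I. \<Sum>b\<in>Basis. l (e' (t, b)) * (x t \<bullet> b))"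
      by (subst sum.cartesian_product) (simp add: split_beta)
    also have "\<dots> = (\<Sum>t\<in>I. (\<Sum>b\<in>Basis. l (e' (t, b)) *\<^sub>R b) \<bullet> x t)"
      by (simp only: inner_sum_left inner_scaleR_left) (simp add: inner_commute)
    finally show ?thesis .
  qed
  have lim: "(\<lambda>n. LINT \<omega>|P. F (\<lambda>j. if j < m then W n (fst (e j)) \<omega> \<bullet> snd (e j) else 0))
    \<longlonglongrightarrow> (LINT \<omega>|N. F (\<lambda>j. if j < m then X (fst (e j)) \<omega> \<bullet> snd (e j) else 0))"
  proof (rule integral_tendsto_by_characteristic_functions[OF _ _ _ _ _ Fc FB])
    show "finite_measure P" "finite_measure N" by unfold_locales
    show "(\<lambda>\<omega>. W n (fst (e j)) \<omega> \<bullet> snd (e j)) \<in> borel_measurable P" for n j by measurable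
    show "(\<lambda>\<omega>. X (fst (e j)) \<omega> \<bullet> snd (e j)) \<in> borel_measurable N" if "j < m" for j
      using eJ[OF that] I by (intro borel_measurable_inner X.X_measurable) auto
    show "(\<lambda>n. CLINT \<omega>|P. iexp (\<Sum>j<m. l j * (W n (fst (e j)) \<omega> \<bullet> snd (e j))))
      \<longlonglongrightarrow> (CLINT \<omega>|N. iexp (\<Sum>j<m. l j * (X (fst (e j)) \<omega> \<bullet> snd (e j))))" for l
      unfolding coords[of l "\<lambda>t. W _ t _"] coords[of l "\<lambda>t. X t _"]
      by (rule char_limit_finite_times[OF gl]) (use I in auto)
  qed
  have fdd: "(\<integral>x. f x \<partial>fin_dim_distr Q Y I) = (LINT \<omega>|Q. F (\<lambda>j. if j < m then Y (fst (e j)) \<omega> \<bullet> snd (e j) else 0))"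
    if Y: "\<And>t. t \<in> I \<Longrightarrow> Y t \<in> borel_measurable Q" for Q :: "'d measure" and Y
  proof -
    let ?PJ = "\<Pi>\<^sub>M t\<in>I. (borel :: 'a measure)"
    have Ym: "(\<lambda>\<omega>. \<lambda>t\<in>I. Y t \<omega>) \<in> Q \<rightarrow>\<^sub>M ?PJ" using Y by (intro measurable_restrict) auto
    have CJ: "C (restrict x I) = C x" for x by (auto simp: C_def fun_eq_iff eJ)
    have "F \<in> borel_measurable borel" using Fc by (rule borel_measurable_continuous_onI)
    moreover have "(\<lambda>x j. if j < m then x (fst (e j)) \<bullet> snd (e j) else 0) \<in> borel_measurable ?PJ"
      using eJ by (intro measurable_truncated_sequence borel_measurable_inner) (auto intro: measurable_component_singleton)
    ultimately have "(\<lambda>x. F (C x)) \<in> borel_measurable ?PJ"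
      unfolding C_def[abs_def] by (rule measurable_compose[rotated])
    moreover have "f x = F (C x)" if "x \<in> space ?PJ" for x
    proof -
      have "restrict x I = x" using that by (auto simp: space_PiM PiE_def intro: extensional_restrict)
      then show ?thesis by (simp add: F_def EC)
    qed
    \<comment> \<open>Points of the product space are extensional, so f coincides there with F after
      C. This gives measurability for the product sigma-algebra, whereas the hypothesis on f is
      topological.\<close>
    ultimately have fm: "f \<in> borel_measurable ?PJ" by (simp cong: measurable_cong)
    have "(\<integral>x. f x \<partial>fin_dim_distr Q Y I) = (LINT \<omega>|Q. f (\<lambda>t\<in>I. Y t \<omega>))"
      unfolding fin_dim_distr_def by (rule integral_distr[OF Ym fm])
    also have "\<dots> = (LINT \<omega>|Q. F (C (\<lambda>t. Y t \<omega>)))"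
      by (simp add: F_def EC)
    finally show ?thesis by (simp add: C_def[abs_def])
  qed
  have "(\<integral>x. f x \<partial>fin_dim_distr P (W n) I) = (LINT \<omega>|P. F (\<lambda>j. if j < m then W n (fst (e j)) \<omega> \<bullet> snd (e j) else 0))" for n
    by (rule fdd) measurable
  moreover have "(\<integral>x. f x \<partial>fin_dim_distr N X I) = (LINT \<omega>|N. F (\<lambda>j. if j < m then X (fst (e j)) \<omega> \<bullet> snd (e j) else 0))"
    using I by (intro fdd X.X_measurable) auto
  ultimately show "(\<lambda>n. \<integral>x. f x \<partial>fin_dim_distr P (W n) I) \<longlonglongrightarrow> (\<integral>x. f x \<partial>fin_dim_distr N X I)"
    using lim by simp
qed

end

theorem theorem4p8:
  fixes \<alpha> :: real
    and \<sigma> :: "'a::euclidean_space measure"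
    and q :: "real \<Rightarrow> 'a \<Rightarrow> real"
    and P :: "'b measure"
    and H :: "'b \<Rightarrow> 'a" and T :: "'b \<Rightarrow> real"
    and Hs :: "nat \<Rightarrow> 'b \<Rightarrow> 'a" and Ts :: "nat \<Rightarrow> 'b \<Rightarrow> real"
    and a :: 'a and \<nu> :: "'a measure"
    and v :: "nat \<Rightarrow> real"
    and \<rho> :: "'a measure"
    and N :: "'c measure" and X :: "real \<Rightarrow> 'c \<Rightarrow> 'a"
  assumes alpha: "0 < \<alpha>" "\<alpha> < 2"
    and sigma: "spherical_measure \<sigma>"
    and q: "tempering_function \<alpha> q"
    and P: "prob_space P"
    and H: "H \<in> borel_measurable P"
    and H_nonzero: "measure P {\<omega> \<in> space P. H \<omega> = 0} = 0"
    and Z: "has_levy_representation \<nu> a (\<lambda>_. 0) (polar_levy_measure \<alpha> (\<lambda>_ _. 1) \<sigma>)"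
    and attraction: "domain_of_attraction (distr P borel H) \<nu>"
    and T: "T \<in> borel_measurable P"
    and T_pos: "AE \<omega> in P. 0 < T \<omega>"
    and T_cond: "has_conditional_distr P T H (\<lambda>x. temper_law \<alpha> q (sgn x))"
    and indep: "prob_space.indep_vars P (\<lambda>_. borel \<Otimes>\<^sub>M borel) (\<lambda>j \<omega>. (Hs j \<omega>, Ts j \<omega>)) {1..}"
    and copies: "\<And>j. j \<ge> 1 \<Longrightarrow>
      distr P (borel \<Otimes>\<^sub>M borel) (\<lambda>\<omega>. (Hs j \<omega>, Ts j \<omega>)) =
      distr P (borel \<Otimes>\<^sub>M borel) (\<lambda>\<omega>. (H \<omega>, T \<omega>))"
    and v_pos: "\<And>n. n \<ge> 1 \<Longrightarrow> 0 < v n"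
    and v_lim: "filterlim v at_top sequentially"
    and v_b: "(\<lambda>n. norm_quantile P H n / v n) \<longlonglongrightarrow> measure \<sigma> (sphere 0 1) powr (1 / \<alpha>)"
    and rho: "has_levy_representation \<rho> 0 (\<lambda>_. 0) (polar_levy_measure \<alpha> q \<sigma>)"
    and X: "levy_process_generated_by N X \<rho>"
  shows "converges_fin_dim_distr P
    (\<lambda>n t \<omega>. (1 / v n) *\<^sub>R tempered_walk v Hs Ts n (nat \<lfloor>real n * t\<rfloor>) \<omega>
              - t *\<^sub>R walk_centering P v Hs Ts n)
    N X"
proof -
  interpret tempered_jumps \<alpha> q P \<sigma> H T Hs Ts a \<nu> v
  proof (intro tempered_jumps.intro tempering.intro tempered_jumps_axioms.intro)
    show "levy_measure (polar_levy_measure \<alpha> q \<sigma>)"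
      using rho by (simp add: has_levy_representation_def)
  qed (fact alpha q P sigma H H_nonzero Z attraction T T_pos T_cond indep copies v_pos v_b)+
  have "generated_levy_process N X \<rho> (polar_levy_measure \<alpha> q \<sigma>)"
    by (rule generated_levy_process.intro[OF X rho])
  from finite_dimensional_limit[OF this] show ?thesis
    unfolding W_def[abs_def] .
qed

end
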